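(* Let $G$ be a finite group and $k$ a formally real closed field (i.e. a real closed field). Let $A$ be a $G$-Galois algebra over $k$ with $|\mathrm{Aut}_G(A)|=|G|$. Then either $A\cong\mathrm{Ind}_S^G(A(k(i)_\sigma[N],\gamma))$ for a semi-real torsor datum $(S,k(i),N,\sigma,\gamma)$ for $G$, or $A\cong\mathrm{Ind}_N^G(A(k_\sigma[N],\gamma_\sigma))$ for a real torsor datum $(N,\sigma)$ for $G$.
   Context: A field is formally real if $-1$ is not a sum of squares; it is real closed if moreover it has no proper formally real algebraic extension. For a formally real $k$, $k(i)$ ($i^2=-1$) is Galois over $k$ with group $\mathbb Z/2$. $\mu_2=\{\pm1\}$, $\mu_4=\{\pm1,\pm i\}$. For a group $G$, a $G$-algebra is a $k$-algebra with $G$ acting by algebra automorphisms; $\mathrm{Aut}_G(A)$ = $G$-equivariant algebra automorphisms. A $G$-Galois algebra over $k$ is a nonzero $G$-algebra $A$ with $A^G=k$ and $A\otimes_kA\to\prod_{g\in G}A$, $x\otimes y\mapsto(x(g\cdot y))_g$, bijective. $\mathrm{Ind}_S^G(B)=\{r:G\to B\mid r(sg)=s\cdot r(g)\}$ with pointwise operations and $(g\cdot r)(x)=r(xg)$. Cohomology: for $N\trianglelefteq S$ and an abelian group $M$ (multiplicative) with $S$-action $m\mapsto{}^gm$ trivial on $N$, $Z^2_S(N,M)$ consists of pairs $(\sigma,\gamma)$, $\sigma:N\times N\to M$, $\gamma:S\times N\to M$, equal to $1$ when an argument is $1$, with $\sigma(x,y)\sigma(xy,z)=\sigma(y,z)\sigma(x,yz)$,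 ${}^g\sigma(x,y)\gamma(g,xy)=\sigma(gxg^{-1},gyg^{-1})\gamma(g,x)\gamma(g,y)$, $\gamma(gh,x)={}^g\gamma(h,x)\gamma(g,hxh^{-1})$; coboundaries $\partial\tau=((x,y)\mapsto\tau(x)\tau(y)/\tau(xy),(g,x)\mapsto{}^g\tau(x)/\tau(gxg^{-1}))$, $\tau:N\to M$, $\tau(1)=1$; $H^2_S(N,M)$ = cocycles mod coboundaries. $Z^2_S(N,M)_n$: cocycles with $\gamma(x,y)=\sigma(x,y)\sigma(xy,x^{-1})\sigma(x,x^{-1})^{-1}$ for $x,y\in N$. $H^2(N,M)$ is ordinary cohomology with trivial action. A normalized 2-cocycle $\sigma$ on $N$ is non-degenerate if $1$ is the only $x$ with $\sigma(x,y)=\sigma(y,x)$ for all $y$ commuting with $x$; $\mathrm{Alt}(\sigma)(x,y)=\sigma(x,y)/\sigma(y,x)$. Galois datum for $G$: $(S,K,N,\sigma,\gamma)$, $S\le G$, $N\trianglelefteq S$, $K\supseteq k$ finite Galois with fixed $S/N\cong\mathrm{Gal}(K|k)$ (write $\bar g$), $\mathrm{char}\,k\nmid|N|$, $(\sigma,\gamma)\in Z^2_S(N,K^* )_n$, $\sigma$ non-degenerate. $A(K_\sigma[N],\gamma)$: twisted group algebra over $K$ (basis $u_x$, $u_xu_y=\sigma(x,y)u_{xy}$) as a $k$-algebra with $S$-action $g\cdot(\alpha u_x)=\bar g(\alpha)\gamma(g,x)u_{gxg^{-1}}$. A torsor datum is a Galois datum with: $S$ abelian; $S=N\oplus\mathrm{Gal}(K|k)$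 (internal direct sum with a complement mapping isomorphically to $S/N\cong\mathrm{Gal}(K|k)$, identified with it); $k$ contains a primitive root of unity of order $\exp(N)$; $\sigma$ is $k^*$-valued; $\gamma:S\times N\to k^*$ bimultiplicative, trivial on $\mathrm{Gal}(K|k)\times N$, equal to $\mathrm{Alt}(\sigma)$ on $N\times N$; $N,S\trianglelefteq G$; for all $g\in G$, $(\sigma^g,\gamma^g)$ cohomologous to $(\sigma,\gamma)$ in $H^2_S(N,K^* )$, where $\sigma^g(x,y)=\sigma(gxg^{-1},gyg^{-1})$, $\gamma^g(s,x)=\gamma(gsg^{-1},gxg^{-1})$. A real torsor datum for $G$ is a pair $(N,\sigma)$ with $N$ a normal elementary abelian $2$-subgroup of $G$, $\sigma\in Z^2(N,\mu_2)$ non-degenerate, and $[\sigma]=[\sigma^g]$ in $H^2(N,\mu_2)$ for all $g\in G$; its associated algebra uses $\gamma_\sigma(x,y)=\sigma(x,y)\sigma(xy,x^{-1})\sigma(x,x^{-1})^{-1}$ ($x,y\in N$), i.e. the Galois datum $(N,k,N,\sigma,\gamma_\sigma)$. A semi-real torsor datum for $G$ is a torsor datum $(S,k(i),N,\sigma,\gamma)$ with $N$ an abelian $2$-group, $\sigma$ taking values in $\mu_2$, and $(\sigma^g,\gamma^g)$ cohomologous to $(\sigma,\gamma)$ in $H^2_S(N,\mu_4)$ for all $g\in G$. *)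

theory Defs
  imports "HOL-Algebra.Algebra" "HOL-Library.Product_Plus"
begin

definition formally_real :: "'k::field itself \<Rightarrow> bool" where
  "formally_real _ \<longleftrightarrow> \<not> (\<exists>xs::'k list. sum_list (map (\<lambda>x. x * x) xs) = - 1)"

text \<open>A field extension of k: a HOL-Algebra field L together with an injective ring
  homomorphism phi from k.  Carriers live on the type 'k list, which is large enough
  to carry every algebraic extension of an infinite field k (formally real fields are
  infinite).\<close>

definition alg_extension :: "('k::field list) ring \<Rightarrow> ('k \<Rightarrow> 'k list) \<Rightarrow> bool" where
  "alg_extension L phi \<longleftrightarrow> field L \<and> inj phi \<and> (\<forall>a. phi a \<in> carrier L)
     \<and> (\<forall>a b. phi (a + b) = phi a \<oplus>\<^bsub>L\<^esub> phi b) \<and> (\<forall>a b. phi (a * b) = phi a \<otimes>\<^bsub>L\<^esub> phi b)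
     \<and> phi 1 = \<one>\<^bsub>L\<^esub>
     \<and> (\<forall>x\<in>carrier L. \<exists>n cs. (\<exists>i\<le>n. cs i \<noteq> (0::'k))
           \<and> finsum L (\<lambda>i. phi (cs i) \<otimes>\<^bsub>L\<^esub> x [^]\<^bsub>L\<^esub> (i::nat)) {..n::nat} = \<zero>\<^bsub>L\<^esub>)"

definition formally_real_ring :: "('a, 'b) ring_scheme \<Rightarrow> bool" where
  "formally_real_ring L \<longleftrightarrow> \<not> (\<exists>xs. set xs \<subseteq> carrier L \<and>
      foldr (\<lambda>x acc. x \<otimes>\<^bsub>L\<^esub> x \<oplus>\<^bsub>L\<^esub> acc) xs \<zero>\<^bsub>L\<^esub> = \<ominus>\<^bsub>L\<^esub> \<one>\<^bsub>L\<^esub>)"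

definition real_closed :: "'k::field itself \<Rightarrow> bool" where
  "real_closed T \<longleftrightarrow> formally_real T \<and>
     \<not> (\<exists>(L::'k list ring) phi. alg_extension L phi \<and> formally_real_ring L
            \<and> range phi \<noteq> carrier L)"

record ('k, 'a, 'g) galg =
  acar :: "'a set"
  azero :: 'a
  aone :: 'a
  aadd :: "'a \<Rightarrow> 'a \<Rightarrow> 'a"
  amul :: "'a \<Rightarrow> 'a \<Rightarrow> 'a"
  asmul :: "'k \<Rightarrow> 'a \<Rightarrow> 'a"
  aact :: "'g \<Rightarrow> 'a \<Rightarrow> 'a"

definition kalg :: "('k::field, 'a, 'g) galg \<Rightarrow> bool" where
  "kalg A \<longleftrightarrow> (let C = acar A; ad = aadd A; m = amul A; s = asmul A in
     azero A \<in> C \<and> aone A \<in> C \<and>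
     (\<forall>x\<in>C. \<forall>y\<in>C. ad x y \<in> C \<and> m x y \<in> C) \<and> (\<forall>c. \<forall>x\<in>C. s c x \<in> C) \<and>
     (\<forall>x\<in>C. \<forall>y\<in>C. \<forall>z\<in>C. ad (ad x y) z = ad x (ad y z) \<and> m (m x y) z = m x (m y z)
        \<and> m x (ad y z) = ad (m x y) (m x z) \<and> m (ad x y) z = ad (m x z) (m y z)) \<and>
     (\<forall>x\<in>C. \<forall>y\<in>C. ad x y = ad y x) \<and>
     (\<forall>x\<in>C. ad (azero A) x = x \<and> (\<exists>y\<in>C. ad x y = azero A)) \<and>
     (\<forall>x\<in>C. m (aone A) x = x \<and> m x (aone A) = x) \<and>
     (\<forall>c d. \<forall>x\<in>C. \<forall>y\<in>C. s c (ad x y) = ad (s c x) (s c y) \<and> s (c + d) x = ad (s c x) (s d x)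
        \<and> s (c * d) x = s c (s d x) \<and> s c (m x y) = m (s c x) y \<and> s c (m x y) = m x (s c y)) \<and>
     (\<forall>x\<in>C. s 1 x = x))"

definition G_alg :: "'g monoid \<Rightarrow> ('k::field, 'a, 'g) galg \<Rightarrow> bool" where
  "G_alg G A \<longleftrightarrow> kalg A \<and>
     (\<forall>g\<in>carrier G. \<forall>x\<in>acar A. aact A g x \<in> acar A) \<and>
     (\<forall>g\<in>carrier G. \<forall>x\<in>acar A. \<forall>y\<in>acar A.
        aact A g (aadd A x y) = aadd A (aact A g x) (aact A g y) \<and>
        aact A g (amul A x y) = amul A (aact A g x) (aact A g y)) \<and>
     (\<forall>g\<in>carrier G. \<forall>c. \<forall>x\<in>acar A. aact A g (asmul A c x) = asmul A c (aact A g x)) \<and>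
     (\<forall>g\<in>carrier G. aact A g (aone A) = aone A) \<and>
     (\<forall>x\<in>acar A. aact A \<one>\<^bsub>G\<^esub> x = x) \<and>
     (\<forall>g\<in>carrier G. \<forall>h\<in>carrier G. \<forall>x\<in>acar A. aact A (g \<otimes>\<^bsub>G\<^esub> h) x = aact A g (aact A h x))"

definition asum :: "('k, 'a, 'g) galg \<Rightarrow> 'a list \<Rightarrow> 'a" where
  "asum A xs = foldr (aadd A) xs (azero A)"

text \<open>Image of the element sum (x_i tensor y_i) under x tensor y to (x (g.y))_g.\<close>
definition galois_map :: "('k, 'a, 'g) galg \<Rightarrow> ('a \<times> 'a) list \<Rightarrow> 'g \<Rightarrow> 'a" where
  "galois_map A ps g = asum A (map (\<lambda>(x, y). amul A x (aact A g y)) ps)"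

definition bilinear_form :: "('k::field, 'a, 'g) galg \<Rightarrow> ('a \<Rightarrow> 'a \<Rightarrow> 'k) \<Rightarrow> bool" where
  "bilinear_form A \<beta> \<longleftrightarrow> (\<forall>x\<in>acar A. \<forall>y\<in>acar A. \<forall>z\<in>acar A. \<forall>c.
      \<beta> (aadd A x y) z = \<beta> x z + \<beta> y z \<and> \<beta> x (aadd A y z) = \<beta> x y + \<beta> x z \<and>
      \<beta> (asmul A c x) y = c * \<beta> x y \<and> \<beta> x (asmul A c y) = c * \<beta> x y)"

text \<open>The element sum (x_i tensor y_i) of A tensor_k A is zero iff it is killed by every
  linear functional on A tensor_k A, i.e. by every k-bilinear form on A.\<close>
definition tensor_zero :: "('k::field, 'a, 'g) galg \<Rightarrow> ('a \<times> 'a) list \<Rightarrow> bool" where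
  "tensor_zero A ps \<longleftrightarrow> (\<forall>\<beta>. bilinear_form A \<beta> \<longrightarrow> sum_list (map (\<lambda>(x, y). \<beta> x y) ps) = 0)"

definition galois_algebra :: "'g monoid \<Rightarrow> ('k::field, 'a, 'g) galg \<Rightarrow> bool" where
  "galois_algebra G A \<longleftrightarrow> G_alg G A \<and> aone A \<noteq> azero A \<and>
     {x \<in> acar A. \<forall>g\<in>carrier G. aact A g x = x} = {asmul A c (aone A) | c. True} \<and>
     (\<forall>F. (\<forall>g\<in>carrier G. F g \<in> acar A) \<longrightarrow>
        (\<exists>ps. set ps \<subseteq> acar A \<times> acar A \<and> (\<forall>g\<in>carrier G. F g = galois_map A ps g))) \<and>
     (\<forall>ps. set ps \<subseteq> acar A \<times> acar A \<longrightarrow> (\<forall>g\<in>carrier G. galois_map A ps g = azero A)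
        \<longrightarrow> tensor_zero A ps)"

definition galg_hom :: "'g monoid \<Rightarrow> ('k, 'a, 'g) galg \<Rightarrow> ('k, 'b, 'g) galg \<Rightarrow> ('a \<Rightarrow> 'b) \<Rightarrow> bool" where
  "galg_hom G A B f \<longleftrightarrow>
     (\<forall>x\<in>acar A. \<forall>y\<in>acar A. f (aadd A x y) = aadd B (f x) (f y) \<and> f (amul A x y) = amul B (f x) (f y)) \<and>
     f (aone A) = aone B \<and> (\<forall>c. \<forall>x\<in>acar A. f (asmul A c x) = asmul B c (f x)) \<and>
     (\<forall>g\<in>carrier G. \<forall>x\<in>acar A. f (aact A g x) = aact B g (f x))"

definition galg_iso :: "'g monoid \<Rightarrow> ('k, 'a, 'g) galg \<Rightarrow> ('k, 'b, 'g) galg \<Rightarrow> bool" where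
  "galg_iso G A B \<longleftrightarrow> (\<exists>f. bij_betw f (acar A) (acar B) \<and> galg_hom G A B f)"

definition aut_G :: "'g monoid \<Rightarrow> ('k, 'a, 'g) galg \<Rightarrow> ('a \<Rightarrow> 'a) set" where
  "aut_G G A = {f. bij_betw f (acar A) (acar A) \<and> galg_hom G A A f \<and> (\<forall>x. x \<notin> acar A \<longrightarrow> f x = undefined)}"

definition ind :: "'g monoid \<Rightarrow> 'g set \<Rightarrow> ('k, 'b, 'g) galg \<Rightarrow> ('k, 'g \<Rightarrow> 'b, 'g) galg" where
  "ind G S B = \<lparr> acar = {r. (\<forall>g\<in>carrier G. r g \<in> acar B) \<and> (\<forall>g. g \<notin> carrier G \<longrightarrow> r g = azero B)
                      \<and> (\<forall>s\<in>S. \<forall>g\<in>carrier G. r (s \<otimes>\<^bsub>G\<^esub> g) = aact B s (r g))},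
     azero = (\<lambda>g. azero B),
     aone = (\<lambda>g. if g \<in> carrier G then aone B else azero B),
     aadd = (\<lambda>r t g. if g \<in> carrier G then aadd B (r g) (t g) else azero B),
     amul = (\<lambda>r t g. if g \<in> carrier G then amul B (r g) (t g) else azero B),
     asmul = (\<lambda>c r g. if g \<in> carrier G then asmul B c (r g) else azero B),
     aact = (\<lambda>g r x. if x \<in> carrier G then r (x \<otimes>\<^bsub>G\<^esub> g) else azero B) \<rparr>"

text \<open>A(K_sigma[N], gamma): elements sum alpha_x u_x are functions N -> K (zero off N);
  coefficient field K given by multiplication cm, embedding ce of k, and the
  action bar of S on K.  Structure constants sigma, gamma are k-valued here.\<close>
definition twisted_alg :: "'g monoid \<Rightarrow> 'g set \<Rightarrow> ('c \<Rightarrow> 'c \<Rightarrow> 'c) \<Rightarrow> ('k \<Rightarrow> 'c) \<Rightarrow> ('g \<Rightarrow> 'c \<Rightarrow> 'c)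
     \<Rightarrow> ('g \<Rightarrow> 'g \<Rightarrow> 'k::field) \<Rightarrow> ('g \<Rightarrow> 'g \<Rightarrow> 'k) \<Rightarrow> ('k, 'g \<Rightarrow> 'c::comm_monoid_add, 'g) galg" where
  "twisted_alg G N cm ce bar \<sigma> \<gamma> = \<lparr> acar = {f. \<forall>z. z \<notin> N \<longrightarrow> f z = 0},
     azero = (\<lambda>z. 0),
     aone = (\<lambda>z. if z = \<one>\<^bsub>G\<^esub> then ce 1 else 0),
     aadd = (\<lambda>f h z. f z + h z),
     amul = (\<lambda>f h z. if z \<in> N then (\<Sum>x\<in>N. cm (cm (f x) (h (inv\<^bsub>G\<^esub> x \<otimes>\<^bsub>G\<^esub> z)))
                                              (ce (\<sigma> x (inv\<^bsub>G\<^esub> x \<otimes>\<^bsub>G\<^esub> z)))) else 0),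
     asmul = (\<lambda>a f z. if z \<in> N then cm (ce a) (f z) else 0),
     aact = (\<lambda>g f z. if z \<in> N then cm (bar g (f (inv\<^bsub>G\<^esub> g \<otimes>\<^bsub>G\<^esub> z \<otimes>\<^bsub>G\<^esub> g)))
                                      (ce (\<gamma> g (inv\<^bsub>G\<^esub> g \<otimes>\<^bsub>G\<^esub> z \<otimes>\<^bsub>G\<^esub> g))) else 0) \<rparr>"

section \<open>The field k(i) = k[x]/(x^2+1), elements a + b i as pairs (a, b)\<close>

definition ci_mul :: "'k::field \<times> 'k \<Rightarrow> 'k \<times> 'k \<Rightarrow> 'k \<times> 'k" where
  "ci_mul z w = (fst z * fst w - snd z * snd w, fst z * snd w + snd z * fst w)"
definition ci_of :: "'k::field \<Rightarrow> 'k \<times> 'k" where "ci_of a = (a, 0)"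
definition ci_conj :: "'k::field \<times> 'k \<Rightarrow> 'k \<times> 'k" where "ci_conj z = (fst z, - snd z)"
definition ci_inv :: "'k::field \<times> 'k \<Rightarrow> 'k \<times> 'k" where
  "ci_inv z = (fst z / (fst z * fst z + snd z * snd z), - snd z / (fst z * fst z + snd z * snd z))"
definition ci_units :: "('k::field \<times> 'k) set" where "ci_units = {z. z \<noteq> 0}"
definition mu4 :: "('k::field \<times> 'k) set" where "mu4 = {(1, 0), (-1, 0), (0, 1), (0, -1)}"
definition mu2 :: "'k::field set" where "mu2 = {1, -1}"

text \<open>The map S -> S/N = Gal(k(i)|k): elements of N act trivially, others by conjugation.\<close>
definition ci_bar :: "'g set \<Rightarrow> 'g \<Rightarrow> 'k::field \<times> 'k \<Rightarrow> 'k \<times> 'k" where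
  "ci_bar N g = (if g \<in> N then id else ci_conj)"

definition cj :: "'g monoid \<Rightarrow> 'g \<Rightarrow> 'g \<Rightarrow> 'g" where
  "cj G g x = g \<otimes>\<^bsub>G\<^esub> x \<otimes>\<^bsub>G\<^esub> inv\<^bsub>G\<^esub> g"

definition Z2S :: "'g monoid \<Rightarrow> 'g set \<Rightarrow> 'g set \<Rightarrow> 'm set \<Rightarrow> ('m \<Rightarrow> 'm \<Rightarrow> 'm) \<Rightarrow> 'm
     \<Rightarrow> ('g \<Rightarrow> 'm \<Rightarrow> 'm) \<Rightarrow> ('g \<Rightarrow> 'g \<Rightarrow> 'm) \<Rightarrow> ('g \<Rightarrow> 'g \<Rightarrow> 'm) \<Rightarrow> bool" where
  "Z2S G S N M mul e act \<sigma> \<gamma> \<longleftrightarrow>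
     (\<forall>x\<in>N. \<forall>y\<in>N. \<sigma> x y \<in> M) \<and> (\<forall>g\<in>S. \<forall>x\<in>N. \<gamma> g x \<in> M) \<and>
     (\<forall>x\<in>N. \<sigma> \<one>\<^bsub>G\<^esub> x = e \<and> \<sigma> x \<one>\<^bsub>G\<^esub> = e \<and> \<gamma> \<one>\<^bsub>G\<^esub> x = e) \<and> (\<forall>g\<in>S. \<gamma> g \<one>\<^bsub>G\<^esub> = e) \<and>
     (\<forall>x\<in>N. \<forall>y\<in>N. \<forall>z\<in>N. mul (\<sigma> x y) (\<sigma> (x \<otimes>\<^bsub>G\<^esub> y) z) = mul (\<sigma> y z) (\<sigma> x (y \<otimes>\<^bsub>G\<^esub> z))) \<and>
     (\<forall>g\<in>S. \<forall>x\<in>N. \<forall>y\<in>N. mul (act g (\<sigma> x y)) (\<gamma> g (x \<otimes>\<^bsub>G\<^esub> y))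
          = mul (mul (\<sigma> (cj G g x) (cj G g y)) (\<gamma> g x)) (\<gamma> g y)) \<and>
     (\<forall>g\<in>S. \<forall>h\<in>S. \<forall>x\<in>N. \<gamma> (g \<otimes>\<^bsub>G\<^esub> h) x = mul (act g (\<gamma> h x)) (\<gamma> g (cj G h x)))"

definition Z2S_n :: "'g monoid \<Rightarrow> 'g set \<Rightarrow> 'g set \<Rightarrow> 'm set \<Rightarrow> ('m \<Rightarrow> 'm \<Rightarrow> 'm) \<Rightarrow> 'm \<Rightarrow> ('m \<Rightarrow> 'm)
     \<Rightarrow> ('g \<Rightarrow> 'm \<Rightarrow> 'm) \<Rightarrow> ('g \<Rightarrow> 'g \<Rightarrow> 'm) \<Rightarrow> ('g \<Rightarrow> 'g \<Rightarrow> 'm) \<Rightarrow> bool" where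
  "Z2S_n G S N M mul e minv act \<sigma> \<gamma> \<longleftrightarrow> Z2S G S N M mul e act \<sigma> \<gamma> \<and>
     (\<forall>x\<in>N. \<forall>y\<in>N. \<gamma> x y = mul (mul (\<sigma> x y) (\<sigma> (x \<otimes>\<^bsub>G\<^esub> y) (inv\<^bsub>G\<^esub> x))) (minv (\<sigma> x (inv\<^bsub>G\<^esub> x))))"

definition same_class_S :: "'g monoid \<Rightarrow> 'g set \<Rightarrow> 'g set \<Rightarrow> 'm set \<Rightarrow> ('m \<Rightarrow> 'm \<Rightarrow> 'm) \<Rightarrow> 'm \<Rightarrow> ('m \<Rightarrow> 'm)
     \<Rightarrow> ('g \<Rightarrow> 'm \<Rightarrow> 'm) \<Rightarrow> ('g \<Rightarrow> 'g \<Rightarrow> 'm) \<Rightarrow> ('g \<Rightarrow> 'g \<Rightarrow> 'm) \<Rightarrow> ('g \<Rightarrow> 'g \<Rightarrow> 'm) \<Rightarrow> ('g \<Rightarrow> 'g \<Rightarrow> 'm) \<Rightarrow> bool" where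
  "same_class_S G S N M mul e minv act \<sigma> \<gamma> \<sigma>' \<gamma>' \<longleftrightarrow>
     Z2S G S N M mul e act \<sigma> \<gamma> \<and> Z2S G S N M mul e act \<sigma>' \<gamma>' \<and>
     (\<exists>\<tau>. (\<forall>x\<in>N. \<tau> x \<in> M) \<and> \<tau> \<one>\<^bsub>G\<^esub> = e \<and>
        (\<forall>x\<in>N. \<forall>y\<in>N. \<sigma>' x y = mul (\<sigma> x y) (mul (mul (\<tau> x) (\<tau> y)) (minv (\<tau> (x \<otimes>\<^bsub>G\<^esub> y))))) \<and>
        (\<forall>g\<in>S. \<forall>x\<in>N. \<gamma>' g x = mul (\<gamma> g x) (mul (act g (\<tau> x)) (minv (\<tau> (cj G g x))))))"

definition Z2 :: "'g monoid \<Rightarrow> 'g set \<Rightarrow> 'm set \<Rightarrow> ('m \<Rightarrow> 'm \<Rightarrow> 'm) \<Rightarrow> 'm \<Rightarrow> ('g \<Rightarrow> 'g \<Rightarrow> 'm) \<Rightarrow> bool" where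
  "Z2 G N M mul e \<sigma> \<longleftrightarrow> (\<forall>x\<in>N. \<forall>y\<in>N. \<sigma> x y \<in> M) \<and> (\<forall>x\<in>N. \<sigma> \<one>\<^bsub>G\<^esub> x = e \<and> \<sigma> x \<one>\<^bsub>G\<^esub> = e) \<and>
     (\<forall>x\<in>N. \<forall>y\<in>N. \<forall>z\<in>N. mul (\<sigma> x y) (\<sigma> (x \<otimes>\<^bsub>G\<^esub> y) z) = mul (\<sigma> y z) (\<sigma> x (y \<otimes>\<^bsub>G\<^esub> z)))"

definition same_class :: "'g monoid \<Rightarrow> 'g set \<Rightarrow> 'm set \<Rightarrow> ('m \<Rightarrow> 'm \<Rightarrow> 'm) \<Rightarrow> 'm \<Rightarrow> ('m \<Rightarrow> 'm)
     \<Rightarrow> ('g \<Rightarrow> 'g \<Rightarrow> 'm) \<Rightarrow> ('g \<Rightarrow> 'g \<Rightarrow> 'm) \<Rightarrow> bool" where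
  "same_class G N M mul e minv \<sigma> \<sigma>' \<longleftrightarrow> Z2 G N M mul e \<sigma> \<and> Z2 G N M mul e \<sigma>' \<and>
     (\<exists>\<tau>. (\<forall>x\<in>N. \<tau> x \<in> M) \<and> \<tau> \<one>\<^bsub>G\<^esub> = e \<and>
        (\<forall>x\<in>N. \<forall>y\<in>N. \<sigma>' x y = mul (\<sigma> x y) (mul (mul (\<tau> x) (\<tau> y)) (minv (\<tau> (x \<otimes>\<^bsub>G\<^esub> y))))))"

definition non_degenerate :: "'g monoid \<Rightarrow> 'g set \<Rightarrow> ('g \<Rightarrow> 'g \<Rightarrow> 'm) \<Rightarrow> bool" where
  "non_degenerate G N \<sigma> \<longleftrightarrow> (\<forall>x\<in>N. (\<forall>y\<in>N. x \<otimes>\<^bsub>G\<^esub> y = y \<otimes>\<^bsub>G\<^esub> x \<longrightarrow> \<sigma> x y = \<sigma> y x) \<longrightarrow> x = \<one>\<^bsub>G\<^esub>)"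

definition conj_coc :: "'g monoid \<Rightarrow> 'g \<Rightarrow> ('g \<Rightarrow> 'g \<Rightarrow> 'm) \<Rightarrow> ('g \<Rightarrow> 'g \<Rightarrow> 'm)" where
  "conj_coc G g \<sigma> = (\<lambda>x y. \<sigma> (cj G g x) (cj G g y))"

definition group_exp :: "'g monoid \<Rightarrow> 'g set \<Rightarrow> nat" where
  "group_exp G N = (LEAST e. 0 < e \<and> (\<forall>x\<in>N. x [^]\<^bsub>G\<^esub> e = \<one>\<^bsub>G\<^esub>))"

definition gamma_sigma :: "'g monoid \<Rightarrow> ('g \<Rightarrow> 'g \<Rightarrow> 'k::field) \<Rightarrow> 'g \<Rightarrow> 'g \<Rightarrow> 'k" where
  "gamma_sigma G \<sigma> x y = \<sigma> x y * \<sigma> (x \<otimes>\<^bsub>G\<^esub> y) (inv\<^bsub>G\<^esub> x) / \<sigma> x (inv\<^bsub>G\<^esub> x)"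

definition real_torsor_datum :: "'g monoid \<Rightarrow> 'g set \<Rightarrow> ('g \<Rightarrow> 'g \<Rightarrow> 'k::field) \<Rightarrow> bool" where
  "real_torsor_datum G N \<sigma> \<longleftrightarrow> N \<lhd> G \<and> (\<forall>x\<in>N. x \<otimes>\<^bsub>G\<^esub> x = \<one>\<^bsub>G\<^esub>) \<and>
     Z2 G N mu2 (*) 1 \<sigma> \<and> non_degenerate G N \<sigma> \<and>
     (\<forall>g\<in>carrier G. same_class G N mu2 (*) 1 inverse \<sigma> (conj_coc G g \<sigma>))"

text \<open>Semi-real torsor datum (S, k(i), N, sigma, gamma); sigma and gamma are k-valued and
  are regarded as k(i)-valued via ci_of.  The fixed isomorphism S/N = Gal(k(i)|k) is the
  unique one (S/N has order 2), realised by ci_bar N.\<close>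
definition semi_real_torsor_datum :: "'g monoid \<Rightarrow> 'g set \<Rightarrow> 'g set \<Rightarrow> ('g \<Rightarrow> 'g \<Rightarrow> 'k::field)
     \<Rightarrow> ('g \<Rightarrow> 'g \<Rightarrow> 'k) \<Rightarrow> bool" where
  "semi_real_torsor_datum G S N \<sigma> \<gamma> \<longleftrightarrow>
     \<comment> \<open>Galois datum part\<close>
     subgroup S G \<and> N \<subseteq> S \<and> N \<lhd> (G\<lparr>carrier := S\<rparr>) \<and> card S = 2 * card N \<and>
     of_nat (card N) \<noteq> (0::'k) \<and>
     Z2S_n G S N ci_units ci_mul (1, 0) ci_inv (ci_bar N) (\<lambda>x y. ci_of (\<sigma> x y)) (\<lambda>s x. ci_of (\<gamma> s x)) \<and>
     non_degenerate G N \<sigma> \<and>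
     \<comment> \<open>torsor datum part\<close>
     (\<forall>s\<in>S. \<forall>t\<in>S. s \<otimes>\<^bsub>G\<^esub> t = t \<otimes>\<^bsub>G\<^esub> s) \<and>
     (\<exists>c\<in>S. c \<notin> N \<and> c \<otimes>\<^bsub>G\<^esub> c = \<one>\<^bsub>G\<^esub> \<and>
        (\<forall>s\<in>S. \<exists>!p. p \<in> N \<times> {\<one>\<^bsub>G\<^esub>, c} \<and> s = fst p \<otimes>\<^bsub>G\<^esub> snd p) \<and>
        (\<forall>x\<in>N. \<gamma> c x = 1)) \<and>
     (\<exists>\<zeta>::'k. \<zeta> ^ group_exp G N = 1 \<and> (\<forall>j. 0 < j \<and> j < group_exp G N \<longrightarrow> \<zeta> ^ j \<noteq> 1)) \<and>
     (\<forall>x\<in>N. \<forall>y\<in>N. \<sigma> x y \<in> mu2) \<and> (\<forall>s\<in>S. \<forall>x\<in>N. \<gamma> s x \<noteq> 0) \<and>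
     (\<forall>s\<in>S. \<forall>t\<in>S. \<forall>x\<in>N. \<gamma> (s \<otimes>\<^bsub>G\<^esub> t) x = \<gamma> s x * \<gamma> t x) \<and>
     (\<forall>s\<in>S. \<forall>x\<in>N. \<forall>y\<in>N. \<gamma> s (x \<otimes>\<^bsub>G\<^esub> y) = \<gamma> s x * \<gamma> s y) \<and>
     (\<forall>x\<in>N. \<forall>y\<in>N. \<gamma> x y = \<sigma> x y / \<sigma> y x) \<and>
     N \<lhd> G \<and> S \<lhd> G \<and>
     \<comment> \<open>N an abelian 2-group\<close>
     (\<exists>n. card N = 2 ^ n) \<and>
     (\<forall>g\<in>carrier G.
        same_class_S G S N ci_units ci_mul (1, 0) ci_inv (ci_bar N)
          (\<lambda>x y. ci_of (\<sigma> x y)) (\<lambda>s x. ci_of (\<gamma> s x))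
          (\<lambda>x y. ci_of (conj_coc G g \<sigma> x y)) (\<lambda>s x. ci_of (conj_coc G g \<gamma> s x)) \<and>
        same_class_S G S N mu4 ci_mul (1, 0) ci_inv (ci_bar N)
          (\<lambda>x y. ci_of (\<sigma> x y)) (\<lambda>s x. ci_of (\<gamma> s x))
          (\<lambda>x y. ci_of (conj_coc G g \<sigma> x y)) (\<lambda>s x. ci_of (conj_coc G g \<gamma> s x)))"

definition semi_real_alg :: "'g monoid \<Rightarrow> 'g set \<Rightarrow> ('g \<Rightarrow> 'g \<Rightarrow> 'k::field) \<Rightarrow> ('g \<Rightarrow> 'g \<Rightarrow> 'k)
     \<Rightarrow> ('k, 'g \<Rightarrow> 'k \<times> 'k, 'g) galg" where
  "semi_real_alg G N \<sigma> \<gamma> = twisted_alg G N ci_mul ci_of (ci_bar N) \<sigma> \<gamma>"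

definition real_alg :: "'g monoid \<Rightarrow> 'g set \<Rightarrow> ('g \<Rightarrow> 'g \<Rightarrow> 'k::field) \<Rightarrow> ('g \<Rightarrow> 'g \<Rightarrow> 'k)
     \<Rightarrow> ('k, 'g \<Rightarrow> 'k, 'g) galg" where
  "real_alg G N \<sigma> \<gamma> = twisted_alg G N (*) id (\<lambda>g a. a) \<sigma> \<gamma>"

end

theory Submission
  imports Defs "HOL-Computational_Algebra.Polynomial"
begin

text \<open>
  The Galois map being onto gives \<open>P\<^sub>i, Q\<^sub>i \<in> A\<close> with \<open>\<Sum>\<^sub>i P\<^sub>i g(Q\<^sub>i) = \<delta>\<^sub>g\<^sub>,\<^sub>1\<close>; its injectivity makes
  \<open>\<Sum>\<^sub>i P\<^sub>i \<otimes> Q\<^sub>i\<close> a Casimir element.  Hence \<open>b \<mapsto> \<Sum>\<^sub>i P\<^sub>i b y\<^sup>-\<^sup>1(Q\<^sub>i)\<close> projects \<open>A\<close> onto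
  \<open>A\<^sub>y = {v. v a = y(a) v for all a}\<close>, and \<open>A\<close> is the direct sum of the \<open>A\<^sub>y\<close>, \<open>y \<in> G\<close> (the
  Miyashita-Ulbrich grading).  Let \<open>e\<close> be a primitive idempotent of the center \<open>A\<^sub>1\<close>, \<open>S\<close> its stabilizer,
  \<open>K = e A\<^sub>1\<close> and \<open>N\<close> the kernel of \<open>S\<close> on the field \<open>K\<close>.  Each \<open>e A\<^sub>y\<close> is zero or a \<open>K\<close>-line spanned by a
  unit of \<open>e A\<close>, and it is zero unless \<open>y \<in> N\<close>; so \<open>e A\<close> is a twisted group algebra without any appeal to
  Skolem-Noether or to dimensions, and \<open>A\<close> is induced from it.

  An equivariant automorphism is counted by the image of \<open>e\<close>, its restriction to \<open>K\<close>, and the scalars \<open>\<chi>(y)\<close>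
  by which it acts on the lines \<open>e A\<^sub>y\<close>.  Summing the characters \<open>\<chi>\<close> over all automorphisms and all \<open>y\<close> in both
  orders bounds the number of the latter by \<open>|N|\<close>.  So there are at most \<open>|G|\<close> equivariant automorphisms, and
  equality forces that every \<open>e A\<^sub>y\<close> with \<open>y \<in> N\<close> is nonzero, that the \<open>\<chi>\<close> separate the points of \<open>N\<close> (so that \<open>N\<close> is
  abelian), that automorphisms reach every translate of \<open>e\<close> and induce every element of \<open>Gal(K|k)\<close>.

  Over a real closed field, \<open>K\<close> is \<open>k\<close> or \<open>k(i)\<close>.  An automorphism inducing the conjugation of \<open>k(i)\<close> allows to
  choose the units in a real form of \<open>e A\<close>; the commutator pairing is then \<open>k\<close>-valued, so it has values in
  \<open>\<mu>\<^sub>2\<close> and \<open>N\<close> has exponent two, and dividing by square roots makes \<open>\<sigma>\<close> take values in \<open>\<mu>\<^sub>2\<close>.  Composing an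
  automorphism that moves \<open>e\<close> to \<open>t\<^sup>-\<^sup>1(e)\<close> with \<open>t\<close> yields the cochain comparing \<open>\<sigma>\<close> with its conjugate by \<open>t\<close>.
\<close>

section \<open>Real closed fields\<close>

text \<open>Neither finite dimension nor semisimplicity of \<open>A\<close> is at hand, so
  finiteness is drawn from the trace. A central idempotent has a positive integer as its trace,
  since on a suitable nonzero multiple of it each of its conjugates acts as 0 or 1; least trace
  therefore means primitive. There is no ordering and no algebraic closure of \<open>k\<close>
  either. Formal reality enters as the statement that 1 plus a sum of squares is not 0, and real
  closedness only through square roots and roots of polynomials of odd degree. The classification of
  \<open>K\<close> is then Artin's argument with a Sylow 2-subgroup, with S in the role of the
  Galois group: it need not act faithfully on \<open>K\<close>, but its invariants are the scalars,
  which is all that the argument uses. The exponent of N is two because a root of unity in a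
  formally real field has square 1; this also bounds the cocycle values, since -1 is not a square.
  All of this takes place in a subset of a type-class ring, for the sake of its arithmetic; a given
  record is placed there by means of its trace form.\<close>

lemma irreducible_bezout:
  fixes p f :: "'k::field poly"
  assumes irr: "Factorial_Ring.irreducible p" and nd: "\<not> p dvd f"
  obtains g h where "g * f + h * p = 1"
proof -
  define I where "I = {a * f + b * p | a b. True}"
  have fI: "f \<in> I" unfolding I_def by (rule CollectI, rule exI[of _ 1], rule exI[of _ 0]) simp
  have pI: "p \<in> I" unfolding I_def by (rule CollectI, rule exI[of _ 0], rule exI[of _ 1]) simp
  have f0: "f \<noteq> 0" using nd by auto
  \<comment> \<open>An element of least degree generates the ideal; as it divides the irreducible
    \<open>p\<close> and not every divisor of \<open>p\<close> divides \<open>f\<close>, it must be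
    a unit.\<close>
  obtain h where h: "h \<in> I" "h \<noteq> 0" "\<And>h'. h' \<in> I \<Longrightarrow> h' \<noteq> 0 \<Longrightarrow> degree h \<le> degree h'"
    using ex_has_least_nat[of "\<lambda>h. h \<in> I \<and> h \<noteq> 0" f degree] f0 fI by blast
  have dv: "h dvd q" if q: "q \<in> I" for q
  proof -
    have "q mod h \<in> I"
    proof -
      obtain a b where "q = a * f + b * p" using q by (auto simp: I_def)
      moreover obtain c d where "h = c * f + d * p" using h(1) by (auto simp: I_def)
      ultimately
      have "q mod h = (a - (q div h) * c) * f + (b - (q div h) * d) * p"
        by (simp add: minus_div_mult_eq_mod[symmetric] algebra_simps)
      thus ?thesis unfolding I_def by blast
    qed
    hence "q mod h = 0" using h(3)[of "q mod h"] degree_mod_less[OF h(2), of q] by fastforce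
    thus ?thesis by auto
  qed
  have "h dvd 1"
  proof -
    obtain r where r: "p = h * r" using dv[OF pI] by auto
    have "h dvd 1 \<or> r dvd 1" using Factorial_Ring.irreducibleD[OF irr r] .
    moreover have "\<not> r dvd 1"
    proof
      assume "r dvd 1"
      hence "p dvd h" using r by (metis dvd_refl dvd_trans mult_dvd_mono mult.right_neutral)
      thus False using nd dv[OF fI] dvd_trans by blast
    qed
    ultimately show ?thesis by blast
  qed
  then obtain s where "1 = h * s" by auto
  moreover obtain c d where "h = c * f + d * p" using h(1) unfolding I_def by auto
  ultimately have "(s * c) * f + (s * d) * p = 1" by (simp add: algebra_simps)
  thus ?thesis using that by blast
qed

text \<open>The field \<open>k[x]/(p)\<close> for irreducible \<open>p\<close>: a residue class is encoded by the coefficient list of its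
  remainder, so that the carrier lives on the type demanded by \<^const>\<open>alg_extension\<close>.\<close>

definition rupt :: "'k::field poly \<Rightarrow> 'k list ring" where
  "rupt p = \<lparr>carrier = coeffs ` {f. degree f < degree p},
     monoid.mult = (\<lambda>x y. coeffs ((Poly x * Poly y) mod p)), monoid.one = coeffs 1,
     ring.zero = coeffs 0, ring.add = (\<lambda>x y. coeffs (Poly x + Poly y))\<rparr>"

lemma rupt_simps:
  "carrier (rupt p) = coeffs ` {f. degree f < degree p}"
  "coeffs f \<otimes>\<^bsub>rupt p\<^esub> coeffs g = coeffs ((f * g) mod p)"
  "coeffs f \<oplus>\<^bsub>rupt p\<^esub> coeffs g = coeffs (f + g)"
  "\<one>\<^bsub>rupt p\<^esub> = coeffs 1" "\<zero>\<^bsub>rupt p\<^esub> = coeffs 0"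
  by (simp_all add: rupt_def)

lemma degree_mod_less_pos: "0 < degree p \<Longrightarrow> degree (q mod p) < degree (p :: 'k::field poly)"
  using degree_mod_less[of p q] by fastforce

lemma coeffs_rupt [simp]: "coeffs f \<in> carrier (rupt p) \<longleftrightarrow> degree f < degree p"
  by (force simp: rupt_simps coeffs_eq_iff[symmetric])

lemma Nil_rupt [simp]: "[] \<in> carrier (rupt p) \<longleftrightarrow> 0 < degree p" "[] \<oplus>\<^bsub>rupt p\<^esub> coeffs f = coeffs f"
  using coeffs_rupt[of 0 p] rupt_simps(3)[of p 0 f] by simp_all

lemma one_rupt [simp]: "[1] \<in> carrier (rupt p) \<longleftrightarrow> 0 < degree p" "[1] \<otimes>\<^bsub>rupt p\<^esub> coeffs f = coeffs (f mod p)"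
  using coeffs_rupt[of 1 p] rupt_simps(2)[of p 1 f] by simp_all

lemma rupt_cases:
  assumes "x \<in> carrier (rupt p)"
  obtains f where "x = coeffs f" "degree f < degree p"
  using assms by (auto simp: rupt_simps)

lemma rupt_field:
  fixes p :: "'k::field poly"
  assumes irr: "Factorial_Ring.irreducible p"
  shows "field (rupt p)"
proof -
  have p0: "p \<noteq> 0" using irr by auto
  have dp: "degree p > 0"
    using irr p0 is_unit_iff_degree Factorial_Ring.irreducible_def by (metis gr0I)
  have dm: "degree (f mod p) < degree p" for f
    using degree_mod_less[OF p0, of f] dp by auto
  have small: "f mod p = f" if "degree f < degree p" for f using that by (rule mod_poly_less)
  have ab: "abelian_group (rupt p)"
  proof (rule abelian_groupI)
    fix x assume x: "x \<in> carrier (rupt p)"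
    then obtain f where f: "x = coeffs f" "degree f < degree p" by (rule rupt_cases)
    show "\<exists>y\<in>carrier (rupt p). y \<oplus>\<^bsub>rupt p\<^esub> x = \<zero>\<^bsub>rupt p\<^esub>"
      by (rule bexI[of _ "coeffs (- f)"]) (use f in \<open>simp_all add: rupt_simps(3-5)\<close>)
  qed (auto elim!: rupt_cases simp: rupt_simps(3-5) dp add_ac intro: degree_add_less)
  have cm: "Group.comm_monoid (rupt p)"
  proof (rule Group.comm_monoidI)
    fix x y z assume "x \<in> carrier (rupt p)" "y \<in> carrier (rupt p)" "z \<in> carrier (rupt p)"
    thus "x \<otimes>\<^bsub>rupt p\<^esub> y \<otimes>\<^bsub>rupt p\<^esub> z = x \<otimes>\<^bsub>rupt p\<^esub> (y \<otimes>\<^bsub>rupt p\<^esub> z)"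
      by (auto elim!: rupt_cases simp: rupt_simps(2) mod_mult_left_eq mod_mult_right_eq mult_ac)
  qed (auto elim!: rupt_cases simp: rupt_simps(2-5) dp dm small mult_ac)
  have cr: "cring (rupt p)"
  proof (rule cringI[OF ab cm])
    fix x y z assume "x \<in> carrier (rupt p)" "y \<in> carrier (rupt p)" "z \<in> carrier (rupt p)"
    thus "(x \<oplus>\<^bsub>rupt p\<^esub> y) \<otimes>\<^bsub>rupt p\<^esub> z = x \<otimes>\<^bsub>rupt p\<^esub> z \<oplus>\<^bsub>rupt p\<^esub> y \<otimes>\<^bsub>rupt p\<^esub> z"
      by (auto elim!: rupt_cases simp: rupt_simps(2-3) distrib_right poly_mod_add_left)
  qed
  show ?thesis
  proof (rule cring.cring_fieldI2[OF cr])
    show "\<zero>\<^bsub>rupt p\<^esub> \<noteq> \<one>\<^bsub>rupt p\<^esub>" by (simp add: rupt_simps)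
    fix x assume x: "x \<in> carrier (rupt p)" "x \<noteq> \<zero>\<^bsub>rupt p\<^esub>"
    obtain f where f: "x = coeffs f" "degree f < degree p" using x(1) by (rule rupt_cases)
    have "f \<noteq> 0" using x(2) f by (auto simp: rupt_simps)
    hence "\<not> p dvd f" using f(2) dvd_imp_degree_le by (metis leD)
    then obtain g h where "g * f + h * p = 1" using irreducible_bezout[OF irr] by metis
    hence "(g * f + h * p) mod p = 1 mod p" by simp
    hence "(f * (g mod p)) mod p = 1" using small[of 1] dp by (simp add: mod_mult_right_eq mult.commute)
    thus "\<exists>b\<in>carrier (rupt p). x \<otimes>\<^bsub>rupt p\<^esub> b = \<one>\<^bsub>rupt p\<^esub>"
      using f dm by (intro bexI[of _ "coeffs (g mod p)"]) (auto simp: rupt_simps(2-5))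
  qed
qed

lemma rupt_pow:
  fixes p :: "'k::field poly"
  assumes irr: "Factorial_Ring.irreducible p" and f: "degree f < degree p"
  shows "coeffs f [^]\<^bsub>rupt p\<^esub> (i::nat) = coeffs (f ^ i mod p)"
proof (induction i)
  interpret field "rupt p" by (rule rupt_field[OF irr])
  case 0
  have "1 mod p = 1" using f by (intro mod_poly_less) auto
  thus ?case by (simp add: rupt_simps)
next
  interpret field "rupt p" by (rule rupt_field[OF irr])
  case (Suc i)
  thus ?case using f by (simp add: rupt_simps(2) mod_mult_left_eq mod_mult_right_eq mult.commute)
qed

lemma rupt_finsum:
  fixes p :: "'k::field poly"
  assumes irr: "Factorial_Ring.irreducible p" and "\<And>i. degree (F i) < degree p"
  shows "finsum (rupt p) (\<lambda>i. coeffs (F i)) {..n::nat} = coeffs (\<Sum>i\<le>n. F i)"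
proof (induction n)
  interpret field "rupt p" by (rule rupt_field[OF irr])
  case 0
  show ?case using assms(2) by simp
next
  interpret field "rupt p" by (rule rupt_field[OF irr])
  case (Suc n)
  thus ?case using assms(2) by (simp add: rupt_simps(3) add.commute)
qed

text \<open>The first deg p + 1 powers lie in the space of remainders, which has dimension deg p.
  Linear dependence of a set does not see repetitions, so the case of two equal powers is settled by
  hand.\<close>

lemma powers_dependent_mod:
  fixes p f :: "'k::field poly"
  assumes dp: "degree p > 0"
  obtains n cs where "\<exists>i\<le>n. cs i \<noteq> 0" "(\<Sum>i\<le>n. smult (cs i) (f ^ i mod p)) = 0"
proof -
  define d where "d = degree p"
  interpret vs: vector_space "smult :: 'k \<Rightarrow> 'k poly \<Rightarrow> 'k poly"
    by standard (auto simp: smult_add_right smult_add_left)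
  define F where "F i = f ^ i mod p" for i
  have F: "degree (F i) < d" for i using degree_mod_less_pos[OF dp] unfolding F_def d_def .
  show thesis
  proof (cases "inj_on F {..d}")
    case False
    then obtain i j where ij: "i \<le> d" "j \<le> d" "i \<noteq> j" "F i = F j" by (auto simp: inj_on_def)
    have "(\<Sum>m\<le>d. smult ((if m = i then 1 else if m = j then - 1 else 0)) (F m))
        = (\<Sum>m\<le>d. (if m = i then F i else 0) - (if m = j then F j else 0))"
      using ij by (intro sum.cong) auto
    also have "\<dots> = 0" using ij by (simp add: sum_subtractf)
    finally show thesis using that[where n = d and cs = "\<lambda>m. if m = i then 1 else if m = j then - 1 else 0"] ij
      unfolding F_def by force
  next
    case True
    define T where "T = (\<lambda>i. monom (1::'k) i) ` {..<d}"
    have sub: "F ` {..d} \<subseteq> vs.span T"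
    proof
      fix g assume "g \<in> F ` {..d}"
      hence "degree g < d" using F by auto
      hence "g = (\<Sum>i<d. smult (coeff g i) (monom 1 i))"
        by (intro poly_eqI) (auto simp: coeff_sum coeff_eq_0 if_distrib cong: if_cong)
      also have "\<dots> \<in> vs.span T"
        by (intro vs.span_sum vs.span_scale vs.span_base) (auto simp: T_def)
      finally show "g \<in> vs.span T" .
    qed
    have "vs.dependent (F ` {..d})"
    proof (rule ccontr)
      assume "\<not> vs.dependent (F ` {..d})"
      hence "card (F ` {..d}) \<le> card T" using vs.independent_span_bound[of T] sub by (auto simp: T_def)
      also have "\<dots> \<le> d" unfolding T_def using card_image_le[of "{..<d}"] by fastforce
      finally show False using True by (simp add: card_image)
    qed
    then obtain c v where c: "v \<in> F ` {..d}" "c v \<noteq> 0" "(\<Sum>v\<in>F ` {..d}. smult (c v) v) = 0"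
      using vs.dependent_finite[of "F ` {..d}"] by auto
    from c(3) have "(\<Sum>i\<le>d. smult (c (F i)) (F i)) = 0" by (simp add: sum.reindex[OF True])
    thus thesis using that[of d "\<lambda>i. c (F i)"] c(1,2) unfolding F_def by auto
  qed
qed

lemma rupt_alg_extension:
  fixes p :: "'k::field poly"
  assumes irr: "Factorial_Ring.irreducible p" and dp: "degree p > 0"
  shows "alg_extension (rupt p) (\<lambda>a. coeffs [:a:])"
  unfolding alg_extension_def
proof (intro conjI allI ballI)
  show "field (rupt p)" by (rule rupt_field[OF irr])
  show "inj (\<lambda>a::'k. coeffs [:a:])" by (rule injI) (metis coeffs_eq_iff pCons_eq_iff)
  have dm: "degree (q mod p) < degree p" for q by (rule degree_mod_less_pos) (use dp in simp)
  show "coeffs [:a * b:] = coeffs [:a:] \<otimes>\<^bsub>rupt p\<^esub> coeffs [:b:]" for a b :: 'k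
    proof -
    have "[:a:] * [:b:] = [:a * b:]" by simp
    thus ?thesis unfolding rupt_simps(2) using dp by (simp only: mod_poly_less[of "[:a * b:]" p] degree_pCons_0)
  qed
  show "coeffs [:a + b:] = coeffs [:a:] \<oplus>\<^bsub>rupt p\<^esub> coeffs [:b:]" for a b :: 'k
    unfolding rupt_simps(3) by simp
  show "coeffs [:1:] = \<one>\<^bsub>rupt p\<^esub>" by (simp add: rupt_simps one_pCons)
  show "coeffs [:a:] \<in> carrier (rupt p)" for a using dp unfolding coeffs_rupt by simp
  fix x assume "x \<in> carrier (rupt p)"
  then obtain f where f: "x = coeffs f" "degree f < degree p" by (rule rupt_cases)
  obtain n cs where cs: "\<exists>i\<le>n. cs i \<noteq> 0" "(\<Sum>i\<le>n. smult (cs i) (f ^ i mod p)) = 0"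
    using powers_dependent_mod[OF dp] by metis
  have e: "(\<lambda>i. coeffs [:cs i:] \<otimes>\<^bsub>rupt p\<^esub> x [^]\<^bsub>rupt p\<^esub> i) = (\<lambda>i. coeffs (smult (cs i) (f ^ i mod p)))"
    unfolding f(1) rupt_pow[OF irr f(2)] rupt_simps(2)
    by (rule ext) (subst mod_poly_less[symmetric, OF le_less_trans[OF degree_smult_le dm]], simp)
  have d: "degree (smult (cs i) (f ^ i mod p)) < degree p" for i
    using dm[of "f ^ i"] degree_smult_le[of "cs i" "f ^ i mod p"] by linarith
  have "finsum (rupt p) (\<lambda>i. coeffs [:cs i:] \<otimes>\<^bsub>rupt p\<^esub> x [^]\<^bsub>rupt p\<^esub> i) {..n} = \<zero>\<^bsub>rupt p\<^esub>"
    
    using rupt_finsum[OF irr d, of "\<lambda>i. i" n] unfolding e cs(2) rupt_simps(5) .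
  thus "\<exists>n cs. (\<exists>i\<le>n. cs i \<noteq> 0) \<and>
      finsum (rupt p) (\<lambda>i. coeffs [:cs i:] \<otimes>\<^bsub>rupt p\<^esub> x [^]\<^bsub>rupt p\<^esub> (i::nat)) {..n::nat} = \<zero>\<^bsub>rupt p\<^esub>" using cs(1) by blast
qed

text \<open>Maximality turned into a divisibility of polynomials: in degree above one k[x]/(p) is a
  proper algebraic extension, so -1 is a sum of squares there, and the remainders of the summands
  are the \<open>fs\<close>.\<close>

lemma real_closed_irreducible:
  fixes p :: "'k::field poly"
  assumes rc: "real_closed TYPE('k)" and irr: "Factorial_Ring.irreducible p" and dp: "degree p > 1"
  obtains fs where "\<And>f. f \<in> set fs \<Longrightarrow> degree f < degree p" "p dvd 1 + sum_list (map (\<lambda>f. f * f) fs)"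
proof -
  interpret field "rupt p" by (rule rupt_field[OF irr])
  have "coeffs [:0,1:] \<in> carrier (rupt p)" using dp unfolding coeffs_rupt by simp
  moreover have "coeffs [:0,1:] \<notin> range (\<lambda>a::'k. coeffs [:a:])"
    by (auto simp del: coeffs_pCons_eq_cCons simp: coeffs_eq_iff[symmetric])
  ultimately have "range (\<lambda>a::'k. coeffs [:a:]) \<noteq> carrier (rupt p)" by blast
  hence "\<not> formally_real_ring (rupt p)"
    using rc rupt_alg_extension[OF irr] dp unfolding real_closed_def by force
  then obtain xs where xs: "set xs \<subseteq> carrier (rupt p)"
    "foldr (\<lambda>x acc. x \<otimes>\<^bsub>rupt p\<^esub> x \<oplus>\<^bsub>rupt p\<^esub> acc) xs \<zero>\<^bsub>rupt p\<^esub> = \<ominus>\<^bsub>rupt p\<^esub> \<one>\<^bsub>rupt p\<^esub>"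
    unfolding formally_real_ring_def by blast
  define fs where "fs = map Poly xs"
  have fs: "xs = map coeffs fs" "\<And>f. f \<in> set fs \<Longrightarrow> degree f < degree p"
    using xs(1) unfolding fs_def rupt_simps(1) 
    by (auto simp: comp_def subset_iff intro!: map_idI[symmetric])
  have dm: "degree (q mod p) < degree p" for q by (rule degree_mod_less_pos) (use dp in simp)
  have "foldr (\<lambda>x acc. x \<otimes>\<^bsub>rupt p\<^esub> x \<oplus>\<^bsub>rupt p\<^esub> acc) (map coeffs fs) \<zero>\<^bsub>rupt p\<^esub>
      = coeffs (sum_list (map (\<lambda>f. f * f) fs) mod p)" for fs
  proof (induction fs)
    case Nil
    show ?case by (simp add: rupt_simps(5))
  next
    case (Cons f fs)
    show ?case by (simp only: list.map foldr.simps comp_def Cons.IH rupt_simps(2,3) sum_list.Cons poly_mod_add_left)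
  qed
  hence "coeffs (sum_list (map (\<lambda>f. f * f) fs) mod p) = \<ominus>\<^bsub>rupt p\<^esub> \<one>\<^bsub>rupt p\<^esub>" using xs(2) fs(1) by simp
  hence "coeffs (sum_list (map (\<lambda>f. f * f) fs) mod p) \<oplus>\<^bsub>rupt p\<^esub> \<one>\<^bsub>rupt p\<^esub> = \<zero>\<^bsub>rupt p\<^esub>"
    using l_neg[OF one_closed] by simp
  hence "sum_list (map (\<lambda>f. f * f) fs) mod p + 1 = 0"
    unfolding rupt_simps by (simp only: coeffs_eq_iff)
  moreover have "1 mod p = 1" using dp by (intro mod_poly_less) auto
  ultimately have "(1 + sum_list (map (\<lambda>f. f * f) fs)) mod p = 0"
    by (simp add: poly_mod_add_left add.commute)
  thus ?thesis using that[OF fs(2)] by auto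
qed

section \<open>Sums of squares and square roots\<close>

text \<open>Stands in for nonnegativity; no ordering of the field is constructed.\<close>

definition sum_of_squares :: "'k::field \<Rightarrow> bool" where
  "sum_of_squares a \<longleftrightarrow> (\<exists>xs. a = sum_list (map (\<lambda>x. x * x) xs))"

lemma sum_of_squares_0 [simp]: "sum_of_squares 0"
  unfolding sum_of_squares_def by (rule exI[of _ "[]"]) simp

lemma sum_of_squares_square [simp]: "sum_of_squares (x * x)"
  unfolding sum_of_squares_def by (rule exI[of _ "[x]"]) simp

lemma sum_of_squares_1 [simp]: "sum_of_squares 1"
  using sum_of_squares_square[of 1] by simp

lemma sum_of_squares_add: "sum_of_squares a \<Longrightarrow> sum_of_squares b \<Longrightarrow> sum_of_squares (a + b)"
  unfolding sum_of_squares_def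
proof (elim exE)
  fix xs ys assume "a = sum_list (map (\<lambda>x. x * x) xs)" "b = sum_list (map (\<lambda>x. x * x) ys)"
  hence "a + b = sum_list (map (\<lambda>x. x * x) (xs @ ys))" by simp
  thus "\<exists>zs. a + b = sum_list (map (\<lambda>x. x * x) zs)" by (rule exI)
qed

lemma sum_of_squares_mult:
  assumes "sum_of_squares a" "sum_of_squares b" shows "sum_of_squares (a * b)"
proof -
  have sq: "sum_of_squares (x * x * b)" for x
  proof -
    obtain ys where "b = sum_list (map (\<lambda>y. y * y) ys)" using assms(2) unfolding sum_of_squares_def by blast
    hence "x * x * b = sum_list (map (\<lambda>y. y * y) (map ((*) x) ys))"
      by (simp add: sum_list_const_mult[symmetric] comp_def mult_ac)
    thus ?thesis unfolding sum_of_squares_def by blast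
  qed
  obtain xs where "a = sum_list (map (\<lambda>x. x * x) xs)" using assms(1) unfolding sum_of_squares_def by blast
  moreover have "sum_of_squares (sum_list (map (\<lambda>x. x * x) xs) * b)" for xs
    by (induction xs) (auto simp: distrib_right intro: sum_of_squares_add sq)
  ultimately show ?thesis by blast
qed

lemma sum_of_squares_of_nat: "sum_of_squares (of_nat n)"
  by (induction n) (auto intro: sum_of_squares_add)

lemma formally_real_add_neq_0:
  assumes "formally_real TYPE('k::field)" "sum_of_squares (s :: 'k)"
  shows "1 + s \<noteq> 0"
  using assms unfolding formally_real_def sum_of_squares_def by (metis add.inverse_inverse add_eq_0_iff)

text \<open>If \<open>s\<close> were nonzero, -1 = t/s = t s (1/s)^2 would be a sum of
  squares.\<close>

lemma formally_real_add_eq_0: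
  assumes fr: "formally_real TYPE('k::field)" and "sum_of_squares (s :: 'k)" "sum_of_squares t" "s + t = 0"
  shows "s = 0"
proof (rule ccontr)
  assume "s \<noteq> 0"
  hence "1 + t * s * (1 / s * (1 / s)) = 0" using assms(4) by (simp add: field_simps)
  moreover have "sum_of_squares (t * s * (1 / s * (1 / s)))" by (intro sum_of_squares_mult assms sum_of_squares_square)
  ultimately show False using formally_real_add_neq_0[OF fr] by blast
qed

lemma formally_real_of_nat:
  assumes fr: "formally_real TYPE('k::field)" and "n > 0"
  shows "of_nat n \<noteq> (0 :: 'k)"
  using formally_real_add_neq_0[OF fr sum_of_squares_of_nat[of "n - 1"]] assms(2)
  by (metis Suc_pred' of_nat_Suc)

lemma formally_real_of_nat_eq:
  assumes fr: "formally_real TYPE('k::field)" and "of_nat m = (of_nat n :: 'k)"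
  shows "m = n"
proof (rule ccontr)
  have less: False if "i < j" "of_nat i = (of_nat j :: 'k)" for i j
  proof -
    have "of_nat (j - i) + of_nat i = (of_nat j :: 'k)" using that(1) by (simp flip: of_nat_add)
    hence "of_nat (j - i) = (0::'k)" using that(2) by simp
    thus False using formally_real_of_nat[OF fr, of "j - i"] that(1) by simp
  qed
  assume "m \<noteq> n"
  hence "m < n \<or> n < m" by arith
  thus False using less[OF _ assms(2)] less[OF _ assms(2)[symmetric]] by blast
qed

lemma irreducible_quadratic:
  fixes a :: "'k::field"
  assumes "\<nexists>b. a = b * b"
  shows "Factorial_Ring.irreducible [:- a, 0, 1:]"
proof (rule Factorial_Ring.irreducibleI)
  show "[:- a, 0, 1:] \<noteq> 0" "\<not> [:- a, 0, 1:] dvd 1" by (simp_all add: is_unit_iff_degree)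
  fix r s assume rs: "[:- a, 0, 1:] = r * s"
  hence r0: "r \<noteq> 0" "s \<noteq> 0" by auto
  have "degree r + degree s = 2" using rs r0 degree_mult_eq[of r s] by (metis degree_pCons_eq_if one_neq_zero pCons_eq_0_iff Suc_1 One_nat_def degree_1 one_pCons)
  moreover have "degree r \<noteq> 1"
  proof
    assume "degree r = 1"
    then obtain c d where r: "r = [:c, d:]" "d \<noteq> 0" by (metis degree1_coeffs)
    have "poly r (- c / d) = 0" using r by simp
    hence "poly [:- a, 0, 1:] (- c / d) = 0" using rs by simp
    hence "a = (- c / d) * (- c / d)" by (simp add: algebra_simps)
    thus False using assms by blast
  qed
  ultimately have "degree r = 0 \<or> degree s = 0" by arith
  thus "r dvd 1 \<or> s dvd 1" using r0 by (simp add: is_unit_iff_degree)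
qed

text \<open>Modulo the quadratic x^2 = a, so the square of b + c x contributes b^2 to
  \<open>s\<close> and c^2 to \<open>t\<close>.\<close>

lemma sum_squares_mod_quadratic:
  fixes a :: "'k::field"
  assumes "\<forall>f\<in>set fs. degree f < 2"
  shows "\<exists>s t u v. sum_of_squares s \<and> sum_of_squares t \<and>
     sum_list (map (\<lambda>f. f * f) fs) = [:s + a * t, u:] + [:- a, 0, 1:] * v"
  using assms
proof (induction fs)
  case Nil
  show ?case by (rule exI[of _ 0])+ simp
next
  case (Cons f fs)
  then obtain s t u v where IH: "sum_of_squares s" "sum_of_squares t"
     "sum_list (map (\<lambda>f. f * f) fs) = [:s + a * t, u:] + [:- a, 0, 1:] * v" by auto
  obtain b c where f: "f = [:b, c:]"
    using Cons.prems by (metis (no_types, lifting) list.set_intros(1) degree1_coeffs degree_eq_zeroE less_2_cases pCons_0_0 One_nat_def)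
  have "f * f = [:b * b + a * (c * c), b * c + b * c:] + [:- a, 0, 1:] * [:c * c:]"
    by (simp add: f)
  hence "sum_list (map (\<lambda>f. f * f) (f # fs)) = ([:b * b + a * (c * c), b * c + b * c:] + [:s + a * t, u:])
      + [:- a, 0, 1:] * ([:c * c:] + v)" unfolding list.map sum_list.Cons IH(3) by (simp only: distrib_left add_ac)
  also have "[:b * b + a * (c * c), b * c + b * c:] + [:s + a * t, u:]
      = [:(b * b + s) + a * (c * c + t), b * c + b * c + u:]" by (simp add: algebra_simps)
  finally have eq: "sum_list (map (\<lambda>f. f * f) (f # fs)) = [:(b * b + s) + a * (c * c + t), b * c + b * c + u:]
        + [:- a, 0, 1:] * ([:c * c:] + v)" .
  show ?case
  proof (intro exI conjI)
    show "sum_of_squares (b * b + s)" "sum_of_squares (c * c + t)" using IH by (auto intro: sum_of_squares_add)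
    show "sum_list (map (\<lambda>f. f * f) (f # fs)) = [:(b * b + s) + a * (c * c + t), b * c + b * c + u:]
        + [:- a, 0, 1:] * ([:c * c:] + v)" by (rule eq)
  qed
qed

text \<open>Adjoining a root of a nonsquare \<open>a\<close> makes -1 a sum of squares. Comparing
  constant terms gives 1 + s + a t = 0 with sums of squares \<open>s\<close> and \<open>t\<close>,
  whence -a = (1 + s)/t.\<close>

lemma real_closed_nonsquare:
  fixes a :: "'k::field"
  assumes rc: "real_closed TYPE('k)" and ns: "\<nexists>b. a = b * b"
  shows "sum_of_squares (- a)"
proof -
  have fr: "formally_real TYPE('k)" using rc unfolding real_closed_def by simp
  have d2: "degree [:- a, 0, 1:] = 2" by simp
  obtain fs where fs: "\<And>f. f \<in> set fs \<Longrightarrow> degree f < degree [:- a, 0, 1:]"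
     "[:- a, 0, 1:] dvd 1 + sum_list (map (\<lambda>f. f * f) fs)"
  proof (rule real_closed_irreducible[OF rc irreducible_quadratic[OF ns]])
    show "1 < degree [:- a, 0, 1:]" using d2 by simp
  qed blast
  obtain s t u v where st: "sum_of_squares s" "sum_of_squares t"
     "sum_list (map (\<lambda>f. f * f) fs) = [:s + a * t, u:] + [:- a, 0, 1:] * v"
    using sum_squares_mod_quadratic[of fs a] fs(1) unfolding d2 by blast
  have "1 + sum_list (map (\<lambda>f. f * f) fs) = [:1 + (s + a * t), u:] + [:- a, 0, 1:] * v"
    unfolding st(3) by (simp add: one_pCons)
  hence "[:- a, 0, 1:] dvd [:1 + (s + a * t), u:]" using fs(2) by (simp only: dvd_add_left_iff[OF dvd_triv_left])
  moreover have "degree [:1 + (s + a * t), u:] < 2" by simp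
  moreover have "[:1 + (s + a * t), u:] = 0 \<or> degree [:- a, 0, 1:] \<le> degree [:1 + (s + a * t), u:]"
    using dvd_imp_degree_le[of "[:- a, 0, 1:]" "[:1 + (s + a * t), u:]"] calculation by blast
  ultimately have "[:1 + (s + a * t), u:] = 0" using d2 by linarith
  hence e: "1 + (s + a * t) = 0" by simp
  have t0: "t \<noteq> 0" using e formally_real_add_neq_0[OF fr st(1)] by auto
  have "1 + s = - (a * t)" using e by (simp add: eq_neg_iff_add_eq_0 algebra_simps)
  hence "- a = (1 + s) * t * (1 / t * (1 / t))" using t0 by (simp only:) (simp add: field_simps)
  moreover have "sum_of_squares ((1 + s) * t * (1 / t * (1 / t)))"
    by (intro sum_of_squares_mult sum_of_squares_add st sum_of_squares_square sum_of_squares_1)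
  ultimately show ?thesis by simp
qed

text \<open>A nonsquare \<open>a\<close> would make both \<open>a\<close> and \<open>- a\<close>
  sums of squares; then \<open>a\<close> is 0, which is a square.\<close>

lemma real_closed_sum_of_squares:
  assumes rc: "real_closed TYPE('k::field)" and a: "sum_of_squares (a :: 'k)"
  obtains b where "a = b * b"
proof -
  have fr: "formally_real TYPE('k)" using rc unfolding real_closed_def by simp
  have "\<exists>b. a = b * b"
  proof (rule ccontr)
    assume n: "\<nexists>b. a = b * b"
    hence "a = 0" using formally_real_add_eq_0[OF fr a real_closed_nonsquare[OF rc n]] by simp
    thus False using n by auto
  qed
  thus ?thesis using that by blast
qed

lemma real_closed_cases:
  assumes rc: "real_closed TYPE('k::field)"
  obtains b where "(a :: 'k) = b * b" | b where "a = - (b * b)"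
  using real_closed_nonsquare[OF rc, of a] real_closed_sum_of_squares[OF rc, of "- a"] by (metis minus_minus)

text \<open>With d = c^2 the geometric sum of the powers of \<open>d\<close> is 1 plus a sum of
  squares, hence nonzero, and d^n = 1 leaves only d = 1.\<close>

lemma formally_real_root_of_unity:
  assumes fr: "formally_real TYPE('k::field)" and "(c :: 'k) ^ n = 1" "n > 0"
  shows "c * c = 1"
proof -
  define d where "d = c * c"
  have d: "d ^ n = 1" unfolding d_def power_mult_distrib using assms(2) by simp
  have "sum_of_squares (\<Sum>i<m. d ^ Suc i)" for m
  proof (induction m)
    case (Suc m)
    have "d ^ Suc m = (c ^ Suc m) * (c ^ Suc m)" unfolding d_def power_mult_distrib ..
    thus ?case using Suc sum_of_squares_add by (metis sum.lessThan_Suc sum_of_squares_square)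
  qed simp
  hence "1 + (\<Sum>i<n - 1. d ^ Suc i) \<noteq> 0" using formally_real_add_neq_0[OF fr] by blast
  moreover have "1 + (\<Sum>i<n - 1. d ^ Suc i) = (\<Sum>i<n. d ^ i)"
    using sum.lessThan_Suc_shift[of "\<lambda>i. d ^ i" "n - 1"] assms(3) by simp
  moreover have "(d - 1) * (\<Sum>i<n. d ^ i) = 0" using power_diff_1_eq[of d n] d by simp
  ultimately show ?thesis unfolding d_def by auto
qed

text \<open>The usual formula: with R the absolute value of a + b i take c^2 = (R + a)/2 and d =
  b/(2c). What needs an argument without an ordering is that (R + a)/2 is a square.\<close>

lemma real_closed_complex_sqrt:
  assumes rc: "real_closed TYPE('k::field)"
  shows "\<exists>c d. (a :: 'k) = c * c - d * d \<and> b = 2 * c * d"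
proof (cases "b = 0")
  case True
  show ?thesis
  proof (cases rule: real_closed_cases[OF rc, of a])
    case (1 c) show ?thesis by (rule exI[of _ c], rule exI[of _ 0]) (simp add: True 1)
  next
    case (2 d) show ?thesis by (rule exI[of _ 0], rule exI[of _ d]) (simp add: True 2)
  qed
next
  case False
  have fr: "formally_real TYPE('k)" using rc unfolding real_closed_def by simp
  have two: "(2::'k) \<noteq> 0" using formally_real_of_nat[OF fr, of 2] by simp
  obtain r0 where r0: "a * a + b * b = r0 * r0"
    using real_closed_sum_of_squares[OF rc, of "a * a + b * b"] sum_of_squares_add by (metis sum_of_squares_square)
  \<comment> \<open>The absolute value is chosen to be a square itself, so that it counts as
    nonnegative: \<open>r0\<close> is a square up to sign, and the sign disappears on
    squaring.\<close>
  have "\<exists>r. a * a + b * b = (r * r) * (r * r)"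
  proof (cases rule: real_closed_cases[OF rc, of r0])
    case (1 c) thus ?thesis using r0 by blast
  next
    case (2 d) thus ?thesis using r0 by auto
  qed
  then obtain r where r: "a * a + b * b = (r * r) * (r * r)" by blast
  define R where "R = r * r"
  have RR: "(R + a) * (R - a) = b * b" using r unfolding R_def by (simp add: algebra_simps)
  have Ra: "R + a \<noteq> 0" "R - a \<noteq> 0" using RR False by auto
  obtain c where c: "(R + a) / 2 = c * c"
  proof (cases rule: real_closed_cases[OF rc, of "(R + a) / 2"])
    case (1 c) thus ?thesis using that by blast
  next
    \<comment> \<open>Here R + a = -2 e^2, so R - a = b^2/(R + a) is minus twice the square of
      b/(2e). Adding the two equations gives R + e^2 + (b/(2e))^2 = 0, against formal
      reality.\<close>
    case (2 e)
    hence Re: "R + a = - (2 * (e * e))" using two by (simp add: field_simps)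
    hence e0: "e \<noteq> 0" using Ra by auto
    have "R - a = b * b / (R + a)" using RR Ra by (simp add: field_simps)
    hence "R - a = - (b * b / (2 * (e * e)))" unfolding Re by simp
    moreover have "2 * R = (R + a) + (R - a)" by simp
    ultimately have "2 * R + (2 * (e * e) + b * b / (2 * (e * e))) = 0" using Re by (simp only:) simp
    moreover have "b * b / (2 * (e * e)) = 2 * ((b / (2 * e)) * (b / (2 * e)))" proof -
      define m where "m = b / (2 * e)"
      have "b = 2 * e * m" using two e0 unfolding m_def by simp
      hence "b * b / (2 * (e * e)) = 2 * (m * m) * ((2 * (e * e)) / (2 * (e * e)))" by (simp add: mult_ac)
      also have "\<dots> = 2 * (m * m)" using two e0 by simp
      finally show ?thesis unfolding m_def .
    qed
    ultimately have "2 * (R + (e * e + (b / (2 * e)) * (b / (2 * e)))) = 0" by (simp add: algebra_simps)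
    hence "R + (e * e + (b / (2 * e)) * (b / (2 * e))) = 0" using two by (simp only: mult_eq_0_iff simp_thms)
    hence "e * e + ((b / (2 * e)) * (b / (2 * e)) + R) = 0" by (simp only: add_ac)
    moreover have "sum_of_squares ((b / (2 * e)) * (b / (2 * e)) + R)"
      unfolding R_def by (intro sum_of_squares_add sum_of_squares_square)
    ultimately have "e * e = 0" using formally_real_add_eq_0[OF fr sum_of_squares_square] by blast
    thus ?thesis using e0 by simp
  qed
  have c0: "c \<noteq> 0" using c Ra two by auto
  have Rc: "R + a = 2 * (c * c)" using c two by (simp add: field_simps)
  have "R - a = b * b / (2 * (c * c))" using RR Ra unfolding Rc using c0 two by (simp add: field_simps)
  moreover have "2 * a = (R + a) - (R - a)" by simp
  ultimately have "2 * a = 2 * (c * c) - b * b / (2 * (c * c))" using Rc by simp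
  moreover obtain d where d: "b = 2 * c * d" using two c0 by (metis nonzero_mult_div_cancel_left times_divide_eq_right mult_eq_0_iff)
  ultimately have "2 * a = 2 * (c * c) - 2 * (d * d) * ((2 * (c * c)) / (2 * (c * c)))" by (simp add: mult_ac)
  hence "2 * a = 2 * (c * c - d * d)" using two c0 by (simp add: right_diff_distrib)
  hence "a = c * c - d * d" using two by (simp only: mult_cancel_left simp_thms)
  thus ?thesis using d by blast
qed

section \<open>Polynomials of odd degree\<close>

text \<open>The leading coefficients are themselves sums of squares and cannot cancel each
  other.\<close>

lemma sum_poly_squares_degree:
  fixes fs :: "'k::field poly list"
  assumes fr: "formally_real TYPE('k)" and "\<forall>f\<in>set fs. degree f \<le> n"
  shows "\<exists>m\<le>n. degree (sum_list (map (\<lambda>f. f * f) fs)) = 2 * m \<and>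
           sum_of_squares (lead_coeff (sum_list (map (\<lambda>f. f * f) fs)))"
  using assms(2)
proof (induction fs)
  case (Cons f fs)
  define g where "g = sum_list (map (\<lambda>f. f * f) fs)"
  obtain m where m: "m \<le> n" "degree g = 2 * m" "sum_of_squares (lead_coeff g)"
    using Cons unfolding g_def by auto
  have df: "degree (f * f) = 2 * degree f" by (cases "f = 0") (auto simp: degree_mult_eq)
  have lf: "lead_coeff (f * f) = lead_coeff f * lead_coeff f" by (rule lead_coeff_mult)
  have fn: "degree f \<le> n" using Cons.prems by simp
  consider "degree (f * f) < degree g" | "degree g < degree (f * f)" | "degree (f * f) = degree g" by linarith
  hence "\<exists>m\<le>n. degree (f * f + g) = 2 * m \<and> sum_of_squares (lead_coeff (f * f + g))"
  proof cases
    case 1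
    show ?thesis using degree_add_eq_right[OF 1] lead_coeff_add_le[OF 1] m by (intro exI[of _ m]) simp
  next
    case 2
    show ?thesis using degree_add_eq_left[OF 2] lead_coeff_add_le[OF 2] df fn lf
      by (intro exI[of _ "degree f"]) (simp add: add.commute)
  next
    case 3
    have cf: "coeff (f * f + g) (2 * m) = lead_coeff f * lead_coeff f + lead_coeff g"
      using 3 m(2) lf by simp
    show ?thesis
    proof (cases "coeff (f * f + g) (2 * m) = 0")
      case True
      hence "lead_coeff f * lead_coeff f = 0" "lead_coeff g = 0"
        using formally_real_add_eq_0[OF fr _ _ , of "lead_coeff f * lead_coeff f" "lead_coeff g"] m(3) cf by auto
      hence "f * f + g = 0" by simp
      thus ?thesis by auto
    next
      case False
      hence "degree (f * f + g) = 2 * m"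
        using le_degree[OF False] degree_add_le[of "f * f" "2 * m" g] 3 m(2) by simp
      thus ?thesis using cf m by (intro exI[of _ m]) (auto intro: sum_of_squares_add)
    qed
  qed
  thus ?case by (simp add: g_def)
qed auto

text \<open>Induction on the degree. A reducible \<open>p\<close> has a factor of smaller odd
  degree. For an irreducible \<open>p\<close> of degree above one, 1 plus a sum of squares of
  remainders equals p q; its degree is even and at most 2 deg p - 2, so \<open>q\<close> has smaller
  odd degree. A root of \<open>q\<close> would be a zero of 1 plus a sum of squares.\<close>

lemma real_closed_odd_root:
  fixes p :: "'k::field poly"
  assumes rc: "real_closed TYPE('k)" and "odd (degree p)"
  shows "\<exists>x. poly p x = 0"
  using assms(2)
proof (induction "degree p" arbitrary: p rule: less_induct)
  case less
  have fr: "formally_real TYPE('k)" using rc unfolding real_closed_def by simp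
  have p0: "p \<noteq> 0" using less.prems by auto
  have nu: "\<not> p dvd 1" using odd_pos[OF less.prems] by (simp add: is_unit_iff_degree[OF p0])
  show ?case
  proof (cases "Factorial_Ring.irreducible p")
    case False
    then obtain a b where ab: "p = a * b" "\<not> a dvd 1" "\<not> b dvd 1"
      using p0 nu unfolding Factorial_Ring.irreducible_def by blast
    have "a \<noteq> 0" "b \<noteq> 0" using p0 ab by auto
    hence d: "degree p = degree a + degree b" "degree a > 0" "degree b > 0"
      using ab by (auto simp: degree_mult_eq is_unit_iff_degree)
    hence "odd (degree a) \<or> odd (degree b)" using less.prems by auto
    hence "(\<exists>x. poly a x = 0) \<or> (\<exists>x. poly b x = 0)" using less.hyps[of a] less.hyps[of b] d by auto
    thus ?thesis using ab by auto
  next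
    case True
    show ?thesis
    proof (cases "degree p = 1")
      case True
      then obtain c d where "p = [:c, d:]" "d \<noteq> 0" by (metis degree1_coeffs)
      thus ?thesis by (intro exI[of _ "- c / d"]) simp
    next
      case False
      hence d1: "degree p > 1" using less.prems by (cases "degree p") auto
      obtain fs where fs: "\<And>f. f \<in> set fs \<Longrightarrow> degree f < degree p" "p dvd 1 + sum_list (map (\<lambda>f. f * f) fs)"
        using real_closed_irreducible[OF rc True d1] by metis
      \<comment> \<open>The summand 1 is counted as one more square.\<close>
      have "\<forall>f\<in>set (1 # fs). degree f \<le> degree p - 1" using fs(1) d1 by fastforce
      then obtain m where m: "m \<le> degree p - 1" "degree (1 + sum_list (map (\<lambda>f. f * f) fs)) = 2 * m"
        using sum_poly_squares_degree[OF fr, of "1 # fs" "degree p - 1"] by auto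
      obtain q where q: "1 + sum_list (map (\<lambda>f. f * f) fs) = p * q" using fs(2) by auto
      have ev: "poly (1 + sum_list (map (\<lambda>f. f * f) fs)) x = 1 + sum_list (map (\<lambda>y. y * y) (map (\<lambda>f. poly f x) fs))" for x
        by (induction fs) (auto simp: add.left_commute)
      have ne: "poly (1 + sum_list (map (\<lambda>f. f * f) fs)) x \<noteq> 0" for x
        unfolding ev by (rule formally_real_add_neq_0[OF fr]) (unfold sum_of_squares_def, rule exI, rule refl)
      have "q \<noteq> 0" using ne[of 0] q by auto
      hence "2 * m = degree p + degree q" using m(2) q p0 by (simp add: degree_mult_eq)
      hence "odd (degree q)" "degree q < degree p" using less.prems m(1) d1 by (presburger, linarith)
      then obtain x where "poly q x = 0" using less.hyps by blast
      thus ?thesis using ne[of x] q by simp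
    qed
  qed
qed

section \<open>Rings with a Galois action and their grading\<close>

text \<open>\<open>act g\<close> is additive on the whole ambient ring, so sums and differences
  carry no membership conditions; everything else is required on \<open>A\<close>, whose unit is
  \<open>u\<close>. No tensor products are formed: \<open>casimir\<close> is the image of the tensor
  identity under the map that sends p tensor q to p b y(q).\<close>

locale ring_with_action = Group.group G for G :: "'g monoid" (structure) +
  fixes A :: "'r::ring set" and u :: 'r and j :: "'k::field \<Rightarrow> 'r" and act :: "'g \<Rightarrow> 'r \<Rightarrow> 'r"
    and P Q :: "nat \<Rightarrow> 'r" and n :: nat
  assumes fin_G: "finite (carrier G)" and rc: "real_closed TYPE('k)"
    and u0: "u \<noteq> 0" and A_u: "u \<in> A"
    and A_add: "\<And>x y. x \<in> A \<Longrightarrow> y \<in> A \<Longrightarrow> x + y \<in> A" and A_mult: "\<And>x y. x \<in> A \<Longrightarrow> y \<in> A \<Longrightarrow> x * y \<in> A"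
    and u_l: "\<And>x. x \<in> A \<Longrightarrow> u * x = x" and u_r: "\<And>x. x \<in> A \<Longrightarrow> x * u = x"
    and A_j: "\<And>c. j c \<in> A" and j_add: "\<And>c d. j (c + d) = j c + j d" and j_mult: "\<And>c d. j (c * d) = j c * j d"
    and j_1: "j 1 = u" and j_comm: "\<And>c x. x \<in> A \<Longrightarrow> j c * x = x * j c"
    and A_act: "\<And>g x. g \<in> carrier G \<Longrightarrow> x \<in> A \<Longrightarrow> act g x \<in> A"
    and act_add: "\<And>g x y. act g (x + y) = act g x + act g y"
    and act_mult: "\<And>g x y. g \<in> carrier G \<Longrightarrow> x \<in> A \<Longrightarrow> y \<in> A \<Longrightarrow> act g (x * y) = act g x * act g y"
    and act_j: "\<And>g c. g \<in> carrier G \<Longrightarrow> act g (j c) = j c"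
    and act_one: "\<And>x. x \<in> A \<Longrightarrow> act \<one> x = x"
    and act_act: "\<And>g h x. g \<in> carrier G \<Longrightarrow> h \<in> carrier G \<Longrightarrow> x \<in> A \<Longrightarrow> act (g \<otimes> h) x = act g (act h x)"
    and fixed: "\<And>x. x \<in> A \<Longrightarrow> \<forall>g\<in>carrier G. act g x = x \<Longrightarrow> \<exists>c. x = j c"
    and A_P: "\<And>i. i < n \<Longrightarrow> P i \<in> A" and A_Q: "\<And>i. i < n \<Longrightarrow> Q i \<in> A"
    and separability: "\<And>g. g \<in> carrier G \<Longrightarrow> (\<Sum>i<n. P i * act g (Q i)) = (if g = \<one> then u else 0)"
    and casimir: "\<And>a b y. a \<in> A \<Longrightarrow> b \<in> A \<Longrightarrow> y \<in> carrier G \<Longrightarrow>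
        (\<Sum>i<n. P i * b * act y (Q i * a)) = (\<Sum>i<n. a * P i * b * act y (Q i))"
begin

lemma fr: "formally_real TYPE('k)" using rc unfolding real_closed_def by simp

lemma of_nat_neq_0: "m > 0 \<Longrightarrow> of_nat m \<noteq> (0::'k)" using formally_real_of_nat[OF fr] .

lemma j_0 [simp]: "j 0 = 0" using j_add[of 0 0] by simp

lemma j_minus: "j (- c) = - j c" using j_add[of c "- c"] by (simp add: eq_neg_iff_add_eq_0 add.commute)

lemma j_diff: "j (c - d) = j c - j d" using j_add[of c "- d"] by (simp add: j_minus)

lemma A_0 [simp]: "0 \<in> A" using A_j[of 0] by simp

lemma A_minus: "x \<in> A \<Longrightarrow> - x \<in> A"
  using A_mult[OF A_j[of "- 1"], of x] by (simp add: j_minus j_1 u_l)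

lemma A_diff: "x \<in> A \<Longrightarrow> y \<in> A \<Longrightarrow> x - y \<in> A"
  using A_add[OF _ A_minus, of x y] by simp

lemma A_sum: "(\<And>i. i \<in> I \<Longrightarrow> f i \<in> A) \<Longrightarrow> sum f I \<in> A"
  by (induction I rule: infinite_finite_induct) (auto intro: A_add)

lemma j_cancel: "c \<noteq> 0 \<Longrightarrow> x \<in> A \<Longrightarrow> j (1 / c) * (j c * x) = x"
  by (simp add: mult.assoc[symmetric] j_mult[symmetric] j_1 u_l)

lemma j_mult_eq_0: "c \<noteq> 0 \<Longrightarrow> x \<in> A \<Longrightarrow> j c * x = 0 \<Longrightarrow> x = 0"
  using j_cancel[of c x] by simp

lemma j_mult_inj: "x \<in> A \<Longrightarrow> x \<noteq> 0 \<Longrightarrow> j c * x = j d * x \<Longrightarrow> c = d"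
  using j_mult_eq_0[of "c - d" x] by (auto simp: j_diff left_diff_distrib)

lemma j_inj: "j c = j d \<longleftrightarrow> c = d"
  using j_mult_inj[of u c d] A_u u0 by auto

lemma sum_const_j:
  assumes "x \<in> A" "finite I" shows "(\<Sum>i\<in>I. x) = j (of_nat (card I)) * x"
  using assms(2)
proof (induction I rule: finite_induct)
  case (insert i I)
  have "(\<Sum>i\<in>insert i I. x) = x + j (of_nat (card I)) * x" using insert by simp
  also have "\<dots> = (j 1 + j (of_nat (card I))) * x" unfolding distrib_right j_1 u_l[OF assms(1)] ..
  also have "j 1 + j (of_nat (card I)) = j (of_nat (card (insert i I)))"
    unfolding j_add[symmetric] card_insert_disjoint[OF insert.hyps(1,2)] of_nat_Suc ..
  finally show ?case .
qed simp

lemma act_0 [simp]: "act g 0 = 0" using act_add[of g 0 0] by simp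

lemma act_minus: "act g (- x) = - act g x" using act_add[of g x "- x"] by (simp add: eq_neg_iff_add_eq_0 add.commute)

lemma act_diff: "act g (x - y) = act g x - act g y" using act_add[of g x "- y"] by (simp add: act_minus)

lemma act_sum: "act g (sum f I) = (\<Sum>i\<in>I. act g (f i))"
  by (induction I rule: infinite_finite_induct) (auto simp: act_add)

lemma act_u: "g \<in> carrier G \<Longrightarrow> act g u = u" using act_j[of g 1] j_1 by simp

lemma act_inv_act: "g \<in> carrier G \<Longrightarrow> x \<in> A \<Longrightarrow> act (inv g) (act g x) = x"
  using act_act[of "inv g" g x] by (simp add: act_one)

lemma act_act_inv: "g \<in> carrier G \<Longrightarrow> x \<in> A \<Longrightarrow> act g (act (inv g) x) = x"
  using act_act[of g "inv g" x] by (simp add: act_one)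

lemma act_inj: "g \<in> carrier G \<Longrightarrow> x \<in> A \<Longrightarrow> y \<in> A \<Longrightarrow> act g x = act g y \<Longrightarrow> x = y"
  by (metis act_inv_act)

lemma act_j_mult: "g \<in> carrier G \<Longrightarrow> x \<in> A \<Longrightarrow> act g (j c * x) = j c * act g x"
  by (simp add: act_mult A_j act_j)

lemma bij_lmult: "h \<in> carrier G \<Longrightarrow> bij_betw (\<lambda>g. h \<otimes> g) (carrier G) (carrier G)"
  by (rule bij_betw_byWitness[where f' = "\<lambda>g. inv h \<otimes> g"]) (auto simp: m_assoc[symmetric])

lemma bij_inv: "bij_betw (\<lambda>g. inv g) (carrier G) (carrier G)"
  by (rule bij_betw_byWitness[where f' = "\<lambda>g. inv g"]) auto

definition tr :: "'r \<Rightarrow> 'r" where "tr a = (\<Sum>g\<in>carrier G. act g a)"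

lemma A_tr: "a \<in> A \<Longrightarrow> tr a \<in> A" unfolding tr_def by (intro A_sum A_act)

lemma tr_add: "tr (a + b) = tr a + tr b" by (simp add: tr_def act_add sum.distrib)

lemma tr_0 [simp]: "tr 0 = 0" by (simp add: tr_def)

lemma tr_sum: "tr (sum f I) = (\<Sum>i\<in>I. tr (f i))"
  by (induction I rule: infinite_finite_induct) (auto simp: tr_add)

lemma act_tr: assumes "h \<in> carrier G" "a \<in> A" shows "act h (tr a) = tr a"
proof -
  have "act h (tr a) = (\<Sum>g\<in>carrier G. act (h \<otimes> g) a)"
    unfolding tr_def act_sum by (intro sum.cong refl) (use assms in \<open>simp add: act_act\<close>)
  also have "\<dots> = tr a" unfolding tr_def
    by (rule sum.reindex_bij_betw[OF bij_lmult[OF assms(1)], of "\<lambda>g. act g a"])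
  finally show ?thesis .
qed

lemma tr_j: assumes "a \<in> A" obtains c where "tr a = j c"
  using fixed[of "tr a"] act_tr assms A_tr by blast

text \<open>After expanding the trace and summing over \<open>i\<close> first,
  \<open>separability\<close> leaves only the term g = 1. So \<open>P\<close> and \<open>Q\<close>
  are dual bases for the trace form.\<close>

lemma dual_basis: assumes a: "a \<in> A" shows "(\<Sum>i<n. P i * tr (Q i * a)) = a"
proof -
  have "(\<Sum>i<n. P i * tr (Q i * a)) = (\<Sum>i<n. \<Sum>g\<in>carrier G. P i * act g (Q i) * act g a)"
    unfolding tr_def sum_distrib_left
    by (intro sum.cong refl) (use a A_Q in \<open>simp add: act_mult mult.assoc\<close>)
  also have "\<dots> = (\<Sum>g\<in>carrier G. \<Sum>i<n. P i * act g (Q i) * act g a)" by (rule sum.swap)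
  also have "\<dots> = (\<Sum>g\<in>carrier G. (\<Sum>i<n. P i * act g (Q i)) * act g a)"
    by (simp add: sum_distrib_right)
  also have "\<dots> = (\<Sum>g\<in>carrier G. (if g = \<one> then act g a else 0))"
    by (intro sum.cong refl) (use a in \<open>auto simp: separability act_one u_l\<close>)
  also have "\<dots> = a" using a fin_G by (simp add: sum.delta act_one)
  finally show ?thesis .
qed

lemma trace_nondegenerate: assumes "a \<in> A" "a \<noteq> 0" shows "\<exists>b\<in>A. tr (b * a) \<noteq> 0"
proof (rule ccontr)
  assume "\<not> ?thesis"
  hence "\<And>i. i < n \<Longrightarrow> tr (Q i * a) = 0" using A_Q by blast
  hence "(\<Sum>i<n. P i * tr (Q i * a)) = 0" by simp
  thus False using dual_basis[OF assms(1)] assms(2) by simp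
qed

section \<open>Homogeneous components and their projections\<close>

definition gr :: "'g \<Rightarrow> 'r set" where "gr y = {v \<in> A. \<forall>a\<in>A. v * a = act y a * v}"

lemma gr_A: "v \<in> gr y \<Longrightarrow> v \<in> A" by (simp add: gr_def)

lemma gr_comm: "v \<in> gr y \<Longrightarrow> a \<in> A \<Longrightarrow> v * a = act y a * v" by (simp add: gr_def)

lemma gr_0 [simp]: "0 \<in> gr y" by (simp add: gr_def)

lemma gr_add: "v \<in> gr y \<Longrightarrow> w \<in> gr y \<Longrightarrow> v + w \<in> gr y"
  by (simp add: gr_def A_add distrib_left distrib_right)

lemma gr_sum: "(\<And>i. i \<in> I \<Longrightarrow> f i \<in> gr y) \<Longrightarrow> sum f I \<in> gr y"
  by (induction I rule: infinite_finite_induct) (auto intro: gr_add)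

lemma gr_mult:
  assumes "x \<in> carrier G" "y \<in> carrier G" "v \<in> gr x" "w \<in> gr y" shows "v * w \<in> gr (x \<otimes> y)"
proof -
  have "v * w * a = act (x \<otimes> y) a * (v * w)" if a: "a \<in> A" for a
  proof -
    have "v * w * a = v * act y a * w" using gr_comm[OF assms(4) a] by (simp add: mult.assoc)
    also have "\<dots> = act x (act y a) * v * w" using gr_comm[OF assms(3) A_act[OF assms(2) a]] by simp
    finally show ?thesis using act_act[OF assms(1,2) a] by (simp add: mult.assoc)
  qed
  moreover have "v * w \<in> A" using A_mult gr_A[OF assms(3)] gr_A[OF assms(4)] by blast
  ultimately show ?thesis by (simp add: gr_def)
qed

lemma gr_act:
  assumes "g \<in> carrier G" "y \<in> carrier G" "v \<in> gr y" shows "act g v \<in> gr (g \<otimes> y \<otimes> inv g)"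
proof -
  have "act g v * a = act (g \<otimes> y \<otimes> inv g) a * act g v" if a: "a \<in> A" for a
  proof -
    have vA: "v \<in> A" using assms gr_A by blast
    have ia: "act (inv g) a \<in> A" using A_act a assms by simp
    have "act g v * a = act g (v * act (inv g) a)"
      using act_mult[OF assms(1) vA ia] act_act_inv[OF assms(1) a] by simp
    also have "\<dots> = act g (act y (act (inv g) a) * v)" using gr_comm[OF assms(3) ia] by simp
    also have "\<dots> = act (g \<otimes> y \<otimes> inv g) a * act g v"
      using assms a ia vA by (simp add: act_mult A_act act_act m_assoc)
    finally show ?thesis .
  qed
  moreover have "act g v \<in> A" using A_act[OF assms(1) gr_A[OF assms(3)]] .
  ultimately show ?thesis by (simp add: gr_def)
qed

definition pr :: "'g \<Rightarrow> 'r \<Rightarrow> 'r" where "pr y b = (\<Sum>i<n. P i * b * act (inv y) (Q i))"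

lemma pr_add: "pr y (a + b) = pr y a + pr y b"
  by (simp add: pr_def distrib_left distrib_right sum.distrib)

lemma pr_0 [simp]: "pr y 0 = 0" by (simp add: pr_def)

lemma pr_sum_distrib: "pr y (sum f I) = (\<Sum>i\<in>I. pr y (f i))"
  by (induction I rule: infinite_finite_induct) (auto simp: pr_add)

lemma pr_gr: assumes y: "y \<in> carrier G" and b: "b \<in> A" shows "pr y b \<in> gr y"
proof -
  have "pr y b * a = act y a * pr y b" if a: "a \<in> A" for a
  proof -
    have "pr y b * a = (\<Sum>i<n. P i * b * act (inv y) (Q i * act y a))"
      unfolding pr_def sum_distrib_right
      by (intro sum.cong refl) (use y a A_Q in \<open>simp add: act_mult A_act act_inv_act mult.assoc\<close>)
    also have "\<dots> = (\<Sum>i<n. act y a * P i * b * act (inv y) (Q i))"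
      by (rule casimir) (use y a b A_act in auto)
    also have "\<dots> = act y a * pr y b" by (simp add: pr_def sum_distrib_left mult.assoc)
    finally show ?thesis .
  qed
  moreover have "pr y b \<in> A" unfolding pr_def by (intro A_sum A_mult A_act) (use y b A_P A_Q in auto)
  ultimately show ?thesis by (simp add: gr_def)
qed

text \<open>Summing over \<open>y\<close> turns the factors \<open>act (inv y) (Q i)\<close> into
  the trace of \<open>Q i\<close>, a scalar that passes to the left of \<open>b\<close>; the dual
  basis expansion of \<open>u\<close> remains.\<close>

lemma pr_sum: assumes b: "b \<in> A" shows "(\<Sum>y\<in>carrier G. pr y b) = b"
proof -
  have "(\<Sum>y\<in>carrier G. pr y b) = (\<Sum>i<n. \<Sum>y\<in>carrier G. P i * b * act (inv y) (Q i))"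
    unfolding pr_def by (rule sum.swap)
  also have "\<dots> = (\<Sum>i<n. P i * b * tr (Q i))"
  proof (intro sum.cong refl)
    fix i
    have "tr (Q i) = (\<Sum>y\<in>carrier G. act (inv y) (Q i))"
      unfolding tr_def using sum.reindex_bij_betw[OF bij_inv, of "\<lambda>g. act g (Q i)"] by (rule sym)
    thus "(\<Sum>y\<in>carrier G. P i * b * act (inv y) (Q i)) = P i * b * tr (Q i)"
      by (simp add: sum_distrib_left)
  qed
  also have "\<dots> = (\<Sum>i<n. P i * tr (Q i * u) * b)"
  proof (intro sum.cong refl)
    fix i assume "i \<in> {..<n}"
    hence "Q i \<in> A" using A_Q by simp
    moreover obtain c where "tr (Q i) = j c" using tr_j calculation by blast
    ultimately show "P i * b * tr (Q i) = P i * tr (Q i * u) * b"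
      using j_comm[OF b] by (simp add: u_r mult.assoc)
  qed
  also have "\<dots> = u * b" using dual_basis[OF A_u] by (simp add: sum_distrib_right[symmetric])
  finally show ?thesis using b u_l by simp
qed

text \<open>Moving \<open>v\<close> to the right changes y^-1(Q i) into (x y^-1)(Q i), and
  \<open>separability\<close> evaluates the sum. Hence the sum of the components is direct.\<close>

lemma pr_gr_eq: assumes x: "x \<in> carrier G" and y: "y \<in> carrier G" and v: "v \<in> gr x"
  shows "pr y v = (if y = x then v else 0)"
proof -
  have "pr y v = (\<Sum>i<n. P i * act (x \<otimes> inv y) (Q i) * v)" unfolding pr_def
    by (intro sum.cong refl) (use gr_comm[OF v] A_act A_Q x y in \<open>simp add: act_act mult.assoc\<close>)
  also have "\<dots> = (if x \<otimes> inv y = \<one> then u else 0) * v"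
    using separability[of "x \<otimes> inv y"] x y by (simp add: sum_distrib_right[symmetric])
  also have "x \<otimes> inv y = \<one> \<longleftrightarrow> y = x" using x y inv_equality[of x "inv y"] by auto
  finally show ?thesis using u_l gr_A[OF v] by simp
qed

lemma gr_disjoint: "x \<in> carrier G \<Longrightarrow> y \<in> carrier G \<Longrightarrow> v \<in> gr x \<Longrightarrow> v \<in> gr y \<Longrightarrow> v \<noteq> 0 \<Longrightarrow> x = y"
  using pr_gr_eq[of x y v] pr_gr_eq[of y y v] by presburger

lemma j_gr: "j c \<in> gr \<one>" by (simp add: gr_def A_j j_comm act_one)

text \<open>The trace is a scalar and so of degree 1, while the translates of \<open>w\<close> have
  degrees conjugate to \<open>z\<close>, none of which is 1.\<close>

lemma tr_gr: assumes z: "z \<in> carrier G" "z \<noteq> \<one>" and w: "w \<in> gr z" shows "tr w = 0"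
proof -
  obtain c where "tr w = j c" using tr_j gr_A[OF w] by blast
  hence "pr \<one> (tr w) = tr w" using pr_gr_eq[of \<one> \<one> "tr w"] j_gr by simp
  moreover have "pr \<one> (act g w) = 0" if "g \<in> carrier G" for g
  proof -
    have "\<one> \<noteq> g \<otimes> z \<otimes> inv g"
    proof
      assume "\<one> = g \<otimes> z \<otimes> inv g"
      hence "g \<otimes> z = g" using that z by (metis inv_solve_right l_one m_closed one_closed)
      thus False using that z by (metis l_cancel_one)
    qed
    thus ?thesis using pr_gr_eq[of "g \<otimes> z \<otimes> inv g" \<one> "act g w"] gr_act that z w by auto
  qed
  ultimately show ?thesis by (simp add: tr_def pr_sum_distrib)
qed

text \<open>By \<open>tr_gr\<close> the trace form pairs degree \<open>y\<close> with degree
  \<open>inv y\<close> only, so its nondegeneracy descends to the components.\<close>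

lemma gr_dual: assumes y: "y \<in> carrier G" and v: "v \<in> gr y" "v \<noteq> 0"
  shows "\<exists>w\<in>gr (inv y). tr (w * v) \<noteq> 0"
proof -
  obtain b where b: "b \<in> A" "tr (b * v) \<noteq> 0" using trace_nondegenerate[OF gr_A[OF v(1)] v(2)] by blast
  have "b * v = (\<Sum>x\<in>carrier G. pr x b * v)" using pr_sum[OF b(1)] by (simp add: sum_distrib_right[symmetric])
  hence "tr (b * v) = (\<Sum>x\<in>carrier G. tr (pr x b * v))" by (simp only: tr_sum)
  hence "(\<Sum>x\<in>carrier G. tr (pr x b * v)) \<noteq> 0" using b(2) by simp
  then obtain x where x: "x \<in> carrier G" "tr (pr x b * v) \<noteq> 0" by (rule sum.not_neutral_contains_not_neutral)
  have "x \<otimes> y = \<one>" using tr_gr[OF m_closed[OF x(1) y] _ gr_mult[OF x(1) y pr_gr[OF x(1) b(1)] v(1)]] x(2) by blast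
  hence "x = inv y" using x y by (simp add: inv_equality)
  thus ?thesis using x pr_gr[OF x(1) b(1)] by blast
qed

section \<open>The center: nilpotents and idempotents\<close>

abbreviation Z where "Z \<equiv> gr \<one>"

lemma Z_iff: "z \<in> Z \<longleftrightarrow> z \<in> A \<and> (\<forall>a\<in>A. z * a = a * z)"
  by (auto simp: gr_def act_one)

lemma Z_comm: "z \<in> Z \<Longrightarrow> a \<in> A \<Longrightarrow> z * a = a * z" by (simp add: Z_iff)

lemma Z_mult: "z \<in> Z \<Longrightarrow> w \<in> Z \<Longrightarrow> z * w \<in> Z" using gr_mult[of \<one> \<one>] by simp

lemma Z_act: "g \<in> carrier G \<Longrightarrow> z \<in> Z \<Longrightarrow> act g z \<in> Z" using gr_act[of g \<one>] by simp

lemma u_Z: "u \<in> Z" using j_gr[of 1] j_1 by simp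

text \<open>Multiplying \<open>f\<close> by those \<open>z i\<close> that do not annihilate it kills the summands one by one; the same device
  evaluates sums of idempotents below.\<close>

lemma central_sum_square_zero:
  assumes "finite I" "\<And>i. i \<in> I \<Longrightarrow> z i \<in> Z \<and> z i * z i = 0" "f \<in> Z" "f \<noteq> 0" "f * sum z I = j c * f"
  shows "c = 0"
  using assms
proof (induction I arbitrary: f rule: finite_induct)
  case empty
  thus ?case using j_mult_eq_0[of c f] gr_A by fastforce
next
  case (insert i I)
  have zi: "z i \<in> Z" "z i * z i = 0" using insert.prems by auto
  have eq: "f * z i + f * sum z I = j c * f" using insert.prems(4) insert.hyps by (simp add: distrib_left)
  have S: "sum z I \<in> Z" using insert.prems(1) by (intro gr_sum) auto
  show ?case
  proof (cases "f * z i = 0")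
    case True
    thus ?thesis using insert.IH[of f] insert.prems eq by simp
  next
    case False
    have "(f * z i) * sum z I = (f * z i + f * sum z I) * z i"
      using zi Z_comm[OF S gr_A[OF zi(1)]] by (simp add: distrib_right mult.assoc)
    hence "(f * z i) * sum z I = j c * (f * z i)" unfolding eq by (simp add: mult.assoc)
    thus ?thesis using insert.IH[of "f * z i"] insert.prems False zi Z_mult by simp
  qed
qed

text \<open>If \<open>z\<close> were nonzero, some central \<open>w\<close> would make the trace of
  w z a nonzero scalar; but that scalar is a sum of central elements of square zero.\<close>

lemma Z_reduced: assumes z: "z \<in> Z" "z * z = 0" shows "z = 0"
proof (rule ccontr)
  assume "z \<noteq> 0"
  then obtain w where w: "w \<in> Z" "tr (w * z) \<noteq> 0" using gr_dual[of \<one> z] z(1) by auto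
  have wz: "w * z \<in> Z" using w z Z_mult by simp
  obtain c where c: "tr (w * z) = j c" using tr_j gr_A[OF wz] by blast
  have "w * z * (w * z) = 0" using z Z_comm[OF z(1) gr_A[OF w(1)]] by (metis mult.assoc mult_zero_right)
  hence "act g (w * z) * act g (w * z) = 0" if "g \<in> carrier G" for g
    using act_mult[OF that gr_A[OF wz] gr_A[OF wz]] by simp
  hence "c = 0" using c
    by (intro central_sum_square_zero[OF fin_G, of "\<lambda>g. act g (w * z)" u c])
       (auto simp: Z_act wz u_Z u0 tr_def[symmetric] u_l u_r A_j)
  thus False using c w(2) by simp
qed

lemma idempotent_sum:
  assumes "finite I" "\<And>i. i \<in> I \<Longrightarrow> z i \<in> Z \<and> z i * z i = z i" "f \<in> Z" "f \<noteq> 0" "f * sum z I = j c * f"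
  shows "\<exists>m. c = of_nat m"
  using assms
proof (induction I arbitrary: f c rule: finite_induct)
  case empty
  hence "c = 0" using j_mult_eq_0[of c f] gr_A by fastforce
  thus ?case by (intro exI[of _ 0]) simp
next
  case (insert i I)
  have zi: "z i \<in> Z" "z i * z i = z i" using insert.prems by auto
  have eq: "f * z i + f * sum z I = j c * f" using insert.prems(4) insert.hyps by (simp add: distrib_left)
  have S: "sum z I \<in> Z" using insert.prems(1) by (intro gr_sum) auto
  show ?case
  proof (cases "f * z i = 0")
    case True
    thus ?thesis using insert.IH[of f c] insert.prems eq by simp
  next
    case False
    have fA: "f * z i \<in> A" using insert.prems zi Z_mult gr_A by blast
    have "f * z i + (f * z i) * sum z I = (f * z i + f * sum z I) * z i"
      using zi Z_comm[OF S gr_A[OF zi(1)]] by (simp add: distrib_right mult.assoc)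
    \<comment> \<open>On the multiple \<open>f * z i\<close> the idempotent \<open>z i\<close> acts
      as 1, so the scalar drops by one.\<close>
    hence "(f * z i) * sum z I = j (c - 1) * (f * z i)" unfolding eq
      using fA by (simp add: mult.assoc j_diff j_1 left_diff_distrib u_l eq_diff_eq add.commute)
    then obtain m where "c - 1 = of_nat m"
      using insert.IH[of "f * z i" "c - 1"] insert.prems False zi Z_mult by auto
    hence "c = of_nat (Suc m)" by (simp add: algebra_simps)
    thus ?thesis by blast
  qed
qed

text \<open>The summand for g = 1 is taken out first: multiplied by \<open>f\<close> it contributes
  exactly 1 to the integer supplied by \<open>idempotent_sum\<close>, which is why the trace is
  positive.\<close>

lemma idempotent_trace: assumes f: "f \<in> Z" "f * f = f" "f \<noteq> 0"
  shows "\<exists>m>0. tr f = j (of_nat m)"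
proof -
  have fA: "f \<in> A" using gr_A[OF f(1)] .
  obtain c where c: "tr f = j c" using tr_j[OF fA] .
  have "tr f = f + (\<Sum>g\<in>carrier G - {\<one>}. act g f)"
    unfolding tr_def by (subst sum.remove[OF fin_G one_closed]) (simp add: act_one fA)
  hence "f * f + f * (\<Sum>g\<in>carrier G - {\<one>}. act g f) = j c * f"
    using c j_comm[OF fA, of c] by (simp add: distrib_left[symmetric])
  hence eq: "f * (\<Sum>g\<in>carrier G - {\<one>}. act g f) = j (c - 1) * f"
    using f fA by (simp add: j_diff j_1 left_diff_distrib u_l eq_diff_eq add.commute)
  obtain m where "c - 1 = of_nat m"
    using idempotent_sum[OF _ _ f(1,3) eq] fin_G f fA Z_act by (auto simp: act_mult[symmetric])
  hence "c = of_nat (Suc m)" by (simp add: algebra_simps)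
  thus ?thesis using c by blast
qed

text \<open>The traces of the orthogonal idempotents \<open>f\<close> and \<open>e - f\<close> are
  positive integers adding up to that of \<open>e\<close>, so an \<open>e\<close> of least trace
  does not split.\<close>

lemma primitive_idempotent_exists:
  obtains e where "e \<in> Z" "e * e = e" "e \<noteq> 0" "\<And>f. f \<in> Z \<Longrightarrow> f * f = f \<Longrightarrow> f * e = f \<Longrightarrow> f = 0 \<or> f = e"
proof -
  define I where "I = {f \<in> Z. f * f = f \<and> f \<noteq> 0}"
  have "u \<in> I" using u_Z u0 u_l A_u unfolding I_def by simp
  define m where "m f = (SOME m. m > 0 \<and> tr f = j (of_nat m))" for f
  have m: "m f > 0" "tr f = j (of_nat (m f))" if "f \<in> I" for f
    using someI_ex[of "\<lambda>m. m > 0 \<and> tr f = j (of_nat m)"] idempotent_trace that unfolding m_def I_def by auto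
  obtain e where e: "e \<in> I" "\<And>f. f \<in> I \<Longrightarrow> m e \<le> m f"
    using ex_has_least_nat[of "\<lambda>f. f \<in> I" u m] \<open>u \<in> I\<close> by blast
  have eZ: "e \<in> Z" "e * e = e" "e \<noteq> 0" using e(1) unfolding I_def by auto
  have "f = 0 \<or> f = e" if f: "f \<in> Z" "f * f = f" "f * e = f" for f
  proof (rule ccontr)
    assume "\<not> ?thesis"
    hence ne: "f \<noteq> 0" "f \<noteq> e" by auto
    have ef: "e * f = f" using Z_comm[OF f(1) gr_A[OF eZ(1)]] f by simp
    have "e - f \<in> Z" using eZ(1) f(1) by (simp add: gr_def A_diff left_diff_distrib right_diff_distrib)
    moreover have "(e - f) * (e - f) = e - f" using ef f eZ by (simp add: algebra_simps)
    ultimately have d: "e - f \<in> I" using ne unfolding I_def by simp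
    have fI: "f \<in> I" using f ne unfolding I_def by simp
    have "tr e = tr f + tr (e - f)" using tr_add[of f "e - f"] by simp
    hence "of_nat (m e) = (of_nat (m f + m (e - f)) :: 'k)"
      using m(2)[OF e(1)] m(2)[OF fI] m(2)[OF d] j_inj by (simp add: j_add[symmetric])
    hence "m e = m f + m (e - f)" using formally_real_of_nat_eq[OF fr] by blast
    thus False using e(2)[OF fI] m(1)[OF d] by simp
  qed
  thus ?thesis using that eZ by blast
qed

end

section \<open>The center at a primitive idempotent\<close>

locale primitive_idempotent = ring_with_action G A u j act P Q n
  for G :: "'g monoid" (structure) and A :: "'r::ring set" and u and j :: "'k::field \<Rightarrow> 'r" and act and P Q n +
  fixes e :: 'r
  assumes e_Z: "e \<in> gr \<one>" and e_e: "e * e = e" and e0: "e \<noteq> 0"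
    and e_prim: "\<And>f. f \<in> gr \<one> \<Longrightarrow> f * f = f \<Longrightarrow> f * e = f \<Longrightarrow> f = 0 \<or> f = e"
begin

lemma e_A: "e \<in> A" using gr_A[OF e_Z] .

lemma e_comm: "a \<in> A \<Longrightarrow> e * a = a * e" using Z_comm[OF e_Z] .

lemma e_j: "e * j c = j c * e" using e_comm[OF A_j] .

lemma e_e_mult: "e * (e * x) = e * x" by (simp add: mult.assoc[symmetric] e_e)

lemma e_act_A: "g \<in> carrier G \<Longrightarrow> act g e \<in> A" using A_act e_A by blast

definition S where "S = {g \<in> carrier G. act g e = e}"

lemma S_G: "g \<in> S \<Longrightarrow> g \<in> carrier G" by (simp add: S_def)

lemma S_e: "g \<in> S \<Longrightarrow> act g e = e" by (simp add: S_def)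

lemma S_subgroup: "subgroup S G"
proof (rule subgroupI)
  show "S \<subseteq> carrier G" by (auto simp: S_def)
  show "S \<noteq> {}" using act_one[OF e_A] by (auto simp: S_def)
  fix a assume a: "a \<in> S"
  show "inv a \<in> S" using act_inv_act[OF S_G[OF a] e_A] S_e[OF a] S_G[OF a] by (simp add: S_def)
  fix b assume b: "b \<in> S"
  show "a \<otimes> b \<in> S" using act_act[OF S_G[OF a] S_G[OF b] e_A] S_e[OF a] S_e[OF b] S_G[OF a] S_G[OF b]
    by (simp add: S_def)
qed

lemma S_one: "\<one> \<in> S" using subgroup.one_closed[OF S_subgroup] .

lemma S_mult: "a \<in> S \<Longrightarrow> b \<in> S \<Longrightarrow> a \<otimes> b \<in> S" using subgroup.m_closed[OF S_subgroup] .

lemma S_inv: "a \<in> S \<Longrightarrow> inv a \<in> S" using subgroup.m_inv_closed[OF S_subgroup] .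

lemma inj_lmult: assumes "s \<in> S" "T \<subseteq> S" shows "inj_on (\<lambda>t. s \<otimes> t) T"
proof (rule inj_onI)
  fix x y assume "x \<in> T" "y \<in> T" "s \<otimes> x = s \<otimes> y"
  thus "x = y" using assms S_G l_cancel[of s x y] by blast
qed

lemma fin_S: "finite S" using fin_G by (rule rev_finite_subset) (auto simp: S_def)

lemma card_S: "card S > 0" using S_one fin_S card_gt_0_iff by blast

text \<open>For h = g^-1 the idempotent h(e) e lies below \<open>e\<close> and is 0 or
  \<open>e\<close>. If it is 0, applying \<open>g\<close> gives the claim. If it is
  \<open>e\<close>, applying \<open>g\<close> shows that g(e) is a nonzero idempotent below
  \<open>e\<close>, so that \<open>g\<close> fixes \<open>e\<close>.\<close>

lemma e_orthogonal: assumes g: "g \<in> carrier G" "g \<notin> S" shows "e * act g e = 0"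
proof -
  define h where "h = inv g"
  have h: "h \<in> carrier G" using g by (simp add: h_def)
  have hA: "act h e \<in> A" using e_act_A[OF h] .
  have f: "act h e * e \<in> Z" using Z_mult Z_act[OF h e_Z] e_Z by blast
  have hh: "act h e * act h e = act h e" using act_mult[OF h e_A e_A] e_e by simp
  have "(act h e * e) * (act h e * e) = (act h e * act h e) * (e * e)"
    using e_comm[OF hA] by (metis mult.assoc)
  hence "act h e * e = 0 \<or> act h e * e = e"
    using e_prim[OF f] hh e_e by (simp add: mult.assoc)
  moreover have "act h e * e \<noteq> e"
  proof
    assume eq: "act h e * e = e"
    have "act g (act h e * e) = e * act g e"
      using act_mult[OF g(1) hA e_A] act_act_inv[OF g(1) e_A] by (simp add: h_def)
    hence ge: "act g e * e = act g e" using eq e_comm[OF e_act_A[OF g(1)]] by simp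
    have "act g e * act g e = act g e" using act_mult[OF g(1) e_A e_A] e_e by simp
    hence "act g e = 0 \<or> act g e = e" using e_prim[OF Z_act[OF g(1) e_Z]] ge by blast
    moreover have "act g e \<noteq> 0" using act_inv_act[OF g(1) e_A] e0 by auto
    ultimately show False using g by (simp add: S_def)
  qed
  ultimately have "act h e * e = 0" by blast
  hence "act g (act h e * e) = 0" by simp
  thus ?thesis using act_mult[OF g(1) hA e_A] act_act_inv[OF g(1) e_A] by (simp add: h_def)
qed

text \<open>By hypothesis all translates of \<open>e\<close> annihilate \<open>a\<close>; so does
  their sum, the nonzero scalar tr(e). This reduces identities in \<open>A\<close> to identities
  between the components e g(a).\<close>

lemma faithful: assumes a: "a \<in> A" "\<forall>g\<in>carrier G. e * act g a = 0" shows "a = 0"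
proof -
  obtain m where m: "m > 0" "tr e = j (of_nat m)" using idempotent_trace[OF e_Z e_e e0] by blast
  have "act (inv g) e * a = 0" if g: "g \<in> carrier G" for g
  proof -
    have "act (inv g) (e * act g a) = 0" using a(2) g by simp
    thus ?thesis using act_mult[of "inv g" e "act g a"] act_inv_act[OF g a(1)] g e_A A_act[OF g a(1)] by simp
  qed
  hence "(\<Sum>g\<in>carrier G. act (inv g) e) * a = 0" by (simp add: sum_distrib_right)
  hence "tr e * a = 0" unfolding tr_def using sum.reindex_bij_betw[OF bij_inv, of "\<lambda>g. act g e"] by simp
  thus ?thesis using m(2) j_mult_eq_0[OF of_nat_neq_0[OF m(1)] a(1)] by simp
qed

section \<open>The corner ring \<open>B\<close> and its center \<open>K\<close>\<close>

definition B where "B = {b \<in> A. e * b = b}"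
definition K where "K = {z \<in> gr \<one>. e * z = z}"

lemma B_A: "b \<in> B \<Longrightarrow> b \<in> A" and B_e: "b \<in> B \<Longrightarrow> e * b = b" by (simp_all add: B_def)
lemma B_e': "b \<in> B \<Longrightarrow> b * e = b" using B_A B_e e_comm by metis
lemma K_Z: "z \<in> K \<Longrightarrow> z \<in> gr \<one>" and K_e: "z \<in> K \<Longrightarrow> e * z = z" by (simp_all add: K_def)
lemma K_A: "z \<in> K \<Longrightarrow> z \<in> A" using K_Z gr_A by blast
lemma K_B: "z \<in> K \<Longrightarrow> z \<in> B" using K_A K_e by (simp add: B_def)
lemma K_e': "z \<in> K \<Longrightarrow> z * e = z" using K_B B_e' by blast
lemma K_comm: "z \<in> K \<Longrightarrow> a \<in> A \<Longrightarrow> z * a = a * z" using K_Z Z_comm by blast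
lemma e_K: "e \<in> K" using e_Z e_e by (simp add: K_def)
lemma K_0 [simp]: "0 \<in> K" by (simp add: K_def)
lemma B_0 [simp]: "0 \<in> B" by (simp add: B_def)
lemma B_add: "b \<in> B \<Longrightarrow> c \<in> B \<Longrightarrow> b + c \<in> B" by (simp add: B_def A_add distrib_left)
lemma B_mult': "b \<in> B \<Longrightarrow> c \<in> A \<Longrightarrow> c * b \<in> B"
  using e_comm[of c] by (simp add: B_def A_mult mult.assoc[symmetric]) (simp add: mult.assoc)
lemma K_add: "z \<in> K \<Longrightarrow> w \<in> K \<Longrightarrow> z + w \<in> K" by (simp add: K_def gr_add distrib_left)
lemma K_mult: "z \<in> K \<Longrightarrow> w \<in> K \<Longrightarrow> z * w \<in> K" by (simp add: K_def Z_mult mult.assoc[symmetric])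
lemma j_K: "j c * e \<in> K" using Z_mult[OF j_gr e_Z] e_j e_e by (simp add: K_def mult.assoc[symmetric]) (simp add: mult.assoc)
lemma j_mult_K: "z \<in> K \<Longrightarrow> j c * z \<in> K" using K_mult[OF j_K[of c]] by (simp add: mult.assoc K_e)
lemma K_minus: "z \<in> K \<Longrightarrow> - z \<in> K" using j_mult_K[of z "- 1"] u_l K_A by (simp add: j_minus j_1)
lemma K_diff: "z \<in> K \<Longrightarrow> w \<in> K \<Longrightarrow> z - w \<in> K" using K_add[OF _ K_minus, of z w] by simp
lemma K_sum: "(\<And>i. i \<in> I \<Longrightarrow> f i \<in> K) \<Longrightarrow> sum f I \<in> K"
  by (induction I rule: infinite_finite_induct) (auto intro: K_add)
lemma B_sum: "(\<And>i. i \<in> I \<Longrightarrow> f i \<in> B) \<Longrightarrow> sum f I \<in> B"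
  by (induction I rule: infinite_finite_induct) (auto intro: B_add)

lemma e_B: "a \<in> A \<Longrightarrow> e * a \<in> B" using e_A A_mult by (simp add: B_def mult.assoc[symmetric] e_e)

lemma S_act_B: "s \<in> S \<Longrightarrow> b \<in> B \<Longrightarrow> act s b \<in> B"
  using act_mult[OF S_G e_A B_A, of s b] S_e[of s] B_e[of b] A_act[OF S_G B_A, of s b] by (simp add: B_def)

lemma S_act_K: "s \<in> S \<Longrightarrow> z \<in> K \<Longrightarrow> act s z \<in> K"
  using S_act_B[OF _ K_B, of s z] Z_act[OF S_G K_Z, of s z] by (simp add: B_def K_def)

lemma e_act: assumes g: "g \<in> carrier G" and b: "b \<in> B" shows "e * act g b = (if g \<in> S then act g b else 0)"
proof (cases "g \<in> S")
  case True
  thus ?thesis using B_e[OF S_act_B[OF True b]] by simp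
next
  case False
  have "act g b = act g e * act g b" using act_mult[OF g e_A B_A[OF b]] B_e[OF b] by simp
  hence "e * act g b = e * act g e * act g b" by (simp add: mult.assoc)
  thus ?thesis using e_orthogonal[OF g False] False by simp
qed

lemma e_tr: assumes b: "b \<in> B" shows "e * tr b = (\<Sum>s\<in>S. act s b)"
proof -
  have "e * tr b = (\<Sum>g\<in>carrier G. if g \<in> S then act g b else 0)"
    unfolding tr_def sum_distrib_left by (intro sum.cong refl e_act b)
  also have "\<dots> = (\<Sum>g\<in>carrier G \<inter> S. act g b)" by (rule sum.inter_restrict[OF fin_G, symmetric])
  also have "carrier G \<inter> S = S" using S_G by auto
  finally show ?thesis .
qed

text \<open>Only the translates by \<open>S\<close> survive in e tr(b), so |S| b is a scalar
  multiple of \<open>e\<close>. In particular the fixed field of \<open>S\<close> on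
  \<open>K\<close> is \<open>k\<close>.\<close>

lemma B_fixed: assumes b: "b \<in> B" "\<forall>s\<in>S. act s b = b" shows "\<exists>c. b = j c * e"
proof -
  obtain c where c: "tr b = j c" using tr_j[OF B_A[OF b(1)]] .
  have "j (of_nat (card S)) * b = (\<Sum>s\<in>S. act s b)"
    using sum_const_j[OF B_A[OF b(1)] fin_S] b(2) by simp
  also have "\<dots> = j c * e" using e_tr[OF b(1)] c e_j by simp
  finally have "j (1 / of_nat (card S)) * (j (of_nat (card S)) * b) = j (1 / of_nat (card S)) * (j c * e)" by simp
  hence "b = j (1 / of_nat (card S) * c) * e"
    unfolding j_cancel[OF of_nat_neq_0[OF card_S] B_A[OF b(1)]] by (simp only: j_mult mult.assoc)
  thus ?thesis by blast
qed

lemma K_square_zero: "z \<in> K \<Longrightarrow> z * z = 0 \<Longrightarrow> z = 0"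
  using Z_reduced K_Z by blast

text \<open>The ambient ring is not commutative, so finite products over \<open>K\<close> are taken
  in this monoid with unit \<open>e\<close>.\<close>

definition KM :: "'r monoid" where "KM = \<lparr>carrier = K, monoid.mult = (*), monoid.one = e\<rparr>"

lemma KM_simps [simp]: "carrier KM = K" "x \<otimes>\<^bsub>KM\<^esub> y = x * y" "\<one>\<^bsub>KM\<^esub> = e"
  by (simp_all add: KM_def)

lemma KM_comm_monoid: "Group.comm_monoid KM"
  by (rule Group.comm_monoidI) (auto simp: K_mult e_K K_e K_e' mult.assoc K_comm K_A)

lemma act_finprod:
  assumes s: "s \<in> S" and T: "finite T" "f \<in> T \<rightarrow> K"
  shows "act s (finprod KM f T) = finprod KM (\<lambda>t. act s (f t)) T"
  using T
proof (induction T rule: finite_induct)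
  interpret M: Group.comm_monoid KM by (rule KM_comm_monoid)
  case empty
  show ?case using S_e[OF s] by simp
next
  interpret M: Group.comm_monoid KM by (rule KM_comm_monoid)
  case (insert x T)
  have f: "f x \<in> K" "f \<in> T \<rightarrow> K" using insert.prems by auto
  have p: "finprod KM f T \<in> K" using M.finprod_closed[of f T] f by simp
  have "act s (finprod KM f (insert x T)) = act s (f x * finprod KM f T)"
    using M.finprod_insert[of T x f] insert.hyps f by simp
  also have "\<dots> = act s (f x) * finprod KM (\<lambda>t. act s (f t)) T"
    using act_mult[OF S_G[OF s] K_A[OF f(1)] K_A[OF p]] insert.IH[OF f(2)] by simp
  also have "\<dots> = finprod KM (\<lambda>t. act s (f t)) (insert x T)"
    using M.finprod_insert[of T x "\<lambda>t. act s (f t)"] insert.hyps f S_act_K[OF s] by (auto simp: Pi_iff)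
  finally show ?case .
qed

text \<open>For a maximal \<open>T \<subseteq> S\<close> with \<open>w = \<Prod>t\<in>T. t(z) \<noteq> 0\<close>, every \<open>s(w)\<close> equals \<open>w\<close> or is orthogonal to \<open>w\<close>.
  Comparing with the \<open>S\<close>-invariant sum of the \<open>s(w)\<close> shows that a scalar multiple of \<open>w\<close> is an idempotent, hence \<open>e\<close>.\<close>

lemma K_inverse: assumes z: "z \<in> K" "z \<noteq> 0" shows "\<exists>w\<in>K. z * w = e"
proof -
  interpret M: Group.comm_monoid KM by (rule KM_comm_monoid)
  define y where "y T = finprod KM (\<lambda>s. act s z) T" for T
  have zK: "(\<lambda>s. act s z) \<in> T \<rightarrow> K" if "T \<subseteq> S" for T using S_act_K z(1) that by auto
  have yK: "y T \<in> K" if "T \<subseteq> S" for T using M.finprod_closed[OF zK[OF that, folded KM_simps(1)]] unfolding y_def by simp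
  have y_insert: "y (insert x T) = act x z * y T" if "insert x T \<subseteq> S" "x \<notin> T" for x T
    unfolding y_def using M.finprod_insert[of T x "\<lambda>s. act s z"] that zK[of T] S_act_K z(1) finite_subset[OF _ fin_S, of T] by auto
  have y_act: "act s (y T) = y ((\<lambda>t. s \<otimes> t) ` T)" if s: "s \<in> S" and T: "T \<subseteq> S" for s T
  proof -
    have inj: "inj_on (\<lambda>t. s \<otimes> t) T" using inj_lmult[OF s T] .
    have "act s (y T) = finprod KM (\<lambda>t. act s (act t z)) T"
      unfolding y_def by (rule act_finprod[OF s finite_subset[OF T fin_S] zK[OF T]])
    also have "\<dots> = finprod KM (\<lambda>t. act (s \<otimes> t) z) T"
      by (rule M.finprod_cong') (use T S_mult[OF s] S_act_K z(1) act_act S_G s K_A in \<open>auto simp: Pi_iff subset_iff\<close>)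
    also have "\<dots> = y ((\<lambda>t. s \<otimes> t) ` T)" unfolding y_def
      by (rule M.finprod_reindex[symmetric, OF _ inj]) (use T S_mult[OF s] S_act_K z(1) in \<open>auto simp: Pi_iff subset_iff\<close>)
    finally show ?thesis .
  qed
  have y1: "y {\<one>} = z" using y_insert[of \<one> "{}"] S_one z by (simp add: y_def act_one K_A K_e')
  obtain T where T: "T \<subseteq> S" "T \<noteq> {}" "y T \<noteq> 0"
    and max: "\<And>U. U \<subseteq> S \<Longrightarrow> U \<noteq> {} \<Longrightarrow> y U \<noteq> 0 \<Longrightarrow> card U \<le> card T"
  proof -
    have b: "\<forall>U. (U \<subseteq> S \<and> U \<noteq> {} \<and> y U \<noteq> 0) \<longrightarrow> card U < Suc (card S)"
      using card_mono[OF fin_S] by (simp add: less_Suc_eq_le)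
    show thesis using ex_has_greatest_nat[OF _ b, of "{\<one>}"] S_one y1 z(2) that by auto
  qed
  have fT: "finite T" using T(1) fin_S finite_subset by blast
  define w where "w = y T"
  have w: "w \<in> K" "w \<noteq> 0" using yK[OF T(1)] T(3) by (auto simp: w_def)
  have ww: "w * w \<noteq> 0" using K_square_zero w by blast
  \<comment> \<open>Translations in \<open>D\<close> permute the factors of \<open>w\<close>. For
    \<open>s\<close> outside \<open>D\<close> the product s(w) has a factor x(z) with x not in
    \<open>T\<close>, and maximality gives x(z) w = 0.\<close>
  define D where "D = {s \<in> S. (\<lambda>t. s \<otimes> t) ` T = T}"
  have "w * act s w = (if s \<in> D then w * w else 0)" if s: "s \<in> S" for s
  proof (cases "(\<lambda>t. s \<otimes> t) ` T \<subseteq> T")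
    case True
    have "card ((\<lambda>t. s \<otimes> t) ` T) = card T"
      by (rule card_image[OF inj_lmult[OF s T(1)]])
    hence "(\<lambda>t. s \<otimes> t) ` T = T" using True fT by (simp add: card_subset_eq)
    thus ?thesis using y_act[OF s T(1)] s by (simp add: D_def w_def)
  next
    case False
    then obtain x where x: "x \<in> (\<lambda>t. s \<otimes> t) ` T" "x \<notin> T" by blast
    define V where "V = (\<lambda>t. s \<otimes> t) ` T - {x}"
    have iS: "(\<lambda>t. s \<otimes> t) ` T \<subseteq> S" using T(1) S_mult[OF s] by auto
    have VS: "V \<subseteq> S" "insert x V = (\<lambda>t. s \<otimes> t) ` T" "x \<in> S" using iS x(1) by (auto simp: V_def)
    have "y (insert x T) = 0" using max[of "insert x T"] VS(3) T(1) x(2) fT by (auto simp: card_insert_disjoint)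
    hence 0: "act x z * w = 0" using y_insert[of x T] VS(3) T(1) x(2) by (simp add: w_def)
    have xz: "act x z \<in> K" using S_act_K[OF VS(3) z(1)] .
    have "act s w = act x z * y V" using y_act[OF s T(1)] y_insert[of x V] VS(3) iS unfolding VS(2) w_def by (simp add: V_def)
    hence "w * act s w = act x z * w * y V" using K_comm[OF w(1) K_A[OF xz]] by (simp add: mult.assoc[symmetric])
    moreover have "s \<notin> D" using False by (auto simp: D_def)
    ultimately show ?thesis using 0 by simp
  qed
  hence "w * (\<Sum>s\<in>S. act s w) = (\<Sum>s\<in>S. if s \<in> D then w * w else 0)"
    by (simp add: sum_distrib_left)
  also have "\<dots> = (\<Sum>s\<in>S \<inter> D. w * w)" by (rule sum.inter_restrict[OF fin_S, symmetric])
  also have "\<dots> = j (of_nat (card (S \<inter> D))) * (w * w)"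
    using sum_const_j[of "w * w" "S \<inter> D"] fin_S A_mult K_A[OF w(1)] by simp
  finally have eq1: "w * (\<Sum>s\<in>S. act s w) = j (of_nat (card (S \<inter> D))) * (w * w)" .
  have m: "of_nat (card (S \<inter> D)) \<noteq> (0::'k)"
  proof (rule of_nat_neq_0)
    have "\<one> \<in> S \<inter> D" using S_one T(1) S_G by (force simp: D_def image_iff)
    thus "card (S \<inter> D) > 0" using fin_S card_gt_0_iff by blast
  qed
  obtain c where c: "tr w = j c" using tr_j[OF K_A[OF w(1)]] .
  have "w * (\<Sum>s\<in>S. act s w) = j c * w"
    using e_tr[OF K_B[OF w(1)]] c j_comm[OF K_A[OF w(1)], of c] K_e'[OF w(1)] by (metis mult.assoc)
  hence eq2: "j (of_nat (card (S \<inter> D))) * (w * w) = j c * w" using eq1 by simp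
  define m' where "m' = (of_nat (card (S \<inter> D)) :: 'k)"
  have wwA: "w * w \<in> A" using A_mult K_A w by blast
  have wwe: "w * w = j (c / m') * w"
  proof -
    have "w * w = j (1 / m') * (j c * w)"
      using j_cancel[OF m wwA] unfolding eq2 m'_def by simp
    also have "\<dots> = j (1 / m' * c) * w" by (simp only: j_mult mult.assoc)
    finally show ?thesis by simp
  qed
  have c0: "c / m' \<noteq> 0" using wwe ww by auto
  define f where "f = j (m' / c) * w"
  have jj: "j (m' / c) * (j (c / m') * w) = w" using j_cancel[OF c0 K_A[OF w(1)]] by simp
  have "f * f = j (m' / c) * (j (m' / c) * (w * w))"
    unfolding f_def using j_comm[OF K_A[OF w(1)], of "m' / c"] by (metis mult.assoc)
  hence ff: "f * f = f" using wwe jj by (simp add: f_def)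
  have fK: "f \<in> K" unfolding f_def using j_mult_K[OF w(1)] .
  have "f \<noteq> 0" using jj w(2) wwe ww ff unfolding f_def by (metis j_comm K_A w(1) mult.assoc mult_zero_left mult_zero_right A_j)
  hence fe: "f = e" using e_prim[OF K_Z[OF fK] ff K_e'[OF fK]] by blast
  \<comment> \<open>\<open>w\<close> contains the factor t(z), so t(z) divides \<open>e\<close>;
    applying t^-1 carries the inverse back to \<open>z\<close>.\<close>
  obtain t where t: "t \<in> T" using T(2) by blast
  have tS: "t \<in> S" using t T(1) by blast
  define r where "r = y (T - {t})"
  have r: "r \<in> K" unfolding r_def using yK T(1) by blast
  have "w = act t z * r" using y_insert[of t "T - {t}"] T(1) t by (simp add: w_def r_def insert_absorb)
  hence "e = j (m' / c) * (act t z * r)" using fe f_def by simp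
  also have "\<dots> = act t z * (j (m' / c) * r)"
    using j_comm[OF K_A[OF S_act_K[OF tS z(1)]], of "m' / c"] by (metis mult.assoc)
  finally have "act t z * (j (m' / c) * r) = e" by simp
  hence "act (inv t) (act t z * (j (m' / c) * r)) = e" using S_e[OF S_inv[OF tS]] by simp
  hence "z * act (inv t) (j (m' / c) * r) = e"
    using act_mult[OF S_G[OF S_inv[OF tS]] K_A[OF S_act_K[OF tS z(1)]] K_A[OF j_mult_K[OF r]]]
      act_inv_act[OF S_G[OF tS] K_A[OF z(1)]] by simp
  thus ?thesis using S_act_K[OF S_inv[OF tS] j_mult_K[OF r]] by blast
qed

lemma K_no_zero_div: assumes "z \<in> K" "z \<noteq> 0" "b \<in> B" "z * b = 0" shows "b = 0"
proof -
  obtain w where "w \<in> K" "z * w = e" using K_inverse assms by blast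
  hence "w * z = e" using K_comm[of z w] K_A assms(1) by simp
  hence "e * b = 0" using assms(4) by (metis mult.assoc mult_zero_right)
  thus ?thesis using B_e assms(3) by simp
qed

end

section \<open>Counting in finite groups\<close>

lemma nat_two_power_odd:
  fixes k :: nat
  assumes "k > 0" shows "\<exists>a m. k = 2 ^ a * m \<and> odd m"
  using assms
proof (induction k rule: less_induct)
  case (less k)
  show ?case
  proof (cases "even k")
    case True
    then obtain l where l: "k = 2 * l" by auto
    then obtain a m where "l = 2 ^ a * m" "odd m" using less.IH[of l] less.prems by auto
    thus ?thesis using l by (intro exI[of _ "Suc a"] exI[of _ m]) simp
  next
    case False
    thus ?thesis by (intro exI[of _ 0] exI[of _ k]) simp
  qed
qed

text \<open>\<open>L\<close> and its coset through \<open>inv x\<close> are disjoint and fill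
  \<open>H\<close> by counting, so \<open>y\<close> lies in that coset.\<close>

lemma (in Group.group) index_two:
  assumes H: "subgroup H G" "finite H" and L: "subgroup L G" "L \<subseteq> H" "card H = 2 * card L"
    and xy: "x \<in> H" "x \<notin> L" "y \<in> H" "y \<notin> L"
  shows "x \<otimes> y \<in> L"
proof -
  have HG: "H \<subseteq> carrier G" using subgroup.subset[OF H(1)] .
  define V where "V = (\<lambda>l. inv x \<otimes> l) ` L"
  have ixH: "inv x \<in> H" using subgroup.m_inv_closed[OF H(1) xy(1)] .
  have XH: "V \<subseteq> H" unfolding V_def using subgroup.m_closed[OF H(1) ixH] L(2) by auto
  have fL: "finite L" using finite_subset[OF L(2) H(2)] .
  have "inj_on (\<lambda>l. inv x \<otimes> l) L" using xy(1) HG L(2) l_cancel by (intro inj_onI) blast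
  hence "card V = card L" unfolding V_def by (rule card_image)
  moreover have dis: "V \<inter> L = {}"
  proof (rule ccontr)
    assume "V \<inter> L \<noteq> {}"
    then obtain l where l: "l \<in> L" "inv x \<otimes> l \<in> L" unfolding V_def by blast
    have "l \<otimes> inv (inv x \<otimes> l) \<in> L" using subgroup.m_closed[OF L(1) l(1) subgroup.m_inv_closed[OF L(1) l(2)]] .
    moreover have "l \<otimes> inv (inv x \<otimes> l) = x" using l(1) L(2) xy(1) HG
      by (simp add: subset_iff inv_mult_group m_assoc[symmetric])
    ultimately show False using xy(2) by simp
  qed
  ultimately have "card (V \<union> L) = card H" using card_Un_disjoint[of V L] fL finite_subset[OF XH H(2)] L(3) by simp
  hence "V \<union> L = H" using card_subset_eq[OF H(2), of "V \<union> L"] XH L(2) by blast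
  then obtain l where l: "l \<in> L" "y = inv x \<otimes> l" using xy(3,4) unfolding V_def by blast
  hence "x \<otimes> y = l" using xy(1) HG L(2) by (simp add: m_assoc[symmetric] subset_iff)
  thus ?thesis using l(1) by simp
qed

text \<open>Translation by \<open>x\<close> permutes \<open>I\<close> and multiplies the sum by
  \<open>c x\<close>, which is not 1.\<close>

lemma (in Group.group) character_sum:
  fixes c :: "'a \<Rightarrow> 'k::field"
  assumes I: "subgroup I G" "finite I" and c: "\<And>x y. x \<in> I \<Longrightarrow> y \<in> I \<Longrightarrow> c (x \<otimes> y) = c x * c y"
    and x: "x \<in> I" "c x \<noteq> 1"
  shows "(\<Sum>y\<in>I. c y) = 0"
proof -
  have IG: "y \<in> carrier G" if "y \<in> I" for y using subgroup.mem_carrier[OF I(1) that] .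
  have "bij_betw (\<lambda>y. x \<otimes> y) I I"
  proof (rule bij_betw_byWitness[where f' = "\<lambda>y. inv x \<otimes> y"])
    show "\<forall>y\<in>I. inv x \<otimes> (x \<otimes> y) = y" "\<forall>y\<in>I. x \<otimes> (inv x \<otimes> y) = y"
      using IG x(1) by (auto simp: m_assoc[symmetric])
  qed (use subgroup.m_closed[OF I(1)] subgroup.m_inv_closed[OF I(1)] x(1) in auto)
  hence "(\<Sum>y\<in>I. c y) = (\<Sum>y\<in>I. c (x \<otimes> y))" by (rule sum.reindex_bij_betw[symmetric])
  also have "\<dots> = c x * (\<Sum>y\<in>I. c y)" unfolding sum_distrib_left by (intro sum.cong refl c x(1))
  finally have "(c x - 1) * (\<Sum>y\<in>I. c y) = 0" by (simp add: left_diff_distrib)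
  thus ?thesis using x(2) by simp
qed

lemma card_fibres:
  assumes "finite V" "\<And>x. x \<in> V \<Longrightarrow> card {y \<in> V. f y = f x} = c"
  shows "card V = card (f ` V) * c"
proof -
  have "card V = (\<Sum>y\<in>f ` V. card {x \<in> V. f x = y})"
    using sum.image_gen[OF assms(1), of "\<lambda>_. 1::nat" f] by simp
  also have "\<dots> = (\<Sum>y\<in>f ` V. c)" by (intro sum.cong refl) (use assms(2) in auto)
  finally show ?thesis by simp
qed

context ring_with_action begin

lemma j_sum: "j (sum f I) = (\<Sum>i\<in>I. j (f i))"
  by (induction I rule: infinite_finite_induct) (auto simp: j_add)

text \<open>Orbit and stabilizer: the fibre over s(x) is the left coset of \<open>H0\<close> through
  \<open>s\<close>.\<close>

lemma card_action_fibres: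
  assumes H: "subgroup H G" and x: "x \<in> A" and "H0 = {h \<in> H. act h x = x}"
  shows "card H = card ((\<lambda>h. act h x) ` H) * card H0"
proof (rule card_fibres)
  have HG: "H \<subseteq> carrier G" using subgroup.subset[OF H] .
  show "finite H" using finite_subset[OF HG fin_G] .
  fix s assume s: "s \<in> H"
  have sG: "s \<in> carrier G" using s HG by blast
  have "bij_betw (\<lambda>t. s \<otimes> t) H0 {t \<in> H. act t x = act s x}"
  proof (rule bij_betw_byWitness[where f' = "\<lambda>t. inv s \<otimes> t"])
    show "\<forall>t\<in>H0. inv s \<otimes> (s \<otimes> t) = t"
      using sG HG unfolding assms(3) by (auto simp: m_assoc[symmetric] subset_iff)
    show "\<forall>t\<in>{t \<in> H. act t x = act s x}. s \<otimes> (inv s \<otimes> t) = t"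
      using sG HG by (auto simp: m_assoc[symmetric] subset_iff)
    show "(\<lambda>t. s \<otimes> t) ` H0 \<subseteq> {t \<in> H. act t x = act s x}"
    proof clarify
      fix t assume t: "t \<in> H0"
      hence "t \<in> H" "act t x = x" unfolding assms(3) by auto
      thus "s \<otimes> t \<in> H \<and> act (s \<otimes> t) x = act s x"
        using subgroup.m_closed[OF H s] act_act[OF sG _ x, of t] HG by auto
    qed
    show "(\<lambda>t. inv s \<otimes> t) ` {t \<in> H. act t x = act s x} \<subseteq> H0"
    proof clarify
      fix t assume t: "t \<in> H" "act t x = act s x"
      have "act (inv s \<otimes> t) x = act (inv s) (act s x)"
        using act_act[of "inv s" t x] x t sG HG by auto
      thus "inv s \<otimes> t \<in> H0" unfolding assms(3)
        using act_inv_act[OF sG x] subgroup.m_closed[OF H subgroup.m_inv_closed[OF H s] t(1)] by simp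
    qed
  qed
  thus "card {t \<in> H. act t x = act s x} = card H0" using bij_betw_same_card by fastforce
qed

end

section \<open>The field \<open>K\<close> is \<open>k\<close> or \<open>k(i)\<close>\<close>

context primitive_idempotent begin

text \<open>\<open>K\<close> is not a type, so a polynomial over it is given by the sequence
  \<open>E\<close> of its coefficients and by its values at the scalars. That \<open>E\<close> does
  not depend on \<open>c\<close> lets the traces of the coefficients form a polynomial over
  \<open>k\<close>.\<close>

lemma linear_factors_expand:
  assumes "finite I" "I \<subseteq> K"
  shows "\<exists>E. (\<forall>i. E i \<in> K) \<and> (\<forall>i>card I. E i = 0) \<and> E (card I) = e \<and>
    (\<forall>c. finprod KM (\<lambda>w. j c * e - w) I = (\<Sum>i\<le>card I. j (c ^ i) * E i))"
  using assms
proof (induction I rule: finite_induct)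
  interpret M: Group.comm_monoid KM by (rule KM_comm_monoid)
  case empty
  show ?case by (rule exI[of _ "\<lambda>i. if i = 0 then e else 0"]) (simp add: e_K j_1 u_l e_A)
next
  interpret M: Group.comm_monoid KM by (rule KM_comm_monoid)
  case (insert w I)
  then obtain E where E: "\<And>i. E i \<in> K" "\<And>i. i > card I \<Longrightarrow> E i = 0" "E (card I) = e"
    "\<And>c. finprod KM (\<lambda>w. j c * e - w) I = (\<Sum>i\<le>card I. j (c ^ i) * E i)" by auto
  \<comment> \<open>Coefficients after multiplication by the factor c - w: a shift minus
    \<open>w\<close> times the old ones.\<close>
  define E' where "E' i = (case i of 0 \<Rightarrow> 0 | Suc k \<Rightarrow> E k) - w * E i" for i
  have wK: "w \<in> K" using insert.prems by simp
  have cd: "card (insert w I) = Suc (card I)" using insert.hyps by simp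
  have "finprod KM (\<lambda>w. j c * e - w) (insert w I) = (\<Sum>i\<le>Suc (card I). j (c ^ i) * E' i)" for c
  proof -
    have cl: "(\<lambda>w. j c * e - w) \<in> insert w I \<rightarrow> carrier KM"
      using insert.prems j_K K_diff by auto
    have "finprod KM (\<lambda>w. j c * e - w) (insert w I) = (j c * e - w) * (\<Sum>i\<le>card I. j (c ^ i) * E i)"
      using M.finprod_insert[of I w "\<lambda>w. j c * e - w"] insert.hyps cl E(4) by (simp add: Pi_iff)
    also have "\<dots> = (\<Sum>i\<le>card I. j c * e * (j (c ^ i) * E i)) - (\<Sum>i\<le>card I. w * (j (c ^ i) * E i))"
      by (simp add: left_diff_distrib sum_distrib_left sum_subtractf)
    also have "(\<Sum>i\<le>card I. j c * e * (j (c ^ i) * E i)) = (\<Sum>i\<le>card I. j (c ^ Suc i) * E i)"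
    proof (intro sum.cong refl)
      fix i
      have "j c * e * (j (c ^ i) * E i) = j c * (e * j (c ^ i)) * E i" by (simp only: mult.assoc)
      also have "\<dots> = j c * j (c ^ i) * (e * E i)" unfolding e_j by (simp only: mult.assoc)
      finally show "j c * e * (j (c ^ i) * E i) = j (c ^ Suc i) * E i"
        using K_e[OF E(1)] by (simp add: j_mult)
    qed
    also have "(\<Sum>i\<le>card I. w * (j (c ^ i) * E i)) = (\<Sum>i\<le>card I. j (c ^ i) * (w * E i))"
    proof (intro sum.cong refl)
      fix i
      show "w * (j (c ^ i) * E i) = j (c ^ i) * (w * E i)"
        using j_comm[OF K_A[OF wK], of "c ^ i"] by (metis mult.assoc)
    qed
    also have "\<dots> = (\<Sum>i\<le>Suc (card I). j (c ^ i) * (w * E i))" using E(2) by simp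
    also have "(\<Sum>i\<le>card I. j (c ^ Suc i) * E i)
        = (\<Sum>i\<le>Suc (card I). j (c ^ i) * (case i of 0 \<Rightarrow> 0 | Suc k \<Rightarrow> E k))"
      unfolding sum.atMost_Suc_shift[of _ "card I"] by simp
    finally show ?thesis by (simp add: E'_def right_diff_distrib sum_subtractf)
  qed
  moreover have "E' i \<in> K" for i unfolding E'_def using E(1) wK K_mult K_diff by (auto split: nat.split)
  moreover have "E' i = 0" if "i > Suc (card I)" for i using that E(2) by (auto simp: E'_def split: nat.split)
  moreover have "E' (Suc (card I)) = e" using E(2,3) by (simp add: E'_def)
  ultimately show ?case unfolding cd by blast
qed

lemma finprod_K_eq_0:
  assumes "finite I" "f \<in> I \<rightarrow> K" "finprod KM f I = 0" shows "\<exists>i\<in>I. f i = 0"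
  using assms
proof (induction I rule: finite_induct)
  interpret M: Group.comm_monoid KM by (rule KM_comm_monoid)
  case empty thus ?case using e0 by simp
next
  interpret M: Group.comm_monoid KM by (rule KM_comm_monoid)
  case (insert x I)
  have "f x * finprod KM f I = 0" using M.finprod_insert[of I x f] insert by (simp add: Pi_iff)
  moreover have "finprod KM f I \<in> B" using M.finprod_closed[of f I] insert.prems(1) K_B by auto
  ultimately have "f x = 0 \<or> finprod KM f I = 0" using K_no_zero_div insert.prems(1) by blast
  thus ?case using insert by auto
qed

lemma tr_j_mult: "a \<in> A \<Longrightarrow> tr (j c * a) = j c * tr a"
  by (simp add: tr_def act_j_mult sum_distrib_left)

text \<open>The orbit of \<open>z\<close> has odd size.  Averaging the coefficients of its polynomial over \<open>S\<close> gives a polynomial over \<open>k\<close>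
  with the same values on \<open>k\<close>, so the orbit meets \<open>k\<close>.\<close>

lemma odd_index_fixed:
  assumes H: "subgroup H G" "H \<subseteq> S" and odd: "card S = card H * m" "odd m"
    and z: "z \<in> K" "\<forall>h\<in>H. act h z = z"
  shows "\<exists>c. z = j c * e"
proof -
  interpret M: Group.comm_monoid KM by (rule KM_comm_monoid)
  define I where "I = (\<lambda>s. act s z) ` S"
  have I: "finite I" "I \<subseteq> K" using fin_S S_act_K z(1) by (auto simp: I_def)
  define H0 where "H0 = {s \<in> S. act s z = z}"
  have "card S = card I * card H0"
    unfolding I_def H0_def by (rule card_action_fibres[OF S_subgroup K_A[OF z(1)]]) simp
  \<comment> \<open>\<open>H\<close> lies in the stabilizer \<open>H0\<close> of \<open>z\<close>,
    so the size of the orbit divides the odd index of \<open>H\<close>.\<close>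
  moreover have "card H dvd card H0"
  proof -
    have "subgroup H0 G"
    proof (rule subgroupI)
      show "H0 \<subseteq> carrier G" "H0 \<noteq> {}" using S_G S_one act_one[OF K_A[OF z(1)]] by (auto simp: H0_def)
      fix a assume a: "a \<in> H0"
      have aS: "a \<in> S" using a by (simp add: H0_def)
      show "inv a \<in> H0" using a act_inv_act[OF S_G[OF aS] K_A[OF z(1)]] S_inv by (simp add: H0_def)
      fix b assume b: "b \<in> H0"
      show "a \<otimes> b \<in> H0" using a b act_act[of a b z] S_G K_A[OF z(1)] S_mult by (simp add: H0_def)
    qed
    moreover have "H \<subseteq> H0" using H(2) z(2) by (auto simp: H0_def)
    ultimately have "subgroup H (G\<lparr>carrier := H0\<rparr>)" "group (G\<lparr>carrier := H0\<rparr>)"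
      using subgroup_incl[OF H(1)] subgroup_imp_group by blast+
    hence "card (rcosets\<^bsub>G\<lparr>carrier := H0\<rparr>\<^esub> H) * card H = card H0"
      using group.lagrange[of "G\<lparr>carrier := H0\<rparr>" H] by (simp add: Coset.order_def)
    thus ?thesis by (metis dvd_triv_right)
  qed
  then obtain l where "card H0 = card H * l" by auto
  ultimately have "card H * m = card H * (card I * l)" using odd(1) by (simp add: mult_ac)
  moreover have "card H > 0" using odd(1) card_S by (cases "card H") auto
  ultimately have "m = card I * l" by simp
  hence oddI: "odd (card I)" using odd(2) by simp
  define F where "F c = finprod KM (\<lambda>w. j c * e - w) I" for c
  have cl: "(\<lambda>w. j c * e - w) \<in> I \<rightarrow> K" for c 
  proof
    fix w assume "w \<in> I"
    thus "j c * e - w \<in> K" using K_diff[OF j_K] I(2) by blast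
  qed
  have FK: "F c \<in> K" for c unfolding F_def using M.finprod_closed[of "\<lambda>w. j c * e - w" I] cl[of c] by simp
  have Fs: "act s (F c) = F c" if s: "s \<in> S" for s c
  proof -
    have bij: "bij_betw (act s) I I"
    proof (rule bij_betw_byWitness[where f' = "act (inv s)"])
      show "\<forall>w\<in>I. act (inv s) (act s w) = w" "\<forall>w\<in>I. act s (act (inv s) w) = w"
        using act_inv_act act_act_inv S_G[OF s] I(2) K_A by blast+
      have "act t ` I \<subseteq> I" if "t \<in> S" for t
      proof
        fix w assume "w \<in> act t ` I"
        then obtain r where r: "r \<in> S" "w = act t (act r z)" unfolding I_def by blast
        hence "w = act (t \<otimes> r) z" using act_act[OF S_G[OF that] S_G[OF r(1)] K_A[OF z(1)]] by simp
        thus "w \<in> I" unfolding I_def using S_mult[OF that r(1)] by blast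
      qed
      thus "act s ` I \<subseteq> I" "act (inv s) ` I \<subseteq> I" using s S_inv by blast+
    qed
    have "act s (F c) = finprod KM (\<lambda>w. act s (j c * e - w)) I"
      unfolding F_def by (rule act_finprod[OF s I(1) cl])
    also have "\<dots> = finprod KM (\<lambda>w. j c * e - act s w) I"
    proof (rule M.finprod_cong')
      show "(\<lambda>w. j c * e - act s w) \<in> I \<rightarrow> carrier KM" using I(2) j_K K_diff S_act_K[OF s] by auto
      fix w assume "w \<in> I"
      show "act s (j c * e - w) = j c * e - act s w" using act_j_mult[OF S_G[OF s] e_A] S_e[OF s] by (simp add: act_diff)
    qed simp
    also have "\<dots> = finprod KM (\<lambda>w. j c * e - w) (act s ` I)"
      using bij cl unfolding bij_betw_def by (intro M.finprod_reindex[symmetric]) auto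
    also have "\<dots> = F c" using bij unfolding bij_betw_def F_def by simp
    finally show ?thesis .
  qed
  obtain E where E: "\<And>i. E i \<in> K" "\<And>i. i > card I \<Longrightarrow> E i = 0" "E (card I) = e"
    "\<And>c. F c = (\<Sum>i\<le>card I. j (c ^ i) * E i)" using linear_factors_expand[OF I] unfolding F_def by blast
  have "\<forall>i. \<exists>t. tr (E i) = j t" 
  proof
    fix i
    obtain c where "tr (E i) = j c" using tr_j[OF K_A[OF E(1)]] .
    thus "\<exists>t. tr (E i) = j t" by blast
  qed
  then obtain t where t: "\<And>i. tr (E i) = j (t i)" by metis
  define p where "p = (\<Sum>i\<le>card I. monom (t i) i)"
  have cf: "coeff p i = (if i \<le> card I then t i else 0)" for i by (simp add: p_def coeff_sum)
  \<comment> \<open>The leading coefficient becomes the trace of \<open>e\<close>, a positive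
    integer, so the polynomial over \<open>k\<close> keeps the odd degree
    \<open>card I\<close>.\<close>
  have "t (card I) \<noteq> 0"

  proof -
    obtain m where m: "m > 0" "tr e = j (of_nat m)" using idempotent_trace[OF e_Z e_e e0] by blast
    hence "t (card I) = of_nat m" using t[of "card I"] E(3) j_inj by simp
    thus ?thesis using of_nat_neq_0[OF m(1)] by simp
  qed
  hence "coeff p (card I) \<noteq> 0" using cf by simp
  moreover have "degree p \<le> card I" by (rule degree_le) (simp add: cf)
  ultimately have "degree p = card I" using le_degree le_antisym by blast
  then obtain c where c: "poly p c = 0" using real_closed_odd_root[OF rc, of p] oddI by auto
  have "tr (F c) = (\<Sum>i\<le>card I. j (c ^ i) * tr (E i))"
    unfolding E(4) tr_sum by (intro sum.cong refl tr_j_mult K_A E(1))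
  also have "\<dots> = (\<Sum>i\<le>card I. j (t i * c ^ i))" by (simp add: t j_mult[symmetric] mult.commute)
  also have "\<dots> = j (\<Sum>i\<le>card I. t i * c ^ i)" by (simp add: j_sum)
  also have "(\<Sum>i\<le>card I. t i * c ^ i) = poly p c" by (simp add: p_def poly_sum poly_monom)
  finally have "tr (F c) = 0" unfolding c j_0 .
  \<comment> \<open>\<open>F c\<close> is invariant under \<open>S\<close>, so |S| times it is e
    tr(F c), which vanishes at the root \<open>c\<close>.\<close>
  moreover have "(\<Sum>s\<in>S. act s (F c)) = (\<Sum>s\<in>S. F c)" by (intro sum.cong refl Fs)
  ultimately have "j (of_nat (card S)) * F c = 0"
    using e_tr[OF K_B[OF FK], of c] unfolding sum_const_j[OF K_A[OF FK] fin_S] by simp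
  hence "F c = 0" using j_mult_eq_0[OF of_nat_neq_0[OF card_S] K_A[OF FK]] by blast
  then obtain s where s: "s \<in> S" "j c * e = act s z"
    
  proof -
    obtain w where "w \<in> I" "j c * e - w = 0" using finprod_K_eq_0[OF I(1) cl] \<open>F c = 0\<close> unfolding F_def by blast
    thus ?thesis using that unfolding I_def by auto
  qed
  have "z = act (inv s) (j c * e)" using act_inv_act[OF S_G[OF s(1)] K_A[OF z(1)]] s(2) by simp
  also have "\<dots> = j c * e" using act_j_mult[OF S_G[OF S_inv[OF s(1)]] e_A] S_e[OF S_inv[OF s(1)]] by simp
  finally show ?thesis by blast
qed

text \<open>Starting from a Sylow 2-subgroup, whose fixed field is \<open>k\<close>, one descends along subgroups of index two; each step
  adjoins square roots only.\<close>

lemma square_root_closed_subfield: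
  assumes C: "C \<subseteq> K" "\<And>x y. x \<in> C \<Longrightarrow> y \<in> C \<Longrightarrow> x + y \<in> C" "\<And>x y. x \<in> C \<Longrightarrow> y \<in> C \<Longrightarrow> x * y \<in> C"
    "\<And>c. j c * e \<in> C" "\<And>y. y \<in> K \<Longrightarrow> y * y \<in> C \<Longrightarrow> y \<in> C"
  shows "K \<subseteq> C"
proof -
  have jC: "j c * x \<in> C" if "x \<in> C" for c x
    using C(3)[OF C(4)[of c] that] K_e that C(1) by (auto simp: mult.assoc)
  have minus: "x - y \<in> C" if "x \<in> C" "y \<in> C" for x y
    using C(2)[OF that(1) jC[OF that(2), of "- 1"]] that C(1) K_A by (auto simp: j_minus j_1 u_l)
  obtain a m where am: "card S = 2 ^ a * m" "odd m" using nat_two_power_odd[OF card_S] by blast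
  have chain: "\<exists>H. subgroup H G \<and> H \<subseteq> S \<and> card H = 2 ^ (a - b) \<and> (\<forall>z\<in>K. (\<forall>h\<in>H. act h z = z) \<longrightarrow> z \<in> C)"
    if "b \<le> a" for b
    using that
  proof (induction b)
    case 0
    obtain H where H: "subgroup H (G\<lparr>carrier := S\<rparr>)" "card H = 2 ^ a"
      using sylow_thm[of 2 "G\<lparr>carrier := S\<rparr>" a m] subgroup_imp_group[OF S_subgroup] am fin_S
      by (auto simp: Coset.order_def)
    have "subgroup H G" using incl_subgroup[OF S_subgroup H(1)] .
    moreover have "H \<subseteq> S" using subgroup.subset[OF H(1)] by simp
    ultimately show ?case using odd_index_fixed[of H m] am H(2) C(4) by (intro exI[of _ H]) force
  next
    case (Suc b)
    then obtain H where H: "subgroup H G" "H \<subseteq> S" "card H = 2 ^ (a - b)"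
      "\<And>z. z \<in> K \<Longrightarrow> \<forall>h\<in>H. act h z = z \<Longrightarrow> z \<in> C" by auto
    have fH: "finite H" using finite_subset[OF H(2) fin_S] .
    have ab: "a - b = Suc (a - Suc b)" using Suc.prems by simp
    \<comment> \<open>Sylow's theorem in the form that allows an even cofactor supplies a subgroup
      of index two.\<close>
    obtain L where L: "subgroup L (G\<lparr>carrier := H\<rparr>)" "card L = 2 ^ (a - Suc b)"
      using sylow_thm[of 2 "G\<lparr>carrier := H\<rparr>" "a - Suc b" 2] subgroup_imp_group[OF H(1)] H(3) fH ab
      by (auto simp: Coset.order_def)
    have LG: "subgroup L G" using incl_subgroup[OF H(1) L(1)] .
    have LH: "L \<subseteq> H" using subgroup.subset[OF L(1)] by simp
    have cLH: "card H = 2 * card L" using L(2) H(3) ab by simp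
    have "z \<in> C" if z: "z \<in> K" "\<forall>h\<in>L. act h z = z" for z
    proof -
      have zA: "z \<in> A" using K_A[OF z(1)] .
      have "L \<noteq> H" using cLH L(2) by auto
      then obtain t where t: "t \<in> H" "t \<notin> L" using LH by blast
      have tS: "t \<in> S" using t H(2) by blast
      \<comment> \<open>The image of \<open>z\<close> under the nontrivial coset of
        \<open>L\<close>. Elements of \<open>H\<close> fix or exchange \<open>z\<close> and
        \<open>z'\<close>, so sum and product are fixed by \<open>H\<close> and lie in
        \<open>C\<close>; so does the discriminant, and its root z - z' follows.\<close>
      define z' where "z' = act t z"
      have z'K: "z' \<in> K" unfolding z'_def using S_act_K[OF tS z(1)] .
      have mem: "act h z = z \<and> act h z' = z' \<or> act h z = z' \<and> act h z' = z" if h: "h \<in> H" for h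
      proof -
        have hS: "h \<in> S" using h H(2) by blast
        have hz': "act h z' = act (h \<otimes> t) z" unfolding z'_def using act_act[OF S_G[OF hS] S_G[OF tS] zA] by simp
        have off: "act x z = z'" if x: "x \<in> H" "x \<notin> L" for x
        proof -
          have xS: "x \<in> S" using x H(2) by blast
          have it: "inv t \<in> H" "inv t \<notin> L"
            using subgroup.m_inv_closed[OF H(1) t(1)] subgroup.m_inv_closed[OF LG, of "inv t"] t inv_inv[OF S_G[OF tS]] by auto
          have "inv t \<otimes> x \<in> L" using index_two[OF H(1) fH LG LH cLH it x] .
          hence "act (inv t \<otimes> x) z = z" using z(2) by blast
          hence "act (inv t) (act x z) = z" using act_act[OF inv_closed[OF S_G[OF tS]] S_G[OF xS] zA] by simp
          thus ?thesis unfolding z'_def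
            using act_act_inv[OF S_G[OF tS] A_act[OF S_G[OF xS] zA]] by simp
        qed
        show ?thesis
        proof (cases "h \<in> L")
          case True
          have "h \<otimes> t \<notin> L"
          proof
            assume "h \<otimes> t \<in> L"
            hence "inv h \<otimes> (h \<otimes> t) \<in> L"
              using subgroup.m_closed[OF LG subgroup.m_inv_closed[OF LG True]] by blast
            thus False using t(2) S_G[OF hS] S_G[OF tS] by (simp add: m_assoc[symmetric])
          qed
          thus ?thesis using True z(2) hz' off subgroup.m_closed[OF H(1) h t(1)] by simp
        next
          case False
          thus ?thesis using hz' off[OF h False] index_two[OF H(1) fH LG LH cLH h False t] z(2) by simp
        qed
      qed
      have y: "z + z' \<in> C"
      proof (rule H(4)[OF K_add[OF z(1) z'K]], rule ballI)
        fix h assume "h \<in> H"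
        thus "act h (z + z') = z + z'" using mem[of h] by (auto simp: act_add add.commute)
      qed
      have x: "z * z' \<in> C"
      proof (rule H(4)[OF K_mult[OF z(1) z'K]], rule ballI)
        fix h assume h: "h \<in> H"
        hence "h \<in> carrier G" using H(2) S_G by blast
        hence "act h (z * z') = act h z * act h z'" by (rule act_mult[OF _ zA K_A[OF z'K]])
        thus "act h (z * z') = z * z'" using mem[OF h] K_comm[OF z'K zA] by metis
      qed
      have "(z - z') * (z - z') = (z + z') * (z + z') - (z * z' + z * z' + (z * z' + z * z'))"
        unfolding left_diff_distrib right_diff_distrib distrib_left distrib_right K_comm[OF z'K zA] by simp
      also have "\<dots> \<in> C" by (intro minus C(2) C(3) x y)
      finally have "z - z' \<in> C" using C(5)[OF K_diff[OF z(1) z'K]] by blast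
      hence "(z + z') + (z - z') \<in> C" using C(2) y by blast
      moreover have "(z + z') + (z - z') = j 2 * z"
        using j_add[of 1 1] zA by (simp add: j_1 distrib_right u_l)
      ultimately have "j (1 / 2) * (j 2 * z) \<in> C" using jC by simp
      thus ?thesis using j_cancel[of 2 z] of_nat_neq_0[of 2] zA by simp
    qed
    thus ?case using LG LH H(2) L(2) by (intro exI[of _ L]) auto
  qed
  obtain H where H: "subgroup H G" "card H = 1" "\<forall>z\<in>K. (\<forall>h\<in>H. act h z = z) \<longrightarrow> z \<in> C"
    using chain[of a] by auto
  have "H = {\<one>}" using H(2) subgroup.one_closed[OF H(1)] by (metis card_1_singletonE singletonD)
  thus ?thesis using H(3) act_one K_A by auto
qed

lemma K_square_eq:
  assumes "y \<in> K" "w \<in> K" "y * y = w * w" shows "y = w \<or> y = - w"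
proof -
  have "(y - w) * (y + w) = 0"
    unfolding left_diff_distrib distrib_left K_comm[OF assms(1) K_A[OF assms(2)]] assms(3) by simp
  hence "y - w = 0 \<or> y + w = 0" using K_no_zero_div[OF K_diff[OF assms(1,2)] _ K_B[OF K_add[OF assms(1,2)]]] by blast
  thus ?thesis by (auto simp: eq_neg_iff_add_eq_0)
qed

lemma j_e_mult: "z \<in> K \<Longrightarrow> (j a * e) * z = j a * z" by (simp add: mult.assoc K_e)

lemma j_mult_comm: "a \<in> A \<Longrightarrow> a * (j c * x) = j c * (a * x)"
  using j_comm[of a c] by (metis mult.assoc)

lemma j_j_mult: "(j a * x) * (j b * y) = j (a * b) * (x * y)" if "x \<in> A"
  using j_mult_comm[OF that, of b y] by (simp add: mult.assoc j_mult)

text \<open>The combinations of \<open>e\<close> and \<open>i\<close>, or the scalars alone if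
  \<open>- e\<close> has no root in \<open>K\<close>, are closed under square roots in
  \<open>K\<close>: in the first case by complex square roots, in the second because a root of a
  negative scalar would yield a root of \<open>- e\<close>.\<close>

lemma K_cases:
  "(\<forall>z\<in>K. \<exists>c. z = j c * e) \<or> (\<exists>i\<in>K. i * i = - e \<and> (\<forall>z\<in>K. \<exists>a b. z = j a * e + j b * i))"
proof (cases "\<exists>i\<in>K. i * i = - e")
  case True
  then obtain i where i: "i \<in> K" "i * i = - e" by blast
  define C where "C = {j a * e + j b * i | a b. True}"
  have CI: "j a * e + j b * i \<in> C" for a b by (auto simp: C_def)
  have mult: "(j a * e + j b * i) * (j c * e + j d * i) = j (a * c - b * d) * e + j (a * d + b * c) * i" for a b c d
    using i K_e[OF i(1)] K_e'[OF i(1)] e_e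
    by (simp add: distrib_left distrib_right j_j_mult e_A K_A[OF i(1)] j_diff j_add left_diff_distrib add_ac)
  have "K \<subseteq> C"
  proof (rule square_root_closed_subfield)
    show "C \<subseteq> K" unfolding C_def using j_K j_mult_K[OF i(1)] K_add by blast
    fix x y assume "x \<in> C" "y \<in> C"
    then obtain a b c d where "x = j a * e + j b * i" "y = j c * e + j d * i" unfolding C_def by blast
    thus "x + y \<in> C" "x * y \<in> C" using CI[of "a + c" "b + d"] CI[of "a * c - b * d" "a * d + b * c"] mult
      by (simp_all add: j_add distrib_right add_ac)
  next
    show "j c * e \<in> C" for c using CI[of c 0] by simp
    fix y assume y: "y \<in> K" "y * y \<in> C"
    then obtain a b where ab: "y * y = j a * e + j b * i" unfolding C_def by blast
    obtain c d where cd: "a = c * c - d * d" "b = 2 * c * d" using real_closed_complex_sqrt[OF rc] by blast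
    have "(j c * e + j d * i) * (j c * e + j d * i) = y * y" 
    proof -
      have "c * d + d * c = b" "c * c - d * d = a" using cd by simp_all
      thus ?thesis unfolding mult ab by simp
    qed
    moreover have "j c * e + j d * i \<in> K" using j_K j_mult_K[OF i(1)] K_add by blast
    ultimately have "y = j c * e + j d * i \<or> y = - (j c * e + j d * i)" using K_square_eq[OF y(1)] by metis
    thus "y \<in> C" using CI[of c d] CI[of "- c" "- d"] by (auto simp: j_minus)
  qed
  thus ?thesis using i unfolding C_def by blast
next
  case False
  define C where "C = {j a * e | a. True}"
  have CI: "j a * e \<in> C" for a by (auto simp: C_def)
  have "K \<subseteq> C"
  proof (rule square_root_closed_subfield)
    show "C \<subseteq> K" unfolding C_def using j_K by blast
    fix x y assume "x \<in> C" "y \<in> C"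
    then obtain a c where "x = j a * e" "y = j c * e" unfolding C_def by blast
    thus "x + y \<in> C" "x * y \<in> C" using CI[of "a + c"] CI[of "a * c"]
      by (simp_all add: j_add distrib_right j_j_mult e_A e_e)
  next
    show "j c * e \<in> C" for c by (rule CI)
    fix y assume y: "y \<in> K" "y * y \<in> C"
    then obtain a where a: "y * y = j a * e" unfolding C_def by blast
    show "y \<in> C"
    proof (cases rule: real_closed_cases[OF rc, of a])
      case (1 b)
      hence "(j b * e) * (j b * e) = y * y" using a by (simp add: j_j_mult e_A e_e)
      hence "y = j b * e \<or> y = - (j b * e)" using K_square_eq[OF y(1) j_K] by metis
      thus ?thesis using CI[of b] CI[of "- b"] by (auto simp: j_minus)
    next
      case (2 b)
      show ?thesis
      proof (cases "b = 0")
        case True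
        hence "y = 0" using a 2 K_square_zero[OF y(1)] by simp
        thus ?thesis using CI[of 0] by simp
      next
        case False
        have "(j (1 / b) * y) * (j (1 / b) * y) = j (1 / b * (1 / b)) * (j a * e)"
          using a by (simp only: j_j_mult[OF K_A[OF y(1)]])
        also have "\<dots> = j (1 / b * (1 / b) * a) * e" by (simp only: j_mult mult.assoc)
        also have "1 / b * (1 / b) * a = - 1" using 2 False by simp
        finally have "(j (1 / b) * y) * (j (1 / b) * y) = - e" by (simp add: j_minus j_1 u_l e_A)
        thus ?thesis using \<open>\<not> (\<exists>i\<in>K. i * i = - e)\<close> j_mult_K[OF y(1)] by blast
      qed
    qed
  qed
  thus ?thesis unfolding C_def by blast
qed

end

section \<open>Equivariant automorphisms\<close>

context ring_with_action begin

text \<open>The case \<open>\<theta> = id\<close> gives the equivariant automorphisms; \<open>\<theta>\<close> is conjugation by \<open>t\<close> when \<open>f\<close> is the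
  action of \<open>t\<close> composed with one of those.\<close>

definition twisted_aut :: "('g \<Rightarrow> 'g) \<Rightarrow> ('r \<Rightarrow> 'r) \<Rightarrow> bool" where
  "twisted_aut \<theta> f \<longleftrightarrow> bij_betw f A A \<and> (\<forall>x\<in>A. \<forall>y\<in>A. f (x + y) = f x + f y \<and> f (x * y) = f x * f y) \<and>
     (\<forall>c. f (j c) = j c) \<and> (\<forall>g\<in>carrier G. \<theta> g \<in> carrier G \<and> (\<forall>x\<in>A. f (act g x) = act (\<theta> g) (f x)))"

definition Auts :: "('r \<Rightarrow> 'r) set" where
  "Auts = {f. twisted_aut id f \<and> (\<forall>x. x \<notin> A \<longrightarrow> f x = undefined)}"

lemma twisted_aut_A: "twisted_aut \<theta> f \<Longrightarrow> x \<in> A \<Longrightarrow> f x \<in> A"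
  by (auto simp: twisted_aut_def bij_betw_def)
lemma twisted_aut_add: "twisted_aut \<theta> f \<Longrightarrow> x \<in> A \<Longrightarrow> y \<in> A \<Longrightarrow> f (x + y) = f x + f y"
  by (auto simp: twisted_aut_def)
lemma twisted_aut_mult: "twisted_aut \<theta> f \<Longrightarrow> x \<in> A \<Longrightarrow> y \<in> A \<Longrightarrow> f (x * y) = f x * f y"
  by (auto simp: twisted_aut_def)
lemma twisted_aut_j: "twisted_aut \<theta> f \<Longrightarrow> f (j c) = j c" by (auto simp: twisted_aut_def)
lemma twisted_aut_act: "twisted_aut \<theta> f \<Longrightarrow> g \<in> carrier G \<Longrightarrow> x \<in> A \<Longrightarrow> f (act g x) = act (\<theta> g) (f x)"
  by (auto simp: twisted_aut_def)
lemma twisted_aut_G: "twisted_aut \<theta> f \<Longrightarrow> g \<in> carrier G \<Longrightarrow> \<theta> g \<in> carrier G" by (auto simp: twisted_aut_def)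
lemma twisted_aut_inj: "twisted_aut \<theta> f \<Longrightarrow> x \<in> A \<Longrightarrow> y \<in> A \<Longrightarrow> f x = f y \<longleftrightarrow> x = y"
  by (auto simp: twisted_aut_def bij_betw_def inj_on_def)
lemma twisted_aut_onto: "twisted_aut \<theta> f \<Longrightarrow> y \<in> A \<Longrightarrow> \<exists>x\<in>A. y = f x"
  by (auto simp: twisted_aut_def bij_betw_def image_iff set_eq_iff)
lemma twisted_aut_0: "twisted_aut \<theta> f \<Longrightarrow> f 0 = 0" using twisted_aut_j[of \<theta> f 0] by simp
lemma twisted_aut_eq_0: "twisted_aut \<theta> f \<Longrightarrow> x \<in> A \<Longrightarrow> f x = 0 \<longleftrightarrow> x = 0" using twisted_aut_inj[of \<theta> f x 0] twisted_aut_0[of \<theta> f] by simp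
lemma twisted_aut_j_mult: "twisted_aut \<theta> f \<Longrightarrow> x \<in> A \<Longrightarrow> f (j c * x) = j c * f x" using twisted_aut_mult[of \<theta> f "j c" x] twisted_aut_j[of \<theta> f c] A_j by simp
lemma twisted_aut_minus: "twisted_aut \<theta> f \<Longrightarrow> x \<in> A \<Longrightarrow> f (- x) = - f x"
  using twisted_aut_j_mult[of \<theta> f x "- 1"] twisted_aut_A[of \<theta> f x] by (simp add: j_minus j_1 u_l)
lemma twisted_aut_sum: assumes "twisted_aut \<theta> f" "\<And>i. i \<in> I \<Longrightarrow> x i \<in> A" shows "f (sum x I) = (\<Sum>i\<in>I. f (x i))"
  using assms(2) by (induction I rule: infinite_finite_induct) (auto simp: twisted_aut_0[OF assms(1)] twisted_aut_add[OF assms(1)] A_sum)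

lemma twisted_aut_gr: assumes f: "twisted_aut \<theta> f" and y: "y \<in> carrier G" and v: "v \<in> gr y" shows "f v \<in> gr (\<theta> y)"
proof -
  have "f v * a = act (\<theta> y) a * f v" if a: "a \<in> A" for a
  proof -
    obtain b where b: "b \<in> A" "a = f b" using twisted_aut_onto[OF f a] by blast
    have "f v * a = f (act y b * v)" using twisted_aut_mult[OF f gr_A[OF v] b(1)] gr_comm[OF v b(1)] b(2) by simp
    also have "\<dots> = act (\<theta> y) a * f v"
      using twisted_aut_mult[OF f A_act[OF y b(1)] gr_A[OF v]] twisted_aut_act[OF f y b(1)] b(2) by simp
    finally show ?thesis .
  qed
  thus ?thesis using twisted_aut_A[OF f gr_A[OF v]] by (simp add: gr_def)
qed

lemma twisted_aut_Z_onto: assumes f: "twisted_aut \<theta> f" and z: "z \<in> gr \<one>" shows "\<exists>w\<in>gr \<one>. f w = z"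
proof -
  obtain w where w: "w \<in> A" "z = f w" using twisted_aut_onto[OF f gr_A[OF z]] by blast
  have "w * a = a * w" if a: "a \<in> A" for a
  proof -
    have "f (w * a) = f (a * w)"
      using twisted_aut_mult[OF f w(1) a] twisted_aut_mult[OF f a w(1)] Z_comm[OF z twisted_aut_A[OF f a]] w(2) by simp
    thus ?thesis using twisted_aut_inj[OF f] A_mult w(1) a by blast
  qed
  thus ?thesis using w Z_iff by blast
qed

lemma twisted_aut_comp:
  assumes "twisted_aut \<theta> f" "twisted_aut \<eta> g" shows "twisted_aut (\<theta> \<circ> \<eta>) (f \<circ> g)"
  unfolding twisted_aut_def
proof (intro conjI ballI allI)
  show "bij_betw (f \<circ> g) A A" using assms bij_betw_trans[of g A A f A] unfolding twisted_aut_def by blast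
  show "(f \<circ> g) (j c) = j c" for c using twisted_aut_j[OF assms(1)] twisted_aut_j[OF assms(2)] by simp
  show "(\<theta> \<circ> \<eta>) h \<in> carrier G" if "h \<in> carrier G" for h
    using twisted_aut_G[OF assms(1) twisted_aut_G[OF assms(2) that]] by simp
  fix x assume x: "x \<in> A"
  note gx = twisted_aut_A[OF assms(2) x]
  show "(f \<circ> g) (act h x) = act ((\<theta> \<circ> \<eta>) h) ((f \<circ> g) x)" if "h \<in> carrier G" for h
    using twisted_aut_act[OF assms(2) that x] twisted_aut_act[OF assms(1) twisted_aut_G[OF assms(2) that] gx] by simp
  fix y assume y: "y \<in> A"
  show "(f \<circ> g) (x + y) = (f \<circ> g) x + (f \<circ> g) y" "(f \<circ> g) (x * y) = (f \<circ> g) x * (f \<circ> g) y"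
    using twisted_aut_add[OF assms(2) x y] twisted_aut_add[OF assms(1) gx twisted_aut_A[OF assms(2) y]]
      twisted_aut_mult[OF assms(2) x y] twisted_aut_mult[OF assms(1) gx twisted_aut_A[OF assms(2) y]] by simp_all
qed

lemma twisted_aut_cong: assumes f: "twisted_aut \<theta> f" and eq: "\<And>x. x \<in> A \<Longrightarrow> f x = f' x" shows "twisted_aut \<theta> f'"
  unfolding twisted_aut_def
proof (intro conjI ballI allI)
  show "bij_betw f' A A" using bij_betw_cong[of A f f' A] eq f unfolding twisted_aut_def by blast
  show "f' (j c) = j c" for c using twisted_aut_j[OF f, of c] eq[OF A_j] by simp
  show "\<theta> h \<in> carrier G" if "h \<in> carrier G" for h using twisted_aut_G[OF f that] .
  fix x assume x: "x \<in> A"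
  show "f' (act h x) = act (\<theta> h) (f' x)" if "h \<in> carrier G" for h
    using twisted_aut_act[OF f that x] eq[OF x] eq[OF A_act[OF that x]] by simp
  fix y assume y: "y \<in> A"
  show "f' (x + y) = f' x + f' y" "f' (x * y) = f' x * f' y"
    using twisted_aut_add[OF f x y] twisted_aut_mult[OF f x y] eq[OF x] eq[OF y] eq[OF A_add[OF x y]] eq[OF A_mult[OF x y]] by simp_all
qed

lemma twisted_aut_inverse:
  assumes "twisted_aut id f" shows "twisted_aut id (inv_into A f)"
proof -
  have b: "bij_betw f A A" using assms by (simp add: twisted_aut_def)
  have i: "inv_into A f x \<in> A" "f (inv_into A f x) = x" if "x \<in> A" for x
    using b that by (auto simp: bij_betw_def inv_into_into f_inv_into_f)
  have l: "inv_into A f y = x" if "x \<in> A" "f x = y" for x y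
    using b that by (auto simp: bij_betw_def)
  show ?thesis unfolding twisted_aut_def
  proof (intro conjI ballI allI)
    show "bij_betw (inv_into A f) A A" using bij_betw_inv_into[OF b] .
    fix c show "inv_into A f (j c) = j c" using l[OF A_j twisted_aut_j[OF assms]] .
  next
    fix x y assume x: "x \<in> A" and y: "y \<in> A"
    show "inv_into A f (x + y) = inv_into A f x + inv_into A f y"
      by (rule l) (use i x y A_add twisted_aut_add[OF assms] in auto)
    show "inv_into A f (x * y) = inv_into A f x * inv_into A f y"
      by (rule l) (use i x y A_mult twisted_aut_mult[OF assms] in auto)
  next
    fix g x assume "g \<in> carrier G" "x \<in> A"
    thus "inv_into A f (act g x) = act (id g) (inv_into A f x)"
      by (intro l) (use i A_act twisted_aut_act[OF assms] in auto)
  qed auto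
qed

lemma twisted_aut_act_group: assumes t: "t \<in> carrier G" shows "twisted_aut (\<lambda>g. t \<otimes> g \<otimes> inv t) (act t)"
  unfolding twisted_aut_def
proof (intro conjI ballI allI)
  show "bij_betw (act t) A A"
    by (rule bij_betw_byWitness[where f' = "act (inv t)"])
       (use act_inv_act[OF t] act_act_inv[OF t] A_act[OF t] A_act[OF inv_closed[OF t]] in \<open>auto simp: image_subset_iff\<close>)
  fix g assume g: "g \<in> carrier G"
  have c: "t \<otimes> g \<otimes> inv t \<in> carrier G" by (intro m_closed inv_closed t g)
  show "t \<otimes> g \<otimes> inv t \<in> carrier G" by (rule c)
  fix x assume x: "x \<in> A"
  have "act (t \<otimes> g \<otimes> inv t) (act t x) = act (t \<otimes> g \<otimes> inv t \<otimes> t) x" by (rule act_act[OF c t x, symmetric])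
  moreover have "t \<otimes> g \<otimes> inv t \<otimes> t = t \<otimes> g" using t g by (simp add: m_assoc)
  moreover note act_act[OF t g x]
  ultimately show "act t (act g x) = act (t \<otimes> g \<otimes> inv t) (act t x)" by simp
next
  fix x y assume "x \<in> A" "y \<in> A"
  show "act t (x + y) = act t x + act t y" by (rule act_add)
  show "act t (x * y) = act t x * act t y" by (rule act_mult) fact+
next
  show "act t (j c) = j c" for c by (rule act_j[OF t])
qed

text \<open>Composition, and below inversion, stay \<open>undefined\<close> outside
  \<open>A\<close>. So \<open>Auts\<close> is closed under them, and equality of its members is
  equality on \<open>A\<close>.\<close>

definition cmp :: "('r \<Rightarrow> 'r) \<Rightarrow> ('r \<Rightarrow> 'r) \<Rightarrow> 'r \<Rightarrow> 'r" where
  "cmp f g = (\<lambda>x. if x \<in> A then f (g x) else undefined)"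
definition ivs :: "('r \<Rightarrow> 'r) \<Rightarrow> 'r \<Rightarrow> 'r" where
  "ivs f = (\<lambda>x. if x \<in> A then inv_into A f x else undefined)"

lemma Auts_taut: "f \<in> Auts \<Longrightarrow> twisted_aut id f" by (simp add: Auts_def)

lemma Auts_eqI: "f \<in> Auts \<Longrightarrow> g \<in> Auts \<Longrightarrow> (\<And>x. x \<in> A \<Longrightarrow> f x = g x) \<Longrightarrow> f = g"
  unfolding Auts_def by (rule ext) (metis (mono_tags, lifting) mem_Collect_eq)

lemma cmp_apply: "x \<in> A \<Longrightarrow> cmp f g x = f (g x)" by (simp add: cmp_def)

lemma cmp_Auts: assumes "f \<in> Auts" "g \<in> Auts" shows "cmp f g \<in> Auts"
proof -
  have "twisted_aut (id \<circ> id) (f \<circ> g)" using twisted_aut_comp assms Auts_taut by blast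
  hence "twisted_aut id (cmp f g)" using twisted_aut_cong[of id "f \<circ> g" "cmp f g"] by (simp add: cmp_def)
  thus ?thesis by (simp add: Auts_def cmp_def)
qed

lemma ivs_Auts: assumes "f \<in> Auts" shows "ivs f \<in> Auts"
proof -
  have "twisted_aut id (ivs f)" using twisted_aut_cong[OF twisted_aut_inverse[OF Auts_taut[OF assms]], of "ivs f"] by (simp add: ivs_def)
  thus ?thesis by (simp add: Auts_def ivs_def)
qed

lemma ivs_apply: assumes f: "f \<in> Auts" and x: "x \<in> A" shows "ivs f (f x) = x" "f (ivs f x) = x"
proof -
  have "bij_betw f A A" using Auts_taut[OF f] by (simp add: twisted_aut_def)
  thus "ivs f (f x) = x" "f (ivs f x) = x" using x twisted_aut_A[OF Auts_taut[OF f] x]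
    by (auto simp: ivs_def bij_betw_def f_inv_into_f)
qed

lemma bij_cmp:
  assumes f: "f \<in> Auts" and I: "I \<subseteq> Auts" and J: "J \<subseteq> Auts"
    and IJ: "\<And>h. h \<in> I \<Longrightarrow> cmp f h \<in> J" "\<And>h. h \<in> J \<Longrightarrow> cmp (ivs f) h \<in> I"
  shows "bij_betw (cmp f) I J"
proof (rule bij_betw_byWitness[where f' = "cmp (ivs f)"])
  show "\<forall>h\<in>I. cmp (ivs f) (cmp f h) = h"
  proof
    fix h assume "h \<in> I"
    hence h: "h \<in> Auts" using I by blast
    show "cmp (ivs f) (cmp f h) = h"
      by (rule Auts_eqI) (use h f cmp_Auts ivs_Auts ivs_apply twisted_aut_A[OF Auts_taut[OF h]] in \<open>simp_all add: cmp_apply\<close>)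
  qed
  show "\<forall>h\<in>J. cmp f (cmp (ivs f) h) = h"
  proof
    fix h assume "h \<in> J"
    hence h: "h \<in> Auts" using J by blast
    show "cmp f (cmp (ivs f) h) = h"
      by (rule Auts_eqI) (use h f cmp_Auts ivs_Auts ivs_apply twisted_aut_A[OF Auts_taut[OF h]] in \<open>simp_all add: cmp_apply\<close>)
  qed
qed (use IJ in auto)

text \<open>The fibres of \<open>k\<close> are the left cosets of \<open>J\<close>. Groups of
  automorphisms are handled as sets of functions closed under \<open>cmp\<close> and
  \<open>ivs\<close>.\<close>

lemma card_Auts_fibres:
  assumes I: "I \<subseteq> Auts" "finite I" "\<And>f h. f \<in> I \<Longrightarrow> h \<in> I \<Longrightarrow> cmp f h \<in> I" "\<And>f. f \<in> I \<Longrightarrow> ivs f \<in> I"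
    and J: "J \<subseteq> I" "\<And>f h. f \<in> I \<Longrightarrow> h \<in> J \<Longrightarrow> k (cmp f h) = k f"
    "\<And>f h. f \<in> I \<Longrightarrow> h \<in> I \<Longrightarrow> k h = k f \<Longrightarrow> cmp (ivs f) h \<in> J"
  shows "card I = card (k ` I) * card J"
proof (rule card_fibres[OF I(2)])
  fix f assume f: "f \<in> I"
  have "bij_betw (cmp f) J {h \<in> I. k h = k f}"
    by (rule bij_cmp) (use f I J in blast)+
  thus "card {h \<in> I. k h = k f} = card J" using bij_betw_same_card by fastforce
qed

definition idA :: "'r \<Rightarrow> 'r" where "idA = (\<lambda>x. if x \<in> A then x else undefined)"

lemma idA_Auts: "idA \<in> Auts"
proof -
  have "twisted_aut id (\<lambda>x. x)" by (auto simp: twisted_aut_def bij_betw_def)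
  hence "twisted_aut id idA" using twisted_aut_cong[of id "\<lambda>x. x" idA] by (simp add: idA_def)
  thus ?thesis by (simp add: Auts_def idA_def)
qed

end

section \<open>The grading of \<open>B\<close>\<close>

context primitive_idempotent begin

definition gB where "gB y = {v \<in> gr y. e * v = v}"

lemma gB_gr: "v \<in> gB y \<Longrightarrow> v \<in> gr y" and gB_e: "v \<in> gB y \<Longrightarrow> e * v = v" by (simp_all add: gB_def)
lemma gB_A: "v \<in> gB y \<Longrightarrow> v \<in> A" using gB_gr gr_A by blast
lemma gB_B: "v \<in> gB y \<Longrightarrow> v \<in> B" using gB_A gB_e by (simp add: B_def)
lemma gB_e': "v \<in> gB y \<Longrightarrow> v * e = v" using gB_B B_e' by blast
lemma gB_0 [simp]: "0 \<in> gB y" by (simp add: gB_def)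
lemma gB_one: "gB \<one> = K" by (auto simp: gB_def K_def)
lemma gB_mult: "x \<in> carrier G \<Longrightarrow> y \<in> carrier G \<Longrightarrow> v \<in> gB x \<Longrightarrow> w \<in> gB y \<Longrightarrow> v * w \<in> gB (x \<otimes> y)"
  by (simp add: gB_def gr_mult mult.assoc[symmetric])
lemma K_gB: "y \<in> carrier G \<Longrightarrow> z \<in> K \<Longrightarrow> v \<in> gB y \<Longrightarrow> z * v \<in> gB y"
  using gB_mult[of \<one> y z v] by (simp add: gB_one)

lemma pr_gB: assumes "y \<in> carrier G" "b \<in> B" shows "pr y b \<in> gB y"
proof -
  have "e * pr y b = pr y (e * b)" unfolding pr_def sum_distrib_left
  proof (intro sum.cong refl)
    fix i assume "i \<in> {..<n}"
    hence "e * P i = P i * e" using e_comm A_P by simp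
    thus "e * (P i * b * act (inv y) (Q i)) = P i * (e * b) * act (inv y) (Q i)" by (metis mult.assoc)
  qed
  thus ?thesis using pr_gr[OF assms(1) B_A[OF assms(2)]] B_e[OF assms(2)] by (simp add: gB_def)
qed

text \<open>\<open>gr_dual\<close> yields \<open>w0\<close> of opposite degree with
  \<open>w0 * v\<close> nonzero in the field \<open>K\<close>, hence a left inverse. It is also a
  right inverse, because \<open>v * w\<close> is then a nonzero idempotent of
  \<open>K\<close>.\<close>

lemma gB_unit: assumes y: "y \<in> carrier G" and v: "v \<in> gB y" "v \<noteq> 0"
  shows "\<exists>w\<in>gB (inv y). w * v = e \<and> v * w = e"
proof -
  obtain w0 where w0: "w0 \<in> gr (inv y)" "tr (w0 * v) \<noteq> 0" using gr_dual[OF y gB_gr[OF v(1)] v(2)] by blast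
  have iy: "inv y \<in> carrier G" using y by simp
  have "w0 * v \<in> gr \<one>" using gr_mult[OF iy y w0(1) gB_gr[OF v(1)]] y by simp
  moreover have "e * (w0 * v) = w0 * v"
    using e_comm[OF gr_A[OF w0(1)]] gB_e[OF v(1)] by (metis mult.assoc)
  ultimately have zK: "w0 * v \<in> K" by (simp add: K_def)
  moreover have "w0 * v \<noteq> 0" using w0(2) by auto
  ultimately obtain z where z: "z \<in> K" "w0 * v * z = e" using K_inverse by blast
  define w where "w = z * w0"
  have wgB: "w \<in> gB (inv y)"
    using gr_mult[OF one_closed iy K_Z[OF z(1)] w0(1)] K_e[OF z(1)] iy by (simp add: gB_def w_def mult.assoc[symmetric])
  have wv: "w * v = e" using z(2) K_comm[OF z(1) K_A[OF zK]] by (simp add: w_def mult.assoc)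
  have f: "v * w \<in> K" using gB_mult[OF y iy v(1) wgB] y by (simp add: gB_one)
  have "(v * w) * (v * w) = v * (w * v) * w" by (simp only: mult.assoc)
  hence ff: "(v * w) * (v * w) = v * w" using wv gB_e'[OF v(1)] by simp
  have "v * w \<noteq> 0"
  proof
    assume "v * w = 0"
    hence "v * (w * v) = 0" by (metis mult.assoc mult_zero_left)
    thus False using wv gB_e'[OF v(1)] v(2) by simp
  qed
  hence "v * w = e" using e_prim[OF K_Z[OF f] ff K_e'[OF f]] by blast
  thus ?thesis using wgB wv by blast
qed

lemma gB_mult_neq_0:
  assumes "x \<in> carrier G" "v \<in> gB x" "v \<noteq> 0" "b \<in> B" "b \<noteq> 0" shows "v * b \<noteq> 0"
proof
  assume 0: "v * b = 0"
  obtain w where "w * v = e" using gB_unit[OF assms(1-3)] by blast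
  hence "e * b = 0" using 0 by (metis mult.assoc mult_zero_right)
  thus False using B_e[OF assms(4)] assms(5) by simp
qed

text \<open>Right multiplication by the inverse of \<open>v\<close> identifies the component of
  degree \<open>y\<close> with \<open>K\<close>.\<close>

lemma gB_line:
  assumes y: "y \<in> carrier G" and v: "v \<in> gB y" "v \<noteq> 0" and w: "w \<in> gB y" shows "\<exists>!z. z \<in> K \<and> w = z * v"
proof -
  obtain i where i: "i \<in> gB (inv y)" "i * v = e" "v * i = e" using gB_unit[OF y v] by blast
  have "w * i \<in> K" using gB_mult[OF y _ w i(1)] y by (simp add: gB_one)
  moreover have "w = w * i * v" using i(2) gB_e'[OF w] by (simp add: mult.assoc)
  moreover have "z = z'" if "z \<in> K" "z' \<in> K" "z * v = z' * v" for z z'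
  proof -
    have "z * (v * i) = z' * (v * i)" using that(3) by (simp only: mult.assoc[symmetric])
    thus ?thesis using i(3) K_e'[OF that(1)] K_e'[OF that(2)] by simp
  qed
  ultimately show ?thesis by (intro ex1I[of _ "w * i"]) auto
qed

lemma K_cancel: "y \<in> carrier G \<Longrightarrow> v \<in> gB y \<Longrightarrow> v \<noteq> 0 \<Longrightarrow> z \<in> K \<Longrightarrow> z' \<in> K \<Longrightarrow> z * v = z' * v \<Longrightarrow> z = z'"
  using gB_line[of y v "z * v"] K_gB by blast

definition N where "N = {s \<in> S. \<forall>z\<in>K. act s z = z}"
text \<open>The support of the grading of \<open>B\<close>. It is a subgroup contained in
  \<open>N\<close>; the count of automorphisms will force equality.\<close>

definition N0 where "N0 = {y \<in> carrier G. \<exists>v\<in>gB y. v \<noteq> 0}"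

lemma N_S: "s \<in> N \<Longrightarrow> s \<in> S" by (simp add: N_def)
lemma N_G: "s \<in> N \<Longrightarrow> s \<in> carrier G" using N_S S_G by blast
lemma N_K: "s \<in> N \<Longrightarrow> z \<in> K \<Longrightarrow> act s z = z" by (simp add: N_def)

text \<open>A unit \<open>v\<close> of degree \<open>y\<close> satisfies v = v e = y(e) v, so y(e)
  meets \<open>e\<close> and \<open>y\<close> lies in \<open>S\<close>; and z v = v z = y(z) v
  forces y(z) = z on \<open>K\<close>.\<close>

lemma N0_N: "N0 \<subseteq> N"
proof
  fix y assume "y \<in> N0"
  then obtain v where y: "y \<in> carrier G" and v: "v \<in> gB y" "v \<noteq> 0" unfolding N0_def by blast
  have "act y e * e * v = v"
    using gr_comm[OF gB_gr[OF v(1)] e_A] gB_e'[OF v(1)] gB_e[OF v(1)] by (simp add: mult.assoc)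
  hence "e * act y e \<noteq> 0" using e_comm[OF e_act_A[OF y]] v(2) by auto
  hence yS: "y \<in> S" using e_orthogonal[OF y] by blast
  have "act y z = z" if z: "z \<in> K" for z
  proof -
    have "z * v = act y z * v" using gr_comm[OF gB_gr[OF v(1)] K_A[OF z]] K_comm[OF z gB_A[OF v(1)]] by simp
    thus ?thesis using K_cancel[OF y v z S_act_K[OF yS z]] by simp
  qed
  thus "y \<in> N" using yS by (simp add: N_def)
qed

lemma N0_one: "\<one> \<in> N0" using e_K e0 by (auto simp: N0_def gB_one)

lemma N0_mult: "x \<in> N0 \<Longrightarrow> y \<in> N0 \<Longrightarrow> x \<otimes> y \<in> N0"
  using gB_mult gB_mult_neq_0 gB_B unfolding N0_def by blast

lemma N0_inv: assumes "y \<in> N0" shows "inv y \<in> N0"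
proof -
  obtain v where y: "y \<in> carrier G" and v: "v \<in> gB y" "v \<noteq> 0" using assms unfolding N0_def by blast
  obtain w where w: "w \<in> gB (inv y)" "w * v = e" using gB_unit[OF y v] by blast
  thus ?thesis using y e0 by (auto simp: N0_def intro!: bexI[of _ w])
qed

lemma fin_N: "finite N" using finite_subset[of N S] fin_S N_S by blast
lemma fin_N0: "finite N0" using finite_subset[OF N0_N fin_N] .

lemma N_subgroup: "subgroup N G"
proof (rule subgroupI)
  show "N \<subseteq> carrier G" using N_G by blast
  have "\<one> \<in> N" using S_one act_one K_A by (simp add: N_def)
  thus "N \<noteq> {}" by blast
  fix a assume a: "a \<in> N"
  have "act (inv a) z = z" if "z \<in> K" for z
    using act_inv_act[OF N_G[OF a] K_A[OF that]] N_K[OF a that] by simp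
  thus "inv a \<in> N" using S_inv[OF N_S[OF a]] by (simp add: N_def)
  fix b assume b: "b \<in> N"
  have "act (a \<otimes> b) z = z" if "z \<in> K" for z
    using act_act[OF N_G[OF a] N_G[OF b] K_A[OF that]] N_K[OF a that] N_K[OF b that] by simp
  thus "a \<otimes> b \<in> N" using S_mult[OF N_S[OF a] N_S[OF b]] by (simp add: N_def)
qed

lemma twisted_aut_B: assumes f: "twisted_aut \<theta> f" "f e = e" and b: "b \<in> B" shows "f b \<in> B"
proof -
  have "e * f b = f (e * b)" using twisted_aut_mult[OF f(1) e_A B_A[OF b]] f(2) by simp
  also have "e * b = b" by (rule B_e[OF b])
  finally show ?thesis using twisted_aut_A[OF f(1) B_A[OF b]] by (simp add: B_def)
qed

lemma twisted_aut_gB: "twisted_aut \<theta> f \<Longrightarrow> f e = e \<Longrightarrow> y \<in> carrier G \<Longrightarrow> v \<in> gB y \<Longrightarrow> f v \<in> gB (\<theta> y)"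
  using twisted_aut_gr[of \<theta> f y v] B_e[OF twisted_aut_B[of \<theta> f v]] gB_gr[of v y] gB_B[of v y] by (simp add: gB_def)

text \<open>\<open>\<theta>\<close> is not assumed to be a homomorphism, but f(u) = u is nonzero and
  has both degree 1 and degree \<open>\<theta> \<one>\<close>.\<close>

lemma twisted_aut_one: assumes "twisted_aut \<theta> f" shows "\<theta> \<one> = \<one>"
proof -
  have "f u \<in> gr (\<theta> \<one>)" using twisted_aut_gr[OF assms one_closed u_Z] .
  hence "u \<in> gr (\<theta> \<one>)" using twisted_aut_j[OF assms, of 1] by (simp add: j_1)
  thus ?thesis using gr_disjoint[OF _ one_closed _ u_Z u0] twisted_aut_G[OF assms one_closed] by blast
qed

lemma twisted_aut_K: "twisted_aut \<theta> f \<Longrightarrow> f e = e \<Longrightarrow> z \<in> K \<Longrightarrow> f z \<in> K"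
  using twisted_aut_gB[of \<theta> f \<one> z] twisted_aut_one[of \<theta> f] by (simp add: gB_one)

lemma twisted_aut_K_onto: assumes "twisted_aut \<theta> f" "f e = e" "z \<in> K" shows "\<exists>w\<in>K. f w = z"
proof -
  obtain w where w: "w \<in> gr \<one>" "f w = z" using twisted_aut_Z_onto[OF assms(1) K_Z[OF assms(3)]] by blast
  have "f (e * w) = z" using twisted_aut_mult[OF assms(1) e_A gr_A[OF w(1)]] assms(2) w(2) K_e[OF assms(3)] by simp
  moreover have "e * w \<in> K" using Z_mult[OF e_Z w(1)] by (simp add: K_def e_e_mult)
  ultimately show ?thesis by blast
qed

text \<open>Some translate h(e) of f(e) meets \<open>e\<close>, and then e h(e) = e by primitivity.
  For the opposite inequality \<open>e\<close> is pulled back along \<open>h\<close>: its preimage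
  is a nonzero idempotent below \<open>e\<close>, hence equal to \<open>e\<close>.\<close>

lemma twisted_aut_e: assumes f: "twisted_aut \<theta> f" shows "\<exists>g\<in>carrier G. act g (f e) = e"
proof -
  have "f e \<noteq> 0" using twisted_aut_eq_0[OF f e_A] e0 by simp
  then obtain g where g: "g \<in> carrier G" "e * act g (f e) \<noteq> 0"
    using faithful[OF twisted_aut_A[OF f e_A]] by blast
  define h where "h = act g \<circ> f"
  define \<eta> where "\<eta> = (\<lambda>x. g \<otimes> x \<otimes> inv g) \<circ> \<theta>"
  have h: "twisted_aut \<eta> h" unfolding h_def \<eta>_def by (rule twisted_aut_comp[OF twisted_aut_act_group[OF g(1)] f])
  have q: "h e \<in> gr \<one>" using twisted_aut_gr[OF h one_closed e_Z] twisted_aut_one[OF h] by simp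
  have qq: "h e * h e = h e" using twisted_aut_mult[OF h e_A e_A] e_e by simp
  have "(e * h e) * (e * h e) = e * h e" using e_comm[OF gr_A[OF q]] qq e_e by (metis mult.assoc)
  moreover have "e * h e * e = e * h e" using e_comm[OF gr_A[OF q]] e_e by (metis mult.assoc)
  ultimately have eq: "e * h e = e" using e_prim[OF Z_mult[OF e_Z q]] g(2) by (auto simp: h_def)
  obtain a where a: "a \<in> gr \<one>" "h a = e" using twisted_aut_Z_onto[OF h e_Z] by blast
  have aA: "a \<in> A" using gr_A[OF a(1)] .
  have "h (a * a) = h a" using twisted_aut_mult[OF h aA aA] a(2) e_e by simp
  hence aa: "a * a = a" using twisted_aut_inj[OF h A_mult[OF aA aA] aA] by simp
  have "h (a * e) = h a" using twisted_aut_mult[OF h aA e_A] a(2) eq by simp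
  hence ae: "a * e = a" using twisted_aut_inj[OF h A_mult[OF aA e_A] aA] by simp
  have "a \<noteq> 0" using a(2) twisted_aut_0[OF h] e0 by auto
  hence "a = e" using e_prim[OF a(1) aa ae] by blast
  thus ?thesis using a(2) g(1) by (auto simp: h_def)
qed

end

lemma product_eq_imp_factors_eq:
  fixes a b c :: nat
  assumes "a * (b * c) = a' * (b' * c')" "a \<le> a'" "b \<le> b'" "c \<le> c'" "a' > 0" "b' > 0" "c' > 0"
  shows "a = a'" "b = b'" "c = c'"
proof -
  have pos: "a > 0" "b > 0" "c > 0" using assms by (auto intro: gr0I)
  have bc: "b * c \<le> b' * c'" using assms mult_le_mono by blast
  show a: "a = a'"
  proof (rule ccontr)
    assume "a \<noteq> a'"
    hence "a * (b * c) < a' * (b * c)" using assms(2) pos by simp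
    also have "\<dots> \<le> a' * (b' * c')" using bc by simp
    finally show False using assms(1) by simp
  qed
  hence eq: "b * c = b' * c'" using assms(1,5) by simp
  show b: "b = b'"
  proof (rule ccontr)
    assume "b \<noteq> b'"
    hence "b * c < b' * c" using assms(3) pos by simp
    also have "\<dots> \<le> b' * c'" using assms(4) by simp
    finally show False using eq by simp
  qed
  thus "c = c'" using eq assms(6) by simp
qed

section \<open>Counting automorphisms by characters\<close>

context primitive_idempotent begin

text \<open>Reindexing along \<open>m\<close> multiplies the sum by \<open>z\<close>, so z - e kills
  it. Leaving \<open>m\<close> open makes the argument serve sums over group elements and sums over
  automorphisms.\<close>

lemma K_char_sum:
  assumes z: "z \<in> K" "z \<noteq> e" and b: "bij_betw m I I" and x: "\<And>i. i \<in> I \<Longrightarrow> x i \<in> K \<and> x (m i) = z * x i"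
  shows "sum x I = 0"
proof -
  have "sum x I = (\<Sum>i\<in>I. x (m i))" by (rule sum.reindex_bij_betw[OF b, symmetric])
  also have "\<dots> = z * sum x I" unfolding sum_distrib_left by (intro sum.cong refl) (use x in auto)
  finally have "(z - e) * sum x I = 0" using K_e[OF K_sum[of I x]] x by (simp add: left_diff_distrib)
  moreover have "sum x I \<in> B" using K_B[OF K_sum[of I x]] x by blast
  moreover have "z - e \<noteq> 0" using z(2) by simp
  ultimately show ?thesis using K_no_zero_div[OF K_diff[OF z(1) e_K]] by blast
qed

definition Auts_e where "Auts_e = {f \<in> Auts. f e = e}"
definition H where "H = {f \<in> Auts_e. \<forall>z\<in>K. f z = z}"

lemma H_Auts_e: "f \<in> H \<Longrightarrow> f \<in> Auts_e" and H_K: "f \<in> H \<Longrightarrow> z \<in> K \<Longrightarrow> f z = z" by (simp_all add: H_def)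
lemma Auts_e_Auts: "f \<in> Auts_e \<Longrightarrow> f \<in> Auts" and Auts_e_e: "f \<in> Auts_e \<Longrightarrow> f e = e" by (simp_all add: Auts_e_def)
lemma Auts_e_taut: "f \<in> Auts_e \<Longrightarrow> twisted_aut id f" using Auts_e_Auts Auts_taut by blast
lemma Auts_e_gB: "f \<in> Auts_e \<Longrightarrow> y \<in> carrier G \<Longrightarrow> v \<in> gB y \<Longrightarrow> f v \<in> gB y"
  using twisted_aut_gB[of id f y v] Auts_e_taut[of f] Auts_e_e[of f] by simp
lemma Auts_e_K: "f \<in> Auts_e \<Longrightarrow> z \<in> K \<Longrightarrow> f z \<in> K" using twisted_aut_K[of id f z] Auts_e_taut[of f] Auts_e_e[of f] by blast
lemma Auts_e_cmp: "f \<in> Auts_e \<Longrightarrow> g \<in> Auts_e \<Longrightarrow> cmp f g \<in> Auts_e"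
  by (simp add: Auts_e_def cmp_Auts cmp_apply e_A)
lemma Auts_e_ivs: assumes "f \<in> Auts_e" shows "ivs f \<in> Auts_e"
  using ivs_Auts[OF Auts_e_Auts[OF assms]] ivs_apply(1)[OF Auts_e_Auts[OF assms] e_A] Auts_e_e[OF assms] by (simp add: Auts_e_def)
lemma H_cmp: "f \<in> H \<Longrightarrow> g \<in> H \<Longrightarrow> cmp f g \<in> H"
  by (simp add: H_def Auts_e_cmp cmp_apply K_A)
lemma H_ivs: assumes "f \<in> H" shows "ivs f \<in> H"
proof -
  have "ivs f z = z" if "z \<in> K" for z
    using ivs_apply(1)[OF Auts_e_Auts[OF H_Auts_e[OF assms]] K_A[OF that]] H_K[OF assms that] by simp
  thus ?thesis using Auts_e_ivs[OF H_Auts_e[OF assms]] by (simp add: H_def)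
qed
lemma idA_Auts_e: "idA \<in> Auts_e" using idA_Auts e_A by (simp add: Auts_e_def idA_def)
lemma idA_H: "idA \<in> H" using idA_Auts_e K_A by (simp add: H_def idA_def)

definition U where "U y = (SOME v. v \<in> gB y \<and> v \<noteq> 0)"

lemma U: assumes "y \<in> N0" shows "U y \<in> gB y" "U y \<noteq> 0"
proof -
  have "\<exists>v. v \<in> gB y \<and> v \<noteq> 0" using assms by (auto simp: N0_def)
  from someI_ex[OF this] show "U y \<in> gB y" "U y \<noteq> 0" unfolding U_def by auto
qed

lemma N0_G: "y \<in> N0 \<Longrightarrow> y \<in> carrier G" by (simp add: N0_def)

text \<open>For a general \<open>f\<close> in \<open>Auts_e\<close> this is only the coefficient on
  the chosen \<open>U y\<close>. If \<open>f\<close> lies in \<open>H\<close> it is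
  \<open>K\<close>-linear, and the same scalar works on the whole line.\<close>

definition chi where "chi f y = (THE z. z \<in> K \<and> f (U y) = z * U y)"

lemma chi: assumes f: "f \<in> Auts_e" and y: "y \<in> N0" shows "chi f y \<in> K" "f (U y) = chi f y * U y"
proof -
  have "\<exists>!z. z \<in> K \<and> f (U y) = z * U y"
    using gB_line[OF N0_G[OF y] U[OF y] Auts_e_gB[OF f N0_G[OF y] U(1)[OF y]]] .
  from theI'[OF this] show "chi f y \<in> K" "f (U y) = chi f y * U y" unfolding chi_def by auto
qed

lemma chi_apply: assumes f: "f \<in> H" and y: "y \<in> N0" and v: "v \<in> gB y" shows "f v = chi f y * v"
proof -
  obtain z where z: "z \<in> K" "v = z * U y" using gB_line[OF N0_G[OF y] U[OF y] v] by blast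
  have "f v = z * (chi f y * U y)"
    using twisted_aut_mult[OF Auts_e_taut[OF H_Auts_e[OF f]] K_A[OF z(1)] gB_A[OF U(1)[OF y]]] H_K[OF f z(1)]
      chi(2)[OF H_Auts_e[OF f] y] z(2) by simp
  also have "\<dots> = chi f y * v" unfolding z(2) using K_comm[OF z(1) K_A[OF chi(1)[OF H_Auts_e[OF f] y]]]
    by (simp add: mult.assoc[symmetric])
  finally show ?thesis .
qed

lemma chi_eqI:
  assumes f: "f \<in> H" and y: "y \<in> N0" and v: "v \<in> gB y" "v \<noteq> 0" and z: "z \<in> K" "f v = z * v" shows "chi f y = z"
  using K_cancel[OF N0_G[OF y] v chi(1)[OF H_Auts_e[OF f] y] z(1)] chi_apply[OF f y v(1)] z(2) by simp

lemma chi_mult: assumes f: "f \<in> H" and x: "x \<in> N0" and y: "y \<in> N0"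
  shows "chi f (x \<otimes> y) = chi f x * chi f y"
proof (rule chi_eqI[OF f N0_mult[OF x y]])
  note c = chi(1)[OF H_Auts_e[OF f]]
  show "U x * U y \<in> gB (x \<otimes> y)" using gB_mult[OF N0_G[OF x] N0_G[OF y] U(1)[OF x] U(1)[OF y]] .
  show "U x * U y \<noteq> 0" using gB_mult_neq_0[OF N0_G[OF x] U[OF x] gB_B[OF U(1)[OF y]] U(2)[OF y]] .
  show "chi f x * chi f y \<in> K" using K_mult c x y by blast
  have "f (U x * U y) = chi f x * U x * (chi f y * U y)"
    using twisted_aut_mult[OF Auts_e_taut[OF H_Auts_e[OF f]] gB_A[OF U(1)[OF x]] gB_A[OF U(1)[OF y]]]
      chi(2)[OF H_Auts_e[OF f] x] chi(2)[OF H_Auts_e[OF f] y] by simp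
  also have "\<dots> = chi f x * (U x * chi f y) * U y" by (simp only: mult.assoc)
  also have "U x * chi f y = chi f y * U x" using K_comm[OF c[OF y] gB_A[OF U(1)[OF x]]] by simp
  finally show "f (U x * U y) = chi f x * chi f y * (U x * U y)" by (simp only: mult.assoc)
qed

lemma chi_one: "f \<in> H \<Longrightarrow> chi f \<one> = e"
  using chi_eqI[OF _ N0_one, of f e e] e_K e0 H_K[of f e] by (simp add: gB_one e_e)

lemma chi_cmp: assumes f: "f \<in> H" and h: "h \<in> H" and y: "y \<in> N0"
  shows "chi (cmp f h) y = chi f y * chi h y"
proof (rule chi_eqI[OF H_cmp[OF f h] y U[OF y]])
  note c = chi(1)[OF H_Auts_e[OF f] y] chi(1)[OF H_Auts_e[OF h] y]
  show "chi f y * chi h y \<in> K" using K_mult c by blast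
  have "cmp f h (U y) = f (chi h y * U y)"
    using chi(2)[OF H_Auts_e[OF h] y] by (simp add: cmp_apply gB_A[OF U(1)[OF y]])
  also have "\<dots> = chi f y * (chi h y * U y)"
    by (rule chi_apply[OF f y K_gB[OF N0_G[OF y] c(2) U(1)[OF y]]])
  finally show "cmp f h (U y) = chi f y * chi h y * U y" by (simp add: mult.assoc)
qed

lemma B_sum_pr: assumes "b \<in> B" shows "b = (\<Sum>y\<in>N0. pr y b)"
proof -
  have "b = (\<Sum>y\<in>carrier G. pr y b)" using pr_sum[OF B_A[OF assms]] by simp
  also have "\<dots> = (\<Sum>y\<in>N0. pr y b)"
    by (rule sum.mono_neutral_right[OF fin_G]) (use pr_gB[OF _ assms] in \<open>auto simp: N0_def\<close>)
  finally show ?thesis .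
qed

text \<open>Componentwise \<open>f\<close> is the identity on \<open>B\<close>; since it commutes
  with the action and fixes \<open>e\<close>, \<open>faithful\<close> extends this to
  \<open>A\<close>.\<close>

lemma chi_trivial: assumes f: "f \<in> H" and c: "\<forall>y\<in>N0. chi f y = e" shows "f = idA"
proof -
  note t = Auts_e_taut[OF H_Auts_e[OF f]]
  have B: "f b = b" if b: "b \<in> B" for b
  proof -
    have p: "pr y b \<in> gB y" if "y \<in> N0" for y using pr_gB[OF N0_G[OF that] b] .
    have "f b = f (\<Sum>y\<in>N0. pr y b)" using B_sum_pr[OF b] by simp
    also have "\<dots> = (\<Sum>y\<in>N0. f (pr y b))" by (rule twisted_aut_sum[OF t]) (use p gB_A in blast)
    also have "\<dots> = (\<Sum>y\<in>N0. pr y b)"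
      by (intro sum.cong refl) (use chi_apply[OF f] p c gB_e in auto)
    finally show ?thesis using B_sum_pr[OF b] by simp
  qed
  show ?thesis
  proof (rule Auts_eqI[OF Auts_e_Auts[OF H_Auts_e[OF f]] idA_Auts])
    fix a assume a: "a \<in> A"
    have fa: "f a \<in> A" using twisted_aut_A[OF t a] .
    have "e * act g (f a - a) = 0" if g: "g \<in> carrier G" for g
    proof -
      have "e * act g (f a) = f (e * act g a)"
        using twisted_aut_mult[OF t e_A A_act[OF g a]] twisted_aut_act[OF t g a] Auts_e_e[OF H_Auts_e[OF f]] by simp
      also have "\<dots> = e * act g a" using B[OF e_B[OF A_act[OF g a]]] .
      finally show ?thesis by (simp add: act_diff right_diff_distrib)
    qed
    hence "f a - a = 0" using faithful[OF A_diff[OF fa a]] by blast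
    thus "f a = idA a" using a by (simp add: idA_def)
  qed
qed

definition kerH where "kerH = {y \<in> N0. \<forall>f\<in>H. chi f y = e}"

text \<open>Double counting of \<open>\<Sum>f\<in>H. \<Sum>y\<in>N0. chi f y\<close>: each inner sum vanishes unless the character is trivial.\<close>

lemma card_H_kerH: assumes finH: "finite H" shows "card H * card kerH = card N0"
proof -
  have c: "chi f y \<in> K" if "f \<in> H" "y \<in> N0" for f y using chi(1)[OF H_Auts_e] that by blast
  have r1: "(\<Sum>y\<in>N0. chi f y) = (if f = idA then j (of_nat (card N0)) * e else 0)" if f: "f \<in> H" for f
  proof (cases "f = idA")
    case True
    have "chi idA y = e" if "y \<in> N0" for y
      using chi_eqI[OF idA_H that U[OF that] e_K] gB_A[OF U(1)[OF that]] gB_e[OF U(1)[OF that]] by (simp add: idA_def)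
    thus ?thesis using True sum_const_j[OF e_A fin_N0] by simp
  next
    case False
    then obtain x where x: "x \<in> N0" "chi f x \<noteq> e" using chi_trivial[OF f] by blast
    have "bij_betw (\<lambda>y. x \<otimes> y) N0 N0"
    proof (rule bij_betw_byWitness[where f' = "\<lambda>y. inv x \<otimes> y"])
      show "\<forall>y\<in>N0. inv x \<otimes> (x \<otimes> y) = y" "\<forall>y\<in>N0. x \<otimes> (inv x \<otimes> y) = y"
        using N0_G x(1) by (auto simp: m_assoc[symmetric])
    qed (use N0_mult[OF x(1)] N0_mult[OF N0_inv[OF x(1)]] in auto)
    hence "(\<Sum>y\<in>N0. chi f y) = 0"
      by (rule K_char_sum[OF c[OF f x(1)] x(2)]) (use c[OF f] chi_mult[OF f x(1)] in auto)
    thus ?thesis using False by simp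
  qed
  have r2: "(\<Sum>f\<in>H. chi f y) = (if y \<in> kerH then j (of_nat (card H)) * e else 0)" if y: "y \<in> N0" for y
  proof (cases "y \<in> kerH")
    case True
    thus ?thesis using sum_const_j[OF e_A finH] by (simp add: kerH_def)
  next
    case False
    then obtain f where f: "f \<in> H" "chi f y \<noteq> e" using y by (auto simp: kerH_def)
    have HG: "H \<subseteq> Auts" using H_Auts_e Auts_e_Auts by blast
    have "bij_betw (cmp f) H H"
      by (rule bij_cmp[OF Auts_e_Auts[OF H_Auts_e[OF f(1)]] HG HG]) (use f(1) H_cmp H_ivs in blast)+
    hence "(\<Sum>f\<in>H. chi f y) = 0"
      by (rule K_char_sum[OF c[OF f(1) y] f(2)]) (use c[OF _ y] chi_cmp[OF f(1) _ y] in auto)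
    thus ?thesis using False by simp
  qed
  have "j (of_nat (card N0)) * e = (\<Sum>f\<in>H. if f = idA then j (of_nat (card N0)) * e else 0)"
    using idA_H finH by (simp add: sum.delta)
  also have "\<dots> = (\<Sum>f\<in>H. \<Sum>y\<in>N0. chi f y)" by (intro sum.cong refl) (simp add: r1)
  also have "\<dots> = (\<Sum>y\<in>N0. \<Sum>f\<in>H. chi f y)" by (rule sum.swap)
  also have "\<dots> = (\<Sum>y\<in>N0. if y \<in> kerH then j (of_nat (card H)) * e else 0)" by (intro sum.cong refl r2)
  also have "\<dots> = (\<Sum>y\<in>N0 \<inter> kerH. j (of_nat (card H)) * e)" by (rule sum.inter_restrict[OF fin_N0, symmetric])
  also have "N0 \<inter> kerH = kerH" by (auto simp: kerH_def)
  also have "(\<Sum>y\<in>kerH. j (of_nat (card H)) * e) = j (of_nat (card kerH)) * (j (of_nat (card H)) * e)"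
    by (rule sum_const_j) (use A_mult[OF A_j e_A] fin_N0 in \<open>auto simp: kerH_def\<close>)
  also have "\<dots> = j (of_nat (card kerH * card H)) * e" by (simp add: j_mult mult.assoc)
  \<comment> \<open>An equality between images of natural numbers in \<open>k\<close>, which
    characteristic zero lifts.\<close>
  finally have "(of_nat (card N0) :: 'k) = of_nat (card kerH * card H)" using j_mult_inj[OF e_A e0] by blast
  thus ?thesis using formally_real_of_nat_eq[OF fr] by (metis mult.commute)
qed

text \<open>-1 is not a square in \<open>k\<close>, so \<open>i\<close> is not a multiple of
  \<open>e\<close> by a scalar and some \<open>s\<close> moves it, by \<open>B_fixed\<close>; its
  image is the other root of \<open>- e\<close>.\<close>

lemma conjugation_exists:
  assumes i: "i \<in> K" "i * i = - e" shows "\<exists>s\<in>S. act s i = - i"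
proof -
  have iA: "i \<in> A" using K_A[OF i(1)] .
  have "\<exists>s\<in>S. act s i \<noteq> i"
  proof (rule ccontr)
    assume "\<not> ?thesis"
    then obtain c where c: "i = j c * e" using B_fixed[OF K_B[OF i(1)]] by blast
    hence "j (c * c) * e = j (- 1) * e" using i(2) e_A by (simp add: j_j_mult e_e j_minus j_1 u_l)
    hence "1 + c * c = 0" using j_mult_inj[OF e_A e0] by fastforce
    thus False using formally_real_add_neq_0[OF fr sum_of_squares_square] by blast
  qed
  then obtain s where s: "s \<in> S" "act s i \<noteq> i" by blast
  have "act s i * act s i = i * i"
    using act_mult[OF S_G[OF s(1)] iA iA] i(2) S_e[OF s(1)] by (simp add: act_minus)
  hence "act s i = - i" using K_square_eq[OF S_act_K[OF s(1) i(1)] i(1)] s(2) by blast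
  thus ?thesis using s(1) by blast
qed

text \<open>On \<open>K\<close> an automorphism is determined by whether it fixes or negates
  \<open>i\<close>, and \<open>S\<close> realizes both.\<close>

lemma Auts_e_restrict_K:
  assumes f: "f \<in> Auts_e" shows "\<exists>s\<in>S. \<forall>z\<in>K. f z = act s z"
proof -
  note t = Auts_e_taut[OF f]
  have fj: "f (j c * e) = j c * e" for c using twisted_aut_j_mult[OF t e_A] Auts_e_e[OF f] by simp
  from K_cases show ?thesis
  proof
    assume "\<forall>z\<in>K. \<exists>c. z = j c * e"
    hence "\<forall>z\<in>K. f z = act \<one> z" using fj act_one K_A by metis
    thus ?thesis using S_one by blast
  next
    assume "\<exists>i\<in>K. i * i = - e \<and> (\<forall>z\<in>K. \<exists>a b. z = j a * e + j b * i)"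
    then obtain i where i: "i \<in> K" "i * i = - e" and span: "\<And>z. z \<in> K \<Longrightarrow> \<exists>a b. z = j a * e + j b * i" by blast
    have iA: "i \<in> A" using K_A[OF i(1)] .
    have ext: "f z = act s z" if s: "s \<in> S" and eq: "f i = act s i" and z: "z \<in> K" for s z
    proof -
      obtain a b where z: "z = j a * e + j b * i" using span[OF z] by blast
      have "f z = f (j a * e) + f (j b * i)" unfolding z by (rule twisted_aut_add[OF t]) (use A_mult A_j e_A iA in auto)
      also have "\<dots> = j a * e + j b * act s i" using fj twisted_aut_j_mult[OF t iA] eq by simp
      also have "\<dots> = act s z" unfolding z act_add
        using act_j_mult[OF S_G[OF s]] e_A iA S_e[OF s] by simp
      finally show ?thesis .
    qed
    have pm: "w = i \<or> w = - i" if "w \<in> K" "w * w = - e" for w using K_square_eq[OF that(1) i(1)] that(2) i(2) by simp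
    have "f i * f i = f (- e)" using twisted_aut_mult[OF t iA iA] i(2) by simp
    also have "f (- e) = - e" using twisted_aut_minus[OF t e_A] Auts_e_e[OF f] by simp
    finally have "f i = i \<or> f i = - i" using pm[OF Auts_e_K[OF f i(1)]] by blast
    thus ?thesis
    proof
      assume "f i = i"
      thus ?thesis using ext[OF S_one] act_one[OF iA] S_one by auto
    next
      assume fi: "f i = - i"
      obtain s where s: "s \<in> S" "act s i = - i" using conjugation_exists[OF i] by blast
      thus ?thesis using ext[OF s(1)] fi s(1) by auto
    qed
  qed
qed

lemma torsor_structure:
  assumes cG: "card Auts = card (carrier G)"
  shows "\<And>t. t \<in> carrier G \<Longrightarrow> \<exists>f\<in>Auts. f e = act t e"
    and "\<And>s. s \<in> S \<Longrightarrow> \<exists>f\<in>Auts_e. \<forall>z\<in>K. f z = act s z"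
    and "N0 = N" and "kerH = {\<one>}"
proof -
  have cpos: "card (carrier G) > 0" using fin_G one_closed card_gt_0_iff by blast
  have finGam: "finite Auts" using cG cpos card_gt_0_iff by metis
  have finGe: "finite Auts_e" using finite_subset[OF _ finGam, of Auts_e] Auts_e_Auts by blast
  have finH: "finite H" using finite_subset[OF _ finGe, of H] H_Auts_e by blast
  \<comment> \<open>The value off \<open>K\<close> is pinned, so that equality of functions means
    equality of restrictions to \<open>K\<close>.\<close>
  define rs where "rs f = (\<lambda>z. if z \<in> K then f z else (undefined :: 'r))" for f :: "'r \<Rightarrow> 'r"
  have rs_eq: "rs f = rs h \<longleftrightarrow> (\<forall>z\<in>K. f z = h z)" for f h by (auto simp: rs_def fun_eq_iff)
  \<comment> \<open>\<open>Auts\<close> fibres over the images of \<open>e\<close> with stabilizer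
    \<open>Auts_e\<close>, which fibres over the restrictions to \<open>K\<close> with kernel
    \<open>H\<close>. The group is decomposed in parallel through \<open>S\<close> and
    \<open>N\<close>.\<close>
  have f1: "card Auts = card ((\<lambda>f. f e) ` Auts) * card Auts_e"
  proof (rule card_Auts_fibres)
    show "Auts \<subseteq> Auts" "finite Auts" "Auts_e \<subseteq> Auts" using finGam Auts_e_Auts by auto
    show "cmp f h \<in> Auts" if "f \<in> Auts" "h \<in> Auts" for f h using cmp_Auts that .
    show "ivs f \<in> Auts" if "f \<in> Auts" for f using ivs_Auts that .
    show "cmp f h e = f e" if "f \<in> Auts" "h \<in> Auts_e" for f h using Auts_e_e[OF that(2)] by (simp add: cmp_apply e_A)
    show "cmp (ivs f) h \<in> Auts_e" if "f \<in> Auts" "h \<in> Auts" "h e = f e" for f h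
      using ivs_apply(1)[OF that(1) e_A] that cmp_Auts[OF ivs_Auts] by (simp add: Auts_e_def cmp_apply e_A)
  qed
  have f2: "card Auts_e = card (rs ` Auts_e) * card H"
  proof (rule card_Auts_fibres)
    show "Auts_e \<subseteq> Auts" "finite Auts_e" "H \<subseteq> Auts_e" using finGe Auts_e_Auts H_Auts_e by auto
    show "cmp f h \<in> Auts_e" if "f \<in> Auts_e" "h \<in> Auts_e" for f h using Auts_e_cmp that .
    show "ivs f \<in> Auts_e" if "f \<in> Auts_e" for f using Auts_e_ivs that .
    show "rs (cmp f h) = rs f" if "f \<in> Auts_e" "h \<in> H" for f h
      unfolding rs_eq using H_K[OF that(2)] by (simp add: cmp_apply K_A)
    show "cmp (ivs f) h \<in> H" if "f \<in> Auts_e" "h \<in> Auts_e" "rs h = rs f" for f h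
      using that(3) ivs_apply(1)[OF Auts_e_Auts[OF that(1)] K_A] Auts_e_cmp[OF Auts_e_ivs[OF that(1)] that(2)]
      unfolding rs_eq by (simp add: H_def cmp_apply K_A)
  qed
  have f3: "card (carrier G) = card ((\<lambda>g. act g e) ` carrier G) * card S"
    by (rule card_action_fibres[OF subgroup_self e_A]) (auto simp: S_def)
  have f4: "card S = card ((\<lambda>s. rs (act s)) ` S) * card N"
  proof (rule card_fibres[OF fin_S])
    fix s assume s: "s \<in> S"
    have "bij_betw (\<lambda>t. s \<otimes> t) N {t \<in> S. rs (act t) = rs (act s)}"
    proof (rule bij_betw_byWitness[where f' = "\<lambda>t. inv s \<otimes> t"])
      show "\<forall>t\<in>N. inv s \<otimes> (s \<otimes> t) = t" "\<forall>t\<in>{t \<in> S. rs (act t) = rs (act s)}. s \<otimes> (inv s \<otimes> t) = t"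
        using S_G N_G s by (auto simp: m_assoc[symmetric])
      show "(\<lambda>t. s \<otimes> t) ` N \<subseteq> {t \<in> S. rs (act t) = rs (act s)}"
        unfolding rs_eq using S_mult[OF s] N_S act_act[OF S_G[OF s] N_G K_A] N_K by auto
      show "(\<lambda>t. inv s \<otimes> t) ` {t \<in> S. rs (act t) = rs (act s)} \<subseteq> N"
        unfolding rs_eq N_def
        using S_mult[OF S_inv[OF s]] act_act[OF S_G[OF S_inv[OF s]] S_G K_A] act_inv_act[OF S_G[OF s] K_A] by auto
    qed
    thus "card {t \<in> S. rs (act t) = rs (act s)} = card N" using bij_betw_same_card by fastforce
  qed
  have s1: "(\<lambda>f. f e) ` Auts \<subseteq> (\<lambda>g. act g e) ` carrier G"
  proof clarify
    fix f assume f: "f \<in> Auts"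
    obtain g where g: "g \<in> carrier G" "act g (f e) = e" using twisted_aut_e[OF Auts_taut[OF f]] by blast
    have "f e = act (inv g) e" using act_inv_act[OF g(1) twisted_aut_A[OF Auts_taut[OF f] e_A]] g(2) by simp
    thus "f e \<in> (\<lambda>g. act g e) ` carrier G" using g(1) by blast
  qed
  have s2: "rs ` Auts_e \<subseteq> (\<lambda>s. rs (act s)) ` S"
  proof clarify
    fix f assume "f \<in> Auts_e"
    then obtain s where "s \<in> S" "\<forall>z\<in>K. f z = act s z" using Auts_e_restrict_K by blast
    thus "rs f \<in> (\<lambda>s. rs (act s)) ` S" using rs_eq by blast
  qed
  have k: "card kerH > 0" "\<one> \<in> kerH" "finite kerH"
  proof -
    show one: "\<one> \<in> kerH" using N0_one chi_one by (simp add: kerH_def)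
    show fk: "finite kerH" using fin_N0 by (simp add: kerH_def)
    show "card kerH > 0" using one fk card_gt_0_iff by blast
  qed
  have hk: "card H * card kerH = card N0" by (rule card_H_kerH[OF finH])
  have "card N0 \<le> card N" using card_mono[OF fin_N N0_N] .
  moreover have "card H \<le> card N0" using hk k(1) by (metis One_nat_def Suc_leI mult.right_neutral mult_le_mono2)
  ultimately have hN: "card H \<le> card N" by simp
  note eqs = product_eq_imp_factors_eq[of "card ((\<lambda>f. f e) ` Auts)" "card (rs ` Auts_e)" "card H"
    "card ((\<lambda>g. act g e) ` carrier G)" "card ((\<lambda>s. rs (act s)) ` S)" "card N"]
  \<comment> \<open>Two threefold factorizations of the same number, with each factor on the left at
    most its counterpart on the right: all three pairs agree.\<close>
  have p: "card ((\<lambda>f. f e) ` Auts) * (card (rs ` Auts_e) * card H)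
     = card ((\<lambda>g. act g e) ` carrier G) * (card ((\<lambda>s. rs (act s)) ` S) * card N)"
    using f1 f2 f3 f4 cG by simp
  have le: "card ((\<lambda>f. f e) ` Auts) \<le> card ((\<lambda>g. act g e) ` carrier G)"
    "card (rs ` Auts_e) \<le> card ((\<lambda>s. rs (act s)) ` S)"
    using card_mono[OF _ s1] card_mono[OF _ s2] fin_G fin_S by auto
  have pos: "card ((\<lambda>g. act g e) ` carrier G) > 0" "card ((\<lambda>s. rs (act s)) ` S) > 0" "card N > 0"
    using f3 f4 cpos card_S by (auto intro: gr0I)
  note e3 = eqs[OF p le hN pos]
  have i1: "(\<lambda>f. f e) ` Auts = (\<lambda>g. act g e) ` carrier G"
    using card_subset_eq[OF _ s1] e3(1) fin_G by simp
  have i2: "rs ` Auts_e = (\<lambda>s. rs (act s)) ` S"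
    using card_subset_eq[OF _ s2] e3(2) fin_S by simp
  have kk: "card kerH = 1"
  proof -
    have "card N * card kerH \<le> card N * 1" using hk e3(3) \<open>card N0 \<le> card N\<close> by simp
    hence "card kerH \<le> 1" using pos(3) by simp
    thus ?thesis using k(1) by simp
  qed
  show "N0 = N" using card_subset_eq[OF fin_N N0_N] hk kk e3(3) by simp
  show "kerH = {\<one>}" using kk k(2) by (metis card_1_singletonE singletonD)
  show "\<exists>f\<in>Auts. f e = act t e" if "t \<in> carrier G" for t
    using i1 that by (metis (no_types, lifting) imageE imageI)
  show "\<exists>f\<in>Auts_e. \<forall>z\<in>K. f z = act s z" if "s \<in> S" for s
  proof -
    have "rs (act s) \<in> rs ` Auts_e" using i2 that by blast
    then obtain f where "f \<in> Auts_e" "rs (act s) = rs f" by blast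
    thus ?thesis unfolding rs_eq by auto
  qed
qed

end

section \<open>Crossed products\<close>

locale torsor = primitive_idempotent G A u j act P Q n e
  for G :: "'g monoid" (structure) and A :: "'r::ring set" and u and j :: "'k::field \<Rightarrow> 'r" and act and P Q n and e +
  assumes card_Auts: "card (Auts :: ('r \<Rightarrow> 'r) set) = card (carrier G)"
begin

lemma N0_eq: "N0 = N" by (rule torsor_structure(3)[OF card_Auts])

lemma U_N: "y \<in> N \<Longrightarrow> U y \<in> gB y" "y \<in> N \<Longrightarrow> U y \<noteq> 0" using U N0_eq by auto

lemma N_one: "\<one> \<in> N" using N0_one N0_eq by simp
lemma N_mult: "x \<in> N \<Longrightarrow> y \<in> N \<Longrightarrow> x \<otimes> y \<in> N" using N0_mult N0_eq by simp
lemma N_inv: "x \<in> N \<Longrightarrow> inv x \<in> N" using N0_inv N0_eq by simp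

lemma chi_K: "f \<in> H \<Longrightarrow> y \<in> N \<Longrightarrow> chi f y \<in> K" using chi(1)[OF H_Auts_e] N0_eq by simp
lemma chi_N_mult: "f \<in> H \<Longrightarrow> x \<in> N \<Longrightarrow> y \<in> N \<Longrightarrow> chi f (x \<otimes> y) = chi f x * chi f y"
  using chi_mult N0_eq by simp

lemma chi_separates:
  assumes x: "x \<in> N" and y: "y \<in> N" and c: "\<And>f. f \<in> H \<Longrightarrow> chi f x = chi f y" shows "x = y"
proof -
  have "chi f (x \<otimes> inv y) = e" if f: "f \<in> H" for f
  proof -
    have "chi f (x \<otimes> inv y) = chi f (y \<otimes> inv y)"
      using chi_N_mult[OF f x N_inv[OF y]] chi_N_mult[OF f y N_inv[OF y]] c[OF f] by simp
    thus ?thesis using chi_one[OF f] N_G[OF y] by simp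
  qed
  hence "x \<otimes> inv y \<in> kerH" using N_mult[OF x N_inv[OF y]] N0_eq by (simp add: kerH_def)
  hence "x \<otimes> inv y = \<one>" using torsor_structure(4)[OF card_Auts] by blast
  thus ?thesis using N_G[OF x] N_G[OF y] by (metis inv_closed inv_equality inv_inv)
qed

text \<open>The characters have values in the commutative \<open>K\<close> and cannot tell x y from
  y x; yet they separate the points of \<open>N\<close>.\<close>

lemma N_comm: assumes x: "x \<in> N" and y: "y \<in> N" shows "x \<otimes> y = y \<otimes> x"
  by (rule chi_separates[OF N_mult[OF x y] N_mult[OF y x]])
     (use chi_N_mult x y K_comm chi_K K_A in \<open>metis\<close>)

lemma chi_root: assumes f: "f \<in> H" and x: "x \<in> N" and c: "chi f x = j c * e" shows "c ^ card (carrier G) = 1"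
proof -
  have "x [^] m \<in> N \<and> chi f (x [^] m) = j (c ^ m) * e" for m :: nat
  proof (induction m)
    case 0 thus ?case using chi_one[OF f] N_one by (simp add: j_1 u_l e_A)
  next
    case (Suc m)
    hence "chi f (x [^] Suc m) = (j (c ^ m) * e) * (j c * e)" using chi_N_mult[OF f _ x] c by simp
    thus ?case using Suc N_mult[OF _ x] by (simp add: j_j_mult e_A e_e mult.commute)
  qed
  from this[of "card (carrier G)"] have "chi f \<one> = j (c ^ card (carrier G)) * e"
    using pow_order_eq_1[OF N_G[OF x]] by (simp add: Coset.order_def)
  hence "j (c ^ card (carrier G)) * e = j 1 * e" using chi_one[OF f] by (simp add: j_1 u_l e_A)
  thus ?thesis using j_mult_inj[OF e_A e0] by blast
qed

text \<open>If \<open>F\<close> induces the conjugation of \<open>K\<close> and \<open>F(v) = z v\<close>, then \<open>F(z) z\<close> is a norm and a root of unity, hence 1, and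
  Hilbert 90 rescales \<open>v\<close> to an \<open>F\<close>-invariant element.\<close>

lemma real_form_exists:
  "\<exists>F\<in>Auts_e. (\<forall>z\<in>K. F z = z \<longrightarrow> (\<exists>c. z = j c * e)) \<and> (\<forall>x\<in>N. \<exists>v\<in>gB x. v \<noteq> 0 \<and> F v = v)"
  using K_cases
proof
  assume "\<forall>z\<in>K. \<exists>c. z = j c * e"
  moreover have "\<exists>v\<in>gB x. v \<noteq> 0 \<and> idA v = v" if "x \<in> N" for x
    using U_N[OF that] gB_A by (intro bexI[of _ "U x"]) (auto simp: idA_def)
  ultimately show ?thesis using idA_Auts_e by blast
next
  assume "\<exists>i\<in>K. i * i = - e \<and> (\<forall>z\<in>K. \<exists>a b. z = j a * e + j b * i)"
  then obtain i where i: "i \<in> K" "i * i = - e" and span: "\<And>z. z \<in> K \<Longrightarrow> \<exists>a b. z = j a * e + j b * i" by blast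
  have iA: "i \<in> A" using K_A[OF i(1)] .
  obtain s where s: "s \<in> S" "act s i = - i" using conjugation_exists[OF i] by blast
  obtain F where F: "F \<in> Auts_e" and Fs: "\<And>z. z \<in> K \<Longrightarrow> F z = act s z"
    using torsor_structure(2)[OF card_Auts s(1)] by blast
  note t = Auts_e_taut[OF F]
  have Fz: "F (j a * e + j b * i) = j a * e - j b * i" for a b
  proof -
    have "j a * e + j b * i \<in> K" using K_add j_K j_mult_K[OF i(1)] by blast
    hence "F (j a * e + j b * i) = act s (j a * e + j b * i)" by (rule Fs)
    also have "\<dots> = j a * e - j b * i"
      using act_j_mult[OF S_G[OF s(1)]] e_A iA S_e[OF s(1)] s(2) by (simp add: act_add)
    finally show ?thesis .
  qed
  have "\<exists>c. z = j c * e" if z: "z \<in> K" "F z = z" for z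
  proof -
    obtain a b where ab: "z = j a * e + j b * i" using span[OF z(1)] by blast
    have "j a * e - j b * i = j a * e + j b * i" using z(2) Fz unfolding ab by simp
    hence "(j a * e + j b * i) - (j a * e - j b * i) = 0" by simp
    hence "j b * i + j b * i = 0" by (simp add: algebra_simps)
    hence "j (b + b) * i = j 0 * i" unfolding j_add distrib_right by simp
    moreover have "i \<noteq> 0" using i(2) e0 by auto
    ultimately have "b + b = 0" using j_mult_inj[OF iA] by blast
    hence "b = 0" using of_nat_neq_0[of 2] by (simp flip: mult_2)
    thus ?thesis using ab by auto
  qed
  moreover have "\<exists>v\<in>gB x. v \<noteq> 0 \<and> F v = v" if x: "x \<in> N" for x
  proof -
    note xG = N_G[OF x]
    define v where "v = U x"
    have v: "v \<in> gB x" "v \<noteq> 0" using U_N[OF x] by (auto simp: v_def)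
    have vA: "v \<in> A" using gB_A[OF v(1)] .
    obtain z where z: "z \<in> K" "F v = z * v" using gB_line[OF xG v Auts_e_gB[OF F xG v(1)]] by blast
    have zA: "z \<in> A" using K_A[OF z(1)] .
    have FzK: "F z \<in> K" using Auts_e_K[OF F z(1)] .
    have FFK: "F (F w) = w" if wK: "w \<in> K" for w
    proof -
      obtain a b where ab: "w = j a * e + j b * i" using span[OF wK] by blast
      have "F (j a * e - j b * i) = j a * e + j b * i" using Fz[of a "- b"] by (simp add: j_minus)
      thus ?thesis unfolding ab Fz .
    qed
    \<comment> \<open>\<open>F\<close> induces an involution of \<open>K\<close>, so its square lies
      in \<open>H\<close>; the scalar by which the square acts on \<open>v\<close> is the norm F(z)
      z.\<close>
    have h: "cmp F F \<in> H" using Auts_e_cmp[OF F F] FFK K_A by (simp add: H_def cmp_apply)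
    have hv: "cmp F F v = (F z * z) * v"
      using twisted_aut_mult[OF t zA vA] z(2) by (simp add: cmp_apply vA mult.assoc)
    have chi_h: "chi (cmp F F) x = F z * z"
      by (rule chi_eqI[OF h _ v _ hv]) (use x N0_eq K_mult[OF FzK z(1)] in auto)
    obtain a b where ab: "z = j a * e + j b * i" using span[OF z(1)] by blast
    have "F z * z = (j a * e - j b * i) * (j a * e + j b * i)" unfolding ab Fz ..
    also have "\<dots> = j (a * a + b * b) * e"
      using i K_e[OF i(1)] K_e'[OF i(1)]
      by (simp add: left_diff_distrib distrib_left j_j_mult e_A iA e_e j_add distrib_right mult.commute[of b a])
    finally have norm: "F z * z = j (a * a + b * b) * e" .
    obtain r where r: "a * a + b * b = r * r"
      using real_closed_sum_of_squares[OF rc sum_of_squares_add[OF sum_of_squares_square sum_of_squares_square]] by blast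
    have "(r * r) ^ card (carrier G) = 1" using chi_root[OF h x] chi_h norm r by simp
    \<comment> \<open>Roots of unity are known only to have square 1. That the norm is a square in
      \<open>k\<close> excludes -1, since 1 + r^2 is nonzero.\<close>
    hence "(r * r) * (r * r) = 1"
      by (rule formally_real_root_of_unity[OF fr]) (use fin_G one_closed card_gt_0_iff in blast)
    hence "(r * r - 1) * (1 + r * r) = 0" by (simp add: algebra_simps)
    hence "r * r = 1" using formally_real_add_neq_0[OF fr sum_of_squares_square[of r]] by simp
    hence zz: "F z * z = e" using norm r by (simp add: j_1 u_l e_A)
    show ?thesis
    \<comment> \<open>As F(z) z = e, multiplication by z + e makes \<open>v\<close> invariant,
      unless this multiplier is zero; in that case \<open>i\<close> serves, because \<open>F\<close>
      negates both \<open>i\<close> and \<open>v\<close>.\<close>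
    proof (cases "z = - e")
      case True
      have "F (i * v) = F i * F v" by (rule twisted_aut_mult[OF t iA vA])
      also have "F i = - i" using Fs[OF i(1)] s(2) by simp
      also have "F v = - v" using z(2) True gB_e[OF v(1)] by simp
      finally have "F (i * v) = i * v" by simp
      moreover have "i * v \<noteq> 0" using K_cancel[OF xG v i(1) K_0] i(2) e0 by auto
      ultimately show ?thesis using K_gB[OF xG i(1) v(1)] by blast
    next
      case False
      have zeK: "z + e \<in> K" using K_add z(1) e_K by blast
      have "F ((z + e) * v) = F (z + e) * F v" by (rule twisted_aut_mult[OF t K_A[OF zeK] vA])
      also have "F (z + e) = F z + e" using twisted_aut_add[OF t zA e_A] Auts_e_e[OF F] by simp
      also have "(F z + e) * F v = (F z * z) * v + (e * z) * v" unfolding z(2) by (simp add: distrib_right mult.assoc)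
      also have "\<dots> = (z + e) * v" using zz K_e[OF z(1)] by (simp add: distrib_right add.commute)
      finally have "F ((z + e) * v) = (z + e) * v" .
      moreover have "(z + e) * v \<noteq> 0"
        using K_cancel[OF xG v zeK K_0] False by (auto simp: eq_neg_iff_add_eq_0)
      ultimately show ?thesis using K_gB[OF xG zeK v(1)] by blast
    qed
  qed
  ultimately show ?thesis using F by blast
qed

text \<open>An \<open>x\<close> with a fixed vector on every line fixes \<open>B\<close> pointwise.
  Then \<open>U x\<close>, of degree \<open>x\<close>, commutes with \<open>A\<close> and so has
  degree 1 as well.\<close>

lemma trivial_action_imp_one:
  assumes x: "x \<in> N" and v: "\<And>y. y \<in> N \<Longrightarrow> \<exists>v\<in>gB y. v \<noteq> 0 \<and> act x v = v" shows "x = \<one>"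
proof -
  note xG = N_G[OF x]
  have B: "act x b = b" if b: "b \<in> B" for b
  proof -
    have "act x (pr y b) = pr y b" if y: "y \<in> N0" for y
    proof -
      obtain w where w: "w \<in> gB y" "w \<noteq> 0" "act x w = w" using v y N0_eq by blast
      obtain z where z: "z \<in> K" "pr y b = z * w" using gB_line[OF N0_G[OF y] w(1,2) pr_gB[OF N0_G[OF y] b]] by blast
      show ?thesis unfolding z(2) using act_mult[OF xG K_A[OF z(1)] gB_A[OF w(1)]] N_K[OF x z(1)] w(3) by simp
    qed
    hence "act x (\<Sum>y\<in>N0. pr y b) = (\<Sum>y\<in>N0. pr y b)" unfolding act_sum by (intro sum.cong refl)
    thus ?thesis using B_sum_pr[OF b] by simp
  qed
  define w where "w = U x"
  have w: "w \<in> gB x" "w \<noteq> 0" using U_N[OF x] by (auto simp: w_def)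
  have "w * a = a * w" if a: "a \<in> A" for a
  proof -
    have "w * a = w * (e * a)" using gB_e'[OF w(1)] by (simp add: mult.assoc[symmetric])
    also have "\<dots> = e * a * w" using gr_comm[OF gB_gr[OF w(1)] B_A[OF e_B[OF a]]] B[OF e_B[OF a]] by simp
    also have "\<dots> = a * w" using e_comm[OF a] gB_e[OF w(1)] by (simp add: mult.assoc)
    finally show ?thesis .
  qed
  hence "w \<in> gr \<one>" using Z_iff gB_A[OF w(1)] by blast
  thus ?thesis using gr_disjoint[OF xG one_closed gB_gr[OF w(1)] _ w(2)] by blast
qed

text \<open>The quotient of two \<open>F\<close>-invariant elements of a line is an
  \<open>F\<close>-invariant element of \<open>K\<close>, hence a scalar.\<close>

lemma real_scalar:
  assumes F: "F \<in> Auts_e" and fixK: "\<And>z. z \<in> K \<Longrightarrow> F z = z \<Longrightarrow> \<exists>c. z = j c * e"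
    and y: "y \<in> carrier G" and v: "v \<in> gB y" "v \<noteq> 0" "F v = v" and w: "w \<in> gB y" "F w = w"
  shows "\<exists>c. w = j c * v"
proof -
  obtain z where z: "z \<in> K" "w = z * v" using gB_line[OF y v(1,2) w(1)] by blast
  have "F z * v = z * v" using twisted_aut_mult[OF Auts_e_taut[OF F] K_A[OF z(1)] gB_A[OF v(1)]] v(3) w(2) z(2) by simp
  hence "F z = z" using K_cancel[OF y v(1,2) Auts_e_K[OF F z(1)] z(1)] by blast
  then obtain c where "z = j c * e" using fixK z(1) by blast
  hence "w = j c * v" using z(2) gB_e[OF v(1)] by (simp add: mult.assoc)
  thus ?thesis by blast
qed

lemma S_act_gB: assumes "s \<in> S" "y \<in> carrier G" "v \<in> gB y" shows "act s v \<in> gB (s \<otimes> y \<otimes> inv s)"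
  using gr_act[OF S_G[OF assms(1)] assms(2) gB_gr[OF assms(3)]] S_act_B[OF assms(1) gB_B[OF assms(3)]] B_e
  by (simp add: gB_def)

lemma Auts_e_act: "F \<in> Auts_e \<Longrightarrow> s \<in> S \<Longrightarrow> a \<in> A \<Longrightarrow> F (act s a) = act s (F a)"
  using twisted_aut_act[OF Auts_e_taut, of F s a] S_G by simp

lemma act_neq_0: "s \<in> carrier G \<Longrightarrow> v \<in> A \<Longrightarrow> v \<noteq> 0 \<Longrightarrow> act s v \<noteq> 0"
  using act_inj[of s v 0] by auto

lemma N_conj: "x \<in> N \<Longrightarrow> y \<in> N \<Longrightarrow> x \<otimes> y \<otimes> inv x = y"
  using N_comm[of x y] N_G by (simp add: m_assoc)

text \<open>On an \<open>F\<close>-invariant \<open>v\<close> the element \<open>x\<close> acts by a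
  scalar of \<open>k\<close> that is a root of unity and so has square 1. Hence x x acts trivially
  on every line.\<close>

lemma N_square: assumes x: "x \<in> N" shows "x \<otimes> x = \<one>"
proof (rule trivial_action_imp_one[OF N_mult[OF x x]])
  note xG = N_G[OF x] and xS = N_S[OF x]
  obtain F where F: "F \<in> Auts_e" and fixK: "\<And>z. z \<in> K \<Longrightarrow> F z = z \<Longrightarrow> \<exists>c. z = j c * e"
    and ex: "\<And>x. x \<in> N \<Longrightarrow> \<exists>v\<in>gB x. v \<noteq> 0 \<and> F v = v" using real_form_exists by blast
  fix y assume y: "y \<in> N"
  obtain v where v: "v \<in> gB y" "v \<noteq> 0" "F v = v" using ex[OF y] by blast
  have vA: "v \<in> A" using gB_A[OF v(1)] .
  have "act x v \<in> gB y" using S_act_gB[OF xS N_G[OF y] v(1)] N_conj[OF x y] by simp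
  moreover have "F (act x v) = act x v" using Auts_e_act[OF F xS vA] v(3) by simp
  ultimately obtain c where c: "act x v = j c * v" using real_scalar[OF F fixK N_G[OF y] v] by blast
  have "act (x [^] m) v = j (c ^ m) * v" for m :: nat
  proof (induction m)
    case 0 show ?case by (simp add: act_one vA j_1 u_l)
  next
    case (Suc m)
    have "act (x [^] Suc m) v = act (x [^] m) (j c * v)" using act_act[OF _ xG vA, of "x [^] m"] xG c by simp
    also have "\<dots> = j c * (j (c ^ m) * v)" using act_j_mult[of "x [^] m" v c] xG vA Suc by simp
    finally show ?case by (simp add: j_mult mult.assoc[symmetric])
  qed
  from this[of "card (carrier G)"] have "j (c ^ card (carrier G)) * v = j 1 * v"
    using pow_order_eq_1[OF xG] by (simp add: Coset.order_def act_one vA j_1 u_l)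
  hence "c ^ card (carrier G) = 1" using j_mult_inj[OF vA v(2)] by blast
  hence cc: "c * c = 1"
    by (rule formally_real_root_of_unity[OF fr]) (use fin_G one_closed card_gt_0_iff in blast)
  have "act (x \<otimes> x) v = act x (j c * v)" using act_act[OF xG xG vA] c by simp
  also have "\<dots> = j (c * c) * v" using act_j_mult[OF xG vA] c by (simp add: j_mult mult.assoc)
  finally have "act (x \<otimes> x) v = v" using cc by (simp add: j_1 u_l vA)
  thus "\<exists>v\<in>gB y. v \<noteq> 0 \<and> act (x \<otimes> x) v = v" using v by blast
qed

lemma twisted_automorphism:
  assumes t: "t \<in> carrier G" obtains \<psi> where "twisted_aut (\<lambda>g. t \<otimes> g \<otimes> inv t) \<psi>" "\<psi> e = e"
proof -
  have "inv t \<in> carrier G" using t by simp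
  then obtain f where f: "f \<in> Auts" "f e = act (inv t) e" using torsor_structure(1)[OF card_Auts] by blast
  have "twisted_aut ((\<lambda>g. t \<otimes> g \<otimes> inv t) \<circ> id) (act t \<circ> f)"
    by (rule twisted_aut_comp[OF twisted_aut_act_group[OF t] Auts_taut[OF f(1)]])
  moreover have "(act t \<circ> f) e = e" using f(2) act_act_inv[OF t e_A] by simp
  ultimately show ?thesis using that by simp
qed

text \<open>A twisted automorphism for \<open>t\<close> that fixes \<open>e\<close> carries the
  stabilizer of \<open>e\<close> to its conjugate by \<open>t\<close>. As it also maps
  \<open>K\<close> onto itself, the same argument serves for \<open>N\<close> below.\<close>

lemma conj_S: assumes t: "t \<in> carrier G" and s: "s \<in> S" shows "t \<otimes> s \<otimes> inv t \<in> S"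
proof -
  obtain p where p: "twisted_aut (\<lambda>g. t \<otimes> g \<otimes> inv t) p" "p e = e" using twisted_automorphism[OF t] .
  have "act (t \<otimes> s \<otimes> inv t) e = e" using twisted_aut_act[OF p(1) S_G[OF s] e_A] p(2) S_e[OF s] by simp
  thus ?thesis using t S_G[OF s] by (simp add: S_def)
qed

lemma conj_N: assumes t: "t \<in> carrier G" and s: "s \<in> N" shows "t \<otimes> s \<otimes> inv t \<in> N"
proof -
  obtain p where p: "twisted_aut (\<lambda>g. t \<otimes> g \<otimes> inv t) p" "p e = e" using twisted_automorphism[OF t] .
  have "act (t \<otimes> s \<otimes> inv t) z = z" if z: "z \<in> K" for z
  proof -
    obtain w where w: "w \<in> K" "p w = z" using twisted_aut_K_onto[OF p z] by blast
    show ?thesis using twisted_aut_act[OF p(1) N_G[OF s] K_A[OF w(1)]] N_K[OF s w(1)] w(2) by simp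
  qed
  thus ?thesis using conj_S[OF t N_S[OF s]] by (simp add: N_def)
qed

text \<open>In exponent two the characters take the values \<open>e\<close> and \<open>- e\<close>,
  which \<open>S\<close> fixes. So \<open>act s (U x)\<close>, whose degree is the conjugate of
  \<open>x\<close>, has the same characters as \<open>U x\<close>, and characters separate
  degrees.\<close>

lemma S_conj_N: assumes s: "s \<in> S" and x: "x \<in> N" shows "s \<otimes> x \<otimes> inv s = x"
proof (rule chi_separates[OF conj_N[OF S_G[OF s] x] x])
  fix f assume f: "f \<in> H"
  note xG = N_G[OF x] and sG = S_G[OF s] and c = chi_K[OF f x]
  have "chi f x * chi f x = e * e" using chi_N_mult[OF f x x] N_square[OF x] chi_one[OF f] e_e by simp
  hence "chi f x = e \<or> chi f x = - e" by (rule K_square_eq[OF c e_K])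
  hence ac: "act s (chi f x) = chi f x" using S_e[OF s] by (auto simp: act_minus)
  note U = U_N[OF x]
  show "chi f (s \<otimes> x \<otimes> inv s) = chi f x"
  proof (rule chi_eqI[OF f _ S_act_gB[OF s xG U(1)] act_neq_0[OF sG gB_A[OF U(1)] U(2)] c])
    show "s \<otimes> x \<otimes> inv s \<in> N0" using conj_N[OF sG x] N0_eq by simp
    have "f (act s (U x)) = act s (chi f x * U x)"
      using Auts_e_act[OF H_Auts_e[OF f] s gB_A[OF U(1)]] chi(2)[OF H_Auts_e[OF f]] x N0_eq by simp
    thus "f (act s (U x)) = chi f x * act s (U x)" using act_mult[OF sG K_A[OF c] gB_A[OF U(1)]] ac by simp
  qed
qed

lemma S_N_comm: assumes "s \<in> S" "x \<in> N" shows "s \<otimes> x = x \<otimes> s"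
  using S_conj_N[OF assms] S_G[OF assms(1)] N_G[OF assms(2)] by (metis inv_solve_right m_closed)

text \<open>\<open>S\<close> centralizes \<open>N\<close> and \<open>F\<close> commutes with the
  action, so both sides of each relation are \<open>F\<close>-invariant elements of one line; by
  \<open>real_scalar\<close> the constants lie in \<open>k\<close>.\<close>

lemma structure_constants_exist:
  "\<exists>F V sg gm. F \<in> Auts_e \<and> (\<forall>z\<in>K. F z = z \<longrightarrow> (\<exists>c. z = j c * e)) \<and> V \<one> = e \<and>
    (\<forall>x\<in>N. V x \<in> gB x \<and> V x \<noteq> 0 \<and> F (V x) = V x \<and> (V x * V x = e \<or> V x * V x = - e)) \<and>
    (\<forall>x\<in>N. \<forall>y\<in>N. V x * V y = j (sg x y) * V (x \<otimes> y)) \<and>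
    (\<forall>s\<in>S. \<forall>x\<in>N. act s (V x) = j (gm s x) * V x)"
proof -
  obtain F where F: "F \<in> Auts_e" and fixK: "\<And>z. z \<in> K \<Longrightarrow> F z = z \<Longrightarrow> \<exists>c. z = j c * e"
    and ex: "\<And>x. x \<in> N \<Longrightarrow> \<exists>v\<in>gB x. v \<noteq> 0 \<and> F v = v" using real_form_exists by blast
  note t = Auts_e_taut[OF F] and Fe = Auts_e_e[OF F]
  \<comment> \<open>The last clause fixes the choice at the identity; it normalizes the
    cocycle.\<close>
  have "\<exists>v\<in>gB x. v \<noteq> 0 \<and> F v = v \<and> (v * v = e \<or> v * v = - e) \<and> (x = \<one> \<longrightarrow> v = e)" if x: "x \<in> N" for x
  proof (cases "x = \<one>")
    case True
    thus ?thesis using e_K e0 Fe e_e by (intro bexI[of _ e]) (auto simp: gB_one)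
  next
    case False
    obtain v where v: "v \<in> gB x" "v \<noteq> 0" "F v = v" using ex[OF x] by blast
    have vA: "v \<in> A" using gB_A[OF v(1)] .
    have "v * v \<in> K" using gB_mult[OF N_G[OF x] N_G[OF x] v(1) v(1)] N_square[OF x] by (simp add: gB_one)
    moreover have "F (v * v) = v * v" using twisted_aut_mult[OF t vA vA] v(3) by simp
    ultimately obtain c where c: "v * v = j c * e" using fixK by blast
    have "v * v \<noteq> 0" using gB_mult_neq_0[OF N_G[OF x] v(1,2) gB_B[OF v(1)] v(2)] .
    hence c0: "c \<noteq> 0" using c by auto
    \<comment> \<open>Up to sign \<open>c\<close> is a square, so dividing \<open>v\<close> by the
      root leaves an element with square \<open>e\<close> or \<open>- e\<close>.\<close>
    obtain b where b: "c = b * b \<or> c = - (b * b)" using real_closed_cases[OF rc, of c] by blast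
    have b0: "b \<noteq> 0" using b c0 by auto
    define w where "w = j (1 / b) * v"
    have "w * w = j (1 / b * (1 / b)) * (j c * e)" unfolding w_def j_j_mult[OF vA] c ..
    also have "\<dots> = j (1 / b * (1 / b) * c) * e" by (simp only: j_mult mult.assoc)
    finally have "w * w = j (1 / b * (1 / b) * c) * e" .
    moreover have "1 / b * (1 / b) * c = 1 \<or> 1 / b * (1 / b) * c = - 1" using b b0 by auto
    ultimately have "w * w = e \<or> w * w = - e" by (auto simp: j_minus j_1 u_l e_A)
    moreover have "w \<noteq> 0" using j_mult_eq_0[of "1 / b" v] b0 vA v(2) by (auto simp: w_def)
    moreover have "w \<in> gB x" using K_gB[OF N_G[OF x] j_K[of "1 / b"] v(1)] gB_e[OF v(1)] by (simp add: w_def mult.assoc)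
    moreover have "F w = w" using twisted_aut_j_mult[OF t vA] v(3) by (simp add: w_def)
    ultimately show ?thesis using False by blast
  qed
  then obtain V where V: "\<And>x. x \<in> N \<Longrightarrow> V x \<in> gB x \<and> V x \<noteq> 0 \<and> F (V x) = V x \<and> (V x * V x = e \<or> V x * V x = - e) \<and> (x = \<one> \<longrightarrow> V x = e)"
    by metis
  have "\<exists>c. V x * V y = j c * V (x \<otimes> y)" if x: "x \<in> N" and y: "y \<in> N" for x y
  proof (rule real_scalar[OF F fixK m_closed[OF N_G[OF x] N_G[OF y]]])
    note Vx = V[OF x] and Vy = V[OF y] and Vxy = V[OF N_mult[OF x y]]
    show "V (x \<otimes> y) \<in> gB (x \<otimes> y)" "V (x \<otimes> y) \<noteq> 0" "F (V (x \<otimes> y)) = V (x \<otimes> y)" using Vxy by auto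
    show "V x * V y \<in> gB (x \<otimes> y)" using gB_mult[OF N_G[OF x] N_G[OF y]] Vx Vy by blast
    show "F (V x * V y) = V x * V y" using twisted_aut_mult[OF t, of "V x" "V y"] Vx Vy gB_A by metis
  qed
  then obtain sg where sg: "\<And>x y. x \<in> N \<Longrightarrow> y \<in> N \<Longrightarrow> V x * V y = j (sg x y) * V (x \<otimes> y)" by metis
  have "\<exists>c. act s (V x) = j c * V x" if s: "s \<in> S" and x: "x \<in> N" for s x
  proof (rule real_scalar[OF F fixK N_G[OF x]])
    note Vx = V[OF x]
    show "V x \<in> gB x" "V x \<noteq> 0" "F (V x) = V x" using Vx by auto
    show "act s (V x) \<in> gB x" using S_act_gB[OF s N_G[OF x], of "V x"] Vx S_conj_N[OF s x] by simp
    show "F (act s (V x)) = act s (V x)" using Auts_e_act[OF F s gB_A, of "V x" x] Vx by simp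
  qed
  then obtain gm where gm: "\<And>s x. s \<in> S \<Longrightarrow> x \<in> N \<Longrightarrow> act s (V x) = j (gm s x) * V x" by metis
  show ?thesis using F fixK V sg gm N_one by blast
qed

end

text \<open>Of the real form \<open>F\<close> only a consequence is retained: \<open>sg\<close> and
  \<open>gm\<close> take values in \<open>k\<close>.\<close>

locale crossed_product = torsor G A u j act P Q n e
  for G :: "'g monoid" (structure) and A :: "'r::ring set" and u and j :: "'k::field \<Rightarrow> 'r" and act and P Q n and e +
  fixes V :: "'g \<Rightarrow> 'r" and sg gm :: "'g \<Rightarrow> 'g \<Rightarrow> 'k"
  assumes V_1: "V \<one> = e" and V_gB: "\<And>x. x \<in> N \<Longrightarrow> V x \<in> gB x" and V_0: "\<And>x. x \<in> N \<Longrightarrow> V x \<noteq> 0"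
    and V_sq: "\<And>x. x \<in> N \<Longrightarrow> V x * V x = e \<or> V x * V x = - e"
    and sg: "\<And>x y. x \<in> N \<Longrightarrow> y \<in> N \<Longrightarrow> V x * V y = j (sg x y) * V (x \<otimes> y)"
    and gm: "\<And>s x. s \<in> S \<Longrightarrow> x \<in> N \<Longrightarrow> act s (V x) = j (gm s x) * V x"

lemma (in torsor) crossed_product_exists: "\<exists>V sg gm. crossed_product G A u j act P Q n e V sg gm"
  using structure_constants_exist
proof (elim exE conjE)
  fix F V sg gm
  assume 1: "V \<one> = e"
    and 2: "\<forall>x\<in>N. V x \<in> gB x \<and> V x \<noteq> 0 \<and> F (V x) = V x \<and> (V x * V x = e \<or> V x * V x = - e)"
    and 3: "\<forall>x\<in>N. \<forall>y\<in>N. V x * V y = j (sg x y) * V (x \<otimes> y)"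
    and 4: "\<forall>s\<in>S. \<forall>x\<in>N. act s (V x) = j (gm s x) * V x"
  have "crossed_product G A u j act P Q n e V sg gm"
    by unfold_locales (use 1 2 3 4 in blast)+
  thus ?thesis by blast
qed

section \<open>Identities for the structure constants\<close>

context crossed_product begin

lemma V_A: "x \<in> N \<Longrightarrow> V x \<in> A" using V_gB gB_A by blast
lemma V_B: "x \<in> N \<Longrightarrow> V x \<in> B" using V_gB gB_B by blast
lemma V_cancel: "x \<in> N \<Longrightarrow> j a * V x = j b * V x \<Longrightarrow> a = b"
  using j_mult_inj[OF V_A V_0] by blast
lemma V_K_cancel: "x \<in> N \<Longrightarrow> z \<in> K \<Longrightarrow> w \<in> K \<Longrightarrow> z * V x = w * V x \<Longrightarrow> z = w"
  using K_cancel[OF N_G V_gB V_0] by blast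
lemma V_mult_0: "x \<in> N \<Longrightarrow> y \<in> N \<Longrightarrow> V x * V y \<noteq> 0"
  using gB_mult_neq_0[OF N_G V_gB V_0 V_B V_0] .

lemma sg_0: "x \<in> N \<Longrightarrow> y \<in> N \<Longrightarrow> sg x y \<noteq> 0" using V_mult_0[of x y] sg[of x y] by auto
lemma gm_0: "s \<in> S \<Longrightarrow> x \<in> N \<Longrightarrow> gm s x \<noteq> 0"
  using act_neq_0[OF S_G V_A V_0, of s x] gm[of s x] by auto

lemma sg_one: assumes x: "x \<in> N" shows "sg \<one> x = 1" "sg x \<one> = 1"
proof -
  have "j (sg \<one> x) * V x = j 1 * V x" "j (sg x \<one>) * V x = j 1 * V x"
    using sg[OF N_one x] sg[OF x N_one] N_G[OF x] gB_e[OF V_gB[OF x]] gB_e'[OF V_gB[OF x]] V_A[OF x]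
    by (simp_all add: V_1 j_1 u_l)
  thus "sg \<one> x = 1" "sg x \<one> = 1" using V_cancel[OF x] by auto
qed

lemma gm_one: "x \<in> N \<Longrightarrow> gm \<one> x = 1" "s \<in> S \<Longrightarrow> gm s \<one> = 1"
proof -
  show "gm \<one> x = 1" if x: "x \<in> N"
    using gm[OF S_one x] V_cancel[OF x, of "gm \<one> x" 1] V_A[OF x] by (simp add: act_one j_1 u_l)
  show "gm s \<one> = 1" if s: "s \<in> S"
    using gm[OF s N_one] V_cancel[OF N_one, of "gm s \<one>" 1] S_e[OF s] e_A by (simp add: V_1 j_1 u_l)
qed

lemma sg_cocycle: assumes x: "x \<in> N" and y: "y \<in> N" and z: "z \<in> N"
  shows "sg x y * sg (x \<otimes> y) z = sg y z * sg x (y \<otimes> z)"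
proof -
  have "V x * V y * V z = j (sg x y) * (j (sg (x \<otimes> y) z) * V (x \<otimes> y \<otimes> z))"
    using sg[OF x y] sg[OF N_mult[OF x y] z] by (simp add: mult.assoc)
  moreover have "V x * (V y * V z) = j (sg y z) * (j (sg x (y \<otimes> z)) * V (x \<otimes> (y \<otimes> z)))"
    using sg[OF y z] sg[OF x N_mult[OF y z]] j_mult_comm[OF V_A[OF x]] by simp
  moreover have "x \<otimes> y \<otimes> z = x \<otimes> (y \<otimes> z)" using N_G x y z by (simp add: m_assoc)
  ultimately have "j (sg x y * sg (x \<otimes> y) z) * V (x \<otimes> y \<otimes> z) = j (sg y z * sg x (y \<otimes> z)) * V (x \<otimes> y \<otimes> z)"
    by (simp add: j_mult mult.assoc)
  thus ?thesis using V_cancel[OF N_mult[OF N_mult[OF x y] z]] by blast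
qed

lemma gm_mult_left: assumes s: "s \<in> S" and t: "t \<in> S" and x: "x \<in> N" shows "gm (s \<otimes> t) x = gm s x * gm t x"
proof -
  have "act (s \<otimes> t) (V x) = j (gm t x) * (j (gm s x) * V x)"
    using act_act[OF S_G[OF s] S_G[OF t] V_A[OF x]] gm[OF t x] gm[OF s x] act_j_mult[OF S_G[OF s] V_A[OF x]] by simp
  hence "j (gm (s \<otimes> t) x) * V x = j (gm t x * gm s x) * V x"
    using gm[OF S_mult[OF s t] x] by (simp add: j_mult mult.assoc)
  thus ?thesis using V_cancel[OF x] by (simp add: mult.commute)
qed

lemma gm_mult_right: assumes s: "s \<in> S" and x: "x \<in> N" and y: "y \<in> N" shows "gm s (x \<otimes> y) = gm s x * gm s y"
proof -
  have xy: "x \<otimes> y \<in> N" using N_mult[OF x y] .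
  have "act s (V x * V y) = (j (gm s x) * V x) * (j (gm s y) * V y)"
    using act_mult[OF S_G[OF s] V_A[OF x] V_A[OF y]] gm[OF s x] gm[OF s y] by simp
  also have "\<dots> = j (gm s x * gm s y) * (j (sg x y) * V (x \<otimes> y))"
    using j_j_mult[OF V_A[OF x]] sg[OF x y] by simp
  finally have "act s (j (sg x y) * V (x \<otimes> y)) = j (gm s x * gm s y) * (j (sg x y) * V (x \<otimes> y))"
    unfolding sg[OF x y] .
  hence "j (sg x y * gm s (x \<otimes> y)) * V (x \<otimes> y) = j (gm s x * gm s y * sg x y) * V (x \<otimes> y)"
    using act_j_mult[OF S_G[OF s] V_A[OF xy]] gm[OF s xy] by (simp add: j_mult mult.assoc)
  hence "sg x y * gm s (x \<otimes> y) = gm s x * gm s y * sg x y" using V_cancel[OF xy] by blast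
  thus ?thesis using sg_0[OF x y] by simp
qed

text \<open>By the definition of the grading, moving \<open>V x\<close> past \<open>V y\<close>
  amounts to the action of \<open>x\<close> on \<open>V y\<close>; so on \<open>N\<close> the action
  constants are the commutator pairing of \<open>sg\<close>.\<close>

lemma gm_alt: assumes x: "x \<in> N" and y: "y \<in> N" shows "gm x y * sg y x = sg x y"
proof -
  have "V x * V y = j (gm x y) * V y * V x"
    using gr_comm[OF gB_gr[OF V_gB[OF x]] V_A[OF y]] gm[OF N_S[OF x] y] by simp
  hence "j (sg x y) * V (x \<otimes> y) = j (gm x y * sg y x) * V (y \<otimes> x)"
    using sg[OF x y] sg[OF y x] by (simp add: j_mult mult.assoc)
  thus ?thesis using V_cancel[OF N_mult[OF x y]] N_comm[OF x y] by metis
qed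

text \<open>The product \<open>V x * V y * V (inv x)\<close> is expanded from the left, and again
  after moving \<open>V x\<close> past \<open>V y\<close>. This is the normalization in
  \<open>Z2S_n\<close>, and it identifies \<open>gm\<close> on \<open>N\<close> with
  \<open>gamma_sigma\<close>.\<close>

lemma gm_normal: assumes x: "x \<in> N" and y: "y \<in> N"
  shows "gm x y * sg x (inv x) = sg x y * sg (x \<otimes> y) (inv x)"
proof -
  note ix = N_inv[OF x]
  have "V x * V y * V (inv x) = j (sg x y * sg (x \<otimes> y) (inv x)) * V (x \<otimes> y \<otimes> inv x)"
    using sg[OF x y] sg[OF N_mult[OF x y] ix] by (simp add: j_mult mult.assoc)
  moreover have "V x * V y * V (inv x) = j (gm x y * sg x (inv x)) * V y"
  proof -
    have "V x * V y * V (inv x) = j (gm x y) * (V y * (V x * V (inv x)))"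
      using gr_comm[OF gB_gr[OF V_gB[OF x]] V_A[OF y]] gm[OF N_S[OF x] y] by (simp add: mult.assoc)
    also have "V x * V (inv x) = j (sg x (inv x)) * e" using sg[OF x ix] N_G[OF x] by (simp add: V_1)
    finally show ?thesis using j_mult_comm[OF V_A[OF y]] gB_e'[OF V_gB[OF y]] by (simp add: j_mult mult.assoc)
  qed
  ultimately show ?thesis using N_conj[OF x y] V_cancel[OF y] by simp
qed

lemma nondegenerate_left: assumes x: "x \<in> N" and c: "\<And>y. y \<in> N \<Longrightarrow> gm x y = 1" shows "x = \<one>"
proof (rule trivial_action_imp_one[OF x])
  fix y assume y: "y \<in> N"
  have "act x (V y) = V y" using gm[OF N_S[OF x] y] c[OF y] V_A[OF y] by (simp add: j_1 u_l)
  thus "\<exists>v\<in>gB y. v \<noteq> 0 \<and> act x v = v" using V_gB[OF y] V_0[OF y] by blast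
qed

lemma gm_square: assumes s: "s \<in> S" and x: "x \<in> N" shows "gm s x * gm s x = 1"
  using gm_mult_right[OF s x x] N_square[OF x] gm_one(2)[OF s] by simp

lemma nondegenerate_right: assumes y: "y \<in> N" and c: "\<And>x. x \<in> N \<Longrightarrow> gm x y = 1" shows "y = \<one>"
proof (rule nondegenerate_left[OF y])
  fix x assume x: "x \<in> N"
  have "sg y x = sg x y" using gm_alt[OF x y] c[OF x] by simp
  thus "gm y x = 1" using gm_alt[OF y x] sg_0[OF x y] by simp
qed

lemma nondegenerate: "non_degenerate G N sg"
  unfolding non_degenerate_def
proof (intro ballI impI)
  fix x assume x: "x \<in> N" and c: "\<forall>y\<in>N. x \<otimes> y = y \<otimes> x \<longrightarrow> sg x y = sg y x"
  show "x = \<one>"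
  proof (rule nondegenerate_left[OF x])
    fix y assume y: "y \<in> N"
    have "sg x y = sg y x" using c y N_comm[OF x y] by blast
    thus "gm x y = 1" using gm_alt[OF x y] sg_0[OF y x] by simp
  qed
qed

lemma minus_one_not_square: "a * a \<noteq> (- 1 :: 'k)"
  using formally_real_add_neq_0[OF fr sum_of_squares_square[of a]] by auto

lemma square_one: "a * a = (1 :: 'k) \<Longrightarrow> a = 1 \<or> a = - 1"
  using square_eq_1_iff[of a] by (simp add: power2_eq_square)

text \<open>The square of \<open>V x * V y\<close> is computed by commuting the middle factors and
  as sg^2 times the square of \<open>V (x \<otimes> y)\<close>. All other factors are signs, so sg^4
  = 1, and -1 is not a square in \<open>k\<close>.\<close>

lemma sg_values: assumes x: "x \<in> N" and y: "y \<in> N" shows "sg x y = 1 \<or> sg x y = - 1"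
proof -
  have xy: "x \<otimes> y \<in> N" using N_mult[OF x y] .
  have sq: "\<exists>c. V z * V z = j c * e \<and> c * c = 1" if "z \<in> N" for z
    using V_sq[OF that] by (metis e_A j_1 j_minus minus_mult_left minus_mult_minus mult.right_neutral u_l)
  obtain a where a: "V x * V x = j a * e" "a * a = 1" using sq[OF x] by blast
  obtain b where b: "V y * V y = j b * e" "b * b = 1" using sq[OF y] by blast
  obtain c where c: "V (x \<otimes> y) * V (x \<otimes> y) = j c * e" "c * c = 1" using sq[OF xy] by blast
  have "V x * V y * (V x * V y) = V x * (V y * V x) * V y" by (simp only: mult.assoc)
  also have "V y * V x = j (gm y x) * (V x * V y)"
    using gr_comm[OF gB_gr[OF V_gB[OF y]] V_A[OF x]] gm[OF N_S[OF y] x] by (simp add: mult.assoc)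
  also have "V x * (j (gm y x) * (V x * V y)) * V y = j (gm y x) * (V x * V x * (V y * V y))"
    using j_mult_comm[OF V_A[OF x]] by (simp add: mult.assoc)
  also have "\<dots> = j (gm y x * (a * b)) * e"
    unfolding a(1) b(1) j_j_mult[OF e_A] e_e by (simp add: j_mult mult.assoc)
  finally have 1: "V x * V y * (V x * V y) = j (gm y x * (a * b)) * e" .
  have "V x * V y * (V x * V y) = j (sg x y * sg x y) * (j c * e)"
    unfolding sg[OF x y] j_j_mult[OF V_A[OF xy]] c(1) ..
  hence "j (sg x y * sg x y * c) * e = j (gm y x * (a * b)) * e" using 1 by (simp add: j_mult mult.assoc)
  hence eq: "sg x y * sg x y * c = gm y x * (a * b)" using j_mult_inj[OF e_A e0] by blast
  have "sg x y * sg x y * (sg x y * sg x y) = (sg x y * sg x y * c) * (sg x y * sg x y * c)"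
    using c(2) by (simp add: mult_ac)
  also have "\<dots> = (gm y x * gm y x) * (a * a) * (b * b)" unfolding eq by (simp add: mult_ac)
  also have "\<dots> = 1" using gm_square[OF N_S[OF y] x] a b by simp
  finally have "sg x y * sg x y = 1 \<or> sg x y * sg x y = - 1" by (rule square_one)
  thus ?thesis using square_one minus_one_not_square by blast
qed

lemma cj_eq: "cj G t x = t \<otimes> x \<otimes> inv t" by (simp add: cj_def)

text \<open>A twisted automorphism \<open>p\<close> for \<open>t\<close> maps the line of degree
  \<open>x\<close> onto that of degree t x t^-1, so there \<open>V\<close> is the image under
  \<open>p\<close> of \<open>\<tau> x * V x\<close>. With \<open>\<tau>\<close> placed inside
  \<open>p\<close>, injectivity pulls every relation back to degrees before conjugation. The squares
  of \<open>\<tau>\<close> are signs because those of \<open>V\<close> are.\<close>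

lemma conjugation_cochain:
  assumes t: "t \<in> carrier G"
  shows "\<exists>\<tau>. \<tau> \<one> = e \<and> (\<forall>x\<in>N. \<tau> x \<in> K \<and> (\<tau> x * \<tau> x = e \<or> \<tau> x * \<tau> x = - e)) \<and>
    (\<forall>x\<in>N. \<forall>y\<in>N. \<tau> x * \<tau> y * j (sg x y) = j (sg (cj G t x) (cj G t y)) * \<tau> (x \<otimes> y)) \<and>
    (\<forall>s\<in>S. \<forall>x\<in>N. act s (\<tau> x) * j (gm s x) = j (gm (cj G t s) (cj G t x)) * \<tau> x)"
proof -
  obtain p where p: "twisted_aut (\<lambda>g. t \<otimes> g \<otimes> inv t) p" "p e = e" using twisted_automorphism[OF t] .
  have c: "cj G t x \<in> N" if "x \<in> N" for x using conj_N[OF t that] by (simp add: cj_eq)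
  have cS: "cj G t x \<in> S" if "x \<in> S" for x using conj_S[OF t that] by (simp add: cj_eq)
  have cm: "cj G t (x \<otimes> y) = cj G t x \<otimes> cj G t y" if "x \<in> N" "y \<in> N" for x y
    using t N_G[OF that(1)] N_G[OF that(2)] by (simp add: cj_eq m_assoc[symmetric]) (simp add: m_assoc)
  have c1: "cj G t \<one> = \<one>" using t by (simp add: cj_eq)
  have "\<exists>z\<in>K. V (cj G t x) = p (z * V x)" if x: "x \<in> N" for x
  proof -
    have pv: "p (V x) \<in> gB (cj G t x)" using twisted_aut_gB[OF p N_G[OF x] V_gB[OF x]] by (simp add: cj_eq)
    have "p (V x) \<noteq> 0" using twisted_aut_eq_0[OF p(1) V_A[OF x]] V_0[OF x] by simp
    then obtain w where w: "w \<in> K" "V (cj G t x) = w * p (V x)"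
      using gB_line[OF N_G[OF c[OF x]] pv _ V_gB[OF c[OF x]]] by blast
    obtain z where z: "z \<in> K" "p z = w" using twisted_aut_K_onto[OF p w(1)] by blast
    have "V (cj G t x) = p (z * V x)" using w(2) z(2) twisted_aut_mult[OF p(1) K_A[OF z(1)] V_A[OF x]] by simp
    thus ?thesis using z(1) by blast
  qed
  then obtain \<tau> where \<tau>: "\<And>x. x \<in> N \<Longrightarrow> \<tau> x \<in> K" "\<And>x. x \<in> N \<Longrightarrow> V (cj G t x) = p (\<tau> x * V x)" by metis
  have \<tau>A: "\<tau> x \<in> A" if "x \<in> N" for x using K_A[OF \<tau>(1)[OF that]] .
  have \<tau>V: "\<tau> x * V x \<in> A" if "x \<in> N" for x using A_mult[OF \<tau>A V_A] that by blast
  have prod: "\<tau> x * V x * (\<tau> y * V y) = \<tau> x * \<tau> y * (V x * V y)" if x: "x \<in> N" and y: "y \<in> N" for x y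
    using K_comm[OF \<tau>(1)[OF y] V_A[OF x]] by (metis mult.assoc)
  have one: "\<tau> \<one> = e"
  proof -
    have "p (\<tau> \<one> * e) = p e" using \<tau>(2)[OF N_one] p(2) by (simp add: c1 V_1)
    thus ?thesis using twisted_aut_inj[OF p(1) A_mult[OF \<tau>A[OF N_one] e_A] e_A] K_e'[OF \<tau>(1)[OF N_one]] by simp
  qed
  have pe: "p (- e) = - e" using twisted_aut_minus[OF p(1) e_A] p(2) by simp
  have sq: "\<tau> x * \<tau> x = e \<or> \<tau> x * \<tau> x = - e" if x: "x \<in> N" for x
  proof -
    have K2: "\<tau> x * \<tau> x \<in> K" using K_mult \<tau>(1)[OF x] by blast
    have "p (\<tau> x * \<tau> x * (V x * V x)) = V (cj G t x) * V (cj G t x)"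
      using twisted_aut_mult[OF p(1) \<tau>V[OF x] \<tau>V[OF x]] \<tau>(2)[OF x] prod[OF x x] by simp
    hence "p (\<tau> x * \<tau> x * (V x * V x)) = p e \<or> p (\<tau> x * \<tau> x * (V x * V x)) = p (- e)"
      using V_sq[OF c[OF x]] p(2) pe by simp
    moreover have "\<tau> x * \<tau> x * (V x * V x) \<in> A" using A_mult K_A[OF K2] V_A[OF x] by blast
    ultimately have "\<tau> x * \<tau> x * (V x * V x) = e \<or> \<tau> x * \<tau> x * (V x * V x) = - e"
      using twisted_aut_inj[OF p(1)] e_A A_minus[OF e_A] by blast
    moreover have "\<tau> x * \<tau> x * (V x * V x) = \<tau> x * \<tau> x \<or> \<tau> x * \<tau> x * (V x * V x) = - (\<tau> x * \<tau> x)"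
      using V_sq[OF x] K_e'[OF K2] by auto
    ultimately show ?thesis by (metis minus_minus)
  qed
  have mult: "\<tau> x * \<tau> y * j (sg x y) = j (sg (cj G t x) (cj G t y)) * \<tau> (x \<otimes> y)" if x: "x \<in> N" and y: "y \<in> N" for x y
  proof -
    have xy: "x \<otimes> y \<in> N" using N_mult[OF x y] .
    let ?d = "sg (cj G t x) (cj G t y)"
    have "p (\<tau> x * V x * (\<tau> y * V y)) = V (cj G t x) * V (cj G t y)"
      using twisted_aut_mult[OF p(1) \<tau>V[OF x] \<tau>V[OF y]] \<tau>(2)[OF x] \<tau>(2)[OF y] by simp
    also have "\<dots> = j ?d * p (\<tau> (x \<otimes> y) * V (x \<otimes> y))" using sg[OF c[OF x] c[OF y]] \<tau>(2)[OF xy] cm[OF x y] by simp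
    also have "\<dots> = p (j ?d * (\<tau> (x \<otimes> y) * V (x \<otimes> y)))" using twisted_aut_j_mult[OF p(1) \<tau>V[OF xy]] by simp
    finally have "\<tau> x * V x * (\<tau> y * V y) = j ?d * (\<tau> (x \<otimes> y) * V (x \<otimes> y))"
      using twisted_aut_inj[OF p(1)] A_mult \<tau>V[OF x] \<tau>V[OF y] \<tau>V[OF xy] A_j by simp
    hence "(\<tau> x * \<tau> y * j (sg x y)) * V (x \<otimes> y) = (j ?d * \<tau> (x \<otimes> y)) * V (x \<otimes> y)"
      unfolding prod[OF x y] sg[OF x y] by (simp only: mult.assoc)
    moreover have "\<tau> x * \<tau> y * j (sg x y) \<in> K"
      using j_mult_K[OF K_mult[OF \<tau>(1)[OF x] \<tau>(1)[OF y]]] j_comm[OF A_mult[OF \<tau>A[OF x] \<tau>A[OF y]]] by simp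
    ultimately show ?thesis using V_K_cancel[OF xy _ j_mult_K[OF \<tau>(1)[OF xy]]] by blast
  qed
  have "act s (\<tau> x) * j (gm s x) = j (gm (cj G t s) (cj G t x)) * \<tau> x" if s: "s \<in> S" and x: "x \<in> N" for s x
  proof -
    let ?d = "gm (cj G t s) (cj G t x)"
    have aK: "act s (\<tau> x) \<in> K" using S_act_K[OF s \<tau>(1)[OF x]] .
    have "p (act s (\<tau> x * V x)) = act (cj G t s) (V (cj G t x))"
      using twisted_aut_act[OF p(1) S_G[OF s] \<tau>V[OF x]] \<tau>(2)[OF x] by (simp add: cj_eq)
    also have "\<dots> = p (j ?d * (\<tau> x * V x))" using gm[OF cS[OF s] c[OF x]] twisted_aut_j_mult[OF p(1) \<tau>V[OF x]] \<tau>(2)[OF x] by simp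
    finally have "act s (\<tau> x * V x) = j ?d * (\<tau> x * V x)"
      using twisted_aut_inj[OF p(1)] A_act[OF S_G[OF s] \<tau>V[OF x]] A_mult[OF A_j \<tau>V[OF x]] by simp
    hence "(act s (\<tau> x) * j (gm s x)) * V x = (j ?d * \<tau> x) * V x"
      using act_mult[OF S_G[OF s] \<tau>A[OF x] V_A[OF x]] gm[OF s x] by (simp add: mult.assoc)
    moreover have "act s (\<tau> x) * j (gm s x) \<in> K" using j_mult_K[OF aK] j_comm[OF K_A[OF aK]] by simp
    ultimately show ?thesis using V_K_cancel[OF x _ j_mult_K[OF \<tau>(1)[OF x]]] by blast
  qed
  thus ?thesis using one \<tau>(1) sq mult by blast
qed

text \<open>An odd prime divisor \<open>p\<close> of the order would give a subgroup of order
  \<open>p\<close>, by Sylow's theorem with exponent 1; there x^p = 1 and x^2 = 1 force x =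
  1.\<close>

lemma card_N_power_of_two: "\<exists>m. card N = 2 ^ m"
proof -
  have "card N > 0" using fin_N N_one card_gt_0_iff by blast
  then obtain a m where am: "card N = 2 ^ a * m" "odd m" using nat_two_power_odd by blast
  have "m = 1"
  proof (rule ccontr)
    assume "m \<noteq> 1"
    then obtain p where p: "Factorial_Ring.prime p" "p dvd m" using prime_factor_nat by blast
    then obtain l where l: "card N = p ^ 1 * l" using am(1) by auto
    have "p \<noteq> 2" using p(2) am(2) by auto
    hence p2: "odd p" using p(1) prime_odd_nat prime_ge_2_nat by (metis le_neq_implies_less)
    obtain L where L: "subgroup L (G\<lparr>carrier := N\<rparr>)" "card L = p"
      using sylow_thm[OF p(1), of "G\<lparr>carrier := N\<rparr>" 1 l] subgroup_imp_group[OF N_subgroup] l fin_N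
      by (auto simp: Coset.order_def)
    have LG: "subgroup L G" using incl_subgroup[OF N_subgroup L(1)] .
    have LN: "L \<subseteq> N" using subgroup.subset[OF L(1)] by simp
    obtain x where x: "x \<in> L" "x \<noteq> \<one>"
    proof -
      have "card L \<noteq> 1" using L(2) p(1) by auto
      hence "L \<noteq> {\<one>}" by auto
      thus ?thesis using that subgroup.one_closed[OF LG] by blast
    qed
    have xN: "x \<in> N" using x LN by blast
    interpret L: Group.group "G\<lparr>carrier := L\<rparr>" by (rule subgroup_imp_group[OF LG])
    have pw: "x [^]\<^bsub>G\<lparr>carrier := L\<rparr>\<^esub> k = x [^] k" for k :: nat by (rule nat_pow_consistent[symmetric])
    have "x [^] p = \<one>" using L.pow_order_eq_1[of x] x(1) L(2) by (simp add: Coset.order_def pw)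
    moreover obtain k where "p = 2 * k + 1" using p2 oddE by blast
    moreover have "x [^] (2 * k + 1) = x" for k :: nat
      using N_square[OF xN] N_G[OF xN] by (induction k) (simp_all add: m_assoc)
    ultimately show False using x(2) by simp
  qed
  thus ?thesis using am(1) by auto
qed

end

section \<open>The induced algebra and the torsor data\<close>

context ring_with_action begin

definition galg_of :: "('k, 'r, 'g) galg" where
  "galg_of = \<lparr>acar = A, azero = 0, aone = u, aadd = (+), amul = (*), asmul = (\<lambda>c x. j c * x), aact = act\<rparr>"

lemma galg_of_simps [simp]:
  "acar galg_of = A" "azero galg_of = 0" "aone galg_of = u" "aadd galg_of = (+)"
  "amul galg_of = (*)" "asmul galg_of c x = j c * x" "aact galg_of = act"
  by (simp_all add: galg_of_def)

end

lemma (in ring_with_action) Auts_eq_aut_G: "Auts = aut_G G galg_of"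
proof -
  have "twisted_aut id f \<longleftrightarrow> bij_betw f A A \<and> galg_hom G galg_of galg_of f" for f
  proof
    assume t: "twisted_aut id f"
    have "f u = u" using twisted_aut_j[OF t, of 1] by (simp add: j_1)
    thus "bij_betw f A A \<and> galg_hom G galg_of galg_of f"
      using t twisted_aut_j_mult[OF t] by (simp add: twisted_aut_def galg_hom_def)
  next
    assume h: "bij_betw f A A \<and> galg_hom G galg_of galg_of f"
    have "f (j c) = j c" for c
    proof -
      have "f (j c * u) = j c * f u" "f u = u" using h A_u by (simp_all add: galg_hom_def)
      thus ?thesis using u_r[OF A_j] by simp
    qed
    thus "twisted_aut id f" using h by (simp add: twisted_aut_def galg_hom_def)
  qed
  thus ?thesis unfolding Auts_def aut_G_def galg_of_simps by auto
qed

context primitive_idempotent begin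

text \<open>An element \<open>a\<close> goes to the function with value c(e g(a)) at
  \<open>g\<close>. It is determined by these components through \<open>faithful\<close>, and
  multiplicativity holds because \<open>e\<close> is central.\<close>

lemma induced_iso:
  fixes T :: "('k, 'b, 'g) galg" and c :: "'r \<Rightarrow> 'b"
  assumes bij: "bij_betw c B (acar T)" and c_0: "c 0 = azero T" and c_e: "c e = aone T"
    and c_add: "\<And>x y. x \<in> B \<Longrightarrow> y \<in> B \<Longrightarrow> c (x + y) = aadd T (c x) (c y)"
    and c_mult: "\<And>x y. x \<in> B \<Longrightarrow> y \<in> B \<Longrightarrow> c (x * y) = amul T (c x) (c y)"
    and c_j: "\<And>a x. x \<in> B \<Longrightarrow> c (j a * x) = asmul T a (c x)"
    and c_act: "\<And>s x. s \<in> S \<Longrightarrow> x \<in> B \<Longrightarrow> c (act s x) = aact T s (c x)"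
  shows "galg_iso G galg_of (ind G S T)"
proof -
  define f where "f a = (\<lambda>g. if g \<in> carrier G then c (e * act g a) else azero T)" for a
  have cT: "c b \<in> acar T" if "b \<in> B" for b using bij that by (auto simp: bij_betw_def)
  have c_inj: "x = y" if "x \<in> B" "y \<in> B" "c x = c y" for x y using bij that by (auto simp: bij_betw_def inj_on_def)
  have eB: "e * act g a \<in> B" if "g \<in> carrier G" "a \<in> A" for g a using e_B A_act that by blast
  have S_eact: "e * act (s \<otimes> g) a = act s (e * act g a)" if s: "s \<in> S" and g: "g \<in> carrier G" and a: "a \<in> A" for s g a
    using act_mult[OF S_G[OF s] e_A A_act[OF g a]] S_e[OF s] act_act[OF S_G[OF s] g a] by simp
  have f_ind: "f a \<in> acar (ind G S T)" if a: "a \<in> A" for a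
    using cT eB[OF _ a] S_eact[OF _ _ a] c_act S_G by (auto simp: ind_def f_def)
  have "bij_betw f A (acar (ind G S T))"
    unfolding bij_betw_def
  proof
    show "inj_on f A"
    proof (rule inj_onI)
      fix a b assume a: "a \<in> A" and b: "b \<in> A" and eq: "f a = f b"
      have "e * act g (a - b) = 0" if g: "g \<in> carrier G" for g
      proof -
        have "c (e * act g a) = c (e * act g b)" using fun_cong[OF eq, of g] g by (simp add: f_def)
        hence "e * act g a = e * act g b" using c_inj eB g a b by blast
        thus ?thesis by (simp add: act_diff right_diff_distrib)
      qed
      hence "a - b = 0" using faithful[OF A_diff[OF a b]] by blast
      thus "a = b" by simp
    qed
    show "f ` A = acar (ind G S T)"
    proof
      show "f ` A \<subseteq> acar (ind G S T)" using f_ind by blast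
      show "acar (ind G S T) \<subseteq> f ` A"
      proof
        fix r assume "r \<in> acar (ind G S T)"
        hence r: "\<And>g. g \<in> carrier G \<Longrightarrow> r g \<in> acar T" "\<And>g. g \<notin> carrier G \<Longrightarrow> r g = azero T"
          "\<And>s g. s \<in> S \<Longrightarrow> g \<in> carrier G \<Longrightarrow> r (s \<otimes> g) = aact T s (r g)" by (auto simp: ind_def)
        have "\<exists>b\<in>B. c b = r g" if "g \<in> carrier G" for g using bij r(1)[OF that] unfolding bij_betw_def by (metis imageE)
        then obtain b where b: "\<And>g. g \<in> carrier G \<Longrightarrow> b g \<in> B" "\<And>g. g \<in> carrier G \<Longrightarrow> c (b g) = r g" by metis
        have bs: "b (s \<otimes> g) = act s (b g)" if s: "s \<in> S" and g: "g \<in> carrier G" for s g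
        proof (rule c_inj)
          have sg: "s \<otimes> g \<in> carrier G" using S_G[OF s] g by simp
          show "b (s \<otimes> g) \<in> B" using b(1)[OF sg] .
          show "act s (b g) \<in> B" using S_act_B[OF s b(1)[OF g]] .
          show "c (b (s \<otimes> g)) = c (act s (b g))" using b(2)[OF sg] b(2)[OF g] r(3)[OF s g] c_act[OF s b(1)[OF g]] by simp
        qed
        \<comment> \<open>The terms g^-1(b g) agree along the cosets S g, so each coset is counted
          |S| times, which the next factor corrects. In e h(a0) only the \<open>g\<close> in S h
          survive, each contributing b h.\<close>
        define a0 where "a0 = (\<Sum>g\<in>carrier G. act (inv g) (b g))"
        define a where "a = j (1 / of_nat (card S)) * a0"
        have a0A: "a0 \<in> A" unfolding a0_def by (intro A_sum A_act B_A b(1)) auto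
        have aA: "a \<in> A" unfolding a_def using A_mult[OF A_j a0A] .
        have "e * act h a = b h" if h: "h \<in> carrier G" for h
        proof -
          have trm: "e * act h (act (inv g) (b g)) = (if g \<in> (\<lambda>s. inv s \<otimes> h) ` S then b h else 0)"
            if g: "g \<in> carrier G" for g
          proof -
            have hg: "h \<otimes> inv g \<in> carrier G" using h g by simp
            have "e * act h (act (inv g) (b g)) = (if h \<otimes> inv g \<in> S then act (h \<otimes> inv g) (b g) else 0)"
              using act_act[OF h inv_closed[OF g] B_A[OF b(1)[OF g]]] e_act[OF hg b(1)[OF g]] by simp
            moreover have "act (h \<otimes> inv g) (b g) = b h" if "h \<otimes> inv g \<in> S"
              using bs[OF that g] h g by (simp add: m_assoc)
            moreover have "h \<otimes> inv g \<in> S \<longleftrightarrow> g \<in> (\<lambda>s. inv s \<otimes> h) ` S"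
            proof
              assume s: "h \<otimes> inv g \<in> S"
              have "g = inv (h \<otimes> inv g) \<otimes> h" using h g by (simp add: inv_mult_group m_assoc)
              thus "g \<in> (\<lambda>s. inv s \<otimes> h) ` S" using s by blast
            next
              assume "g \<in> (\<lambda>s. inv s \<otimes> h) ` S"
              then obtain s where s: "s \<in> S" "g = inv s \<otimes> h" by blast
              have "h \<otimes> inv g = s" unfolding s(2) using h S_G[OF s(1)] by (simp add: inv_mult_group m_assoc[symmetric])
              thus "h \<otimes> inv g \<in> S" using s(1) by simp
            qed
            ultimately show ?thesis by simp
          qed
          have inj: "inj_on (\<lambda>s. inv s \<otimes> h) S"
          proof (rule inj_onI)
            fix x y assume "x \<in> S" "y \<in> S" "inv x \<otimes> h = inv y \<otimes> h"
            thus "x = y" using S_G h r_cancel[of "inv x" h "inv y"] inv_inj by (metis inv_closed inv_inv)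
          qed
          have sub: "(\<lambda>s. inv s \<otimes> h) ` S \<subseteq> carrier G" using S_G h by auto
          have "e * act h a0 = (\<Sum>g\<in>carrier G. if g \<in> (\<lambda>s. inv s \<otimes> h) ` S then b h else 0)"
            unfolding a0_def act_sum sum_distrib_left by (intro sum.cong refl trm)
          also have "\<dots> = (\<Sum>g\<in>carrier G \<inter> (\<lambda>s. inv s \<otimes> h) ` S. b h)"
            by (rule sum.inter_restrict[OF fin_G, symmetric])
          also have "carrier G \<inter> (\<lambda>s. inv s \<otimes> h) ` S = (\<lambda>s. inv s \<otimes> h) ` S" using sub by blast
          also have "(\<Sum>g\<in>(\<lambda>s. inv s \<otimes> h) ` S. b h) = j (of_nat (card S)) * b h"
            using sum_const_j[OF B_A[OF b(1)[OF h]], of "(\<lambda>s. inv s \<otimes> h) ` S"] fin_S card_image[OF inj] by simp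
          finally have "j (1 / of_nat (card S)) * (e * act h a0) = b h"
            using j_cancel[OF of_nat_neq_0[OF card_S] B_A[OF b(1)[OF h]]] by simp
          thus ?thesis unfolding a_def using act_j_mult[OF h a0A] j_mult_comm[OF e_A] by simp
        qed
        hence "f a = r" using b(2) r(2) by (auto simp: f_def fun_eq_iff)
        thus "r \<in> f ` A" using aA by blast
      qed
    qed
  qed
  moreover have "galg_hom G galg_of (ind G S T) f"
  proof -
    have add: "f (x + y) = aadd (ind G S T) (f x) (f y)" if x: "x \<in> A" and y: "y \<in> A" for x y
    proof (rule ext)
      fix g show "f (x + y) g = aadd (ind G S T) (f x) (f y) g"
        using eB[OF _ x, of g] eB[OF _ y, of g] by (auto simp: ind_def f_def act_add distrib_left c_add)
    qed
    have mult: "f (x * y) = amul (ind G S T) (f x) (f y)" if x: "x \<in> A" and y: "y \<in> A" for x y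
    proof (rule ext)
      fix g show "f (x * y) g = amul (ind G S T) (f x) (f y) g"
      proof (cases "g \<in> carrier G")
        case True
        have "e * act g (x * y) = (e * act g x) * (e * act g y)"
        proof -
          have "(e * act g x) * (e * act g y) = e * (act g x * e) * act g y" by (simp only: mult.assoc)
          also have "act g x * e = e * act g x" using e_comm[OF A_act[OF True x]] by simp
          finally show ?thesis using act_mult[OF True x y] by (simp add: mult.assoc e_e_mult)
        qed
        thus ?thesis using True c_mult[OF eB[OF True x] eB[OF True y]] by (simp add: ind_def f_def)
      qed (simp add: ind_def f_def)
    qed
    have one: "f u = aone (ind G S T)"
      using act_u u_r[OF e_A] c_e by (auto simp: ind_def f_def fun_eq_iff)
    have smul: "f (j a * x) = asmul (ind G S T) a (f x)" if x: "x \<in> A" for a x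
    proof (rule ext)
      fix g show "f (j a * x) g = asmul (ind G S T) a (f x) g"
        using c_j[OF eB[OF _ x], of g a] act_j_mult[OF _ x, of g a] j_mult_comm[OF e_A]
        by (simp add: ind_def f_def)
    qed
    have act: "f (act g x) = aact (ind G S T) g (f x)" if g: "g \<in> carrier G" and x: "x \<in> A" for g x
    proof (rule ext)
      fix h show "f (act g x) h = aact (ind G S T) g (f x) h"
        using act_act[OF _ g x, of h] g by (simp add: ind_def f_def)
    qed
    show ?thesis unfolding galg_hom_def galg_of_simps using add mult one smul act by blast
  qed
  ultimately show ?thesis unfolding galg_iso_def galg_of_simps by blast
qed

end

section \<open>Twisted group algebras; the case \<open>K = k\<close>\<close>

context crossed_product begin

text \<open>The coefficient type is abstract and \<open>\<kappa>\<close> identifies it with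
  \<open>K\<close>, so one computation covers \<open>k\<close> and \<open>k(i)\<close>. The sum of
  the \<kappa>(f x) V x is inverted by the projections of the grading. \<open>gm'\<close> agrees
  with \<open>gm\<close> only where it is evaluated, as \<open>gamma_sigma\<close> does.\<close>

lemma twisted_iso:
  fixes \<kappa> :: "'c::comm_monoid_add \<Rightarrow> 'r" and cm :: "'c \<Rightarrow> 'c \<Rightarrow> 'c" and ce :: "'k \<Rightarrow> 'c"
  assumes bij: "bij_betw \<kappa> UNIV K" and \<kappa>_0: "\<kappa> 0 = 0" and \<kappa>_add: "\<And>z w. \<kappa> (z + w) = \<kappa> z + \<kappa> w"
    and \<kappa>_mult: "\<And>z w. \<kappa> (cm z w) = \<kappa> z * \<kappa> w" and \<kappa>_ce: "\<And>a. \<kappa> (ce a) = j a * e"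
    and \<kappa>_bar: "\<And>s z. s \<in> S \<Longrightarrow> \<kappa> (bar s z) = act s (\<kappa> z)"
    and gm': "\<And>s x. s \<in> S \<Longrightarrow> x \<in> N \<Longrightarrow> gm' s x = gm s x"
  shows "galg_iso G galg_of (ind G S (twisted_alg G N cm ce bar sg gm'))"
proof -
  define T where "T = twisted_alg G N cm ce bar sg gm'"
  define h where "h f = (\<Sum>x\<in>N. \<kappa> (f x) * V x)" for f
  have \<kappa>K: "\<kappa> z \<in> K" for z using bij by (auto simp: bij_betw_def)
  have \<kappa>A: "\<kappa> z \<in> A" for z using K_A \<kappa>K .
  have \<kappa>_inj: "\<kappa> z = \<kappa> w \<longleftrightarrow> z = w" for z w using bij by (auto simp: bij_betw_def inj_on_def)
  have acarT: "acar T = {f. \<forall>z. z \<notin> N \<longrightarrow> f z = 0}" by (simp add: T_def twisted_alg_def)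
  have tgB: "\<kappa> z * V x \<in> gB x" if "x \<in> N" for x z using K_gB[OF N_G[OF that] \<kappa>K V_gB[OF that]] .
  have hB: "h f \<in> B" for f unfolding h_def by (rule B_sum) (rule gB_B[OF tgB])
  have pr_h: "pr x (h f) = \<kappa> (f x) * V x" if x: "x \<in> N" for x f
  proof -
    have "pr x (h f) = (\<Sum>y\<in>N. pr x (\<kappa> (f y) * V y))" unfolding h_def pr_sum_distrib ..
    also have "\<dots> = (\<Sum>y\<in>N. if x = y then \<kappa> (f x) * V x else 0)"
      by (intro sum.cong refl) (use pr_gr_eq[OF N_G N_G[OF x] gB_gr[OF tgB]] in auto)
    also have "\<dots> = \<kappa> (f x) * V x" using fin_N x by simp
    finally show ?thesis .
  qed
  have h_bij: "bij_betw h (acar T) B"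
    unfolding bij_betw_def
  proof
    show "inj_on h (acar T)"
    proof (rule inj_onI)
      fix f f' assume f: "f \<in> acar T" "f' \<in> acar T" "h f = h f'"
      show "f = f'"
      proof (rule ext)
        fix x show "f x = f' x"
        proof (cases "x \<in> N")
          case True
          hence "\<kappa> (f x) * V x = \<kappa> (f' x) * V x" using pr_h f(3) by metis
          thus ?thesis using V_K_cancel[OF True \<kappa>K \<kappa>K] \<kappa>_inj by blast
        next
          case False
          thus ?thesis using f acarT by auto
        qed
      qed
    qed
    show "h ` acar T = B"
    proof
      show "h ` acar T \<subseteq> B" using hB by blast
      show "B \<subseteq> h ` acar T"
      proof
        fix b assume b: "b \<in> B"
        have "\<exists>z. pr x b = \<kappa> z * V x" if x: "x \<in> N" for x
        proof -
          obtain z where z: "z \<in> K" "pr x b = z * V x"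
            using gB_line[OF N_G[OF x] V_gB[OF x] V_0[OF x] pr_gB[OF N_G[OF x] b]] by blast
          thus ?thesis using bij unfolding bij_betw_def by (metis imageE)
        qed
        then obtain f where f: "\<And>x. x \<in> N \<Longrightarrow> pr x b = \<kappa> (f x) * V x" by metis
        define f' where "f' x = (if x \<in> N then f x else 0)" for x
        have "b = (\<Sum>x\<in>N. pr x b)" using B_sum_pr[OF b] N0_eq by simp
        also have "\<dots> = h f'" unfolding h_def by (intro sum.cong refl) (simp add: f f'_def)
        finally have "b = h f'" .
        moreover have "f' \<in> acar T" by (simp add: acarT f'_def)
        ultimately show "b \<in> h ` acar T" by blast
      qed
    qed
  qed
  have h_add: "h (aadd T f f') = h f + h f'" for f f'
    by (simp add: h_def T_def twisted_alg_def \<kappa>_add distrib_right sum.distrib)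
  have h_one: "h (aone T) = e"
  proof -
    have "h (aone T) = (\<Sum>x\<in>N. if x = \<one> then e else 0)"
      unfolding h_def by (intro sum.cong refl)
        (auto simp: T_def twisted_alg_def \<kappa>_ce \<kappa>_0 j_1 u_l e_A V_1 e_e)
    thus ?thesis using fin_N N_one by simp
  qed
  have h_smul: "h (asmul T a f) = j a * h f" for a f
    unfolding h_def sum_distrib_left
    by (intro sum.cong refl) (simp add: T_def twisted_alg_def \<kappa>_mult \<kappa>_ce j_e_mult[OF \<kappa>K] mult.assoc[of "j a"])
  have h_act: "h (aact T s f) = act s (h f)" if s: "s \<in> S" for s f
    unfolding h_def act_sum
  proof (intro sum.cong refl)
    fix x assume x: "x \<in> N"
    \<comment> \<open>\<open>S\<close> centralizes \<open>N\<close>, so the conjugated argument in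
      the action is \<open>x\<close> itself.\<close>
    have sx: "inv s \<otimes> x \<otimes> s = x" using S_conj_N[OF S_inv[OF s] x] S_G[OF s] by simp
    have "\<kappa> (aact T s f x) * V x = act s (\<kappa> (f x)) * (j (gm s x) * e) * V x"
      using x sx gm'[OF s x] by (simp add: T_def twisted_alg_def \<kappa>_mult \<kappa>_ce \<kappa>_bar[OF s])
    also have "\<dots> = act s (\<kappa> (f x)) * act s (V x)"
      using gm[OF s x] gB_e[OF V_gB[OF x]] by (simp add: mult.assoc)
    finally show "\<kappa> (aact T s f x) * V x = act s (\<kappa> (f x) * V x)"
      using act_mult[OF S_G[OF s] \<kappa>A V_A[OF x]] by simp
  qed
  have \<kappa>_sum: "\<kappa> (sum w I) = (\<Sum>i\<in>I. \<kappa> (w i))" for w :: "'g \<Rightarrow> 'c" and I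
    by (induction I rule: infinite_finite_induct) (auto simp: \<kappa>_0 \<kappa>_add)
  have h_mult: "h (amul T f f') = h f * h f'" for f f'
  proof -
    have "h (amul T f f') = (\<Sum>z\<in>N. \<Sum>x\<in>N. \<kappa> (f x) * \<kappa> (f' (inv x \<otimes> z)) * (j (sg x (inv x \<otimes> z)) * e) * V z)"
      unfolding h_def by (intro sum.cong refl)
        (simp add: T_def twisted_alg_def \<kappa>_sum \<kappa>_mult \<kappa>_ce sum_distrib_right)
    also have "\<dots> = (\<Sum>x\<in>N. \<Sum>z\<in>N. \<kappa> (f x) * \<kappa> (f' (inv x \<otimes> z)) * (j (sg x (inv x \<otimes> z)) * e) * V z)"
      by (rule sum.swap)
    also have "\<dots> = (\<Sum>x\<in>N. \<Sum>y\<in>N. (\<kappa> (f x) * V x) * (\<kappa> (f' y) * V y))"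
    proof (rule sum.cong[OF refl])
      fix x assume x: "x \<in> N"
      have xG: "x \<in> carrier G" using N_G[OF x] .
      have b: "bij_betw (\<lambda>y. x \<otimes> y) N N"
      proof (rule bij_betw_byWitness[where f' = "\<lambda>y. inv x \<otimes> y"])
        show "\<forall>y\<in>N. inv x \<otimes> (x \<otimes> y) = y" "\<forall>y\<in>N. x \<otimes> (inv x \<otimes> y) = y"
          using N_G xG by (auto simp: m_assoc[symmetric])
      qed (use N_mult[OF x] N_mult[OF N_inv[OF x]] in auto)
      have "(\<Sum>z\<in>N. \<kappa> (f x) * \<kappa> (f' (inv x \<otimes> z)) * (j (sg x (inv x \<otimes> z)) * e) * V z)
        = (\<Sum>y\<in>N. \<kappa> (f x) * \<kappa> (f' (inv x \<otimes> (x \<otimes> y))) * (j (sg x (inv x \<otimes> (x \<otimes> y))) * e) * V (x \<otimes> y))"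
        by (rule sum.reindex_bij_betw[OF b, symmetric])
      also have "\<dots> = (\<Sum>y\<in>N. (\<kappa> (f x) * V x) * (\<kappa> (f' y) * V y))"
      proof (intro sum.cong refl)
        fix y assume y: "y \<in> N"
        have c: "inv x \<otimes> (x \<otimes> y) = y" using xG N_G[OF y] by (simp add: m_assoc[symmetric])
        have "(\<kappa> (f x) * V x) * (\<kappa> (f' y) * V y) = \<kappa> (f x) * (V x * \<kappa> (f' y)) * V y" by (simp only: mult.assoc)
        also have "V x * \<kappa> (f' y) = \<kappa> (f' y) * V x" using K_comm[OF \<kappa>K V_A[OF x]] by simp
        also have "\<kappa> (f x) * (\<kappa> (f' y) * V x) * V y = \<kappa> (f x) * \<kappa> (f' y) * (V x * V y)" by (simp only: mult.assoc)
        also have "\<dots> = \<kappa> (f x) * \<kappa> (f' y) * (j (sg x y) * e) * V (x \<otimes> y)"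
          unfolding sg[OF x y] using gB_e[OF V_gB[OF N_mult[OF x y]]] by (simp add: mult.assoc)
        finally show "\<kappa> (f x) * \<kappa> (f' (inv x \<otimes> (x \<otimes> y))) * (j (sg x (inv x \<otimes> (x \<otimes> y))) * e) * V (x \<otimes> y)
          = (\<kappa> (f x) * V x) * (\<kappa> (f' y) * V y)" unfolding c by simp
      qed
      finally show "(\<Sum>z\<in>N. \<kappa> (f x) * \<kappa> (f' (inv x \<otimes> z)) * (j (sg x (inv x \<otimes> z)) * e) * V z)
        = (\<Sum>y\<in>N. (\<kappa> (f x) * V x) * (\<kappa> (f' y) * V y))" .
    qed
    also have "\<dots> = h f * h f'" unfolding h_def by (rule sum_product[symmetric])
    finally show ?thesis .
  qed
  have cl: "aadd T f f' \<in> acar T" "amul T f f' \<in> acar T" "asmul T a f \<in> acar T" "aone T \<in> acar T"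
     "aact T s f \<in> acar T" "azero T \<in> acar T" if "f \<in> acar T" "f' \<in> acar T" for f f' a s
    using that N_one unfolding acarT by (auto simp: T_def twisted_alg_def)
  have h0: "h (azero T) = 0" by (simp add: h_def T_def twisted_alg_def \<kappa>_0)
  \<comment> \<open>\<open>induced_iso\<close> asks for a map out of \<open>B\<close>, hence the
    inverse of \<open>h\<close>.\<close>
  define c where "c = inv_into (acar T) h"
  have c_h: "c (h f) = f" if "f \<in> acar T" for f
    using h_bij that unfolding c_def bij_betw_def by simp
  have h_c: "\<exists>f\<in>acar T. b = h f \<and> c b = f" if "b \<in> B" for b
    using h_bij that c_h unfolding bij_betw_def by (metis imageE)
  have z: "azero T \<in> acar T" by (simp add: T_def twisted_alg_def)
  show ?thesis unfolding T_def[symmetric]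
  proof (rule induced_iso)
    show "bij_betw c B (acar T)" unfolding c_def by (rule bij_betw_inv_into[OF h_bij])
    show "c 0 = azero T" using c_h[OF z] h0 by simp
    show "c e = aone T" using c_h[OF cl(4)[OF z z]] h_one by simp
    fix x assume x: "x \<in> B"
    then obtain f where f: "f \<in> acar T" "x = h f" "c x = f" using h_c by blast
    show "c (j a * x) = asmul T a (c x)" for a using c_h[OF cl(3)[OF f(1) f(1)]] f h_smul by metis
    show "c (act s x) = aact T s (c x)" if "s \<in> S" for s
      using c_h[OF cl(5)[OF f(1) f(1)]] f h_act[OF that] by metis
    fix y assume y: "y \<in> B"
    then obtain f' where f': "f' \<in> acar T" "y = h f'" "c y = f'" using h_c by blast
    show "c (x + y) = aadd T (c x) (c y)" using c_h[OF cl(1)[OF f(1) f'(1)]] f f' h_add by metis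
    show "c (x * y) = amul T (c x) (c y)" using c_h[OF cl(2)[OF f(1) f'(1)]] f f' h_mult by metis
  qed
qed

lemma conjugation_cochainE:
  assumes t: "t \<in> carrier G"
  obtains \<tau> where "\<tau> \<one> = e" "\<And>x. x \<in> N \<Longrightarrow> \<tau> x \<in> K" "\<And>x. x \<in> N \<Longrightarrow> \<tau> x * \<tau> x = e \<or> \<tau> x * \<tau> x = - e"
    "\<And>x y. x \<in> N \<Longrightarrow> y \<in> N \<Longrightarrow> \<tau> x * \<tau> y * j (sg x y) = j (sg (cj G t x) (cj G t y)) * \<tau> (x \<otimes> y)"
    "\<And>s x. s \<in> S \<Longrightarrow> x \<in> N \<Longrightarrow> act s (\<tau> x) * j (gm s x) = j (gm (cj G t s) (cj G t x)) * \<tau> x"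
  using conjugation_cochain[OF t]
proof (elim exE conjE)
  fix \<tau> assume a: "\<tau> \<one> = e" "\<forall>x\<in>N. \<tau> x \<in> K \<and> (\<tau> x * \<tau> x = e \<or> \<tau> x * \<tau> x = - e)"
    "\<forall>x\<in>N. \<forall>y\<in>N. \<tau> x * \<tau> y * j (sg x y) = j (sg (cj G t x) (cj G t y)) * \<tau> (x \<otimes> y)"
    "\<forall>s\<in>S. \<forall>x\<in>N. act s (\<tau> x) * j (gm s x) = j (gm (cj G t s) (cj G t x)) * \<tau> x"
  show thesis
    by (rule that[OF a(1) a(2)[rule_format, THEN conjunct1] a(2)[rule_format, THEN conjunct2]
        a(3)[rule_format] a(4)[rule_format]])
qed

lemma real_case:
  assumes real: "\<forall>z\<in>K. \<exists>c. z = j c * e"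
  shows "real_torsor_datum G N sg"
    and "galg_iso G galg_of (ind G N (real_alg G N sg (gamma_sigma G sg)))"
proof -
  \<comment> \<open>\<open>S\<close> fixes the scalar multiples of \<open>e\<close>, and these are
    all of \<open>K\<close>.\<close>
  have SN: "S = N"
  proof
    show "N \<subseteq> S" using N_S by blast
    show "S \<subseteq> N"
    proof
      fix s assume s: "s \<in> S"
      have "act s z = z" if z: "z \<in> K" for z
      proof -
        obtain c where "z = j c * e" using real z by blast
        thus ?thesis using act_j_mult[OF S_G[OF s] e_A] S_e[OF s] by simp
      qed
      thus "s \<in> N" using s by (simp add: N_def)
    qed
  qed
  have "galg_iso G galg_of (ind G S (twisted_alg G N (*) id (\<lambda>g a. a) sg (gamma_sigma G sg)))"
  proof (rule twisted_iso[where \<kappa> = "\<lambda>a. j a * e"])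
    show "bij_betw (\<lambda>a. j a * e) UNIV K"
      unfolding bij_betw_def using j_mult_inj[OF e_A e0] j_K real by (auto simp: inj_on_def)
    show "j (z * w) * e = j z * e * (j w * e)" for z w by (simp add: j_j_mult e_A e_e)
    show "j z * e = act s (j z * e)" if "s \<in> S" for s z using act_j_mult[OF S_G[OF that] e_A] S_e[OF that] by simp
    show "gamma_sigma G sg s x = gm s x" if "s \<in> S" "x \<in> N" for s x
    proof -
      have s: "s \<in> N" using that SN by simp
      show ?thesis using gm_normal[OF s that(2)] sg_0[OF s N_inv[OF s]] by (simp add: gamma_sigma_def field_simps)
    qed
  qed (auto simp: j_add distrib_right)
  thus "galg_iso G galg_of (ind G N (real_alg G N sg (gamma_sigma G sg)))" unfolding SN real_alg_def .
  have cN: "cj G t x \<in> N" if "t \<in> carrier G" "x \<in> N" for t x using conj_N[OF that] by (simp add: cj_def)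
  have cm: "cj G t (x \<otimes> y) = cj G t x \<otimes> cj G t y" if "t \<in> carrier G" "x \<in> N" "y \<in> N" for t x y
    using that(1) N_G[OF that(2)] N_G[OF that(3)] by (simp add: cj_def m_assoc[symmetric]) (simp add: m_assoc)
  have c1: "cj G t \<one> = \<one>" if "t \<in> carrier G" for t using that by (simp add: cj_def)
  have Z2: "Z2 G N mu2 (*) 1 sg"
    unfolding Z2_def mu2_def using sg_values sg_one sg_cocycle by auto
  have Z2': "Z2 G N mu2 (*) 1 (conj_coc G t sg)" if t: "t \<in> carrier G" for t
    unfolding Z2_def mu2_def conj_coc_def
    using sg_values[OF cN[OF t] cN[OF t]] sg_one[OF cN[OF t]] sg_cocycle[OF cN[OF t] cN[OF t] cN[OF t]]
    by (auto simp: cm[OF t] c1[OF t])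
  have "same_class G N mu2 (*) 1 inverse sg (conj_coc G t sg)" if t: "t \<in> carrier G" for t
  proof -
    obtain \<tau> where \<tau>: "\<tau> \<one> = e" "\<And>x. x \<in> N \<Longrightarrow> \<tau> x \<in> K" "\<And>x. x \<in> N \<Longrightarrow> \<tau> x * \<tau> x = e \<or> \<tau> x * \<tau> x = - e"
      "\<And>x y. x \<in> N \<Longrightarrow> y \<in> N \<Longrightarrow> \<tau> x * \<tau> y * j (sg x y) = j (sg (cj G t x) (cj G t y)) * \<tau> (x \<otimes> y)"
      "\<And>s x. s \<in> S \<Longrightarrow> x \<in> N \<Longrightarrow> act s (\<tau> x) * j (gm s x) = j (gm (cj G t s) (cj G t x)) * \<tau> x"
      by (rule conjugation_cochainE[OF t]) blast
    have "\<forall>x\<in>N. \<exists>c. \<tau> x = j c * e" using \<tau>(2) real by blast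
    then obtain c where "\<forall>x\<in>N. \<tau> x = j (c x) * e" by (rule bchoice[THEN exE])
    hence c: "\<And>x. x \<in> N \<Longrightarrow> \<tau> x = j (c x) * e" by blast
    have c1: "c \<one> = 1" using c[OF N_one] \<tau>(1) j_mult_inj[OF e_A e0, of "c \<one>" 1] e_A by (simp add: j_1 u_l)
    \<comment> \<open>The square of \<open>c x\<close> is 1 or -1, and -1 is not a square in
      \<open>k\<close>; so the cochain has values in \<open>mu2\<close>.\<close>
    have cc: "c x = 1 \<or> c x = - 1" if x: "x \<in> N" for x
    proof -
      have "j (c x * c x) * e = j 1 * e \<or> j (c x * c x) * e = j (- 1) * e"
        using \<tau>(3)[OF x] c[OF x] e_A by (auto simp: j_j_mult e_e j_minus j_1 u_l)
      hence "c x * c x = 1 \<or> c x * c x = - 1" using j_mult_inj[OF e_A e0] by blast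
      thus ?thesis using square_one minus_one_not_square by blast
    qed
    have "conj_coc G t sg x y = sg x y * (c x * c y * inverse (c (x \<otimes> y)))" if x: "x \<in> N" and y: "y \<in> N" for x y
    proof -
      have xy: "x \<otimes> y \<in> N" using N_mult[OF x y] .
      have "\<tau> x * \<tau> y * j (sg x y) = j (c x * c y) * (e * j (sg x y))"
        unfolding c[OF x] c[OF y] j_j_mult[OF e_A] e_e by (simp only: mult.assoc)
      also have "\<dots> = j (c x * c y * sg x y) * e" unfolding e_j by (simp add: j_mult mult.assoc)
      finally have "j (c x * c y * sg x y) * e = j (sg (cj G t x) (cj G t y) * c (x \<otimes> y)) * e"
        using \<tau>(4)[OF x y] c[OF xy] by (simp add: j_mult mult.assoc)
      hence "c x * c y * sg x y = sg (cj G t x) (cj G t y) * c (x \<otimes> y)" using j_mult_inj[OF e_A e0] by blast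
      moreover have "c (x \<otimes> y) \<noteq> 0" using cc[OF xy] by auto
      ultimately have "sg (cj G t x) (cj G t y) = c x * c y * sg x y * inverse (c (x \<otimes> y))" by simp
      thus ?thesis by (simp add: conj_coc_def mult_ac)
    qed
    thus ?thesis unfolding same_class_def using Z2 Z2'[OF t] c1 cc by (intro conjI exI[of _ c]) (auto simp: mu2_def)
  qed
  moreover have "N \<lhd> G" using normal_inv_iff N_subgroup conj_N by blast
  ultimately show "real_torsor_datum G N sg"
    unfolding real_torsor_datum_def using N_square Z2 nondegenerate by blast
qed

end

section \<open>Arithmetic of \<open>k(i)\<close> on pairs\<close>

lemma ci_mul_assoc: "ci_mul (ci_mul a b) c = ci_mul a (ci_mul b c)"
  by (simp add: ci_mul_def algebra_simps)
lemma ci_mul_commute: "ci_mul a b = ci_mul b a" by (simp add: ci_mul_def mult.commute add.commute)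
lemma ci_mul_one: "ci_mul (1, 0) a = a" "ci_mul a (1, 0) = a" by (simp_all add: ci_mul_def)
lemma ci_of_mult: "ci_mul (ci_of a) (ci_of b) = ci_of (a * b)" by (simp add: ci_mul_def ci_of_def)
lemma ci_of_1: "(1, 0) = ci_of 1" by (simp add: ci_of_def)
lemma ci_bar_of: "ci_bar N g (ci_of a) = ci_of a" by (simp add: ci_bar_def ci_conj_def ci_of_def)
lemma ci_inv_of: "a \<noteq> 0 \<Longrightarrow> ci_inv (ci_of a) = ci_of (1 / a)" by (simp add: ci_inv_def ci_of_def)
lemma mu4_inverse: "z \<in> mu4 \<Longrightarrow> ci_mul z (ci_inv z) = (1, 0)"
  by (auto simp: mu4_def ci_mul_def ci_inv_def)
lemma mu4_units: "mu4 \<subseteq> ci_units" by (auto simp: mu4_def ci_units_def zero_prod_def)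
lemma ci_of_mu4: "a = 1 \<or> a = - 1 \<Longrightarrow> ci_of a \<in> mu4" by (auto simp: mu4_def ci_of_def)

text \<open>The values 1 and -1 are fixed by the conjugation of k(i), and \<open>S\<close>
  centralizes \<open>N\<close>; so the twisted identities reduce to multiplicativity in
  \<open>k\<close>. \<open>M\<close> is left open to serve both \<open>ci_units\<close> and
  \<open>mu4\<close>.\<close>

lemma Z2S_ci_of:
  assumes M: "\<And>a::'k::field. a = 1 \<or> a = - 1 \<Longrightarrow> ci_of a \<in> M"
    and \<sigma>: "\<And>x y. x \<in> N \<Longrightarrow> y \<in> N \<Longrightarrow> \<sigma> x y = 1 \<or> \<sigma> x y = - 1"
    and \<gamma>: "\<And>s x. s \<in> S \<Longrightarrow> x \<in> N \<Longrightarrow> \<gamma> s x = 1 \<or> \<gamma> s x = - 1"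
    and one: "\<And>x. x \<in> N \<Longrightarrow> \<sigma> \<one>\<^bsub>G\<^esub> x = 1" "\<And>x. x \<in> N \<Longrightarrow> \<sigma> x \<one>\<^bsub>G\<^esub> = 1" "\<And>x. x \<in> N \<Longrightarrow> \<gamma> \<one>\<^bsub>G\<^esub> x = 1"
      "\<And>s. s \<in> S \<Longrightarrow> \<gamma> s \<one>\<^bsub>G\<^esub> = 1"
    and cocycle: "\<And>x y z. x \<in> N \<Longrightarrow> y \<in> N \<Longrightarrow> z \<in> N \<Longrightarrow> \<sigma> x y * \<sigma> (x \<otimes>\<^bsub>G\<^esub> y) z = \<sigma> y z * \<sigma> x (y \<otimes>\<^bsub>G\<^esub> z)"
    and left: "\<And>s t x. s \<in> S \<Longrightarrow> t \<in> S \<Longrightarrow> x \<in> N \<Longrightarrow> \<gamma> (s \<otimes>\<^bsub>G\<^esub> t) x = \<gamma> s x * \<gamma> t x"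
    and right: "\<And>s x y. s \<in> S \<Longrightarrow> x \<in> N \<Longrightarrow> y \<in> N \<Longrightarrow> \<gamma> s (x \<otimes>\<^bsub>G\<^esub> y) = \<gamma> s x * \<gamma> s y"
    and cj: "\<And>s x. s \<in> S \<Longrightarrow> x \<in> N \<Longrightarrow> cj G s x = x"
  shows "Z2S G S N M ci_mul (1, 0) (ci_bar N) (\<lambda>x y. ci_of (\<sigma> x y)) (\<lambda>s x. ci_of (\<gamma> s x))"
  unfolding Z2S_def ci_of_1 ci_bar_of ci_of_mult
proof (intro conjI ballI)
  fix g x assume g: "g \<in> S" and x: "x \<in> N"
  show "ci_of (\<gamma> g x) \<in> M" using M \<gamma>[OF g x] .
  fix y assume y: "y \<in> N"
  show "ci_of (\<sigma> x y * \<gamma> g (x \<otimes>\<^bsub>G\<^esub> y)) = ci_of (\<sigma> (cj G g x) (cj G g y) * \<gamma> g x * \<gamma> g y)"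
    using right[OF g x y] cj[OF g x] cj[OF g y] by (simp add: mult.assoc)
next
  fix g h x assume g: "g \<in> S" and h: "h \<in> S" and x: "x \<in> N"
  show "ci_of (\<gamma> (g \<otimes>\<^bsub>G\<^esub> h) x) = ci_of (\<gamma> h x * \<gamma> g (cj G h x))"
    using left[OF g h x] cj[OF h x] by (simp add: mult.commute)
next
  fix x y assume "x \<in> N" "y \<in> N"
  thus "ci_of (\<sigma> x y) \<in> M" using M \<sigma> by blast
qed (use one cocycle in auto)

section \<open>The case \<open>K = k(i)\<close>\<close>

context crossed_product begin

context
  fixes i assumes i: "i \<in> K" "i * i = - e" and span: "\<forall>z\<in>K. \<exists>a b. z = j a * e + j b * i"
begin

definition ci_val :: "'k \<times> 'k \<Rightarrow> 'r" where "ci_val z = j (fst z) * e + j (snd z) * i"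

lemma i_A: "i \<in> A" using K_A[OF i(1)] .

lemma i_neq: "act s i = - i \<Longrightarrow> act s i \<noteq> i"
proof
  assume "act s i = - i" "act s i = i"
  hence "i + i = 0" by (metis add.right_inverse)
  hence "j 2 * i = 0" using j_add[of 1 1] i_A by (simp add: j_1 distrib_right u_l)
  hence "i = 0" using j_mult_eq_0[OF _ i_A, of 2] of_nat_neq_0[of 2] by simp
  thus False using i(2) e0 by simp
qed

lemma ci_val_add: "ci_val (z + w) = ci_val z + ci_val w" by (simp add: ci_val_def j_add distrib_right add_ac)
lemma ci_val_K: "ci_val z \<in> K" unfolding ci_val_def using K_add j_K j_mult_K[OF i(1)] by blast

lemma ci_val_mult: "ci_val (ci_mul z w) = ci_val z * ci_val w"
proof -
  have "ci_val z * ci_val w = j (fst z * fst w) * (e * e) + j (fst z * snd w) * (e * i)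
      + (j (snd z * fst w) * (i * e) + j (snd z * snd w) * (i * i))"
    unfolding ci_val_def by (simp only: distrib_left distrib_right j_j_mult[OF e_A] j_j_mult[OF i_A]) (simp add: add_ac)
  also have "\<dots> = ci_val (ci_mul z w)"
    unfolding e_e K_e[OF i(1)] K_e'[OF i(1)] i(2) ci_val_def ci_mul_def
    by (simp add: j_diff j_add left_diff_distrib distrib_right add_ac)
  finally show ?thesis by simp
qed

lemma ci_val_of: "ci_val (ci_of a) = j a * e" by (simp add: ci_val_def ci_of_def)

text \<open>The image of \<open>i\<close> is again a root of \<open>- e\<close>, and an
  \<open>s\<close> that fixes \<open>i\<close> fixes the span of \<open>e\<close> and
  \<open>i\<close>, which is \<open>K\<close>.\<close>

lemma S_act_i: assumes "s \<in> S" shows "act s i = (if s \<in> N then i else - i)"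
proof (cases "s \<in> N")
  case True thus ?thesis using N_K i by simp
next
  case False
  have "act s i * act s i = i * i"
    using act_mult[OF S_G[OF assms] i_A i_A] i(2) S_e[OF assms] by (simp add: act_minus)
  hence c: "act s i = i \<or> act s i = - i" using K_square_eq[OF S_act_K[OF assms i(1)] i(1)] by blast
  have "act s i \<noteq> i"
  proof
    assume si: "act s i = i"
    have "act s z = z" if z: "z \<in> K" for z
    proof -
      obtain a b where ab: "z = j a * e + j b * i" using span z by blast
      show ?thesis unfolding ab act_add act_j_mult[OF S_G[OF assms] e_A] act_j_mult[OF S_G[OF assms] i_A]
        using si S_e[OF assms] by simp
    qed
    thus False using False assms by (simp add: N_def)
  qed
  thus ?thesis using c False by simp
qed

lemma ci_val_bar: "s \<in> S \<Longrightarrow> ci_val (ci_bar N s z) = act s (ci_val z)"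
  unfolding ci_val_def act_add using act_j_mult[OF S_G e_A] act_j_mult[OF S_G i_A] S_e S_act_i
  by (simp add: ci_bar_def ci_conj_def j_minus)

text \<open>For the independence of \<open>e\<close> and \<open>i\<close>, a linear relation is
  added to its image under an \<open>s\<close> that negates \<open>i\<close>.\<close>

lemma ci_val_bij: "bij_betw ci_val UNIV K"
proof -
  obtain s where s: "s \<in> S" "act s i = - i" using conjugation_exists[OF i] by blast
  have "z = w" if eq: "ci_val z = ci_val w" for z w
  proof -
    define a b where "a = fst z - fst w" and "b = snd z - snd w"
    have "j a * e + j b * i = ci_val z - ci_val w" by (simp add: ci_val_def a_def b_def j_diff left_diff_distrib)
    hence 0: "j a * e + j b * i = 0" using eq by simp
    hence "act s (j a * e + j b * i) = 0" by simp
    hence 1: "j a * e - j b * i = 0"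
      unfolding act_add act_j_mult[OF S_G[OF s(1)] e_A] act_j_mult[OF S_G[OF s(1)] i_A] S_e[OF s(1)] s(2) by simp
    have "j (2 * a) * e = (j a * e + j b * i) + (j a * e - j b * i)"
      unfolding mult_2 j_add distrib_right by simp
    hence "j (2 * a) * e = j 0 * e" unfolding 0 1 by simp
    hence "2 * a = 0" using j_mult_inj[OF e_A e0] by blast
    hence a: "a = 0" using of_nat_neq_0[of 2] by simp
    have "i \<noteq> 0" using i(2) e0 by auto
    moreover have "j b * i = j 0 * i" using 0 a by simp
    ultimately have "b = 0" using j_mult_inj[OF i_A] by blast
    thus ?thesis using a by (simp add: a_def b_def prod_eq_iff)
  qed
  moreover have "\<exists>w. z = ci_val w" if "z \<in> K" for z using span that unfolding ci_val_def by (metis fst_conv snd_conv)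
  ultimately show ?thesis using ci_val_K unfolding bij_betw_def inj_on_def by blast
qed

lemma semi_real_iso: "galg_iso G galg_of (ind G S (semi_real_alg G N sg gm))"
  unfolding semi_real_alg_def
  by (rule twisted_iso[OF ci_val_bij]) (use ci_val_add ci_val_mult ci_val_of ci_val_bar in \<open>auto simp: ci_val_def\<close>)

lemma card_S_N: "card S = 2 * card N"
proof -
  obtain s where s: "s \<in> S" "act s i = - i" using conjugation_exists[OF i] by blast
  have "(\<lambda>h. act h i) ` S = {i, - i}"
  proof
    show "(\<lambda>h. act h i) ` S \<subseteq> {i, - i}" using S_act_i by auto
    have "i = act \<one> i" "- i = act s i" using act_one[OF i_A] s(2) by simp_all
    thus "{i, - i} \<subseteq> (\<lambda>h. act h i) ` S" using S_one s(1) by blast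
  qed
  moreover have ne: "i \<noteq> - i" using i_neq[OF s(2)] s(2) by metis
  moreover have "N = {h \<in> S. act h i = i}"
  proof
    show "N \<subseteq> {h \<in> S. act h i = i}" using N_S S_act_i by auto
    show "{h \<in> S. act h i = i} \<subseteq> N"
    proof clarify
      fix h assume "h \<in> S" "act h i = i"
      thus "h \<in> N" using S_act_i[of h] ne by (metis (full_types))
    qed
  qed
  ultimately show ?thesis using card_action_fibres[OF S_subgroup i_A] by simp
qed

lemma S_square_N: assumes "s \<in> S" "s \<notin> N" "t \<in> S" "t \<notin> N" shows "s \<otimes> t \<in> N"
proof (rule ccontr)
  assume n: "s \<otimes> t \<notin> N"
  have "act (s \<otimes> t) i = i"
    using act_act[OF S_G[OF assms(1)] S_G[OF assms(3)] i_A] S_act_i[OF assms(1)] S_act_i[OF assms(3)] assms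
    by (simp add: act_minus)
  thus False using S_act_i[OF S_mult[OF assms(1,3)]] n i_neq[of "s \<otimes> t"] by simp
qed

lemma S_comm: assumes s: "s \<in> S" and t: "t \<in> S" shows "s \<otimes> t = t \<otimes> s"
proof -
  consider "s \<in> N" | "t \<in> N" | "s \<notin> N" "t \<notin> N" by blast
  thus ?thesis
  proof cases
    case 1 thus ?thesis using S_N_comm[OF t] by simp
  next
    case 2 thus ?thesis using S_N_comm[OF s] by simp
  next
    case 3
    have "inv s \<notin> N" using N_inv[of "inv s"] 3 S_G[OF s] by auto
    \<comment> \<open>A product of two elements outside \<open>N\<close> lies in \<open>N\<close>,
      which \<open>S\<close> centralizes. So \<open>s\<close> commutes with t s^-1 and therefore
      with \<open>t\<close>.\<close>
    hence m: "t \<otimes> inv s \<in> N" using S_square_N[OF t 3(2) S_inv[OF s]] by blast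
    have "s \<otimes> t = s \<otimes> (t \<otimes> inv s) \<otimes> s" using S_G[OF s] S_G[OF t] by (simp add: m_assoc)
    also have "s \<otimes> (t \<otimes> inv s) = (t \<otimes> inv s) \<otimes> s" using S_N_comm[OF s m] .
    also have "\<dots> \<otimes> s = t \<otimes> s" using S_G[OF s] S_G[OF t] by (simp add: m_assoc)
    finally show ?thesis .
  qed
qed

lemma gm_values: "s \<in> S \<Longrightarrow> x \<in> N \<Longrightarrow> gm s x = 1 \<or> gm s x = - 1"
  using square_one gm_square by blast

text \<open>If no translate of \<open>gm s\<close> by an element of \<open>N\<close> were trivial, summing all \<open>gm (m s) y\<close> over \<open>m, y \<in> N\<close> would give 0
  as well as \<open>|N|\<close>.\<close>

lemma complement_exists: "\<exists>c\<in>S. c \<notin> N \<and> c \<otimes> c = \<one> \<and> (\<forall>x\<in>N. gm c x = 1)"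
proof -
  obtain s where s: "s \<in> S" "act s i = - i" using conjugation_exists[OF i] by blast
  have sN: "s \<notin> N" using S_act_i[OF s(1)] s(2) i_neq[OF s(2)] by auto
  have "\<exists>m\<in>N. \<forall>y\<in>N. gm (m \<otimes> s) y = 1"
  proof (rule ccontr)
    assume "\<not> ?thesis"
    hence n: "\<exists>y\<in>N. gm (m \<otimes> s) y \<noteq> 1" if "m \<in> N" for m using that by blast
    have "(\<Sum>m\<in>N. \<Sum>y\<in>N. gm (m \<otimes> s) y) = (\<Sum>m\<in>N. 0)"
    proof (rule sum.cong[OF refl])
      fix m assume m: "m \<in> N"
      obtain y where y: "y \<in> N" "gm (m \<otimes> s) y \<noteq> 1" using n[OF m] by blast
      show "(\<Sum>y\<in>N. gm (m \<otimes> s) y) = 0"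
        using character_sum[OF N_subgroup fin_N, of "gm (m \<otimes> s)" y] gm_mult_right[OF S_mult[OF N_S[OF m] s(1)]] y by blast
    qed
    moreover have "(\<Sum>m\<in>N. \<Sum>y\<in>N. gm (m \<otimes> s) y) = (\<Sum>y\<in>N. \<Sum>m\<in>N. gm m y * gm s y)"

    proof (subst sum.swap, intro sum.cong refl)
      fix m y assume "m \<in> N" "y \<in> N"
      thus "gm (m \<otimes> s) y = gm m y * gm s y" using gm_mult_left[OF N_S s(1)] by blast
    qed
    moreover have "\<dots> = (\<Sum>y\<in>N. if y = \<one> then of_nat (card N) else 0)"
    proof (rule sum.cong[OF refl])
      fix y assume y: "y \<in> N"
      show "(\<Sum>m\<in>N. gm m y * gm s y) = (if y = \<one> then of_nat (card N) else 0)"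
      proof (cases "y = \<one>")
        case True
        thus ?thesis using gm_one(2)[OF s(1)] gm_one(2)[OF N_S] by simp
      next
        case False
        then obtain x where x: "x \<in> N" "gm x y \<noteq> 1" using nondegenerate_right[OF y] by blast
        have "(\<Sum>m\<in>N. gm m y) = 0"
          using character_sum[OF N_subgroup fin_N, of "\<lambda>m. gm m y" x] gm_mult_left[OF N_S N_S y] x by blast
        thus ?thesis using False by (simp add: sum_distrib_right[symmetric])
      qed
    qed
    moreover have "\<dots> = of_nat (card N)" using fin_N N_one by (simp add: sum.delta)
    ultimately have "of_nat (card N) = (0 :: 'k)" by (simp only: sum.neutral_const)
    moreover have "card N > 0" using fin_N N_one card_gt_0_iff by blast
    ultimately show False using of_nat_neq_0 by blast
  qed
  then obtain m where m: "m \<in> N" "\<And>y. y \<in> N \<Longrightarrow> gm (m \<otimes> s) y = 1" by blast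
  define c where "c = m \<otimes> s"
  have cS: "c \<in> S" unfolding c_def using S_mult[OF N_S[OF m(1)] s(1)] .
  have cN: "c \<notin> N"
  proof
    assume "c \<in> N"
    hence "inv m \<otimes> c \<in> N" using N_mult[OF N_inv[OF m(1)]] by blast
    moreover have "inv m \<otimes> c = s" unfolding c_def using N_G[OF m(1)] S_G[OF s(1)] by (simp add: m_assoc[symmetric])
    ultimately show False using sN by simp
  qed
  \<comment> \<open>The square of \<open>c\<close> lies in \<open>N\<close> and acts trivially on
    all lines, so nondegeneracy makes it trivial.\<close>
  have "c \<otimes> c = \<one>"
  proof (rule nondegenerate_left[OF S_square_N[OF cS cN cS cN]])
    show "gm (c \<otimes> c) y = 1" if "y \<in> N" for y
      using gm_mult_left[OF cS cS that] m(2)[OF that] by (simp add: c_def)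
  qed
  thus ?thesis using cS cN m(2) c_def by blast
qed

lemma complement_unique:
  assumes c: "c \<in> S" "c \<notin> N" "c \<otimes> c = \<one>" and s: "s \<in> S"
  shows "\<exists>!p. p \<in> N \<times> {\<one>, c} \<and> s = fst p \<otimes> snd p"
proof -
  have cG: "c \<in> carrier G" and sG: "s \<in> carrier G" using S_G c s by auto
  have ex: "\<exists>p. p \<in> N \<times> {\<one>, c} \<and> s = fst p \<otimes> snd p"
  proof (cases "s \<in> N")
    case True thus ?thesis using sG by (intro exI[of _ "(s, \<one>)"]) simp
  next
    case False
    thus ?thesis using S_square_N[OF s False c(1,2)] sG cG c(3) by (intro exI[of _ "(s \<otimes> c, c)"]) (simp add: m_assoc)
  qed
  have mc: "x \<otimes> c \<notin> N" if x: "x \<in> N" for x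
  proof
    assume "x \<otimes> c \<in> N"
    hence "inv x \<otimes> (x \<otimes> c) \<in> N" using N_mult[OF N_inv[OF x]] by blast
    thus False using c(2) N_G[OF x] cG by (simp add: m_assoc[symmetric])
  qed
  have "p = q" if p: "p \<in> N \<times> {\<one>, c}" "s = fst p \<otimes> snd p" and q: "q \<in> N \<times> {\<one>, c}" "s = fst q \<otimes> snd q" for p q
  proof -
    obtain x y where p': "p = (x, y)" "x \<in> N" "y = \<one> \<or> y = c" using p by auto
    obtain x' y' where q': "q = (x', y')" "x' \<in> N" "y' = \<one> \<or> y' = c" using q by auto
    have eq: "x \<otimes> y = x' \<otimes> y'" using p q p' q' by simp
    have "y = y'" using p'(3) q'(3) eq mc[OF p'(2)] mc[OF q'(2)] p'(2) q'(2) N_G by auto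
    moreover have "x = x'" using eq calculation p' q' N_G cG by auto
    ultimately show ?thesis using p' q' by simp
  qed
  thus ?thesis using ex by blast
qed

text \<open>The exponent of \<open>N\<close> is 1 or 2, and -1 differs from 1 in
  \<open>k\<close>.\<close>

lemma root_of_unity_exists:
  "\<exists>\<zeta>::'k. \<zeta> ^ group_exp G N = 1 \<and> (\<forall>m. 0 < m \<and> m < group_exp G N \<longrightarrow> \<zeta> ^ m \<noteq> 1)"
proof -
  define P' where "P' = (\<lambda>m::nat. 0 < m \<and> (\<forall>x\<in>N. x [^] m = \<one>))"
  have "x [^] (2::nat) = \<one>" if "x \<in> N" for x using N_square[OF that] N_G[OF that] by (simp add: numeral_2_eq_2)
  hence P2: "P' 2" by (simp add: P'_def)
  have g: "group_exp G N = (LEAST m. P' m)" by (simp add: group_exp_def P'_def)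
  have "(LEAST m. P' m) \<le> 2" by (rule Least_le[of P', OF P2])
  moreover have "0 < (LEAST m. P' m)" using LeastI[of P', OF P2] by (simp add: P'_def)
  ultimately consider "group_exp G N = 1" | "group_exp G N = 2" unfolding g by linarith
  thus ?thesis
  proof cases
    case 1 thus ?thesis by (intro exI[of _ 1]) auto
  next
    case 2
    have "(- 1 :: 'k) \<noteq> 1"
    proof
      assume "(- 1 :: 'k) = 1"
      hence "1 + 1 * 1 = (0 :: 'k)" by (metis add.right_inverse mult_1)
      thus False using formally_real_add_neq_0[OF fr sum_of_squares_square[of 1]] by blast
    qed
    hence "(- 1 :: 'k) ^ m \<noteq> 1" if "0 < m \<and> m < 2" for m :: nat
    proof -
      have "m = 1" using that by linarith
      thus ?thesis using \<open>(- 1 :: 'k) \<noteq> 1\<close> by simp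
    qed
    thus ?thesis unfolding 2 by (intro exI[of _ "- 1"]) simp
  qed
qed

text \<open>The squares of \<open>e\<close> and \<open>i\<close> are \<open>e\<close> and
  \<open>- e\<close>, and in the field \<open>K\<close> a square determines its root up to
  sign.\<close>

lemma ci_val_mu4: assumes "ci_val z * ci_val z = e \<or> ci_val z * ci_val z = - e" shows "z \<in> mu4"
proof -
  have k: "ci_val (1, 0) = e" "ci_val (- 1, 0) = - e" "ci_val (0, 1) = i" "ci_val (0, - 1) = - i"
    using i_A e_A by (simp_all add: ci_val_def j_1 j_minus u_l)
  have "ci_val z * ci_val z = e * e \<or> ci_val z * ci_val z = i * i" using assms i(2) e_e by simp
  hence "ci_val z = e \<or> ci_val z = - e \<or> ci_val z = i \<or> ci_val z = - i"
    using K_square_eq[OF ci_val_K e_K] K_square_eq[OF ci_val_K i(1)] by blast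
  hence "z = (1, 0) \<or> z = (- 1, 0) \<or> z = (0, 1) \<or> z = (0, - 1)"
    using ci_val_bij k unfolding bij_betw_def inj_on_def by (metis UNIV_I)
  thus ?thesis by (auto simp: mu4_def)
qed

lemma cj_S: "t \<in> carrier G \<Longrightarrow> s \<in> S \<Longrightarrow> cj G t s \<in> S" using conj_S by (simp add: cj_def)
lemma cj_N: "t \<in> carrier G \<Longrightarrow> x \<in> N \<Longrightarrow> cj G t x \<in> N" using conj_N by (simp add: cj_def)
lemma cj_mult: "t \<in> carrier G \<Longrightarrow> x \<in> carrier G \<Longrightarrow> y \<in> carrier G \<Longrightarrow> cj G t (x \<otimes> y) = cj G t x \<otimes> cj G t y"
  by (simp add: cj_def m_assoc[symmetric]) (simp add: m_assoc)
lemma cj_one: "t \<in> carrier G \<Longrightarrow> cj G t \<one> = \<one>" by (simp add: cj_def)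
lemma cj_S_N: "s \<in> S \<Longrightarrow> x \<in> N \<Longrightarrow> cj G s x = x" using S_conj_N by (simp add: cj_def)

lemma Z2S_sg_gm:
  assumes M: "mu4 \<subseteq> M"
  shows "Z2S G S N M ci_mul (1, 0) (ci_bar N) (\<lambda>x y. ci_of (sg x y)) (\<lambda>s x. ci_of (gm s x))"
  by (rule Z2S_ci_of)
     (use M ci_of_mu4 in blast, (use sg_values gm_values sg_one gm_one sg_cocycle gm_mult_left gm_mult_right cj_S_N in blast)+)

lemma Z2S_conj:
  assumes M: "mu4 \<subseteq> M" and t: "t \<in> carrier G"
  shows "Z2S G S N M ci_mul (1, 0) (ci_bar N) (\<lambda>x y. ci_of (conj_coc G t sg x y)) (\<lambda>s x. ci_of (conj_coc G t gm s x))"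
proof (rule Z2S_ci_of)
  note cN = cj_N[OF t] and cS = cj_S[OF t]
  show "ci_of a \<in> M" if "a = 1 \<or> a = - 1" for a :: 'k using ci_of_mu4[OF that] M by blast
  show "conj_coc G t sg x y = 1 \<or> conj_coc G t sg x y = - 1" if "x \<in> N" "y \<in> N" for x y
    unfolding conj_coc_def using sg_values[OF cN cN] that .
  show "conj_coc G t gm s x = 1 \<or> conj_coc G t gm s x = - 1" if "s \<in> S" "x \<in> N" for s x
    unfolding conj_coc_def using gm_values[OF cS cN] that .
  show "conj_coc G t sg \<one> x = 1" "conj_coc G t sg x \<one> = 1" "conj_coc G t gm \<one> x = 1" if "x \<in> N" for x
    unfolding conj_coc_def cj_one[OF t] using sg_one[OF cN[OF that]] gm_one(1)[OF cN[OF that]] by auto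
  show "conj_coc G t gm s \<one> = 1" if "s \<in> S" for s
    unfolding conj_coc_def cj_one[OF t] using gm_one(2)[OF cS[OF that]] .
  show "conj_coc G t sg x y * conj_coc G t sg (x \<otimes> y) z = conj_coc G t sg y z * conj_coc G t sg x (y \<otimes> z)"
    if "x \<in> N" "y \<in> N" "z \<in> N" for x y z
    unfolding conj_coc_def using cj_mult[OF t N_G N_G] sg_cocycle[OF cN cN cN] that by simp
  show "conj_coc G t gm (s \<otimes> s') x = conj_coc G t gm s x * conj_coc G t gm s' x"
    if "s \<in> S" "s' \<in> S" "x \<in> N" for s s' x
    unfolding conj_coc_def using cj_mult[OF t S_G S_G] gm_mult_left[OF cS cS cN] that by simp
  show "conj_coc G t gm s (x \<otimes> y) = conj_coc G t gm s x * conj_coc G t gm s y"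
    if "s \<in> S" "x \<in> N" "y \<in> N" for s x y
    unfolding conj_coc_def using cj_mult[OF t N_G N_G] gm_mult_right[OF cS cN cN] that by simp
  show "cj G s x = x" if "s \<in> S" "x \<in> N" for s x using cj_S_N that .
qed

text \<open>The cochain is that of \<open>conjugation_cochain\<close>, read in pairs. Its values
  have square 1 or -1, so they lie in \<open>mu4\<close>, and the same cochain proves the comparison
  over \<open>mu4\<close> and over all units.\<close>

lemma same_class_conj:
  assumes M: "mu4 \<subseteq> M" and t: "t \<in> carrier G"
  shows "same_class_S G S N M ci_mul (1, 0) ci_inv (ci_bar N)
          (\<lambda>x y. ci_of (sg x y)) (\<lambda>s x. ci_of (gm s x))
          (\<lambda>x y. ci_of (conj_coc G t sg x y)) (\<lambda>s x. ci_of (conj_coc G t gm s x))"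
proof -
  obtain \<tau> where \<tau>: "\<tau> \<one> = e" "\<And>x. x \<in> N \<Longrightarrow> \<tau> x \<in> K" "\<And>x. x \<in> N \<Longrightarrow> \<tau> x * \<tau> x = e \<or> \<tau> x * \<tau> x = - e"
    "\<And>x y. x \<in> N \<Longrightarrow> y \<in> N \<Longrightarrow> \<tau> x * \<tau> y * j (sg x y) = j (sg (cj G t x) (cj G t y)) * \<tau> (x \<otimes> y)"
    "\<And>s x. s \<in> S \<Longrightarrow> x \<in> N \<Longrightarrow> act s (\<tau> x) * j (gm s x) = j (gm (cj G t s) (cj G t x)) * \<tau> x"
    by (rule conjugation_cochainE[OF t]) blast
  have "\<forall>x\<in>N. \<exists>z. \<tau> x = ci_val z" using \<tau>(2) ci_val_bij unfolding bij_betw_def by blast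
  then obtain c where "\<forall>x\<in>N. \<tau> x = ci_val (c x)" by (rule bchoice[THEN exE])
  hence c: "\<And>x. x \<in> N \<Longrightarrow> \<tau> x = ci_val (c x)" by blast
  have inj: "z = w" if "ci_val z = ci_val w" for z w
    using ci_val_bij that injD[of ci_val z w] by (simp add: bij_betw_def)
  have c4: "c x \<in> mu4" if "x \<in> N" for x using ci_val_mu4 \<tau>(3)[OF that] c[OF that] by simp
  have c1: "c \<one> = (1, 0)"
    using inj[of "c \<one>" "(1, 0)"] c[OF N_one] \<tau>(1) ci_val_of[of 1] e_A by (simp add: ci_of_def j_1 u_l)
  have cancel: "ci_of a = ci_mul z (ci_inv w)" if "ci_mul (ci_of a) w = z" "w \<in> mu4" for a z w
    using that(1)[symmetric] mu4_inverse[OF that(2)] by (simp add: ci_mul_assoc ci_mul_one)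
  have e_scal: "z * j a = z * (j a * e)" if "z \<in> K" for z a
    using e_j K_e'[OF that] by (metis mult.assoc)
  have m1: "ci_of (conj_coc G t sg x y) = ci_mul (ci_of (sg x y)) (ci_mul (ci_mul (c x) (c y)) (ci_inv (c (x \<otimes> y))))"
    if x: "x \<in> N" and y: "y \<in> N" for x y
  proof -
    have xy: "x \<otimes> y \<in> N" using N_mult[OF x y] .
    have "ci_mul (ci_of (sg (cj G t x) (cj G t y))) (c (x \<otimes> y)) = ci_mul (ci_of (sg x y)) (ci_mul (c x) (c y))"
    proof (rule inj)
      have "ci_val (ci_mul (ci_of (sg (cj G t x) (cj G t y))) (c (x \<otimes> y))) = \<tau> x * \<tau> y * j (sg x y)"
        unfolding ci_val_mult ci_val_of \<tau>(4)[OF x y] c[OF xy] using j_e_mult[OF ci_val_K] by simp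
      also have "\<dots> = ci_val (ci_mul (ci_mul (c x) (c y)) (ci_of (sg x y)))"
        using e_scal[OF K_mult[OF \<tau>(2)[OF x] \<tau>(2)[OF y]]] c[OF x] c[OF y] by (simp add: ci_val_mult ci_val_of)
      finally show "ci_val (ci_mul (ci_of (sg (cj G t x) (cj G t y))) (c (x \<otimes> y)))
          = ci_val (ci_mul (ci_of (sg x y)) (ci_mul (c x) (c y)))" by (simp add: ci_mul_commute)
    qed
    from cancel[OF this c4[OF xy]] show ?thesis by (simp add: conj_coc_def ci_mul_assoc)
  qed
  have m2: "ci_of (conj_coc G t gm s x) = ci_mul (ci_of (gm s x)) (ci_mul (ci_bar N s (c x)) (ci_inv (c (cj G s x))))"
    if s: "s \<in> S" and x: "x \<in> N" for s x
  proof -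
    have "ci_mul (ci_of (gm (cj G t s) (cj G t x))) (c x) = ci_mul (ci_of (gm s x)) (ci_bar N s (c x))"
    proof (rule inj)
      have "ci_val (ci_mul (ci_of (gm (cj G t s) (cj G t x))) (c x)) = act s (\<tau> x) * j (gm s x)"
        unfolding \<tau>(5)[OF s x] unfolding ci_val_mult ci_val_of j_e_mult[OF ci_val_K] c[OF x] ..
      also have "\<dots> = ci_val (ci_mul (ci_bar N s (c x)) (ci_of (gm s x)))"
        using e_scal[OF S_act_K[OF s \<tau>(2)[OF x]]] c[OF x] ci_val_bar[OF s] by (simp add: ci_val_mult ci_val_of)
      finally show "ci_val (ci_mul (ci_of (gm (cj G t s) (cj G t x))) (c x))
          = ci_val (ci_mul (ci_of (gm s x)) (ci_bar N s (c x)))" by (simp add: ci_mul_commute)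
    qed
    from cancel[OF this c4[OF x]] show ?thesis by (simp add: conj_coc_def ci_mul_assoc cj_S_N[OF s x])
  qed
  have cM: "\<forall>x\<in>N. c x \<in> M" using c4 M by blast
  show ?thesis unfolding same_class_S_def
    using Z2S_sg_gm[OF M] Z2S_conj[OF M t] cM c1 m1 m2 by blast
qed

lemma semi_real_datum: "semi_real_torsor_datum G S N sg gm"
  unfolding semi_real_torsor_datum_def
proof (intro conjI ballI)
  show "subgroup S G" "N \<subseteq> S" "card S = 2 * card N" "non_degenerate G N sg"
    using S_subgroup N_S card_S_N nondegenerate by auto
  show nG: "N \<lhd> G" "S \<lhd> G" using normal_inv_iff N_subgroup S_subgroup conj_N conj_S by auto
  show "N \<lhd> G\<lparr>carrier := S\<rparr>"
    by (rule normal_restrict_supergroup[OF S_subgroup nG(1)]) (use N_S in blast)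
  have "card N > 0" using fin_N N_one card_gt_0_iff by blast
  thus "of_nat (card N) \<noteq> (0::'k)" by (rule of_nat_neq_0)
  have u: "mu4 \<subseteq> (ci_units :: ('k \<times> 'k) set)" by (rule mu4_units)
  show "Z2S_n G S N ci_units ci_mul (1, 0) ci_inv (ci_bar N) (\<lambda>x y. ci_of (sg x y)) (\<lambda>s x. ci_of (gm s x))"
    unfolding Z2S_n_def
  proof (intro conjI ballI)
    show "Z2S G S N ci_units ci_mul (1, 0) (ci_bar N) (\<lambda>x y. ci_of (sg x y)) (\<lambda>s x. ci_of (gm s x))"
      by (rule Z2S_sg_gm[OF u])
    fix x y assume x: "x \<in> N" and y: "y \<in> N"
    have "gm x y = sg x y * sg (x \<otimes> y) (inv x) * (1 / sg x (inv x))"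
      using gm_normal[OF x y] sg_0[OF x N_inv[OF x]] by (simp add: field_simps)
    thus "ci_of (gm x y) = ci_mul (ci_mul (ci_of (sg x y)) (ci_of (sg (x \<otimes> y) (inv x)))) (ci_inv (ci_of (sg x (inv x))))"
      using sg_0[OF x N_inv[OF x]] by (simp only: ci_of_mult ci_inv_of not_False_eq_True)
  qed
  show "s \<otimes> t = t \<otimes> s" if "s \<in> S" "t \<in> S" for s t using S_comm that .
  show "\<exists>c\<in>S. c \<notin> N \<and> c \<otimes> c = \<one> \<and> (\<forall>s\<in>S. \<exists>!p. p \<in> N \<times> {\<one>, c} \<and> s = fst p \<otimes> snd p) \<and> (\<forall>x\<in>N. gm c x = 1)"
    using complement_exists complement_unique by blast
  show "\<exists>\<zeta>::'k. \<zeta> ^ group_exp G N = 1 \<and> (\<forall>j. 0 < j \<and> j < group_exp G N \<longrightarrow> \<zeta> ^ j \<noteq> 1)"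
    by (rule root_of_unity_exists)
  show "sg x y \<in> mu2" if "x \<in> N" "y \<in> N" for x y using sg_values[OF that] by (auto simp: mu2_def)
  show "gm s x \<noteq> 0" if "s \<in> S" "x \<in> N" for s x using gm_0[OF that] .
  show "gm (s \<otimes> t) x = gm s x * gm t x" if "s \<in> S" "t \<in> S" "x \<in> N" for s t x using gm_mult_left[OF that] .
  show "gm s (x \<otimes> y) = gm s x * gm s y" if "s \<in> S" "x \<in> N" "y \<in> N" for s x y using gm_mult_right[OF that] .
  show "gm x y = sg x y / sg y x" if "x \<in> N" "y \<in> N" for x y
    using gm_alt[OF that] sg_0[OF that(2,1)] by (simp add: field_simps)
  show "\<exists>n. card N = 2 ^ n" by (rule card_N_power_of_two)
qed (use same_class_conj[OF mu4_units] same_class_conj[OF subset_refl] in auto)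

end

lemma datum_cases:
  "(\<exists>S N \<sigma> \<gamma>. semi_real_torsor_datum G S N \<sigma> \<gamma> \<and> galg_iso G galg_of (ind G S (semi_real_alg G N \<sigma> \<gamma>)))
    \<or> (\<exists>N \<sigma>. real_torsor_datum G N \<sigma> \<and> galg_iso G galg_of (ind G N (real_alg G N \<sigma> (gamma_sigma G \<sigma>))))"
  using K_cases
proof
  assume "\<forall>z\<in>K. \<exists>c. z = j c * e"
  thus ?thesis using real_case by blast
next
  assume "\<exists>i\<in>K. i * i = - e \<and> (\<forall>z\<in>K. \<exists>a b. z = j a * e + j b * i)"
  then obtain i where "i \<in> K" "i * i = - e" "\<forall>z\<in>K. \<exists>a b. z = j a * e + j b * i" by blast
  thus ?thesis using semi_real_datum semi_real_iso by blast
qed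

end

section \<open>Passage from records to subrings of a type-class ring\<close>

text \<open>The dual basis of the trace form makes \<open>A\<close> a retract of the space of functions \<open>A \<rightarrow> k\<close>, hence a subset of its
  endomorphism ring.  The unit of \<open>A\<close> becomes an idempotent there, not the identity.\<close>

typedef (overloaded) ('a, 'k::field) additive_endo =
  "{F :: ('a \<Rightarrow> 'k) \<Rightarrow> 'a \<Rightarrow> 'k. \<forall>p q. F (\<lambda>x. p x + q x) = (\<lambda>x. F p x + F q x)}"
  morphisms app endo
  by (rule exI[of _ "\<lambda>_ _. 0"]) simp

lemma app_add: "app F (\<lambda>x. p x + q x) = (\<lambda>x. app F p x + app F q x)"
  using app[of F] by simp

lemma app_endo: "(\<And>p q. F (\<lambda>x. p x + q x) = (\<lambda>x. F p x + F q x)) \<Longrightarrow> app (endo F) = F"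
  by (rule endo_inverse) simp

lemma endo_eqI: "(\<And>p x. app F p x = app F' p x) \<Longrightarrow> F = F'"
  unfolding app_inject[symmetric] by (intro ext)

instantiation additive_endo :: (type, field) ring
begin
definition zero_additive_endo :: "('a, 'b) additive_endo" where "zero_additive_endo = endo (\<lambda>_ _. 0)"
definition plus_additive_endo :: "('a, 'b) additive_endo \<Rightarrow> _ \<Rightarrow> _" where
  "plus_additive_endo F F' = endo (\<lambda>p x. app F p x + app F' p x)"
definition uminus_additive_endo :: "('a, 'b) additive_endo \<Rightarrow> _" where
  "uminus_additive_endo F = endo (\<lambda>p x. - app F p x)"
definition minus_additive_endo :: "('a, 'b) additive_endo \<Rightarrow> _ \<Rightarrow> _" where
  "minus_additive_endo F F' = endo (\<lambda>p x. app F p x - app F' p x)"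
definition times_additive_endo :: "('a, 'b) additive_endo \<Rightarrow> _ \<Rightarrow> _" where
  "times_additive_endo F F' = endo (\<lambda>p. app F (app F' p))"

lemma app_simps:
  "app 0 = (\<lambda>_ _. 0)" "app (F + F') = (\<lambda>p x. app F p x + app F' p x)"
  "app (- F) = (\<lambda>p x. - app F p x)" "app (F - F') = (\<lambda>p x. app F p x - app F' p x)"
  "app (F * F') = (\<lambda>p. app F (app F' p))"
  unfolding zero_additive_endo_def plus_additive_endo_def uminus_additive_endo_def
    minus_additive_endo_def times_additive_endo_def
  by (subst app_endo; simp add: app_add algebra_simps)+

instance
  by standard (rule endo_eqI, simp add: app_simps app_add algebra_simps)+
end

section \<open>Transport along isomorphisms of records\<close>

text \<open>Closure of the carrier is all that inverting a homomorphism, or changing it off the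
  carrier, requires.\<close>

definition galg_closed :: "'g monoid \<Rightarrow> ('k, 'a, 'g) galg \<Rightarrow> bool" where
  "galg_closed G A \<longleftrightarrow> aone A \<in> acar A \<and>
     (\<forall>x\<in>acar A. \<forall>y\<in>acar A. aadd A x y \<in> acar A \<and> amul A x y \<in> acar A) \<and>
     (\<forall>c. \<forall>x\<in>acar A. asmul A c x \<in> acar A) \<and> (\<forall>g\<in>carrier G. \<forall>x\<in>acar A. aact A g x \<in> acar A)"

lemma galg_hom_comp:
  assumes f: "galg_hom G A B f" "f ` acar A \<subseteq> acar B" and h: "galg_hom G B C h"
  shows "galg_hom G A C (h \<circ> f)"
  using assms unfolding galg_hom_def by (simp add: image_subset_iff)

lemma galg_hom_cong:
  assumes f: "galg_hom G A B f" and cl: "galg_closed G A" and eq: "\<And>x. x \<in> acar A \<Longrightarrow> f x = f' x"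
  shows "galg_hom G A B f'"
  unfolding galg_hom_def
proof (intro conjI ballI allI)
  show "f' (aone A) = aone B" using f cl eq[of "aone A"] by (simp add: galg_hom_def galg_closed_def)
  fix x assume x: "x \<in> acar A"
  show "f' (asmul A c x) = asmul B c (f' x)" for c
    using f cl x eq[OF x] eq[of "asmul A c x"] by (simp add: galg_hom_def galg_closed_def)
  show "f' (aact A g x) = aact B g (f' x)" if "g \<in> carrier G" for g
    using f cl x that eq[OF x] eq[of "aact A g x"] by (simp add: galg_hom_def galg_closed_def)
  fix y assume y: "y \<in> acar A"
  show "f' (aadd A x y) = aadd B (f' x) (f' y)" "f' (amul A x y) = amul B (f' x) (f' y)"
    using f cl x y eq[OF x] eq[OF y] eq[of "aadd A x y"] eq[of "amul A x y"] by (simp_all add: galg_hom_def galg_closed_def)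
qed

lemma galg_hom_inverse:
  assumes f: "bij_betw f (acar A) (acar B)" "galg_hom G A B f" and cl: "galg_closed G A"
  shows "galg_hom G B A (inv_into (acar A) f)"
proof -
  let ?h = "inv_into (acar A) f"
  have i: "?h y \<in> acar A" "f (?h y) = y" if "y \<in> acar B" for y
    using f(1) that by (auto simp: bij_betw_def inv_into_into f_inv_into_f)
  have l: "?h y = x" if "x \<in> acar A" "f x = y" for x y using f(1) that by (auto simp: bij_betw_def)
  show ?thesis unfolding galg_hom_def
  proof (intro conjI ballI allI)
    show "?h (aone B) = aone A" using l f(2) cl by (simp add: galg_hom_def galg_closed_def)
    fix x assume x: "x \<in> acar B"
    show "?h (asmul B c x) = asmul A c (?h x)" for c
      by (rule l) (use i[OF x] f(2) cl in \<open>simp_all add: galg_hom_def galg_closed_def\<close>)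
    show "?h (aact B g x) = aact A g (?h x)" if "g \<in> carrier G" for g
      by (rule l) (use i[OF x] f(2) cl that in \<open>simp_all add: galg_hom_def galg_closed_def\<close>)
    fix y assume y: "y \<in> acar B"
    show "?h (aadd B x y) = aadd A (?h x) (?h y)"
      by (rule l) (use i[OF x] i[OF y] f(2) cl in \<open>simp_all add: galg_hom_def galg_closed_def\<close>)
    show "?h (amul B x y) = amul A (?h x) (?h y)"
      by (rule l) (use i[OF x] i[OF y] f(2) cl in \<open>simp_all add: galg_hom_def galg_closed_def\<close>)
  qed
qed

lemma galg_iso_trans:
  assumes "galg_iso G A B" "galg_iso G B C" shows "galg_iso G A C"
proof -
  obtain f h where f: "bij_betw f (acar A) (acar B)" "galg_hom G A B f"
    and h: "bij_betw h (acar B) (acar C)" "galg_hom G B C h" using assms unfolding galg_iso_def by blast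
  have "galg_hom G A C (h \<circ> f)" using galg_hom_comp[OF f(2) _ h(2)] f(1) by (simp add: bij_betw_def)
  thus ?thesis using bij_betw_trans[OF f(1) h(1)] unfolding galg_iso_def by blast
qed

lemma aut_G_conj:
  assumes h: "bij_betw h (acar A) (acar B)" "galg_hom G A B h" "bij_betw k (acar B) (acar A)" "galg_hom G B A k"
    and cl: "galg_closed G B" and f: "f \<in> aut_G G A"
  shows "(\<lambda>y. if y \<in> acar B then h (f (k y)) else undefined) \<in> aut_G G B"
proof -
  have f': "bij_betw f (acar A) (acar A)" "galg_hom G A A f" using f unfolding aut_G_def by auto
  have "bij_betw (h \<circ> (f \<circ> k)) (acar B) (acar B)" by (intro bij_betw_trans[OF bij_betw_trans[OF h(3) f'(1)] h(1)])
  hence b: "bij_betw (\<lambda>y. if y \<in> acar B then h (f (k y)) else undefined) (acar B) (acar B)"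
    by (subst bij_betw_cong[of _ _ "h \<circ> (f \<circ> k)"]) auto
  have "galg_hom G B A (f \<circ> k)" using galg_hom_comp[OF h(4) _ f'(2)] h(3) by (simp add: bij_betw_def)
  moreover have "(f \<circ> k) ` acar B \<subseteq> acar A" using bij_betw_trans[OF h(3) f'(1)] by (simp add: bij_betw_def)
  ultimately have "galg_hom G B B (h \<circ> (f \<circ> k))" by (rule galg_hom_comp[OF _ _ h(2)])
  hence "galg_hom G B B (\<lambda>y. if y \<in> acar B then h (f (k y)) else undefined)"
    by (rule galg_hom_cong[OF _ cl]) simp
  thus ?thesis using b unfolding aut_G_def by simp
qed

lemma card_aut_G_iso:
  assumes h: "bij_betw h (acar A) (acar B)" "galg_hom G A B h" and cl: "galg_closed G A" "galg_closed G B"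
  shows "card (aut_G G A) = card (aut_G G B)"
proof -
  define k where "k = inv_into (acar A) h"
  have k: "bij_betw k (acar B) (acar A)" "galg_hom G B A k"
    unfolding k_def using bij_betw_inv_into[OF h(1)] galg_hom_inverse[OF h cl(1)] by auto
  have kh: "k (h x) = x" if "x \<in> acar A" for x using h(1) that by (simp add: k_def bij_betw_def)
  have hk: "h (k y) = y" if "y \<in> acar B" for y
    using h(1) that by (simp add: k_def bij_betw_def f_inv_into_f)
  have hB: "h x \<in> acar B" if "x \<in> acar A" for x using h(1) that by (auto simp: bij_betw_def)
  have kA: "k y \<in> acar A" if "y \<in> acar B" for y using k(1) that by (auto simp: bij_betw_def)
  define \<Phi> where "\<Phi> = (\<lambda>f y. if y \<in> acar B then h (f (k y)) else undefined)"
  define \<Psi> where "\<Psi> = (\<lambda>f x. if x \<in> acar A then k (f (h x)) else undefined)"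
  have A: "f x \<in> acar A" if "f \<in> aut_G G A" "x \<in> acar A" for f x
    using that unfolding aut_G_def bij_betw_def by auto
  have B: "f x \<in> acar B" if "f \<in> aut_G G B" "x \<in> acar B" for f x
    using that unfolding aut_G_def bij_betw_def by auto
  have "bij_betw \<Phi> (aut_G G A) (aut_G G B)"
  proof (rule bij_betw_byWitness[where f' = \<Psi>])
    show "\<Phi> ` aut_G G A \<subseteq> aut_G G B" unfolding \<Phi>_def using aut_G_conj[OF h k cl(2)] by blast
    show "\<Psi> ` aut_G G B \<subseteq> aut_G G A" unfolding \<Psi>_def using aut_G_conj[OF k h cl(1)] by blast
    show "\<forall>f\<in>aut_G G A. \<Psi> (\<Phi> f) = f"
    proof
      fix f assume f: "f \<in> aut_G G A"
      show "\<Psi> (\<Phi> f) = f"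
      proof (rule ext)
        fix x show "\<Psi> (\<Phi> f) x = f x"
          using kh hB A[OF f] f unfolding \<Phi>_def \<Psi>_def aut_G_def by (cases "x \<in> acar A") auto
      qed
    qed
    show "\<forall>f\<in>aut_G G B. \<Phi> (\<Psi> f) = f"
    proof
      fix f assume f: "f \<in> aut_G G B"
      show "\<Phi> (\<Psi> f) = f"
      proof (rule ext)
        fix y show "\<Phi> (\<Psi> f) y = f y"
          using hk kA B[OF f] f unfolding \<Phi>_def \<Psi>_def aut_G_def by (cases "y \<in> acar B") auto
      qed
    qed
  qed
  thus ?thesis by (rule bij_betw_same_card)
qed

section \<open>Trace form and Casimir relation of a Galois algebra\<close>

locale galois_alg = Group.group G for G :: "'g monoid" (structure) +
  fixes A :: "('k::field, 'a, 'g) galg"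
  assumes fin: "finite (carrier G)" and gal: "galois_algebra G A"
begin

abbreviation C where "C \<equiv> acar A"
abbreviation pl (infixl "\<boxplus>" 65) where "x \<boxplus> y \<equiv> aadd A x y"
abbreviation ti (infixl "\<boxdot>" 70) where "x \<boxdot> y \<equiv> amul A x y"
abbreviation sm where "sm \<equiv> asmul A"
abbreviation ac where "ac \<equiv> aact A"
abbreviation o0 where "o0 \<equiv> azero A"
abbreviation i1 where "i1 \<equiv> aone A"

lemma kalg: "kalg A" using gal unfolding galois_algebra_def G_alg_def by blast

lemma C_ops: "o0 \<in> C" "i1 \<in> C" "x \<in> C \<Longrightarrow> y \<in> C \<Longrightarrow> x \<boxplus> y \<in> C" "x \<in> C \<Longrightarrow> y \<in> C \<Longrightarrow> x \<boxdot> y \<in> C" "x \<in> C \<Longrightarrow> sm c x \<in> C"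
  using kalg unfolding kalg_def Let_def by auto

lemma pl_assoc: "x \<in> C \<Longrightarrow> y \<in> C \<Longrightarrow> z \<in> C \<Longrightarrow> (x \<boxplus> y) \<boxplus> z = x \<boxplus> (y \<boxplus> z)"
  and ti_assoc: "x \<in> C \<Longrightarrow> y \<in> C \<Longrightarrow> z \<in> C \<Longrightarrow> (x \<boxdot> y) \<boxdot> z = x \<boxdot> (y \<boxdot> z)"
  and distl: "x \<in> C \<Longrightarrow> y \<in> C \<Longrightarrow> z \<in> C \<Longrightarrow> x \<boxdot> (y \<boxplus> z) = (x \<boxdot> y) \<boxplus> (x \<boxdot> z)"
  and distr: "x \<in> C \<Longrightarrow> y \<in> C \<Longrightarrow> z \<in> C \<Longrightarrow> (x \<boxplus> y) \<boxdot> z = (x \<boxdot> z) \<boxplus> (y \<boxdot> z)"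
  and pl_comm: "x \<in> C \<Longrightarrow> y \<in> C \<Longrightarrow> x \<boxplus> y = y \<boxplus> x"
  and o0_l: "x \<in> C \<Longrightarrow> o0 \<boxplus> x = x" and neg: "x \<in> C \<Longrightarrow> \<exists>y\<in>C. x \<boxplus> y = o0"
  and i1_l: "x \<in> C \<Longrightarrow> i1 \<boxdot> x = x" and i1_r: "x \<in> C \<Longrightarrow> x \<boxdot> i1 = x"
  using kalg unfolding kalg_def Let_def by blast+

lemma sm_pl: "x \<in> C \<Longrightarrow> y \<in> C \<Longrightarrow> sm c (x \<boxplus> y) = sm c x \<boxplus> sm c y"
  and sm_add: "x \<in> C \<Longrightarrow> sm (c + d) x = sm c x \<boxplus> sm d x"
  and sm_mult: "x \<in> C \<Longrightarrow> sm (c * d) x = sm c (sm d x)"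
  and sm_ti_l: "x \<in> C \<Longrightarrow> y \<in> C \<Longrightarrow> sm c (x \<boxdot> y) = sm c x \<boxdot> y"
  and sm_ti_r: "x \<in> C \<Longrightarrow> y \<in> C \<Longrightarrow> sm c (x \<boxdot> y) = x \<boxdot> sm c y"
  and sm_1: "x \<in> C \<Longrightarrow> sm 1 x = x"
  using kalg unfolding kalg_def Let_def by blast+

lemma ac_C: "g \<in> carrier G \<Longrightarrow> x \<in> C \<Longrightarrow> ac g x \<in> C"
  and ac_pl: "g \<in> carrier G \<Longrightarrow> x \<in> C \<Longrightarrow> y \<in> C \<Longrightarrow> ac g (x \<boxplus> y) = ac g x \<boxplus> ac g y"
  and ac_ti: "g \<in> carrier G \<Longrightarrow> x \<in> C \<Longrightarrow> y \<in> C \<Longrightarrow> ac g (x \<boxdot> y) = ac g x \<boxdot> ac g y"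
  and ac_sm: "g \<in> carrier G \<Longrightarrow> x \<in> C \<Longrightarrow> ac g (sm c x) = sm c (ac g x)"
  and ac_i1: "g \<in> carrier G \<Longrightarrow> ac g i1 = i1" and ac_one: "x \<in> C \<Longrightarrow> ac \<one> x = x"
  and ac_ac: "g \<in> carrier G \<Longrightarrow> h \<in> carrier G \<Longrightarrow> x \<in> C \<Longrightarrow> ac (g \<otimes> h) x = ac g (ac h x)"
  using gal unfolding galois_algebra_def G_alg_def by blast+

lemma i1_neq: "i1 \<noteq> o0"
  and ac_fixed: "x \<in> C \<Longrightarrow> \<forall>g\<in>carrier G. ac g x = x \<Longrightarrow> \<exists>c. x = sm c i1"
  and gal_surj: "\<forall>g\<in>carrier G. f g \<in> C \<Longrightarrow> \<exists>ps. set ps \<subseteq> C \<times> C \<and> (\<forall>g\<in>carrier G. f g = galois_map A ps g)"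
  and gal_inj: "set ps \<subseteq> C \<times> C \<Longrightarrow> \<forall>g\<in>carrier G. galois_map A ps g = o0 \<Longrightarrow> tensor_zero A ps"
  using gal unfolding galois_algebra_def by (blast, (simp add: set_eq_iff, blast), blast, blast)

lemma o0_r: "x \<in> C \<Longrightarrow> x \<boxplus> o0 = x" using o0_l pl_comm C_ops by metis

lemma pl_cancel: assumes "x \<in> C" "y \<in> C" "z \<in> C" "x \<boxplus> z = y \<boxplus> z" shows "x = y"
proof -
  obtain w where w: "w \<in> C" "z \<boxplus> w = o0" using neg assms by blast
  have "x \<boxplus> (z \<boxplus> w) = y \<boxplus> (z \<boxplus> w)"
    using assms(4) pl_assoc[OF assms(1,3) w(1)] pl_assoc[OF assms(2,3) w(1)] by simp
  thus ?thesis using w(2) o0_r[OF assms(1)] o0_r[OF assms(2)] by simp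
qed

lemma idem_o0: assumes "x \<in> C" "x \<boxplus> x = x" shows "x = o0"
  using pl_cancel[of x o0 x] assms C_ops o0_l by simp

lemma ti_o0: "x \<in> C \<Longrightarrow> x \<boxdot> o0 = o0"
  using idem_o0[of "x \<boxdot> o0"] distl[of x o0 o0] o0_l[of o0] C_ops by simp
lemma o0_ti: "x \<in> C \<Longrightarrow> o0 \<boxdot> x = o0"
  using idem_o0[of "o0 \<boxdot> x"] distr[of o0 o0 x] o0_l[of o0] C_ops by simp
lemma sm_o0: "sm c o0 = o0"
  using idem_o0[of "sm c o0"] sm_pl[of o0 o0 c] o0_l[of o0] C_ops by simp
lemma sm_0: "x \<in> C \<Longrightarrow> sm 0 x = o0"
  using idem_o0[of "sm 0 x"] sm_add[of x 0 0] C_ops by simp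
lemma ac_o0: "g \<in> carrier G \<Longrightarrow> ac g o0 = o0"
  using idem_o0[of "ac g o0"] ac_pl[of g o0 o0] o0_l[of o0] C_ops ac_C by simp

lemma sm_inj: assumes "sm c i1 = sm d i1" shows "c = d"
proof (rule ccontr)
  assume "c \<noteq> d"
  hence nz: "c - d \<noteq> 0" by simp
  have "sm c i1 = sm (c - d) i1 \<boxplus> sm d i1" using sm_add[OF C_ops(2), of "c - d" d] by simp
  hence "sm (c - d) i1 \<boxplus> sm d i1 = o0 \<boxplus> sm d i1"
    unfolding assms o0_l[OF C_ops(5)[OF C_ops(2)]] by (rule sym)
  hence z: "sm (c - d) i1 = o0" by (rule pl_cancel[OF C_ops(5)[OF C_ops(2)] C_ops(1) C_ops(5)[OF C_ops(2)]])
  have "sm (1 / (c - d) * (c - d)) i1 = sm (1 / (c - d)) (sm (c - d) i1)" by (rule sm_mult[OF C_ops(2)])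
  also have "\<dots> = o0" unfolding z by (rule sm_o0)
  also have "1 / (c - d) * (c - d) = 1" using nz by simp
  finally show False using sm_1[OF C_ops(2)] i1_neq by simp
qed

lemma sm_neg: assumes "x \<in> C" shows "sm (- 1) x \<boxplus> x = o0"
  using sm_add[OF assms, of "- 1" 1] sm_1[OF assms] sm_0[OF assms] by simp

lemma asum_simps [simp]: "asum A [] = o0" "asum A (x # xs) = x \<boxplus> asum A xs"
  by (simp_all add: asum_def)

lemma asum_C: "set xs \<subseteq> C \<Longrightarrow> asum A xs \<in> C"
  by (induction xs) (auto intro: C_ops)

lemma asum_append: "set xs \<subseteq> C \<Longrightarrow> set ys \<subseteq> C \<Longrightarrow> asum A (xs @ ys) = asum A xs \<boxplus> asum A ys"
  by (induction xs) (auto simp: o0_l asum_C pl_assoc)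

lemma asum_perm: "set xs \<subseteq> C \<Longrightarrow> mset xs = mset ys \<Longrightarrow> asum A xs = asum A ys"
proof (induction xs arbitrary: ys)
  case Nil thus ?case by simp
next
  case (Cons x xs)
  have "x \<in> set ys" using Cons.prems(2) by (metis list.set_intros(1) set_mset_mset)
  then obtain y1 y2 where ys: "ys = y1 @ x # y2" by (metis split_list)
  have sub: "set y1 \<subseteq> C" "set y2 \<subseteq> C" "x \<in> C"
    using Cons.prems mset_eq_setD[OF Cons.prems(2)] ys by auto
  have "asum A xs = asum A (y1 @ y2)" by (rule Cons.IH) (use Cons.prems ys in auto)
  moreover have "asum A ys = x \<boxplus> asum A (y1 @ y2)"
  proof -
    have "asum A ys = asum A y1 \<boxplus> (x \<boxplus> asum A y2)" unfolding ys using asum_append[of y1 "x # y2"] sub by simp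
    also have "\<dots> = (x \<boxplus> asum A y1) \<boxplus> asum A y2"
      using pl_assoc[of "asum A y1" x "asum A y2"] pl_comm[of "asum A y1" x] asum_C sub by simp
    also have "\<dots> = x \<boxplus> (asum A y1 \<boxplus> asum A y2)" using pl_assoc asum_C sub by simp
    finally show ?thesis using asum_append sub by simp
  qed
  ultimately show ?case by simp
qed

lemma asum_add:
  assumes "\<And>x. x \<in> set xs \<Longrightarrow> f x \<in> C" "\<And>x. x \<in> set xs \<Longrightarrow> h x \<in> C"
  shows "asum A (map (\<lambda>x. f x \<boxplus> h x) xs) = asum A (map f xs) \<boxplus> asum A (map h xs)"
  using assms
proof (induction xs)
  case Nil thus ?case using o0_l C_ops by simp
next
  case (Cons x xs)
  have a: "asum A (map f xs) \<in> C" "asum A (map h xs) \<in> C" using Cons.prems by (auto intro!: asum_C)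
  have b: "f x \<in> C" "h x \<in> C" using Cons.prems by auto
  let ?a = "asum A (map f xs)" and ?b = "asum A (map h xs)"
  have "(f x \<boxplus> h x) \<boxplus> (?a \<boxplus> ?b) = f x \<boxplus> (h x \<boxplus> (?a \<boxplus> ?b))" using pl_assoc a b C_ops by simp
  also have "h x \<boxplus> (?a \<boxplus> ?b) = (h x \<boxplus> ?a) \<boxplus> ?b" using pl_assoc a b by simp
  also have "h x \<boxplus> ?a = ?a \<boxplus> h x" using pl_comm a b by simp
  also have "(?a \<boxplus> h x) \<boxplus> ?b = ?a \<boxplus> (h x \<boxplus> ?b)" using pl_assoc a b by simp
  also have "f x \<boxplus> (?a \<boxplus> (h x \<boxplus> ?b)) = (f x \<boxplus> ?a) \<boxplus> (h x \<boxplus> ?b)" using pl_assoc a b C_ops by simp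
  finally show ?case using Cons by simp
qed

lemma asum_map:
  assumes "\<And>x y. x \<in> C \<Longrightarrow> y \<in> C \<Longrightarrow> \<phi>' (x \<boxplus> y) = \<phi>' x \<boxplus> \<phi>' y" "\<phi>' o0 = o0" "set xs \<subseteq> C"
  shows "\<phi>' (asum A xs) = asum A (map \<phi>' xs)"
  using assms(3) by (induction xs) (auto simp: assms(1,2) asum_C)

lemma asum_o0: "asum A (map (\<lambda>_. o0) xs) = o0"
  by (induction xs) (auto simp: o0_l C_ops)

lemma asum_swap:
  assumes "\<And>x y. x \<in> set xs \<Longrightarrow> y \<in> set ys \<Longrightarrow> f x y \<in> C"
  shows "asum A (map (\<lambda>x. asum A (map (f x) ys)) xs) = asum A (map (\<lambda>y. asum A (map (\<lambda>x. f x y) xs)) ys)"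
  using assms
proof (induction xs)
  case Nil thus ?case by (simp add: asum_o0)
next
  case (Cons x xs)
  have "asum A (map (\<lambda>y. f x y \<boxplus> asum A (map (\<lambda>x. f x y) xs)) ys)
      = asum A (map (f x) ys) \<boxplus> asum A (map (\<lambda>y. asum A (map (\<lambda>x. f x y) xs)) ys)"
    by (rule asum_add) (use Cons.prems in \<open>auto intro!: asum_C\<close>)
  thus ?case using Cons by simp
qed

lemma asum_delta:
  assumes "distinct xs" "a \<in> set xs" "v \<in> C"
  shows "asum A (map (\<lambda>x. if x = a then v else o0) xs) = v"
  using assms(1,2)
proof (induction xs)
  case (Cons x xs)
  show ?case
  proof (cases "x = a")
    case True
    hence "map (\<lambda>x. if x = a then v else o0) xs = map (\<lambda>_. o0) xs" using Cons.prems by (intro map_cong) auto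
    hence "asum A (map (\<lambda>x. if x = a then v else o0) xs) = o0" by (simp only: asum_o0)
    thus ?thesis using True o0_r[OF assms(3)] by simp
  next
    case False thus ?thesis using Cons o0_l[OF assms(3)] by simp
  qed
qed simp

text \<open>Sums in a record are folds over lists, so the trace needs an enumeration of the group;
  \<open>asum_perm\<close> makes it independent of the order.\<close>

definition gs where "gs = (SOME xs. set xs = carrier G \<and> distinct xs)"

lemma gs: "set gs = carrier G" "distinct gs"
  using someI_ex[OF finite_distinct_list[OF fin]] unfolding gs_def by auto

definition trc where "trc a = asum A (map (\<lambda>g. ac g a) gs)"

lemma trc_C: "a \<in> C \<Longrightarrow> trc a \<in> C" unfolding trc_def by (rule asum_C) (use ac_C gs in auto)

lemma trc_pl: "a \<in> C \<Longrightarrow> b \<in> C \<Longrightarrow> trc (a \<boxplus> b) = trc a \<boxplus> trc b"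
proof -
  assume a: "a \<in> C" "b \<in> C"
  have "trc (a \<boxplus> b) = asum A (map (\<lambda>g. ac g a \<boxplus> ac g b) gs)"
    unfolding trc_def using ac_pl a gs(1) by (intro arg_cong[of _ _ "asum A"]) auto
  thus ?thesis unfolding trc_def using asum_add[of gs "\<lambda>g. ac g a" "\<lambda>g. ac g b"] ac_C a gs(1) by simp
qed

lemma trc_sm: "a \<in> C \<Longrightarrow> trc (sm c a) = sm c (trc a)"
proof -
  assume a: "a \<in> C"
  have "sm c (trc a) = asum A (map (sm c) (map (\<lambda>g. ac g a) gs))"
    unfolding trc_def by (rule asum_map) (use sm_pl sm_o0 ac_C a gs(1) in auto)
  also have "\<dots> = trc (sm c a)"
    unfolding trc_def using ac_sm a gs(1) by (intro arg_cong[of _ _ "asum A"]) auto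
  finally show ?thesis by simp
qed

lemma trc_fixed: assumes a: "a \<in> C" and h: "h \<in> carrier G" shows "ac h (trc a) = trc a"
proof -
  have "ac h (trc a) = asum A (map (ac h) (map (\<lambda>g. ac g a) gs))"
    unfolding trc_def by (rule asum_map) (use ac_pl[OF h] ac_o0[OF h] ac_C a gs(1) in auto)
  also have "map (ac h) (map (\<lambda>g. ac g a) gs) = map (\<lambda>g. ac g a) (map (\<lambda>g. h \<otimes> g) gs)"
    using ac_ac[OF h _ a] gs(1) by auto
  also have "asum A \<dots> = asum A (map (\<lambda>g. ac g a) gs)"
  proof (rule asum_perm)
    show "set (map (\<lambda>g. ac g a) (map (\<lambda>g. h \<otimes> g) gs)) \<subseteq> C" using ac_C a h gs(1) by auto
    have inj: "inj_on (\<lambda>g. h \<otimes> g) (carrier G)" using h by (auto simp: inj_on_def)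
    have "(\<lambda>g. h \<otimes> g) ` carrier G = carrier G"
    proof
      show "carrier G \<subseteq> (\<lambda>g. h \<otimes> g) ` carrier G"
      proof
        fix g assume g: "g \<in> carrier G"
        have "g = h \<otimes> (inv h \<otimes> g)" using g h by (simp add: m_assoc[symmetric])
        thus "g \<in> (\<lambda>g. h \<otimes> g) ` carrier G" using g h by blast
      qed
    qed (use h in auto)
    hence "set (map (\<lambda>g. h \<otimes> g) gs) = set gs" "distinct (map (\<lambda>g. h \<otimes> g) gs)"
      using gs inj by (auto simp: distinct_map)
    hence "mset (map (\<lambda>g. h \<otimes> g) gs) = mset gs" using gs(2) set_eq_iff_mset_eq_distinct by blast
    thus "mset (map (\<lambda>g. ac g a) (map (\<lambda>g. h \<otimes> g) gs)) = mset (map (\<lambda>g. ac g a) gs)"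
      by (metis mset_map)
  qed
  finally show ?thesis by (simp add: trc_def)
qed

definition T where "T a = (SOME c. trc a = sm c i1)"

lemma T: "a \<in> C \<Longrightarrow> trc a = sm (T a) i1"
  unfolding T_def by (rule someI_ex) (use ac_fixed[OF trc_C] trc_fixed in blast)

lemma T_pl: "a \<in> C \<Longrightarrow> b \<in> C \<Longrightarrow> T (a \<boxplus> b) = T a + T b"
  by (rule sm_inj) (simp add: T[symmetric] trc_pl C_ops sm_add)
lemma T_sm: "a \<in> C \<Longrightarrow> T (sm c a) = c * T a"
  by (rule sm_inj) (simp add: T[symmetric] trc_sm C_ops sm_mult)
lemma T_o0: "T o0 = 0" using T_sm[OF C_ops(1), of 0] sm_0[OF C_ops(1)] by simp
lemma T_asum: "set xs \<subseteq> C \<Longrightarrow> T (asum A xs) = sum_list (map T xs)"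
  by (induction xs) (auto simp: T_o0 T_pl asum_C)

definition ps where "ps = (SOME ps. set ps \<subseteq> C \<times> C \<and> (\<forall>g\<in>carrier G. (if g = \<one> then i1 else o0) = galois_map A ps g))"

lemma ps: "set ps \<subseteq> C \<times> C" "g \<in> carrier G \<Longrightarrow> galois_map A ps g = (if g = \<one> then i1 else o0)"
proof -
  have "\<exists>ps. set ps \<subseteq> C \<times> C \<and> (\<forall>g\<in>carrier G. (if g = \<one> then i1 else o0) = galois_map A ps g)"
    by (rule gal_surj) (use C_ops in auto)
  hence "set ps \<subseteq> C \<times> C \<and> (\<forall>g\<in>carrier G. (if g = \<one> then i1 else o0) = galois_map A ps g)"
    unfolding ps_def by (rule someI_ex)
  thus "set ps \<subseteq> C \<times> C" "g \<in> carrier G \<Longrightarrow> galois_map A ps g = (if g = \<one> then i1 else o0)" by auto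
qed

lemma ps_C: "(p, q) \<in> set ps \<Longrightarrow> p \<in> C" "(p, q) \<in> set ps \<Longrightarrow> q \<in> C" using ps(1) by auto

text \<open>The computation of \<open>dual_basis\<close>, carried out in the record itself because
  the embedding into a type-class ring rests on it.\<close>

lemma dual: assumes v: "v \<in> C" shows "asum A (map (\<lambda>(p, q). sm (T (q \<boxdot> v)) p) ps) = v"
proof -
  have "map (\<lambda>(p, q). sm (T (q \<boxdot> v)) p) ps = map (\<lambda>r. asum A (map (\<lambda>g. (fst r \<boxdot> ac g (snd r)) \<boxdot> ac g v) gs)) ps"
  proof (rule map_cong[OF refl])
    fix r assume rp: "r \<in> set ps"
    obtain p q where rpq: "r = (p, q)" by (cases r)
    have r: "r = (p, q)" "p \<in> C" "q \<in> C" using rpq ps_C[of p q] rp by auto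
    have "sm (T (q \<boxdot> v)) p = p \<boxdot> trc (q \<boxdot> v)"
      using T[OF C_ops(4)[OF r(3) v]] sm_ti_r[OF r(2) C_ops(2)] i1_r[OF r(2)] by simp
    also have "\<dots> = asum A (map ((\<boxdot>) p) (map (\<lambda>g. ac g (q \<boxdot> v)) gs))"
      unfolding trc_def by (rule asum_map) (use distl ti_o0 r v ac_C C_ops gs(1) in auto)
    also have "map ((\<boxdot>) p) (map (\<lambda>g. ac g (q \<boxdot> v)) gs) = map (\<lambda>g. (p \<boxdot> ac g q) \<boxdot> ac g v) gs"
      using ac_ti[OF _ r(3) v] ti_assoc[OF r(2)] ac_C r v gs(1) by auto
    finally show "(\<lambda>(p, q). sm (T (q \<boxdot> v)) p) r = asum A (map (\<lambda>g. (fst r \<boxdot> ac g (snd r)) \<boxdot> ac g v) gs)"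
      using r by simp
  qed
  hence "asum A (map (\<lambda>(p, q). sm (T (q \<boxdot> v)) p) ps)
      = asum A (map (\<lambda>r. asum A (map (\<lambda>g. (fst r \<boxdot> ac g (snd r)) \<boxdot> ac g v) gs)) ps)" by (rule arg_cong)
  also have "\<dots> = asum A (map (\<lambda>g. asum A (map (\<lambda>r. (fst r \<boxdot> ac g (snd r)) \<boxdot> ac g v) ps)) gs)"
    by (rule asum_swap) (use ps_C ac_C v C_ops gs(1) in auto)
  also have "map (\<lambda>g. asum A (map (\<lambda>r. (fst r \<boxdot> ac g (snd r)) \<boxdot> ac g v) ps)) gs = map (\<lambda>g. if g = \<one> then v else o0) gs"
  proof (rule map_cong[OF refl])
    fix g assume "g \<in> set gs"
    hence g: "g \<in> carrier G" using gs by simp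
    have gv: "ac g v \<in> C" using ac_C g v by simp
    have "(\<lambda>x. x \<boxdot> ac g v) (asum A (map (\<lambda>(p, q). p \<boxdot> ac g q) ps))
        = asum A (map (\<lambda>x. x \<boxdot> ac g v) (map (\<lambda>(p, q). p \<boxdot> ac g q) ps))"
      by (rule asum_map) (use distr o0_ti gv ps_C ac_C g C_ops in auto)
    also have "map (\<lambda>x. x \<boxdot> ac g v) (map (\<lambda>(p, q). p \<boxdot> ac g q) ps) = map (\<lambda>r. (fst r \<boxdot> ac g (snd r)) \<boxdot> ac g v) ps" by auto
    finally show "asum A (map (\<lambda>r. (fst r \<boxdot> ac g (snd r)) \<boxdot> ac g v) ps) = (if g = \<one> then v else o0)"
      using ps(2)[OF g] unfolding galois_map_def using i1_l o0_ti gv ac_one[OF v] by (auto split: if_splits)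
  qed
  also have "asum A \<dots> = v" using asum_delta[OF gs(2) _ v] gs(1) by simp
  finally show ?thesis .
qed

lemma T_separates: assumes v: "v \<in> C" and 0: "\<And>w. w \<in> C \<Longrightarrow> T (w \<boxdot> v) = 0" shows "v = o0"
proof -
  have "map (\<lambda>(p, q). sm (T (q \<boxdot> v)) p) ps = map (\<lambda>_. o0) ps" using 0 ps_C sm_0 by auto
  thus ?thesis using dual[OF v] asum_o0 by metis
qed

text \<open>The tensors p tensor q a and a p tensor q, summed over \<open>ps\<close>, have the same
  image under the Galois map: \<open>a\<close> at the identity and 0 elsewhere. Injectivity makes
  their difference zero, and the relation is its image under a bilinear map.\<close>

lemma casimir_rec:
  assumes a: "a \<in> C" and b: "b \<in> C" and y: "y \<in> carrier G"
  shows "asum A (map (\<lambda>(p, q). (p \<boxdot> b) \<boxdot> ac y (q \<boxdot> a)) ps) = asum A (map (\<lambda>(p, q). ((a \<boxdot> p) \<boxdot> b) \<boxdot> ac y q) ps)"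
    (is "?l = ?r")
proof -
  \<comment> \<open>The difference of the two tensors, with the minus sign put on the first factor
    as the scalar -1.\<close>
  define L where "L = map (\<lambda>(p, q). (p, q \<boxdot> a)) ps @ map (\<lambda>(p, q). (sm (- 1) (a \<boxdot> p), q)) ps"
  have LC: "set L \<subseteq> C \<times> C" unfolding L_def using ps_C a C_ops by auto
  have "galois_map A L g = o0" if g: "g \<in> carrier G" for g
  proof -
    have ga: "ac g a \<in> C" using ac_C g a by simp
    let ?d = "asum A (map (\<lambda>(p, q). p \<boxdot> ac g q) ps)"
    have dC: "set (map (\<lambda>(p, q). p \<boxdot> ac g q) ps) \<subseteq> C" using ps_C ac_C g C_ops by auto
    have 1: "asum A (map ((\<lambda>(x, z). x \<boxdot> ac g z) \<circ> (\<lambda>(p, q). (p, q \<boxdot> a))) ps) = ?d \<boxdot> ac g a"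
    proof -
      have "?d \<boxdot> ac g a = asum A (map (\<lambda>x. x \<boxdot> ac g a) (map (\<lambda>(p, q). p \<boxdot> ac g q) ps))"
        by (rule asum_map[OF _ _ dC]) (use distr o0_ti ga in auto)
      also have "map (\<lambda>x. x \<boxdot> ac g a) (map (\<lambda>(p, q). p \<boxdot> ac g q) ps)
          = map ((\<lambda>(x, z). x \<boxdot> ac g z) \<circ> (\<lambda>(p, q). (p, q \<boxdot> a))) ps"
        using ps_C ac_ti[OF g _ a] ti_assoc ac_C[OF g] ga by auto
      finally show ?thesis by simp
    qed
    have 2: "asum A (map ((\<lambda>(x, z). x \<boxdot> ac g z) \<circ> (\<lambda>(p, q). (sm (- 1) (a \<boxdot> p), q))) ps) = sm (- 1) (a \<boxdot> ?d)"
    proof -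
      have "sm (- 1) (a \<boxdot> ?d) = asum A (map (\<lambda>x. sm (- 1) (a \<boxdot> x)) (map (\<lambda>(p, q). p \<boxdot> ac g q) ps))"
        by (rule asum_map[OF _ _ dC]) (use distl ti_o0 sm_pl sm_o0 a C_ops in auto)
      also have "map (\<lambda>x. sm (- 1) (a \<boxdot> x)) (map (\<lambda>(p, q). p \<boxdot> ac g q) ps)
          = map ((\<lambda>(x, z). x \<boxdot> ac g z) \<circ> (\<lambda>(p, q). (sm (- 1) (a \<boxdot> p), q))) ps"
        using ps_C ti_assoc[OF a] sm_ti_l[OF C_ops(4)[OF a]] ac_C[OF g] by auto
      finally show ?thesis by simp
    qed
    have "galois_map A L g = (?d \<boxdot> ac g a) \<boxplus> sm (- 1) (a \<boxdot> ?d)"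
    proof -
      have "galois_map A L g = asum A (map ((\<lambda>(x, z). x \<boxdot> ac g z) \<circ> (\<lambda>(p, q). (p, q \<boxdot> a))) ps
         @ map ((\<lambda>(x, z). x \<boxdot> ac g z) \<circ> (\<lambda>(p, q). (sm (- 1) (a \<boxdot> p), q))) ps)"
        by (simp add: galois_map_def L_def)
      also have "\<dots> = (?d \<boxdot> ac g a) \<boxplus> sm (- 1) (a \<boxdot> ?d)"
        unfolding 1[symmetric] 2[symmetric] by (rule asum_append) (use ps_C a ac_C[OF g] C_ops in auto)
      finally show ?thesis .
    qed
    moreover have "?d = (if g = \<one> then i1 else o0)" using ps(2)[OF g] by (simp add: galois_map_def)
    ultimately show ?thesis
      using i1_l[OF ga] i1_r[OF a] o0_ti[OF ga] ti_o0[OF a] sm_o0 ac_one[OF a] sm_neg[OF a]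
        pl_comm[of "sm (- 1) a" a] C_ops a o0_l by (auto split: if_splits)
  qed
  hence tz: "tensor_zero A L" using gal_inj[OF LC] by blast
  define \<Phi> where "\<Phi> = (\<lambda>x z. (x \<boxdot> b) \<boxdot> ac y z)"
  have \<Phi>C: "\<Phi> x z \<in> C" if "x \<in> C" "z \<in> C" for x z unfolding \<Phi>_def using that b ac_C[OF y] C_ops by simp
  have lC: "set (map (\<lambda>(p, q). (p \<boxdot> b) \<boxdot> ac y (q \<boxdot> a)) ps) \<subseteq> C" "set (map (\<lambda>(p, q). ((a \<boxdot> p) \<boxdot> b) \<boxdot> ac y q) ps) \<subseteq> C"
    using ps_C a b ac_C[OF y] C_ops by auto
  have l: "?l \<in> C" and r: "?r \<in> C" using asum_C lC by auto
  have sumL: "asum A (map (\<lambda>(x, z). \<Phi> x z) L) = ?l \<boxplus> sm (- 1) ?r"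
  proof -
    have m1: "map (\<lambda>(x, z). \<Phi> x z) (map (\<lambda>(p, q). (p, q \<boxdot> a)) ps) = map (\<lambda>(p, q). (p \<boxdot> b) \<boxdot> ac y (q \<boxdot> a)) ps"
      by (auto simp: \<Phi>_def)
    have m2: "map (\<lambda>(x, z). \<Phi> x z) (map (\<lambda>(p, q). (sm (- 1) (a \<boxdot> p), q)) ps)
        = map (sm (- 1)) (map (\<lambda>(p, q). ((a \<boxdot> p) \<boxdot> b) \<boxdot> ac y q) ps)"
      using ps_C sm_ti_l C_ops(4) a b ac_C[OF y] by (auto simp: \<Phi>_def)
    have e: "asum A (map (sm (- 1)) (map (\<lambda>(p, q). ((a \<boxdot> p) \<boxdot> b) \<boxdot> ac y q) ps)) = sm (- 1) ?r"
      by (rule asum_map[symmetric, OF _ _ lC(2)]) (use sm_pl sm_o0 in auto)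
    have c: "set (map (sm (- 1)) (map (\<lambda>(p, q). ((a \<boxdot> p) \<boxdot> b) \<boxdot> ac y q) ps)) \<subseteq> C"
      using lC(2) C_ops(5) by auto
    show ?thesis unfolding L_def map_append m1 m2 asum_append[OF lC(1) c] e ..
  qed
  have "?l \<boxplus> sm (- 1) ?r = o0"
  \<comment> \<open>\<open>tensor_zero\<close> speaks of scalar forms only. The bilinear map into
    \<open>A\<close> is therefore composed with the functionals given by multiplication with
    \<open>w\<close> and the trace, which separate points.\<close>
  proof (rule T_separates)
    show "?l \<boxplus> sm (- 1) ?r \<in> C" using l r C_ops by blast
    fix w assume w: "w \<in> C"
    have "bilinear_form A (\<lambda>x z. T (w \<boxdot> \<Phi> x z))"
      unfolding bilinear_form_def \<Phi>_def
    proof (intro ballI allI conjI)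
      fix x x' z c assume x: "x \<in> C" and x': "x' \<in> C" and z: "z \<in> C"
      note m = C_ops(4) and ax' = ac_C[OF y x'] and az = ac_C[OF y z]
      note xb = m[OF x b] and x'b = m[OF x' b]
      have "w \<boxdot> ((x \<boxplus> x') \<boxdot> b \<boxdot> ac y z) = w \<boxdot> (x \<boxdot> b \<boxdot> ac y z) \<boxplus> w \<boxdot> (x' \<boxdot> b \<boxdot> ac y z)"
        unfolding distr[OF x x' b] distr[OF xb x'b az] distl[OF w m[OF xb az] m[OF x'b az]] ..
      thus "T (w \<boxdot> ((x \<boxplus> x') \<boxdot> b \<boxdot> ac y z)) = T (w \<boxdot> (x \<boxdot> b \<boxdot> ac y z)) + T (w \<boxdot> (x' \<boxdot> b \<boxdot> ac y z))"
        using T_pl[OF m[OF w m[OF xb az]] m[OF w m[OF x'b az]]] by (simp only:)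
      have "w \<boxdot> (x \<boxdot> b \<boxdot> ac y (x' \<boxplus> z)) = w \<boxdot> (x \<boxdot> b \<boxdot> ac y x') \<boxplus> w \<boxdot> (x \<boxdot> b \<boxdot> ac y z)"
        unfolding ac_pl[OF y x' z] distl[OF xb ax' az] distl[OF w m[OF xb ax'] m[OF xb az]] ..
      thus "T (w \<boxdot> (x \<boxdot> b \<boxdot> ac y (x' \<boxplus> z))) = T (w \<boxdot> (x \<boxdot> b \<boxdot> ac y x')) + T (w \<boxdot> (x \<boxdot> b \<boxdot> ac y z))"
        using T_pl[OF m[OF w m[OF xb ax']] m[OF w m[OF xb az]]] by (simp only:)
      have "w \<boxdot> (sm c x \<boxdot> b \<boxdot> ac y x') = sm c (w \<boxdot> (x \<boxdot> b \<boxdot> ac y x'))"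
        unfolding sm_ti_l[OF x b, symmetric] sm_ti_l[OF xb ax', symmetric] sm_ti_r[OF w m[OF xb ax'], symmetric] ..
      thus "T (w \<boxdot> (sm c x \<boxdot> b \<boxdot> ac y x')) = c * T (w \<boxdot> (x \<boxdot> b \<boxdot> ac y x'))"
        using T_sm[OF m[OF w m[OF xb ax']]] by (simp only:)
      have "w \<boxdot> (x \<boxdot> b \<boxdot> ac y (sm c x')) = sm c (w \<boxdot> (x \<boxdot> b \<boxdot> ac y x'))"
        unfolding ac_sm[OF y x'] sm_ti_r[OF xb ax', symmetric] sm_ti_r[OF w m[OF xb ax'], symmetric] ..
      thus "T (w \<boxdot> (x \<boxdot> b \<boxdot> ac y (sm c x'))) = c * T (w \<boxdot> (x \<boxdot> b \<boxdot> ac y x'))"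
        using T_sm[OF m[OF w m[OF xb ax']]] by (simp only:)
    qed
    hence "sum_list (map (\<lambda>(x, z). T (w \<boxdot> \<Phi> x z)) L) = 0" using tz unfolding tensor_zero_def by blast
    also have "map (\<lambda>(x, z). T (w \<boxdot> \<Phi> x z)) L = map T (map ((\<boxdot>) w) (map (\<lambda>(x, z). \<Phi> x z) L))" by auto
    also have "sum_list \<dots> = T (asum A (map ((\<boxdot>) w) (map (\<lambda>(x, z). \<Phi> x z) L)))"
      by (rule T_asum[symmetric]) (use LC \<Phi>C w C_ops in auto)
    also have "asum A (map ((\<boxdot>) w) (map (\<lambda>(x, z). \<Phi> x z) L)) = w \<boxdot> asum A (map (\<lambda>(x, z). \<Phi> x z) L)"
      by (rule asum_map[symmetric]) (use distl ti_o0 w LC \<Phi>C in auto)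
    finally show "T (w \<boxdot> (?l \<boxplus> sm (- 1) ?r)) = 0" unfolding sumL .
  qed
  hence "?l \<boxplus> sm (- 1) ?r = ?r \<boxplus> sm (- 1) ?r" using sm_neg[OF r] pl_comm[OF r C_ops(5)[OF r]] by simp
  thus ?thesis using pl_cancel[OF l r C_ops(5)[OF r]] by blast
qed

end

section \<open>The embedding by endomorphisms of a function space\<close>

context galois_alg begin

definition iota :: "'a \<Rightarrow> 'a \<Rightarrow> 'k" where "iota v = (\<lambda>x. if x \<in> C then T (x \<boxdot> v) else 0)"
definition retr :: "('a \<Rightarrow> 'k) \<Rightarrow> 'a" where "retr p = asum A (map (\<lambda>r. sm (p (snd r)) (fst r)) ps)"
text \<open>Left multiplication by \<open>a\<close>, carried to functions by \<open>retr\<close> and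
  \<open>iota\<close>. Since \<open>retr\<close> inverts \<open>iota\<close> on the left, products
  go to compositions, and the unit goes to the projector onto the image of
  \<open>iota\<close>.\<close>

definition rho :: "'a \<Rightarrow> ('a, 'k) additive_endo" where "rho a = endo (\<lambda>p. iota (a \<boxdot> retr p))"

lemma ps_fst: "r \<in> set ps \<Longrightarrow> fst r \<in> C" and ps_snd: "r \<in> set ps \<Longrightarrow> snd r \<in> C" using ps(1) by auto

lemma retr_C: "retr p \<in> C" unfolding retr_def by (rule asum_C) (use ps_fst C_ops in auto)

lemma retr_add: "retr (\<lambda>x. p x + q x) = retr p \<boxplus> retr q"
proof -
  have "map (\<lambda>r. sm (p (snd r) + q (snd r)) (fst r)) ps = map (\<lambda>r. sm (p (snd r)) (fst r) \<boxplus> sm (q (snd r)) (fst r)) ps"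
    by (rule map_cong[OF refl]) (rule sm_add[OF ps_fst])
  hence "retr (\<lambda>x. p x + q x) = asum A (map (\<lambda>r. sm (p (snd r)) (fst r) \<boxplus> sm (q (snd r)) (fst r)) ps)"
    unfolding retr_def by (rule arg_cong)
  also have "\<dots> = retr p \<boxplus> retr q" unfolding retr_def by (rule asum_add) (use ps_fst C_ops in auto)
  finally show ?thesis .
qed

lemma iota_add: "v \<in> C \<Longrightarrow> w \<in> C \<Longrightarrow> iota (v \<boxplus> w) = (\<lambda>x. iota v x + iota w x)"
  by (auto simp: iota_def distl T_pl C_ops)

lemma retr_iota: assumes v: "v \<in> C" shows "retr (iota v) = v"
proof -
  have "map (\<lambda>r. sm (iota v (snd r)) (fst r)) ps = map (\<lambda>(p, q). sm (T (q \<boxdot> v)) p) ps"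
    by (rule map_cong[OF refl]) (use ps_snd in \<open>auto simp: iota_def split: prod.split\<close>)
  hence "retr (iota v) = asum A (map (\<lambda>(p, q). sm (T (q \<boxdot> v)) p) ps)" unfolding retr_def by (rule arg_cong)
  thus ?thesis using dual[OF v] by simp
qed

lemma app_rho: assumes a: "a \<in> C" shows "app (rho a) = (\<lambda>p. iota (a \<boxdot> retr p))"
  unfolding rho_def
  by (rule app_endo) (simp add: retr_add distl[OF a retr_C retr_C] iota_add[OF C_ops(4)[OF a retr_C] C_ops(4)[OF a retr_C]])

lemma rho_add: assumes "a \<in> C" "b \<in> C" shows "rho (a \<boxplus> b) = rho a + rho b"
  by (rule endo_eqI)
     (simp add: app_simps app_rho assms C_ops(3) distr[OF assms retr_C] iota_add[OF C_ops(4)[OF assms(1) retr_C] C_ops(4)[OF assms(2) retr_C]])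

lemma rho_mult: assumes "a \<in> C" "b \<in> C" shows "rho (a \<boxdot> b) = rho a * rho b"
  by (rule endo_eqI)
     (simp add: app_simps app_rho assms C_ops(4) retr_iota[OF C_ops(4)[OF assms(2) retr_C]] ti_assoc[OF assms retr_C])

text \<open>An element is recovered from its left multiplication by evaluation at the unit; this
  gives injectivity of \<open>rho\<close> and a formula for the action.\<close>

lemma rho_one_eval: "a \<in> C \<Longrightarrow> retr (app (rho a) (iota i1)) = a"
  by (simp add: app_rho retr_iota C_ops i1_r)

lemma rho_inj: "a \<in> C \<Longrightarrow> b \<in> C \<Longrightarrow> rho a = rho b \<Longrightarrow> a = b"
  using rho_one_eval by metis

lemma rho_0: "rho o0 = 0"
  using rho_add[OF C_ops(1) C_ops(1)] o0_l[OF C_ops(1)] by simp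

lemma rho_sum:
  assumes "\<And>r. r \<in> set xs \<Longrightarrow> f r \<in> C"
  shows "(\<Sum>i<length xs. rho (f (xs ! i))) = rho (asum A (map f xs))"
proof -
  have "rho (asum A (map f xs)) = sum_list (map (\<lambda>r. rho (f r)) xs)"
    using assms by (induction xs) (auto simp: rho_0 rho_add asum_C image_subset_iff)
  also have "\<dots> = (\<Sum>i<length xs. rho (f (xs ! i)))" by (simp add: sum_list_sum_nth atLeast0LessThan)
  finally show ?thesis by simp
qed

text \<open>Written through evaluation at the unit rather than through an inverse of
  \<open>rho\<close>, and with value 0 outside the group, so that it is additive on all
  endomorphisms, as \<open>act_add\<close> demands.\<close>

definition Act :: "'g \<Rightarrow> ('a, 'k) additive_endo \<Rightarrow> ('a, 'k) additive_endo" where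
  "Act g M = (if g \<in> carrier G then rho (ac g (retr (app M (iota i1)))) else 0)"
definition Scal :: "'k \<Rightarrow> ('a, 'k) additive_endo" where "Scal c = rho (sm c i1)"

lemma Act_rho: "g \<in> carrier G \<Longrightarrow> a \<in> C \<Longrightarrow> Act g (rho a) = rho (ac g a)"
  by (simp add: Act_def rho_one_eval)

lemma Act_add: "Act g (M + M') = Act g M + Act g M'"
  by (simp add: Act_def app_simps retr_add ac_pl retr_C rho_add ac_C)

lemma Scal_rho: assumes "a \<in> C" shows "Scal c * rho a = rho (sm c a)" "rho a * Scal c = rho (sm c a)"
  using assms rho_mult[OF C_ops(5)[OF C_ops(2)] assms, of c] rho_mult[OF assms C_ops(5)[OF C_ops(2)], of c]
    sm_ti_l[OF C_ops(2) assms, of c] sm_ti_r[OF assms C_ops(2), of c] i1_l i1_r by (simp_all add: Scal_def)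

lemma ring_with_action:
  assumes rc: "real_closed TYPE('k)"
  shows "ring_with_action G (rho ` C) (rho i1) Scal Act (\<lambda>i. rho (fst (ps ! i))) (\<lambda>i. rho (snd (ps ! i))) (length ps)"
proof (unfold_locales)
  show "finite (carrier G)" by (rule fin)
  show "real_closed TYPE('k)" by (rule rc)
  show "rho i1 \<noteq> 0" using rho_inj[OF C_ops(2,1)] rho_0 i1_neq by auto
  show "rho i1 \<in> rho ` C" using C_ops by blast
  show "Scal c \<in> rho ` C" for c using C_ops by (auto simp: Scal_def)
  show "Scal 1 = rho i1" using sm_1[OF C_ops(2)] by (simp add: Scal_def)
  show "Scal (c + d) = Scal c + Scal d" for c d
    using sm_add[OF C_ops(2), of c d] rho_add C_ops by (simp add: Scal_def)
  show "Scal (c * d) = Scal c * Scal d" for c d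
    using Scal_rho(1)[OF C_ops(5)[OF C_ops(2)], of c d] sm_mult[OF C_ops(2), of c d] by (simp add: Scal_def[of d] Scal_def[of "c * d"])
  show "Act g (x + y) = Act g x + Act g y" for g x y by (rule Act_add)
  show "Act g (Scal c) = Scal c" if "g \<in> carrier G" for g c
    using Act_rho[OF that C_ops(5)[OF C_ops(2)], of c] ac_sm[OF that C_ops(2)] ac_i1[OF that] by (simp add: Scal_def)
  fix x assume "x \<in> rho ` C"
  then obtain a where a: "a \<in> C" "x = rho a" by blast
  show "rho i1 * x = x" "x * rho i1 = x"
    using rho_mult[OF C_ops(2) a(1)] rho_mult[OF a(1) C_ops(2)] i1_l[OF a(1)] i1_r[OF a(1)] a(2) by simp_all
  show "Scal c * x = x * Scal c" for c using Scal_rho[OF a(1)] a(2) by simp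
  show "Act \<one> x = x" using Act_rho[OF one_closed a(1)] ac_one[OF a(1)] a(2) by simp
  show Ag: "Act g x \<in> rho ` C" if "g \<in> carrier G" for g using Act_rho[OF that a(1)] ac_C[OF that a(1)] a(2) by simp
  show "Act (g \<otimes> h) x = Act g (Act h x)" if "g \<in> carrier G" "h \<in> carrier G" for g h
    using Act_rho[OF m_closed[OF that] a(1)] Act_rho[OF that(2) a(1)] Act_rho[OF that(1) ac_C[OF that(2) a(1)]]
      ac_ac[OF that a(1)] a(2) by simp
  show "\<exists>c. x = Scal c" if fx: "\<forall>g\<in>carrier G. Act g x = x"
  proof -
    have "\<forall>g\<in>carrier G. ac g a = a"
    proof
      fix g assume g: "g \<in> carrier G"
      show "ac g a = a" by (rule rho_inj[OF ac_C[OF g a(1)] a(1)]) (use Act_rho[OF g a(1)] fx g a(2) in simp)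
    qed
    then obtain c where "a = sm c i1" using ac_fixed[OF a(1)] by blast
    thus ?thesis using a(2) by (auto simp: Scal_def)
  qed
  fix y assume "y \<in> rho ` C"
  then obtain b where b: "b \<in> C" "y = rho b" by blast
  show "x + y \<in> rho ` C" using rho_add[OF a(1) b(1)] C_ops(3)[OF a(1) b(1)] a(2) b(2) by (metis image_eqI)
  show "x * y \<in> rho ` C" using rho_mult[OF a(1) b(1)] C_ops(4)[OF a(1) b(1)] a(2) b(2) by (metis image_eqI)
  show "Act g (x * y) = Act g x * Act g y" if "g \<in> carrier G" for g
    using Act_rho[OF that C_ops(4)[OF a(1) b(1)]] rho_mult[OF a(1) b(1)] rho_mult[OF ac_C[OF that a(1)] ac_C[OF that b(1)]]
      Act_rho[OF that a(1)] Act_rho[OF that b(1)] ac_ti[OF that a(1) b(1)] a(2) b(2) by simp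
  show "(\<Sum>i<length ps. rho (fst (ps ! i)) * y * Act g (rho (snd (ps ! i)) * x))
      = (\<Sum>i<length ps. x * rho (fst (ps ! i)) * y * Act g (rho (snd (ps ! i))))" if g: "g \<in> carrier G" for g
  proof -
    have "(\<Sum>i<length ps. rho (fst (ps ! i)) * y * Act g (rho (snd (ps ! i)) * x))
      = (\<Sum>i<length ps. rho ((\<lambda>(p, q). (p \<boxdot> b) \<boxdot> ac g (q \<boxdot> a)) (ps ! i)))"
    proof (rule sum.cong[OF refl])
      fix i assume "i \<in> {..<length ps}"
      hence "ps ! i \<in> set ps" by simp
      note p = ps_fst[OF this] and q = ps_snd[OF this]
      show "rho (fst (ps ! i)) * y * Act g (rho (snd (ps ! i)) * x) = rho ((\<lambda>(p, q). (p \<boxdot> b) \<boxdot> ac g (q \<boxdot> a)) (ps ! i))"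
        unfolding a(2) b(2) using rho_mult[OF C_ops(4)[OF p b(1)] ac_C[OF g C_ops(4)[OF q a(1)]]]
          rho_mult[OF p b(1)] Act_rho[OF g C_ops(4)[OF q a(1)]] rho_mult[OF q a(1)] by (simp add: case_prod_beta)
    qed
    also have "\<dots> = rho (asum A (map (\<lambda>(p, q). (p \<boxdot> b) \<boxdot> ac g (q \<boxdot> a)) ps))"
      by (rule rho_sum) (use ps_fst ps_snd a b ac_C[OF g] C_ops in \<open>auto simp: case_prod_beta\<close>)
    also have "\<dots> = rho (asum A (map (\<lambda>(p, q). ((a \<boxdot> p) \<boxdot> b) \<boxdot> ac g q) ps))"
      unfolding casimir_rec[OF a(1) b(1) g] ..
    also have "\<dots> = (\<Sum>i<length ps. rho ((\<lambda>(p, q). ((a \<boxdot> p) \<boxdot> b) \<boxdot> ac g q) (ps ! i)))"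
      by (rule rho_sum[symmetric]) (use ps_fst ps_snd a b ac_C[OF g] C_ops in \<open>auto simp: case_prod_beta\<close>)
    also have "\<dots> = (\<Sum>i<length ps. x * rho (fst (ps ! i)) * y * Act g (rho (snd (ps ! i))))"
    proof (rule sum.cong[OF refl])
      fix i assume "i \<in> {..<length ps}"
      hence "ps ! i \<in> set ps" by simp
      note p = ps_fst[OF this] and q = ps_snd[OF this]
      show "rho ((\<lambda>(p, q). ((a \<boxdot> p) \<boxdot> b) \<boxdot> ac g q) (ps ! i)) = x * rho (fst (ps ! i)) * y * Act g (rho (snd (ps ! i)))"
        unfolding a(2) b(2) using rho_mult[OF C_ops(4)[OF C_ops(4)[OF a(1) p] b(1)] ac_C[OF g q]]
          rho_mult[OF C_ops(4)[OF a(1) p] b(1)] rho_mult[OF a(1) p] Act_rho[OF g q] by (simp add: case_prod_beta)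
    qed
    finally show ?thesis .
  qed
next
  show "rho (fst (ps ! i)) \<in> rho ` C" "rho (snd (ps ! i)) \<in> rho ` C" if "i < length ps" for i
    using ps_fst[OF nth_mem[OF that]] ps_snd[OF nth_mem[OF that]] by auto
  fix g assume g: "g \<in> carrier G"
  have "(\<Sum>i<length ps. rho (fst (ps ! i)) * Act g (rho (snd (ps ! i))))
      = (\<Sum>i<length ps. rho ((\<lambda>(p, q). p \<boxdot> ac g q) (ps ! i)))"
  proof (rule sum.cong[OF refl])
    fix i assume "i \<in> {..<length ps}"
    hence "ps ! i \<in> set ps" by simp
    note p = ps_fst[OF this] and q = ps_snd[OF this]
    show "rho (fst (ps ! i)) * Act g (rho (snd (ps ! i))) = rho ((\<lambda>(p, q). p \<boxdot> ac g q) (ps ! i))"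
      using rho_mult[OF p ac_C[OF g q]] Act_rho[OF g q] by (simp add: case_prod_beta)
  qed
  also have "\<dots> = rho (galois_map A ps g)" unfolding galois_map_def
    by (rule rho_sum) (use ps_fst ps_snd ac_C[OF g] C_ops in \<open>auto simp: case_prod_beta\<close>)
  finally show "(\<Sum>i<length ps. rho (fst (ps ! i)) * Act g (rho (snd (ps ! i)))) = (if g = \<one> then rho i1 else 0)"
    using ps(2)[OF g] rho_0 by simp
qed

end

text \<open>In the theorem, \<open>order\<close> is the order of a group, not the order of a root.\<close>

hide_const (open) Polynomial.order

theorem theorem3p14:
  fixes G :: "'g monoid" and A :: "('k::field, 'a, 'g) galg"
  assumes "group G" and "finite (carrier G)"
    and "real_closed TYPE('k)"
    and "galois_algebra G A"
    and "card (aut_G G A) = order G"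
  shows "(\<exists>S N \<sigma> \<gamma>. semi_real_torsor_datum G S N \<sigma> \<gamma> \<and>
            galg_iso G A (ind G S (semi_real_alg G N \<sigma> \<gamma>)))
       \<or> (\<exists>N \<sigma>. real_torsor_datum G N \<sigma> \<and>
            galg_iso G A (ind G N (real_alg G N \<sigma> (gamma_sigma G \<sigma>))))"
proof -
  interpret galois_alg G A
    by (rule galois_alg.intro[OF assms(1)]) (simp add: galois_alg_axioms_def assms)
  interpret R: ring_with_action G "rho ` acar A" "rho (aone A)" Scal Act
    "\<lambda>i. rho (fst (ps ! i))" "\<lambda>i. rho (snd (ps ! i))" "length ps"
    by (rule ring_with_action[OF assms(3)])
  have bij: "bij_betw rho (acar A) (acar R.galg_of)"
    using rho_inj by (auto simp: bij_betw_def inj_on_def)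
  have hom: "galg_hom G A R.galg_of rho"
    unfolding galg_hom_def by (simp add: rho_add rho_mult Scal_rho Act_rho)
  have cl: "galg_closed G A" using C_ops ac_C by (simp add: galg_closed_def)
  have cl': "galg_closed G R.galg_of"
    using R.A_u R.A_add R.A_mult R.A_j R.A_act by (simp add: galg_closed_def)
  have iso: "galg_iso G A R.galg_of" using bij hom unfolding galg_iso_def by blast
  \<comment> \<open>The hypothesis on the number of automorphisms enters here, transported along
    \<open>rho\<close>.\<close>
  have "card R.Auts = card (carrier G)"
    using card_aut_G_iso[OF bij hom cl cl'] assms(5) by (simp add: R.Auts_eq_aut_G Coset.order_def)
  moreover obtain e where "e \<in> R.gr \<one>\<^bsub>G\<^esub>" "e * e = e" "e \<noteq> 0"
    "\<And>f. f \<in> R.gr \<one>\<^bsub>G\<^esub> \<Longrightarrow> f * f = f \<Longrightarrow> f * e = f \<Longrightarrow> f = 0 \<or> f = e"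
    using R.primitive_idempotent_exists by blast
  ultimately interpret T: torsor G "rho ` acar A" "rho (aone A)" Scal Act
    "\<lambda>i. rho (fst (ps ! i))" "\<lambda>i. rho (snd (ps ! i))" "length ps" e
    by unfold_locales
  obtain V sg gm where "crossed_product G (rho ` acar A) (rho (aone A)) Scal Act
    (\<lambda>i. rho (fst (ps ! i))) (\<lambda>i. rho (snd (ps ! i))) (length ps) e V sg gm"
    using T.crossed_product_exists by blast
  then interpret X: crossed_product G "rho ` acar A" "rho (aone A)" Scal Act
    "\<lambda>i. rho (fst (ps ! i))" "\<lambda>i. rho (snd (ps ! i))" "length ps" e V sg gm .
  note trans = galg_iso_trans[OF iso]
  from X.datum_cases show ?thesis
  proof (elim disjE exE conjE)
    fix S N \<sigma> \<gamma>
    assume "semi_real_torsor_datum G S N \<sigma> \<gamma>" "galg_iso G R.galg_of (ind G S (semi_real_alg G N \<sigma> \<gamma>))"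
    hence "semi_real_torsor_datum G S N \<sigma> \<gamma> \<and> galg_iso G A (ind G S (semi_real_alg G N \<sigma> \<gamma>))"
      using trans by simp
    thus ?thesis by (intro disjI1 exI)
  next
    fix N \<sigma>
    assume "real_torsor_datum G N \<sigma>" "galg_iso G R.galg_of (ind G N (real_alg G N \<sigma> (gamma_sigma G \<sigma>)))"
    hence "real_torsor_datum G N \<sigma> \<and> galg_iso G A (ind G N (real_alg G N \<sigma> (gamma_sigma G \<sigma>)))"
      using trans by simp
    thus ?thesis by (intro disjI2 exI)
  qed
qed

end
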